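(* The following holds. (1) If $\alpha>1$: for each $N$ the limit $v_N=\lim_{n\to\infty}\mathcal X_N(n)/n=\lim_{n\to\infty}\mathcal X_1(n)/n$ exists almost surely and in $L^1$, and $v_N\sim\rho_\alpha c_N/\log_2 N$ as $N\to\infty$, where the limit $\rho_\alpha=\lim_{t\to\infty}\mathcal R^\alpha(t)/t$ exists almost surely and in $L^1$ and is a positive and finite constant. (2) If $\alpha=1$ and $\mathbb E[X]<\infty$: for each $N$ the limit $v_N=\lim_{n\to\infty}\mathcal X_N(n)/n=\lim_{n\to\infty}\mathcal X_1(n)/n$ exists almost surely and in $L^1$, and, as $N\to\infty$, \[ v_N\sim\frac{c_N}{\log_2 N}\int_1^\infty\frac{h(c_N)}{h(c_Nx)}\,\mathrm dx. \] (3) If $\alpha=1$ and $\mathbb E[X]=\infty$: set $b^N_n=\int_1^{h^{-1}(n)}\frac{h(c_N)}{h(c_Nx)}\,\mathrm dx$. Then, for $i\in\{1,N\}$, \[ \lim_{N\to\infty}\limsup_{n\to\infty} d\left(\mathcal L\left(\frac{\log_2 N}{c_N}\,\frac{\mathcal X_i(n)}{n\,b^N_n}\right),\delta_1\right)=0. \] (4) If $0<\alpha<1$: let $W_\alpha$ be a random variable with Laplace transform \[ \mathbb E[e^{-\lambda W_\alpha}]=\exp\Big(-\alpha\int_0^\infty(1-e^{-\lambda x})x^{-\alpha-1}\,\mathrm dx\Big),\qquad \lambda\ge0. \] Then, for $i\in\{1,N\}$, \[ \lim_{N\to\infty}\limsup_{n\to\infty} d\left(\mathcal L\left((2N)^{-1/\alpha}\,\frac{\mathcal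 X_i(n)}{h^{-1}(n)}\right),\mathcal L(W_\alpha)\right)=0. \]
   Context: Let $X$ be a random variable with values in $[0,\infty)$ and define $h$ by $\mathbb P(X>x)=1/h(x)$ for $x\ge0$. Assume $h$ is regularly varying at $+\infty$ with index $\alpha>0$. Let $h^{-1}(y)=\inf\{x\ge0:h(x)>y\}$ be the generalized inverse and $c_N=h^{-1}(2N\log_2 N)$ (which is positive for all large $N$). $N$-BRW ($N$-branching random walk): Let $(X_{n,i})_{n\ge0,\,i\in[2N]}$ be i.i.d. copies of $X$, where $[k]=\{1,\dots,k\}$. Set $\mathcal X_i(0)=0$ for $i\in[N]$. Inductively, for $n\ge0$, $\mathcal X_1(n+1)\le\dots\le\mathcal X_N(n+1)$ are the $N$ largest numbers (with multiplicity) of the collection $(\mathcal X_i(n)+X_{n,2i-j})_{i\in[N],\,j\in\{0,1\}}$, sorted in ascending order. Stairs process: A stairs measure is a non-zero measure $\mu$ on $(0,\infty)$ with $\mu([a,\infty))<\infty$ for every $a>0$. Given a Poisson point process on $\{(t,x):t,x>0\}$ with intensity $\mathrm dt\otimes\mu$, set $\xi_t=x$ if $(t,x)$ is an atom and $\xi_t=0$ otherwise (in particular $\xi_t=0$ for $t\le0$). The $\mu$-stairs process $\mathcal R$ is defined by $\mathcal R(t)=0$ for $t\le0$ and, inductively for $n=0,1,2,\dots$ and $t\in(n,n+1]$, $\mathcal R(t)=\max_{s\in[0,1]}(\mathcal R(t-s-1)+\xi_{t-s})$. $\mathcal R^\alpha$ denotes the $\mu_\alpha$-stairs process, where $\mu_\alpha([x,\infty))=x^{-\alpha}$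 for $x>0$. $\mathcal L(Y)$ is the law of $Y$, $d$ is the Prokhorov metric on probability measures on $\mathbb R$, and $a_N\sim b_N$ means $a_N/b_N\to1$ as $N\to\infty$. *)

theory Defs
  imports "HOL-Probability.Probability"
begin

section \<open>Regular variation, generalised inverse, modes of convergence\<close>

text \<open>Measurability of \<open>f\<close>, often part of the definition, is omitted: it is only used below for
  reciprocals of tail functions, which are monotone.\<close>

definition regularly_varying :: "(real \<Rightarrow> real) \<Rightarrow> real \<Rightarrow> bool" where
  "regularly_varying f a \<longleftrightarrow>
     (\<forall>\<^sub>F x in at_top. f x > 0) \<and>
     (\<forall>t>0. ((\<lambda>x. f (t * x) / f x) \<longlongrightarrow> t powr a) at_top)"

definition gen_inverse :: "(real \<Rightarrow> real) \<Rightarrow> real \<Rightarrow> real" where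
  "gen_inverse h y = Inf {x. 0 \<le> x \<and> h x > y}"

definition c_scale :: "(real \<Rightarrow> real) \<Rightarrow> nat \<Rightarrow> real" where
  "c_scale h N = gen_inverse h (2 * real N * log 2 (real N))"

definition tendsto_AE_and_L1 ::
    "'a measure \<Rightarrow> ('i \<Rightarrow> 'a \<Rightarrow> real) \<Rightarrow> real \<Rightarrow> 'i filter \<Rightarrow> bool" where
  "tendsto_AE_and_L1 M Y l F \<longleftrightarrow>
     (AE \<omega> in M. ((\<lambda>i. Y i \<omega>) \<longlongrightarrow> l) F) \<and>
     (\<forall>\<^sub>F i in F. integrable M (Y i)) \<and>
     ((\<lambda>i. \<integral>\<omega>. \<bar>Y i \<omega> - l\<bar> \<partial>M) \<longlongrightarrow> 0) F"

definition prokhorov_dist :: "real measure \<Rightarrow> real measure \<Rightarrow> real" where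
  "prokhorov_dist \<mu> \<nu> = Inf {\<epsilon>. \<epsilon> > 0 \<and> (\<forall>A\<in>sets borel.
       measure \<mu> A \<le> measure \<nu> (\<Union>a\<in>A. ball a \<epsilon>) + \<epsilon> \<and>
       measure \<nu> A \<le> measure \<mu> (\<Union>a\<in>A. ball a \<epsilon>) + \<epsilon>)}"


section \<open>The N-branching random walk\<close>

text \<open>\<open>nbrw_list N x n\<close> is the generation-\<open>n\<close> population in ascending order, driven by the jumps
  \<open>x n 1, \<dots>, x n (2 * N)\<close>. Among the \<open>2 * N\<close> sorted children, dropping the first \<open>N\<close> keeps the
  \<open>N\<close> largest.\<close>

fun nbrw_list :: "nat \<Rightarrow> (nat \<Rightarrow> nat \<Rightarrow> real) \<Rightarrow> nat \<Rightarrow> real list" where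
  "nbrw_list N x 0 = replicate N 0"
| "nbrw_list N x (Suc n) =
     drop N (sort [nbrw_list N x n ! (i - 1) + x n (2 * i - j). i \<leftarrow> [1..<Suc N], j \<leftarrow> [0, 1]])"

text \<open>Particles are numbered from 1, lists from 0.\<close>

definition nbrw :: "nat \<Rightarrow> (nat \<Rightarrow> nat \<Rightarrow> real) \<Rightarrow> nat \<Rightarrow> nat \<Rightarrow> real" where
  "nbrw N x i n = nbrw_list N x n ! (i - 1)"

definition iid_copies ::
    "'p measure \<Rightarrow> ('p \<Rightarrow> real) \<Rightarrow> 'a measure \<Rightarrow> ('i \<Rightarrow> 'a \<Rightarrow> real) \<Rightarrow> 'i set \<Rightarrow> bool" where
  "iid_copies P X M Y I \<longleftrightarrow>
     prob_space.indep_vars M (\<lambda>_. borel) Y I \<and>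
     (\<forall>i\<in>I. distr M borel (Y i) = distr P borel X)"


section \<open>Stairs processes\<close>

text \<open>A random set is used for the point process. This loses nothing for the intensities
  \<open>dt \<otimes> \<mu>\<close> considered here: as they do not charge points, multiple points almost surely do not
  occur. The Poisson probabilities are written out because \<^const>\<open>poisson_pmf\<close> is only specified for
  positive rates.\<close>

definition poisson_point_process ::
    "'a measure \<Rightarrow> 'b measure \<Rightarrow> ('a \<Rightarrow> 'b set) \<Rightarrow> bool" where
  "poisson_point_process M \<Lambda> \<eta> \<longleftrightarrow>
     (\<forall>\<omega>\<in>space M. \<eta> \<omega> \<subseteq> space \<Lambda>) \<and>
     (\<forall>B\<in>sets \<Lambda>. emeasure \<Lambda> B < \<infinity> \<longrightarrow>
        (AE \<omega> in M. finite (\<eta> \<omega> \<inter> B)) \<and>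
        (\<lambda>\<omega>. card (\<eta> \<omega> \<inter> B)) \<in> measurable M (count_space UNIV) \<and>
        (\<forall>k. measure M {\<omega>\<in>space M. card (\<eta> \<omega> \<inter> B) = k} =
             measure \<Lambda> B ^ k / fact k * exp (- measure \<Lambda> B))) \<and>
     (\<forall>(B :: nat \<Rightarrow> 'b set) n.
        disjoint_family_on B {..<n} \<longrightarrow>
        (\<forall>i<n. B i \<in> sets \<Lambda> \<and> emeasure \<Lambda> (B i) < \<infinity>) \<longrightarrow>
        prob_space.indep_vars M (\<lambda>_. count_space UNIV) (\<lambda>i \<omega>. card (\<eta> \<omega> \<inter> B i)) {..<n})"

text \<open>A measure on \<open>(0, \<infinity>)\<close> has \<open>(0, \<infinity>)\<close> as its space.\<close>

definition stairs_measure :: "real measure \<Rightarrow> bool" where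
  "stairs_measure \<mu> \<longleftrightarrow>
     sets \<mu> = sets (restrict_space borel {0<..}) \<and>
     emeasure \<mu> (space \<mu>) \<noteq> 0 \<and>
     (\<forall>a>0. emeasure \<mu> {a..} < \<infinity>)"

text \<open>As usual, the realisations of the point process are locally finite for every outcome and not
  only almost surely; here this means that in finite time there are finitely many atoms of size at
  least \<open>a > 0\<close>. It makes \<open>R t\<close> measurable without completing the probability space.\<close>

definition stairs_point_process ::
    "'a measure \<Rightarrow> real measure \<Rightarrow> ('a \<Rightarrow> (real \<times> real) set) \<Rightarrow> bool" where
  "stairs_point_process M \<mu> \<eta> \<longleftrightarrow>
     poisson_point_process M (restrict_space lborel {0<..} \<Otimes>\<^sub>M \<mu>) \<eta> \<and>
     (\<forall>\<omega>\<in>space M. \<forall>T. \<forall>a>0. finite {(t, x) \<in> \<eta> \<omega>. t \<le> T \<and> a \<le> x})"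

text \<open>\<open>\<xi>\<^sub>t = x\<close> if \<open>(t, x)\<close> is an atom, and \<open>\<xi>\<^sub>t = 0\<close> if there is none; in the null event that there are
  several atoms with the same \<open>t\<close> the largest is taken.\<close>

definition atom_size :: "(real \<times> real) set \<Rightarrow> real \<Rightarrow> real" where
  "atom_size A t = Sup (insert 0 {x. (t, x) \<in> A})"

text \<open>For locally finite \<open>\<xi>\<close> the supremum is attained, so that it is the maximum.\<close>

function stairs :: "(real \<Rightarrow> real) \<Rightarrow> real \<Rightarrow> real" where
  "stairs \<xi> t = (if t \<le> 0 then 0 else SUP s\<in>{0..1}. stairs \<xi> (t - s - 1) + \<xi> (t - s))"
  by auto
termination
proof (relation "Wellfounded.measure (\<lambda>(\<xi>, t). nat \<lceil>t\<rceil>)", goal_cases)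
  case (2 \<xi> t s)
  then have "\<lceil>t - s - 1\<rceil> \<le> \<lceil>t\<rceil> - 1" "\<lceil>t\<rceil> > 0"
    by (auto simp: ceiling_le_iff) linarith
  then show ?case by auto
qed simp

declare stairs.simps [simp del]

end

(*
A particle with a lead over the population needs about log2 N generations until it or its descendants make up the
whole population. Hence the minimum at time n + log2 N is at least the maximum at time n, and the positions are
squeezed between maximal sums of the generation maxima over sets of generations with gaps slightly above, respectively
slightly below, log2 N; the error of the upper bound comes from particles with two positive jumps (above a threshold)
during such a gap. Since the minimum is superadditive and the maximum subadditive, up to a time shift of order log2 N,
both have the same deterministic speed.

For alpha > 1, the maxima over blocks of (log2 N)/q generations, divided by c_N, converge to Frechet variables, and
the stairs process is squeezed between the same separated sums of Frechet variables on a mesh 1/q.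
For alpha = 1 and finite mean, the threshold c_N shows that v_N is asymptotic to 2 N E[(X - c_N)^+], which is 2 N c_N
times the integral of 1/h(c_N x) over x > 1, and h(c_N) is asymptotic to 2 N log2 N.
If the mean is infinite, the positions are at most the sum of all 2 N n jumps so far, and at least a sum of maxima
over long blocks of generations. Both bounds have the same asymptotic Laplace transform, because in a block of fixed
length two jumps of the relevant order are unlikely.
*)
theory Submission
 imports Defs "HOL-Real_Asymp.Real_Asymp"
begin

text \<open>No general subadditive ergodic theorem enters: maximum and minimum differ by a time
  shift, so a one-sided bound for Birkhoff sums over blocks, applied to the maximum and to minus the
  minimum, gives both almost sure limits. For \<alpha> > 1 the threshold D has to meet two demands.
  Jumps up to D cost D per generation, so D = e c_N / log2 N with small e. With gap d the error per
  generation is of order N 2^d G(D)^2 c_N, where G is the tail, and G(D) exceeds G(c_N), about 1 /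
  (2 N log2 N), by powers of log N. With d at most (1 - e) log2 N there remains N^(-e) times such
  powers; a gap of log2 N itself would not beat them. The two bounds meet because gap q + 1 on the
  mesh 1/q becomes, after scaling time, gap q + 1 on the mesh 1/(q + 1). Lower speeds are thus upper
  speeds times a factor tending to 1. For infinite mean, N is fixed while n grows, so takeover times
  are constants. The limit in n is found for each N; for \<alpha> = 1 it is the point mass at 2 N
  log2 N G(c_N), for \<alpha> < 1 already the law of W.\<close>

notation (input) tendsto (infixr "--->" 55) and LIMSEQ (infix "---->" 60)

abbreviation (input) eventually_nat :: "(nat => bool) => bool" (binder "EV " 10) where
 "eventually_nat P == eventually P sequentially"

lemmas L1_add = Bochner_Integration.integrable_add
lemmas L1_diff = Bochner_Integration.integrable_diff
lemmas L1_sum = Bochner_Integration.integrable_sum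
lemmas L1_bound = Bochner_Integration.integrable_bound
lemmas LINT_add = Bochner_Integration.integral_add
lemmas LINT_diff = Bochner_Integration.integral_diff
lemmas LINT_sum = Bochner_Integration.integral_sum
lemmas LINT_cong = Bochner_Integration.integral_cong
lemmas LINT_nonneg = Bochner_Integration.integral_nonneg

section \<open>Shifts of product spaces\<close>

text \<open>One shift serves for points of the sequence space, for jump arrays indexed by
  generations, and for the weights of \<open>sep_max\<close>.\<close>

definition shift :: "nat => (nat => 'a) => nat => 'a" where
 "shift m w = (%i. w (m + i))"

lemma shift_apply: "shift m w i = w (m + i)"
 by (simp add: shift_def)

lemma shift_0 [simp]: "shift 0 w = w"
 by (simp add: shift_def)

lemma shift_shift [simp]: "shift m (shift k w) = shift (k + m) w"
 by (simp add: shift_def add.assoc)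

lemma shift_comb_seq: "shift m (comb_seq m w w') = w'"
 by (simp add: shift_def comb_seq_def)

context sequence_space
begin

lemma measurable_shift [measurable]: "shift m \<in> measurable S S"
 unfolding shift_def by (rule measurable_PiM_single') (auto simp: space_PiM PiE_iff)

lemma shift_in_space [simp]: "w \<in> space S ==> shift m w \<in> space S"
 by (auto simp: space_PiM shift_apply)

lemma distr_shift: "distr S S (shift m) = S"
 using distr_PiM_reindex[of UNIV "%i. M" "%i. m + i" UNIV] M.prob_space_axioms
 by (simp add: shift_def[abs_def] restrict_UNIV)

lemma integrable_shift: "integrable S f ==> integrable S (%w. f (shift m w))" for f :: "_ => real"
 using integrable_distr[of "shift m" S S f] by (simp add: distr_shift)

lemma integral_shift:
 "f \<in> borel_measurable S ==> (LINT w|S. f (shift m w)) = (LINT w|S. f w)" for f :: "_ => real"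
 using integral_distr[of "shift m" S S f] by (simp add: distr_shift)

text \<open>Independence of past and future: gluing the first \<open>m\<close> coordinates of one
  sample to a second, independent sample reproduces the product measure.\<close>

lemma nn_integral_comb_seq:
 assumes [measurable]: "f \<in> borel_measurable S"
 shows "(\<integral>\<^sup>+w. f w \<partial>S) = (\<integral>\<^sup>+w. \<integral>\<^sup>+w'. f (comb_seq m w w') \<partial>S \<partial>S)"
proof -
 have "(\<integral>\<^sup>+w. f w \<partial>S) = (\<integral>\<^sup>+p. f (case p of (w, w') => comb_seq m w w') \<partial>(S \<Otimes>\<^sub>M S))"
  by (subst PiM_comb_seq[symmetric, of m], subst nn_integral_distr) (auto intro: measurable_comb_seq)
 also have "... = (\<integral>\<^sup>+w. \<integral>\<^sup>+w'. f (comb_seq m w w') \<partial>S \<partial>S)"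
  by (subst P.nn_integral_fst[symmetric]) auto
 finally show ?thesis .
qed

text \<open>The hypothesis \<open>past\<close> says that \<open>f\<close> is determined by the
  coordinates before \<open>n\<close>, without introducing a filtration.\<close>

lemma nn_integral_past_times_present:
 assumes f [measurable]: "f \<in> borel_measurable S" and g [measurable]: "g \<in> borel_measurable M"
  and past: "\<And>w w'. w \<in> space S ==> w' \<in> space S ==> f (comb_seq n w w') = f w"
 shows "(\<integral>\<^sup>+w. f w * g (w n) \<partial>S) = (\<integral>\<^sup>+w. f w \<partial>S) * (\<integral>\<^sup>+x. g x \<partial>M)"
proof -
 have "(\<integral>\<^sup>+w. f w * g (w n) \<partial>S) = (\<integral>\<^sup>+w. \<integral>\<^sup>+w'. f (comb_seq n w w') * g (comb_seq n w w' n) \<partial>S \<partial>S)"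
  by (rule nn_integral_comb_seq) measurable
 also have "... = (\<integral>\<^sup>+w. \<integral>\<^sup>+w'. f w * g (w' 0) \<partial>S \<partial>S)"
  by (intro nn_integral_cong) (simp add: past comb_seq_def)
 also have "... = (\<integral>\<^sup>+w. f w * (\<integral>\<^sup>+w'. g (w' 0) \<partial>S) \<partial>S)"
  by (intro nn_integral_cong nn_integral_cmult) measurable
 also have "(\<integral>\<^sup>+w'. g (w' 0) \<partial>S) = (\<integral>\<^sup>+x. g x \<partial>M)"
  by (subst (2) PiM_component[of 0, symmetric], simp, subst nn_integral_distr) auto
 also have "(\<integral>\<^sup>+w. f w * (\<integral>\<^sup>+x. g x \<partial>M) \<partial>S) = (\<integral>\<^sup>+w. f w \<partial>S) * (\<integral>\<^sup>+x. g x \<partial>M)"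
  by (rule nn_integral_multc) measurable
 finally show ?thesis .
qed

text \<open>An invariant event is independent of every cylinder set, and therefore of itself.\<close>

lemma shift_invariant_0_1:
 assumes A [measurable]: "A \<in> sets S" and m: "m >= 1"
  and inv: "\<And>w. w \<in> space S ==> shift m w \<in> A \<longleftrightarrow> w \<in> A"
 shows "prob A = 0 \<or> prob A = 1"
proof -
 have inv': "shift (k * m) w \<in> A \<longleftrightarrow> w \<in> A" if "w \<in> space S" for k w
  using that
 proof (induction k)
  case (Suc k)
  then show ?case using inv[of "shift (k * m) w"] by (simp add: add.commute)
 qed simp
 let ?P = "density S (indicator A)" and ?Q = "scale_measure (emeasure S A) S"
 have "?P = ?Q"
 proof (rule measure_eqI_PiM_infinite)
  fix E :: "nat => 'a set" and J
  assume J: "finite J" "J \<subseteq> UNIV" "\<And>i. i \<in> J ==> E i \<in> sets M"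
  define C where "C = prod_emb UNIV (%_. M) J (Pi\<^sub>E J E)"
  have [measurable]: "C \<in> sets S" unfolding C_def using J by (intro sets_PiM_I) auto
  \<comment> \<open>A shift by \<open>k * m \<ge> k\<close> preserves \<open>A\<close> but forgets
    all coordinates in \<open>J\<close>.\<close>
  obtain k where k: "\<And>i. i \<in> J ==> i < k"
   using J(1) finite_nat_set_iff_bounded by auto
  have lt: "i < k * m" if "i \<in> J" for i
  proof -
   have "k * 1 <= k * m" using m by (intro mult_le_mono2)
   then show ?thesis using k[OF that] by linarith
  qed
  have C: "comb_seq (k * m) w w' \<in> C \<longleftrightarrow> w \<in> C" if "w \<in> space S" "w' \<in> space S" for w w'
   using that lt by (auto simp: C_def prod_emb_def space_PiM PiE_iff comb_seq_less split: split_comb_seq)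
  have A': "comb_seq (k * m) w w' \<in> A \<longleftrightarrow> w' \<in> A" if "w \<in> space S" "w' \<in> space S" for w w'
   using inv'[of "comb_seq (k * m) w w'" k] that
   by (auto simp: shift_comb_seq space_PiM PiE_iff split: split_comb_seq)
  have "emeasure ?P C = (\<integral>\<^sup>+w. indicator A w * indicator C w \<partial>S)"
   by (simp add: emeasure_density)
  also have "... = (\<integral>\<^sup>+w. \<integral>\<^sup>+w'. indicator A (comb_seq (k * m) w w') * indicator C (comb_seq (k * m) w w') \<partial>S \<partial>S)"
   by (rule nn_integral_comb_seq) measurable
  also have "... = (\<integral>\<^sup>+w. \<integral>\<^sup>+w'. indicator A w' * indicator C w \<partial>S \<partial>S)"
   by (intro nn_integral_cong) (simp add: indicator_def A' C)
  also have "... = emeasure S A * emeasure S C"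
   by (simp add: nn_integral_multc nn_integral_cmult)
  finally show "emeasure ?P (prod_emb UNIV (%_. M) J (Pi\<^sub>E J E)) = emeasure ?Q (prod_emb UNIV (%_. M) J (Pi\<^sub>E J E))"
   by (simp add: C_def)
 next
  show "finite_measure ?P"
   by (rule finite_measureI) (simp add: emeasure_density emeasure_eq_measure)
 qed auto
 then have "emeasure ?P A = emeasure ?Q A" by simp
 moreover have "emeasure ?P A = emeasure S A"
  by (simp add: emeasure_density flip: indicator_inter_arith)
 ultimately have "ennreal (prob A) = ennreal (prob A * prob A)"
  by (simp add: emeasure_eq_measure ennreal_mult)
 then have "prob A = prob A * prob A" by (simp add: measure_nonneg)
 then show ?thesis by (metis mult_cancel_left2)
qed

text \<open>\<open>birkhoff_max Y T n w\<close> is the maximum of \<open>0\<close> and of the Birkhoff sums of \<open>Y\<close> of length at most \<open>n\<close>.\<close>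

primrec birkhoff_max :: "('w => real) => ('w => 'w) => nat => 'w => real" where
 "birkhoff_max Y T 0 w = 0"
| "birkhoff_max Y T (Suc n) w = max 0 (Y w + birkhoff_max Y T n (T w))"

lemma birkhoff_max_nonneg: "birkhoff_max Y T n w >= 0"
 by (cases n) auto

lemma birkhoff_max_mono: "birkhoff_max Y T n w <= birkhoff_max Y T (Suc n) w"
proof (induction n arbitrary: w)
 case (Suc n)
 from Suc[of "T w"] show ?case by auto
qed auto

lemma sum_le_birkhoff_max: "(\<Sum>j<n. Y (shift (j * m) w)) <= birkhoff_max Y (shift m) n w"
proof (induction n arbitrary: w)
 case (Suc n)
 from Suc[of "shift m w"] show ?case
  by (subst sum.lessThan_Suc_shift) (simp add: add.commute)
qed auto

text \<open>If the maxima of the Birkhoff sums of \<open>Y = f - c\<close> were unbounded, their increments \<open>B (Suc n) w - B n (shift m w)\<close>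
 would converge to \<open>Y w\<close>; but these have nonnegative integral.\<close>

theorem birkhoff_sum_bounded:
 assumes f: "integrable S f" and c: "(LINT w|S. f w) < c" and m: "m >= 1"
 shows "AE w in S. \<exists>K. \<forall>n. (\<Sum>j<n. f (shift (j * m) w)) <= K + c * real n"
proof -
 define Y where "Y w = f w - c" for w
 define B where "B = birkhoff_max Y (shift m)"
 have Y: "integrable S Y" "(LINT w|S. Y w) < 0"
 proof -
  show "integrable S Y" unfolding Y_def[abs_def] by (intro L1_diff f) simp
  have "(LINT w|S. Y w) = (LINT w|S. f w) - (LINT w|S. c)"
   unfolding Y_def by (intro LINT_diff f) simp
  with c show "(LINT w|S. Y w) < 0" by (simp add: P.prob_space)
 qed
 have [measurable]: "Y \<in> borel_measurable S" by (rule borel_measurable_integrable[OF Y(1)])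
 have intB: "integrable S (B n)" for n
 proof (induction n)
  case (Suc n)
  have "integrable S (%w. Y w + B n (shift m w))"
   by (rule L1_add[OF Y(1) integrable_shift[OF Suc]])
  then have "integrable S (%w. max 0 (Y w + B n (shift m w)))"
   by (rule integrable_max[rotated]) simp
  then show ?case unfolding B_def birkhoff_max.simps .
 qed (simp add: B_def)
 then have [measurable]: "B n \<in> borel_measurable S" for n by (rule borel_measurable_integrable)
 define A where "A = {w\<in>space S. \<forall>K::nat. \<exists>n. B n w > real K}"
 have [measurable]: "A \<in> sets S" unfolding A_def by measurable
 \<comment> \<open>Natural thresholds make \<open>A\<close> measurable; real ones are convenient
   when \<open>Y w\<close> is added.\<close>
 have unb: "(\<forall>K::nat. \<exists>n. B n w > real K) \<longleftrightarrow> (\<forall>K. \<exists>n. B n w > K)" for w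
 proof
  assume *: "\<forall>K::nat. \<exists>n. B n w > real K"
  show "\<forall>K. \<exists>n. B n w > K"
  proof
   fix K :: real
   obtain k :: nat where "K <= real k" using real_arch_simple by blast
   with * show "\<exists>n. B n w > K" by (meson order_le_less_trans)
  qed
 qed blast
 have Binf: "w \<in> A ==> filterlim (%n. B n w) at_top sequentially" for w
 proof -
  assume "w \<in> A"
  then have w: "\<exists>n. B n w > K" for K unfolding A_def using unb[of w] by auto
  have inc: "incseq (%n. B n w)"
   by (rule incseq_SucI) (simp add: B_def birkhoff_max_mono del: birkhoff_max.simps)
  show ?thesis unfolding filterlim_at_top eventually_sequentially
  proof (intro allI)
   fix Z
   obtain n where "B n w > Z" using w by blast
   then show "\<exists>N. \<forall>n\<ge>N. Z <= B n w" using incseqD[OF inc] by (meson less_imp_le order_trans)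
  qed
 qed
 have "prob A = 0 \<or> prob A = 1"
 proof (rule shift_invariant_0_1[OF _ m])
  fix w assume w: "w \<in> space S"
  have "(\<forall>K. \<exists>n. B n (shift m w) > K) \<longleftrightarrow> (\<forall>K. \<exists>n. B n w > K)"
  proof safe
   fix K assume "\<forall>K. \<exists>n. B n (shift m w) > K"
   then obtain n where "B n (shift m w) > K - Y w" by blast
   then have "B (Suc n) w > K" by (simp add: B_def)
   then show "\<exists>n. B n w > K" ..
  next
   fix K assume "\<forall>K. \<exists>n. B n w > K"
   then obtain n where n: "B n w > max 0 (K + Y w)" by blast
   then obtain k where k: "n = Suc k" by (cases n) (auto simp: B_def)
   with n have "B k (shift m w) > K" by (auto simp: B_def)
   then show "\<exists>n. B n (shift m w) > K" ..
  qed
  then show "shift m w \<in> A \<longleftrightarrow> w \<in> A"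
   using w by (simp only: A_def mem_Collect_eq unb shift_in_space)
 qed measurable
 moreover have "prob A \<noteq> 1"
 proof
  assume "prob A = 1"
  then have A1: "AE w in S. w \<in> A" using prob_eq_1[of A] by simp
  define D where "D n w = B (Suc n) w - B n (shift m w)" for n w
  \<comment> \<open>\<open>max 0 (y + b) - b = max (- b) y\<close>. For b \<ge> 0 its absolute value
    is at most that of y, and it equals y as soon as b \<ge> - y.\<close>
  have D: "D n w = max (- B n (shift m w)) (Y w)" for n w
   by (auto simp: D_def B_def)
  have "(%n. \<integral>w. D n w \<partial>S) ----> (LINT w|S. Y w)"
  proof (rule integral_dominated_convergence[where w="%w. \<bar>Y w\<bar>"])
   show "AE w in S. (%n. D n w) ----> Y w"
    using A1 AE_space
   proof eventually_elim
    case (elim w)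
    then have "shift m w \<in> A" using Binf[of w]
    proof -
     have "filterlim (%n. B (Suc n) w) at_top sequentially"
      using Binf[of w] elim by (subst filterlim_sequentially_Suc) auto
     then have *: "\<exists>n. B (Suc n) w > max 0 (K + Y w)" for K
      unfolding filterlim_at_top_dense eventually_sequentially by blast
     have "\<exists>n. B n (shift m w) > K" for K
      using *[of K] by (auto simp: B_def)
     then show ?thesis using elim by (auto simp: A_def)
    qed
    from Binf[OF this] have "EV n. B n (shift m w) >= - Y w"
     by (auto simp: filterlim_at_top)
    then have "EV n. D n w = Y w"
     by eventually_elim (auto simp: D)
    then show ?case by (rule tendsto_eventually)
   qed
   show "AE w in S. norm (D n w) <= \<bar>Y w\<bar>" for n
   proof (rule AE_I2)
    fix w
    have "B n (shift m w) >= 0" by (simp add: B_def birkhoff_max_nonneg)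
    then show "norm (D n w) <= \<bar>Y w\<bar>" unfolding D real_norm_def by linarith
   qed
  qed (simp_all add: D_def Y(1))
  moreover have "(LINT w|S. D n w) >= 0" for n
  proof -
   have "(LINT w|S. D n w) = (LINT w|S. B (Suc n) w) - (LINT w|S. B n w)"
    unfolding D_def by (subst LINT_diff)
     (simp_all add: integral_shift intB integrable_shift)
   also have "... >= 0"
    using integral_mono[OF intB[of n] intB[of "Suc n"]] by (simp add: B_def birkhoff_max_mono del: birkhoff_max.simps)
   finally show ?thesis .
  qed
  ultimately have "(LINT w|S. Y w) >= 0" by (auto intro: LIMSEQ_le_const)
  with Y show False by simp
 qed
 ultimately have "prob A = 0" by simp
 then have "AE w in S. w \<notin> A" by (simp add: P.prob_eq_0)
 then show ?thesis using AE_space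
 proof eventually_elim
  case (elim w)
  then obtain K :: nat where K: "\<And>n. B n w <= real K" by (auto simp: A_def not_less)
  have "(\<Sum>j<n. f (shift (j * m) w)) <= real K + c * real n" for n
   using order_trans[OF sum_le_birkhoff_max[of Y m w n] K[of n, unfolded B_def]]
   by (simp add: Y_def sum_subtractf mult.commute)
  then show ?case by blast
 qed
qed

end

section \<open>Speeds of subadditive arrays\<close>

text \<open>Scheffe's argument: \<open>\<bar>y - v\<bar> = (y - v) + 2 * max 0 (v - y)\<close>,
  where the positive part is dominated by the constant \<open>v\<close>.\<close>

lemma tendsto_AE_and_L1_sequentiallyI:
 fixes Y :: "nat => 'a => real"
 assumes M: "prob_space M" and AE: "AE w in M. (%n. Y n w) ----> v"
  and int: "\<And>n. integrable M (Y n)" and nonneg: "\<And>n. AE w in M. 0 <= Y n w"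
  and E: "(%n. \<integral>w. Y n w \<partial>M) ----> v"
 shows "tendsto_AE_and_L1 M Y v sequentially"
 unfolding tendsto_AE_and_L1_def
proof (intro conjI AE always_eventually allI int)
 interpret prob_space M by fact
 have v: "v >= 0"
  using E by (rule LIMSEQ_le_const) (auto intro!: integral_nonneg_AE nonneg)
 have [measurable]: "Y n \<in> borel_measurable M" for n by (rule borel_measurable_integrable[OF int])
 have int2: "integrable M (%w. max 0 (v - Y n w))" for n
  by (intro integrable_max L1_diff int) auto
 have "(%n. \<integral>w. max 0 (v - Y n w) \<partial>M) ----> (LINT w|M. 0)"
 proof (rule integral_dominated_convergence[where w="%_. v"])
  show "AE w in M. (%n. max 0 (v - Y n w)) ----> 0"
   using AE
  proof eventually_elim
   case (elim w)
   then have "(%n. max 0 (v - Y n w)) ----> max 0 (v - v)" by (intro tendsto_intros)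
   then show ?case by simp
  qed
  show "AE w in M. norm (max 0 (v - Y n w)) <= v" for n
   using nonneg[of n] v by (auto elim!: eventually_mono)
 qed simp_all
 then have "(%n. (LINT w|M. Y n w) - v + 2 * (LINT w|M. max 0 (v - Y n w))) ----> v - v + 2 * 0"
  by (intro tendsto_intros E) simp
 moreover have "(LINT w|M. \<bar>Y n w - v\<bar>) = (LINT w|M. Y n w) - v + 2 * (LINT w|M. max 0 (v - Y n w))" for n
 proof -
  have "(LINT w|M. \<bar>Y n w - v\<bar>) = (LINT w|M. (Y n w - v) + 2 * max 0 (v - Y n w))"
   by (intro LINT_cong refl) (simp add: max_def abs_if)
  also have "... = (LINT w|M. (Y n w - v)) + (LINT w|M. 2 * max 0 (v - Y n w))"
   by (intro LINT_add L1_diff int integrable_mult_right int2) simp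
  also have "(LINT w|M. (Y n w - v)) = (LINT w|M. Y n w) - v"
   by (subst LINT_diff) (simp_all add: int prob_space)
  finally show ?thesis by simp
 qed
 ultimately show "(%n. \<integral>w. \<bar>Y n w - v\<bar> \<partial>M) ----> 0" by simp
qed

text \<open>The L1 limit may be tested on sequences tending to infinity. The almost sure limit has
  to be assumed along all real times at once, since uncountably many null sets cannot be
  joined.\<close>

lemma tendsto_AE_and_L1_at_topI:
 fixes Y :: "real => 'a => real"
 assumes M: "prob_space M" and AE: "AE w in M. ((%t. Y t w) ---> v) at_top"
  and int: "\<And>t. integrable M (Y t)" and nonneg: "\<And>t. AE w in M. 0 <= Y t w"
  and E: "((%t. \<integral>w. Y t w \<partial>M) ---> v) at_top"
 shows "tendsto_AE_and_L1 M Y v at_top"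
proof -
 have "tendsto_AE_and_L1 M (%n. Y (X n)) v sequentially" if "filterlim X at_top sequentially" for X
 proof (rule tendsto_AE_and_L1_sequentiallyI[OF M _ int nonneg])
  show "AE w in M. (%n. Y (X n) w) ----> v"
   using AE by eventually_elim (rule filterlim_compose[OF _ that])
  show "(%n. \<integral>w. Y (X n) w \<partial>M) ----> v" by (rule filterlim_compose[OF E that])
 qed
 then have "((%t. \<integral>w. \<bar>Y t w - v\<bar> \<partial>M) ---> 0) at_top"
  by (intro tendsto_at_topI_sequentially) (simp add: tendsto_AE_and_L1_def)
 then show ?thesis by (simp add: tendsto_AE_and_L1_def AE int)
qed

lemma real_div_bounds: "real (n div m) <= real n / real m" "real n / real m <= real (n div m) + 1"
 using floor_correct[of "real n / real m"] unfolding floor_divide_of_nat_eq by simp_all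

text \<open>Applied twice: to the extreme positions of the walk and to \<open>sep_max\<close> with
  iid weights. The link \<open>H_le_L\<close> between a subadditive majorant and a superadditive
  minorant makes both grow at the same deterministic rate.\<close>

locale speed_array = sequence_space +
 fixes H L :: "nat => (nat => 'a) => real" and c :: nat
 assumes H_integrable: "integrable S (H n)"
  and L_measurable [measurable]: "L n \<in> borel_measurable S"
  and L_nonneg: "0 <= L n w"
  and L_le_H: "L n w <= H n w"
  and H_le_L: "H n w <= L (n + c) w"
  and H_subadd: "H (m + n) w <= H m w + H n (shift m w)"
  and L_superadd: "L m w + L n (shift m w) <= L (m + n) w"
  and H_mono: "H n w <= H (Suc n) w"
  and L_mono: "L n w <= L (Suc n) w"
begin

lemma L_integrable: "integrable S (L n)"
proof (rule L1_bound[OF H_integrable[of n]])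
 show "AE w in S. norm (L n w) <= norm (H n w)"
  using L_nonneg[of n] order_trans[OF L_nonneg L_le_H, of n] L_le_H[of n] by (intro AE_I2) simp
qed simp

lemma H_measurable [measurable]: "H n \<in> borel_measurable S"
 by (rule borel_measurable_integrable[OF H_integrable])

text \<open>An infimum exists before any convergence is known; it turns out to be the limit for
  \<open>H\<close> and for \<open>L\<close>.\<close>

definition speed :: real where
 "speed = (INF n\<in>{1..}. (LINT w|S. H n w) / real n)"

lemma EH_subadd: "(LINT w|S. H (m + n) w) <= (LINT w|S. H m w) + (LINT w|S. H n w)"
proof -
 have "(LINT w|S. H (m + n) w) <= (LINT w|S. H m w + H n (shift m w))"
  by (rule integral_mono[OF H_integrable L1_add[OF H_integrable integrable_shift[OF H_integrable]] H_subadd])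
 also have "... = (LINT w|S. H m w) + (LINT w|S. H n w)"
  by (subst LINT_add[OF H_integrable integrable_shift[OF H_integrable]])
   (simp add: integral_shift)
 finally show ?thesis .
qed

lemma EL_superadd: "(LINT w|S. L m w) + (LINT w|S. L n w) <= (LINT w|S. L (m + n) w)"
proof -
 have "(LINT w|S. L m w) + (LINT w|S. L n w) = (LINT w|S. L m w + L n (shift m w))"
  by (subst LINT_add[OF L_integrable integrable_shift[OF L_integrable]])
   (simp add: integral_shift)
 also have "... <= (LINT w|S. L (m + n) w)"
  by (rule integral_mono[OF L1_add[OF L_integrable integrable_shift[OF L_integrable]] L_integrable L_superadd])
 finally show ?thesis .
qed

lemma EH_mult: "(LINT w|S. H (k * m) w) <= real k * (LINT w|S. H m w)" if "k >= 1"
 using that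
proof (induction k rule: dec_induct)
 case (step k)
 then show ?case using EH_subadd[of m "k * m"] by (simp add: algebra_simps)
qed simp

lemma EL_mult: "real k * (LINT w|S. L m w) <= (LINT w|S. L (k * m) w)" if "k >= 1"
 using that
proof (induction k rule: dec_induct)
 case (step k)
 then show ?case using EL_superadd[of m "k * m"] by (simp add: algebra_simps)
qed simp

lemma EL_le_EH: "(LINT w|S. L n w) <= (LINT w|S. H n w)"
 by (rule integral_mono[OF L_integrable H_integrable L_le_H])

lemma EH_le_EL: "(LINT w|S. H n w) <= (LINT w|S. L (n + c) w)"
 by (rule integral_mono[OF H_integrable L_integrable H_le_L])

lemma speed_le: "speed * real n <= (LINT w|S. H n w)"
proof (cases "n = 0")
 case True
 then show ?thesis using order_trans[OF L_nonneg L_le_H] by (auto intro!: LINT_nonneg)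
next
 case False
 have "speed <= (LINT w|S. H n w) / real n"
  unfolding speed_def using False order_trans[OF L_nonneg L_le_H]
  by (intro cINF_lower bdd_belowI2[where m=0]) (auto intro!: divide_nonneg_nonneg LINT_nonneg)
 then show ?thesis using False by (simp add: field_simps)
qed

text \<open>The ratios for \<open>L k\<close> and \<open>H m\<close> are compared at the common time
  \<open>k * m\<close>, where \<open>L\<close> lies below \<open>H\<close>.\<close>

lemma le_speed: "(LINT w|S. L k w) <= speed * real k"
proof (cases "k = 0")
 case True
 \<comment> \<open>Superadditivity at time 0 forces this expectation to be at most 0.\<close>
 have "(LINT w|S. L 0 w) + (LINT w|S. L 0 w) <= (LINT w|S. L 0 w)" using EL_superadd[of 0 0] by simp
 then show ?thesis using True by simp
next
 case False
 have "(LINT w|S. L k w) / real k <= speed"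
  unfolding speed_def
 proof (rule cINF_greatest)
  fix m :: nat assume m: "m \<in> {1..}"
  have "real m * (LINT w|S. L k w) <= (LINT w|S. L (m * k) w)" using m by (intro EL_mult) auto
  also have "... <= (LINT w|S. H (k * m) w)" using EL_le_EH[of "m * k"] by (simp add: mult.commute)
  also have "... <= real k * (LINT w|S. H m w)" using False by (intro EH_mult) auto
  finally show "(LINT w|S. L k w) / real k <= (LINT w|S. H m w) / real m"
   using m False by (simp add: field_simps)
 qed auto
 then show ?thesis using False by (simp add: field_simps)
qed

lemma speed_nonneg: "speed >= 0"
proof -
 have "0 <= (LINT w|S. L 1 w)" by (intro LINT_nonneg L_nonneg)
 with le_speed[of 1] show ?thesis by simp
qed

text \<open>The time shift makes the convergence quantitative: the expectation of \<open>H n\<close>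
  lies between \<open>speed * n\<close> and \<open>speed * (n + c)\<close>.\<close>

lemma EH_over_n_tendsto: "(%n. (LINT w|S. H n w) / real n) ----> speed"
proof (rule tendsto_sandwich)
 show "EV n. speed <= (LINT w|S. H n w) / real n"
  using eventually_gt_at_top[of 0] by eventually_elim (use speed_le in \<open>simp add: field_simps\<close>)
 show "EV n. (LINT w|S. H n w) / real n <= speed * (1 + real c * inverse (real n))"
  using eventually_gt_at_top[of 0]
 proof eventually_elim
  case (elim n)
  have "(LINT w|S. H n w) <= speed * real (n + c)" by (rule order_trans[OF EH_le_EL le_speed])
  then show ?case using elim by (simp add: field_simps)
 qed
 have "(%n. speed * (1 + real c * inverse (real n))) ----> speed * (1 + real c * 0)"
  by (intro tendsto_intros lim_inverse_n)
 then show "(%n. speed * (1 + real c * inverse (real n))) ----> speed" by simp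
qed simp

lemma EL_over_n_tendsto: "(%n. (LINT w|S. L n w) / real n) ----> speed"
proof (rule tendsto_sandwich)
 show "EV n. (LINT w|S. L n w) / real n <= speed"
  using eventually_gt_at_top[of 0] by eventually_elim (use le_speed in \<open>simp add: field_simps\<close>)
 show "EV n. speed * (1 - real c * inverse (real n)) <= (LINT w|S. L n w) / real n"
  using eventually_gt_at_top[of "max 0 c"]
 proof eventually_elim
  case (elim n)
  have "speed * real (n - c) <= (LINT w|S. L (n - c + c) w)" by (rule order_trans[OF speed_le EH_le_EL])
  then have "speed * (real n - real c) <= (LINT w|S. L n w)" using elim by (simp add: of_nat_diff)
  then have "speed * (real n - real c) / real n <= (LINT w|S. L n w) / real n" by (rule divide_right_mono) simp
  then show ?case using elim by (simp add: field_simps)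
 qed
 have "(%n. speed * (1 - real c * inverse (real n))) ----> speed * (1 - real c * 0)"
  by (intro tendsto_intros lim_inverse_n)
 then show "(%n. speed * (1 - real c * inverse (real n))) ----> speed" by simp
qed simp

lemma H_mono_le: "m <= n ==> H m w <= H n w"
 by (rule lift_Suc_mono_le[of "%n. H n w"]) (auto intro: H_mono)

lemma L_mono_le: "m <= n ==> L m w <= L n w"
 by (rule lift_Suc_mono_le[of "%n. L n w"]) (auto intro: L_mono)

lemma H_le_sum: "H (Suc k * m) w <= (\<Sum>j<Suc k. H m (shift (j * m) w))"
proof (induction k)
 case (Suc k)
 then show ?case using H_subadd[of "Suc k * m" m w] by (simp add: algebra_simps)
qed simp

lemma sum_le_L: "(\<Sum>j<k. L m (shift (j * m) w)) <= L (k * m) w"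
proof (induction k)
 case (Suc k)
 then show ?case using L_superadd[of "k * m" w m] by (simp add: algebra_simps)
qed (simp add: L_nonneg)

text \<open>For a block length \<open>m\<close> with nearly optimal mean, \<open>H\<close> is at
  most a sum over blocks, which \<open>birkhoff_sum_bounded\<close> controls up to a constant. Half
  of \<open>e\<close> pays for the choice of \<open>m\<close>, the rest absorbs the
  constant.\<close>

lemma AE_eventually_H_le:
 assumes "e > 0"
 shows "AE w in S. EV n. H n w / real n <= speed + e"
proof -
 have "EV m. (LINT w|S. H m w) / real m < speed + e / 2 \<and> m >= 1"
  using order_tendstoD(2)[OF EH_over_n_tendsto, of "speed + e/2"] assms
  by (intro eventually_conj eventually_ge_at_top) auto
 then obtain m where m: "(LINT w|S. H m w) / real m < speed + e / 2" "m >= 1"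
  by (auto simp: eventually_sequentially)
 define d where "d = real m * (speed + e / 2)"
 have "(LINT w|S. H m w) < d" using m by (simp add: d_def field_simps)
 from birkhoff_sum_bounded[OF H_integrable this m(2)]
 show ?thesis
 proof eventually_elim
  case (elim w)
  then obtain K where K: "\<And>n. (\<Sum>j<n. H m (shift (j * m) w)) <= K + d * real n" by blast
  have bound: "H n w / real n <= (K + d) / real n + (speed + e / 2)" if "n > 0" for n
  proof -
   have "n <= Suc (n div m) * m"
    using m(2) dividend_less_times_div[of m n] by (simp add: algebra_simps)
   then have "H n w <= H (Suc (n div m) * m) w" by (rule H_mono_le)
   also have "... <= K + d * real (Suc (n div m))" by (rule order_trans[OF H_le_sum K])
   also have "... <= K + d * (real n / real m + 1)"
    using m(2) assms speed_nonneg by (intro add_left_mono mult_left_mono)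
     (auto simp: d_def real_div_bounds)
   also have "... = K + d + (speed + e / 2) * real n"
    using m(2) by (simp add: d_def field_simps)
   finally show ?thesis using that by (simp add: field_simps)
  qed
  have "(%n. (K + d) / real n + (speed + e / 2)) ----> 0 + (speed + e / 2)"
   by (intro tendsto_intros lim_const_over_n)
  then have "EV n. (K + d) / real n + (speed + e / 2) < speed + e"
   using assms by (intro order_tendstoD) auto
  then show ?case using eventually_gt_at_top[of 0]
   by eventually_elim (use bound in \<open>meson less_imp_le order_trans\<close>)
 qed
qed

text \<open>The same bound for \<open>- L\<close>, whose block sums dominate it by
  superadditivity.\<close>

lemma AE_eventually_L_ge:
 assumes "e > 0"
 shows "AE w in S. EV n. speed - e <= L n w / real n"
proof -
 have "EV m. speed - e / 2 < (LINT w|S. L m w) / real m \<and> m >= 1"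
  using order_tendstoD(1)[OF EL_over_n_tendsto, of "speed - e/2"] assms
  by (intro eventually_conj eventually_ge_at_top) auto
 then obtain m where m: "speed - e / 2 < (LINT w|S. L m w) / real m" "m >= 1"
  by (auto simp: eventually_sequentially)
 define d where "d = real m * (speed - e / 2)"
 have "(LINT w|S. - L m w) < - d" using m by (simp add: d_def field_simps)
 from birkhoff_sum_bounded[OF integrable_minus[OF L_integrable] this m(2)]
 show ?thesis
 proof eventually_elim
  case (elim w)
  then obtain K where K: "\<And>n. (\<Sum>j<n. - L m (shift (j * m) w)) <= K + - d * real n" by blast
  have bound: "speed - e / 2 - (K + \<bar>d\<bar>) / real n <= L n w / real n" if "n > 0" for n
  proof -
   have "- K + d * real (n div m) <= (\<Sum>j<n div m. L m (shift (j * m) w))"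
    using K[of "n div m"] by (simp add: sum_negf)
   also have "... <= L (n div m * m) w" by (rule sum_le_L)
   also have "... <= L n w" by (rule L_mono_le) simp
   finally have *: "- K + d * real (n div m) <= L n w" .
   \<comment> \<open>As \<open>d\<close> may be negative, the rounding of \<open>n / m\<close> is
     charged with \<open>\<bar>d\<bar>\<close>.\<close>
   have "\<bar>real (n div m) - real n / real m\<bar> <= 1"
    using real_div_bounds[of n m] by linarith
   then have "\<bar>d\<bar> * \<bar>real (n div m) - real n / real m\<bar> <= \<bar>d\<bar> * 1" by (intro mult_left_mono) auto
   then have "\<bar>d * (real (n div m) - real n / real m)\<bar> <= \<bar>d\<bar>" by (simp add: abs_mult)
   then have "d * real (n div m) >= d * (real n / real m) - \<bar>d\<bar>" by (simp add: algebra_simps)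
   moreover have "d * (real n / real m) = (speed - e / 2) * real n" using m(2) by (simp add: d_def)
   ultimately have "(speed - e / 2) * real n - (K + \<bar>d\<bar>) <= L n w" using * by linarith
   then have "((speed - e / 2) * real n - (K + \<bar>d\<bar>)) / real n <= L n w / real n" by (rule divide_right_mono) simp
   then show ?thesis using that by (simp add: diff_divide_distrib)
  qed
  have "(%n. speed - e / 2 - (K + \<bar>d\<bar>) / real n) ----> speed - e / 2 - 0"
   by (intro tendsto_intros lim_const_over_n)
  then have "EV n. speed - e < speed - e / 2 - (K + \<bar>d\<bar>) / real n"
   using assms by (intro order_tendstoD) auto
  then show ?case using eventually_gt_at_top[of 0]
   by eventually_elim (use bound in \<open>meson less_imp_le order_trans\<close>)
 qed
qed

lemma AE_tendsto_speed:
 "AE w in S. (%n. H n w / real n) ----> speed \<and> (%n. L n w / real n) ----> speed"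
proof -
 have "AE w in S. \<forall>k::nat. (EV n. H n w / real n <= speed + 1 / real (Suc k)) \<and>
   (EV n. speed - 1 / real (Suc k) <= L n w / real n)"
  unfolding AE_all_countable by (intro allI AE_conjI AE_eventually_H_le AE_eventually_L_ge) auto
 then show ?thesis
 proof eventually_elim
  case (elim w)
  have le: "L n w / real n <= H n w / real n" for n by (simp add: L_le_H divide_right_mono)
  have *: "EV n. \<bar>H n w / real n - speed\<bar> < e \<and> \<bar>L n w / real n - speed\<bar> < e"
   if e: "e > 0" for e
  proof -
   obtain k where k: "1 / real (Suc k) < e" using reals_Archimedean[OF e] by (auto simp: inverse_eq_divide)
   from elim[rule_format, of k, THEN conjunct1] elim[rule_format, of k, THEN conjunct2]
   show ?thesis
    by eventually_elim (use le k in \<open>smt (verit, best)\<close>)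
  qed
  have "EV n. dist (H n w / real n) speed < e" if "e > 0" for e
   using *[OF that] by (simp add: eventually_conj_iff dist_real_def)
  moreover have "EV n. dist (L n w / real n) speed < e" if "e > 0" for e
   using *[OF that] by (simp add: eventually_conj_iff dist_real_def)
  ultimately show ?case by (simp add: tendsto_iff)
 qed
qed

theorem H_tendsto_speed: "tendsto_AE_and_L1 S (%n w. H n w / real n) speed sequentially"
proof (rule tendsto_AE_and_L1_sequentiallyI)
 show "AE w in S. (%n. H n w / real n) ----> speed"
  using AE_tendsto_speed by eventually_elim blast
 show "integrable S (%w. H n w / real n)" for n by (rule integrable_divide[OF H_integrable])
 show "AE w in S. 0 <= H n w / real n" for n
  by (intro AE_I2 divide_nonneg_nonneg order_trans[OF L_nonneg L_le_H]) auto
 show "(%n. \<integral>w. H n w / real n \<partial>S) ----> speed" using EH_over_n_tendsto by simp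
qed (rule P.prob_space_axioms)

theorem L_tendsto_speed: "tendsto_AE_and_L1 S (%n w. L n w / real n) speed sequentially"
proof (rule tendsto_AE_and_L1_sequentiallyI)
 show "AE w in S. (%n. L n w / real n) ----> speed"
  using AE_tendsto_speed by eventually_elim blast
 show "integrable S (%w. L n w / real n)" for n by (rule integrable_divide[OF L_integrable])
 show "AE w in S. 0 <= L n w / real n" for n by (intro AE_I2 divide_nonneg_nonneg L_nonneg) auto
 show "(%n. \<integral>w. L n w / real n \<partial>S) ----> speed" using EL_over_n_tendsto by simp
qed (rule P.prob_space_axioms)

end

section \<open>Maximal sums over separated sets\<close>

definition separated :: "nat => nat set => bool" where
 "separated g S \<longleftrightarrow> (\<forall>i\<in>S. \<forall>j\<in>S. i < j \<longrightarrow> i + g <= j)"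

text \<open>The functional to which both models are compared: the weights are maxima of generations
  for the walk and maxima of time cells for the stairs process.\<close>

definition sep_max :: "nat => nat => (nat => real) => real" where
 "sep_max g n a = Max (sum a ` {S. S \<subseteq> {..<n} \<and> separated g S})"

lemma separated_empty [simp]: "separated g {}"
 by (simp add: separated_def)

lemma separatedD: "separated g S ==> i \<in> S ==> j \<in> S ==> i < j ==> i + g <= j"
 by (auto simp: separated_def)

lemma separated_subset: "separated g S ==> T \<subseteq> S ==> separated g T"
 by (auto simp: separated_def)

lemma finite_separated_sets: "finite {S. S \<subseteq> {..<n} \<and> separated g S}"
 by (rule finite_subset[of _ "Pow {..<n}"]) auto

lemma sep_max_ge: "S \<subseteq> {..<n} ==> separated g S ==> sum a S <= sep_max g n a"
 unfolding sep_max_def by (intro Max_ge finite_imageI finite_separated_sets) auto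

lemma sep_max_attained:
 obtains S where "S \<subseteq> {..<n}" "separated g S" "sep_max g n a = sum a S"
proof -
 have "sep_max g n a \<in> sum a ` {S. S \<subseteq> {..<n} \<and> separated g S}"
  unfolding sep_max_def
  by (intro Max_in finite_imageI finite_separated_sets) (auto intro!: exI[of _ "{}"])
 then show ?thesis using that by blast
qed

lemma sep_max_leI: "(\<And>S. S \<subseteq> {..<n} ==> separated g S ==> sum a S <= b) ==> sep_max g n a <= b"
 by (metis sep_max_attained)

lemma sep_max_nonneg: "0 <= sep_max g n a"
 using sep_max_ge[of "{}" n g a] by simp

lemma sep_max_0 [simp]: "sep_max g 0 a = 0"
 by (rule antisym[OF sep_max_leI sep_max_nonneg]) simp

lemma sep_max_mono:
 assumes "m <= n" and "\<And>i. i < m ==> a i <= b i"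
 shows "sep_max g m a <= sep_max g n b"
proof (rule sep_max_leI)
 fix S assume S: "S \<subseteq> {..<m}" "separated g S"
 have "sum a S <= sum b S" using S assms by (intro sum_mono) auto
 also have "... <= sep_max g n b" using S assms by (intro sep_max_ge) auto
 finally show "sum a S <= sep_max g n b" .
qed

lemma sep_max_cong: "(\<And>i. i < n ==> a i = b i) ==> sep_max g n a = sep_max g n b"
 by (intro antisym sep_max_mono) auto

lemma sep_max_antimono: "g <= g' ==> sep_max g' n a <= sep_max g n a"
 by (rule sep_max_leI, rule sep_max_ge) (auto simp: separated_def intro: le_trans[OF add_left_mono])

text \<open>Cutting a separated set at \<open>m\<close> leaves two separated sets.\<close>

lemma sep_max_subadd: "sep_max g (m + n) a <= sep_max g m a + sep_max g n (shift m a)"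
proof (rule sep_max_leI)
 fix S assume S: "S \<subseteq> {..<m + n}" "separated g S"
 have fin: "finite S" using S(1) finite_subset by blast
 let ?T = "(%i. i - m) ` (S - {..<m})"
 have inj: "inj_on (%i. i - m) (S - {..<m})" by (auto simp: inj_on_def)
 have "sum a S = sum a (S \<inter> {..<m}) + sum a (S - {..<m})"
  using fin by (metis sum.Int_Diff)
 also have "sum a (S \<inter> {..<m}) <= sep_max g m a"
  using S by (intro sep_max_ge) (auto intro: separated_subset)
 also have "sum a (S - {..<m}) = sum (shift m a) ?T"
  using inj by (subst sum.reindex) (auto simp: shift_def intro!: sum.cong)
 also have "... <= sep_max g n (shift m a)"
 proof (rule sep_max_ge)
  show "separated g ?T"
   unfolding separated_def
  proof (intro ballI impI, elim imageE)
   fix i j i' j' assume *: "i < j" "i = i' - m" "j = j' - m" "i' \<in> S - {..<m}" "j' \<in> S - {..<m}"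
   then have "i' + g <= j'" using separatedD[OF S(2), of i' j'] by auto
   with * show "i + g <= j" by auto
  qed
 qed (use S(1) in auto)
 finally show "sum a S <= sep_max g m a + sep_max g n (shift m a)" by simp
qed

text \<open>With the shortened horizon the first set ends at \<open>m - g\<close>, which leaves the
  full gap to the second one starting at \<open>m\<close>. Truncated subtraction makes horizons
  shorter than the gap empty.\<close>

lemma sep_max_superadd:
 assumes "g >= 1"
 shows "sep_max g (m - (g - 1)) a + sep_max g (n - (g - 1)) (shift m a) <= sep_max g (m + n - (g - 1)) a"
proof -
 obtain S where S: "S \<subseteq> {..<m - (g - 1)}" "separated g S" "sep_max g (m - (g - 1)) a = sum a S"
  by (rule sep_max_attained)
 obtain T where T: "T \<subseteq> {..<n - (g - 1)}" "separated g T" "sep_max g (n - (g - 1)) (shift m a) = sum (shift m a) T"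
  by (rule sep_max_attained)
 let ?T = "(%i. m + i) ` T"
 have Sm: "i + g <= m" if "i \<in> S" for i using that S(1) by (auto dest!: subsetD)
 have Tm: "i + g <= n" if "i \<in> T" for i using that T(1) by (auto dest!: subsetD)
 have fin: "finite S" "finite T" using S(1) T(1) finite_subset by blast+
 have dj: "S \<inter> ?T = {}" using Sm assms by fastforce
 have "sum a S + sum (shift m a) T = sum a S + sum a ?T"
  by (subst sum.reindex) (auto simp: shift_def inj_on_def)
 also have "... = sum a (S \<union> ?T)" using fin dj by (intro sum.union_disjoint[symmetric]) auto
 also have "... <= sep_max g (m + n - (g - 1)) a"
 proof (rule sep_max_ge)
  show "S \<union> ?T \<subseteq> {..<m + n - (g - 1)}"
   using Sm Tm assms by fastforce
  show "separated g (S \<union> ?T)"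
   unfolding separated_def
  proof (intro ballI impI)
   fix i j assume ij: "i \<in> S \<union> ?T" "j \<in> S \<union> ?T" "i < j"
   consider "i \<in> S" "j \<in> S" | "i \<in> S" "j \<in> ?T" | "i \<in> ?T" "j \<in> S" | "i \<in> ?T" "j \<in> ?T"
    using ij by blast
   then show "i + g <= j"
   proof cases
    case 1 then show ?thesis using separatedD[OF S(2)] ij by blast
   next
    case 2 then show ?thesis using Sm[of i] by auto
   next
    case 3 then show ?thesis using Sm[of j] ij(3) by auto
   next
    case 4 then show ?thesis using separatedD[OF T(2)] ij(3) by auto
   qed
  qed
 qed
 finally show ?thesis using S(3) T(3) by simp
qed

text \<open>The recursion behind the upper bounds for the walk and for the stairs process: the index
  \<open>u\<close> may be added to any separated set that ends at \<open>u - g\<close>.\<close>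

lemma sep_max_step:
 assumes "g >= 1"
 shows "sep_max g (Suc u - g) a + a u <= sep_max g (Suc u) a"
proof -
 obtain S where S: "S \<subseteq> {..<Suc u - g}" "separated g S" "sep_max g (Suc u - g) a = sum a S"
  by (rule sep_max_attained)
 have lt: "i + g <= u" if "i \<in> S" for i using that S(1) by (auto dest!: subsetD)
 have fin: "finite S" using S(1) finite_subset by blast
 have "u \<notin> S" using lt[of u] assms by auto
 then have "sum a S + a u = sum a (insert u S)" using fin by simp
 also have "... <= sep_max g (Suc u) a"
 proof (rule sep_max_ge)
  show "insert u S \<subseteq> {..<Suc u}" using lt by fastforce
  show "separated g (insert u S)"
   unfolding separated_def
  proof (intro ballI impI)
   fix i j assume "i \<in> insert u S" "j \<in> insert u S" "i < j"
   then show "i + g <= j" using separatedD[OF S(2), of i j] lt[of i] lt[of j] by auto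
  qed
 qed
 finally show ?thesis using S by simp
qed

lemma sep_max_le_sum: "(\<And>i. i < n ==> 0 <= a i) ==> sep_max g n a <= (\<Sum>i<n. a i)"
 by (rule sep_max_leI, rule sum_mono2) auto

text \<open>Through this bound, L1 couplings of the weights give convergence of the expected maximal
  sums.\<close>

lemma sep_max_lipschitz: "\<bar>sep_max g n a - sep_max g n b\<bar> <= (\<Sum>i<n. \<bar>a i - b i\<bar>)"
proof -
 have *: "sep_max g n a <= sep_max g n b + (\<Sum>i<n. \<bar>a i - b i\<bar>)" for a b :: "nat => real"
 proof (rule sep_max_leI)
  fix S assume S: "S \<subseteq> {..<n}" "separated g S"
  have "sum a S <= sum b S + (\<Sum>i\<in>S. \<bar>a i - b i\<bar>)"
   unfolding sum.distrib[symmetric] by (rule sum_mono) auto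
  also have "(\<Sum>i\<in>S. \<bar>a i - b i\<bar>) <= (\<Sum>i<n. \<bar>a i - b i\<bar>)" using S by (intro sum_mono2) auto
  also have "sum b S <= sep_max g n b" using S by (rule sep_max_ge)
  finally show "sum a S <= sep_max g n b + (\<Sum>i<n. \<bar>a i - b i\<bar>)" by simp
 qed
 from *[of a b] *[of b a] show ?thesis by (simp add: abs_minus_commute abs_le_iff)
qed

lemma sep_max_scale: "c >= 0 ==> sep_max g n (%i. c * a i) = c * sep_max g n a"
proof (rule antisym)
 assume c: "c >= 0"
 show "sep_max g n (%i. c * a i) <= c * sep_max g n a"
  by (rule sep_max_leI) (auto simp: sum_distrib_left[symmetric] intro!: mult_left_mono sep_max_ge c)
 obtain S where "S \<subseteq> {..<n}" "separated g S" "sep_max g n a = sum a S" by (rule sep_max_attained)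
 then show "c * sep_max g n a <= sep_max g n (%i. c * a i)"
  using sep_max_ge[of S n g "%i. c * a i"] by (simp add: sum_distrib_left)
qed

lemma inj_on_div_separated:
 fixes p :: nat
 assumes "separated g S" "p <= g" "p >= 1"
 shows "inj_on (%i. i div p) S"
proof -
 have "i div p \<noteq> j div p" if "i \<in> S" "j \<in> S" "i < j" for i j
 proof -
  have "(i + p) div p <= j div p"
   using separatedD[OF assms(1) that] assms(2) by (intro div_le_mono) linarith
  then show ?thesis using assms(3) by simp
 qed
 then show ?thesis unfolding inj_on_def by (metis linorder_neqE_nat)
qed

lemma sep_max_le_card:
 assumes "g >= 1" "K >= 0" "\<And>i. i < n ==> a i <= K"
 shows "sep_max g n a <= K * (real n / real g + 1)"
proof (rule sep_max_leI)
 fix S assume S: "S \<subseteq> {..<n}" "separated g S"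
 have "card S = card ((%i. i div g) ` S)"
  using inj_on_div_separated[OF S(2), of g] assms by (simp add: card_image)
 also have "... <= card {..n div g}"
  using S by (intro card_mono) (auto intro!: div_le_mono dest!: subsetD)
 finally have "real (card S) <= real n / real g + 1"
  using real_div_bounds(1)[of n g] by simp
 moreover have "sum a S <= (\<Sum>i\<in>S. K)" using S assms by (intro sum_mono) auto
 ultimately show "sum a S <= K * (real n / real g + 1)"
  using assms(2) by (simp add: mult.commute) (meson mult_left_mono order_trans)
qed

text \<open>Indices \<open>p * q\<close> apart lie in blocks of length \<open>p\<close> whose
  numbers are at least \<open>q\<close> apart; in particular no block is used twice.\<close>

lemma sep_max_coarsen:
 assumes pq: "p >= 1" "q >= 1" and le: "\<And>i. i < p * m ==> a i <= b (i div p)"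
 shows "sep_max (p * q) (p * m) a <= sep_max q m b"
proof (rule sep_max_leI)
 fix S assume S: "S \<subseteq> {..<p * m}" "separated (p * q) S"
 have "p * 1 <= p * q" using pq(2) by (rule mult_le_mono2)
 then have inj: "inj_on (%i. i div p) S" using pq by (intro inj_on_div_separated[OF S(2)]) auto
 have "sum a S <= (\<Sum>i\<in>S. b (i div p))" using S le by (intro sum_mono) auto
 also have "... = sum b ((%i. i div p) ` S)" using inj by (simp add: sum.reindex)
 also have "... <= sep_max q m b"
 proof (rule sep_max_ge)
  show "(%i. i div p) ` S \<subseteq> {..<m}"
   using S(1) by (auto simp: less_mult_imp_div_less mult.commute dest!: subsetD)
  show "separated q ((%i. i div p) ` S)"
   unfolding separated_def
  proof (intro ballI impI, elim imageE)
   fix x y i j assume *: "x < y" "x = i div p" "y = j div p" "i \<in> S" "j \<in> S"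
   then have "i < j" by (meson div_le_mono leD not_less)
   then have "(i + p * q) div p <= j div p" using * separatedD[OF S(2)] by (intro div_le_mono) blast
   then show "x + q <= y" using * pq by simp
  qed
 qed
 finally show "sum a S <= sep_max q m b" .
qed

text \<open>The last index of one block and the first index of the block \<open>q + 1\<close>
  further on differ by \<open>p * q + 1\<close>; this is the origin of \<open>Suc\<close> on both
  sides.\<close>

lemma sep_max_refine:
 assumes p: "p >= 1" and ex: "\<And>j. j < m ==> \<exists>i. i div p = j \<and> b j <= a i"
 shows "sep_max (Suc q) m b <= sep_max (Suc (p * q)) (p * m) a"
proof (rule sep_max_leI)
 fix S assume S: "S \<subseteq> {..<m}" "separated (Suc q) S"
 obtain f where f: "\<And>j. j < m ==> f j div p = j \<and> b j <= a (f j)" using ex by metis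
 have fS: "j \<in> S ==> f j div p = j \<and> b j <= a (f j)" for j using S f by auto
 have inj: "inj_on f S" by (rule inj_onI) (metis fS)
 have "sum b S <= (\<Sum>j\<in>S. a (f j))" using fS by (intro sum_mono) auto
 also have "... = sum a (f ` S)" using inj by (simp add: sum.reindex)
 also have "... <= sep_max (Suc (p * q)) (p * m) a"
 proof (rule sep_max_ge)
  have "f j < p * m" if "j \<in> S" for j
   using fS[OF that] S(1) that p by (metis lessThan_iff less_mult_imp_div_less mult.commute not_le div_le_mono nonzero_mult_div_cancel_left not_one_le_zero leD subsetD)
  then show "f ` S \<subseteq> {..<p * m}" by auto
  show "separated (Suc (p * q)) (f ` S)"
   unfolding separated_def
  proof (intro ballI impI, elim imageE)
   fix x y i j assume *: "x < y" "x = f i" "y = f j" "i \<in> S" "j \<in> S"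
   have "i < j" using * fS by (metis div_le_mono less_imp_le nat_less_le order_less_irrefl)
   then have ij: "i + Suc q <= j" using separatedD[OF S(2)] * by blast
   have "f i < Suc (f i div p) * p" using p by (metis dividend_less_div_times le_eq_less_or_eq less_one mult.commute mult_Suc not_less neq0_conv Nat.add_0_right mult_Suc_right)
   then have "f i < Suc i * p" using fS[OF *(4)] by simp
   moreover have "j * p <= f j" using fS[OF *(5)] by (metis div_times_less_eq_dividend)
   moreover have "(i + Suc q) * p <= j * p" using ij by (rule mult_le_mono1)
   ultimately show "x + Suc (p * q) <= y" using * by (simp add: algebra_simps)
  qed
 qed
 finally show "sum b S <= sep_max (Suc (p * q)) (p * m) a" .
qed

lemma sep_max_measurable [measurable]:
 assumes [measurable]: "\<And>i. f i \<in> borel_measurable M"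
 shows "(%w. sep_max g n (%i. f i w)) \<in> borel_measurable M"
 unfolding sep_max_def by (intro borel_measurable_Max finite_separated_sets borel_measurable_sum) simp

section \<open>Pathwise properties of the N-branching random walk\<close>

definition nbrw_step :: "nat => real list => (nat => real) => real list" where
 "nbrw_step N p y = drop N (sort [p ! (i - 1) + y (2 * i - j). i \<leftarrow> [1..<Suc N], j \<leftarrow> [0, 1]])"

lemma nbrw_list_Suc: "nbrw_list N x (Suc n) = nbrw_step N (nbrw_list N x n) (x n)"
 by (simp add: nbrw_step_def)

declare nbrw_list.simps(2) [simp del]

text \<open>Child \<open>k = 2 * i - j\<close> with \<open>j\<close> in {0, 1} has parent
  \<open>i\<close>, whose position in the list is \<open>i - 1 = (k - 1) div 2\<close>.\<close>

definition child :: "real list => (nat => real) => nat => real" where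
 "child p y k = p ! ((k - 1) div 2) + y k"

lemma upset_eq:
 assumes "U \<subseteq> {..<n::nat}" and "\<And>i j. i \<in> U ==> i <= j ==> j < n ==> j \<in> U"
 shows "U = {n - card U..<n}"
proof (cases "U = {}")
 case False
 have fin: "finite U" using assms(1) finite_subset by blast
 have "U = {Min U..<n}"
  using assms(1) fin assms(2)[OF Min_in[OF fin False]] by (auto intro: Min_le)
 moreover from this have "card U = n - Min U" by (metis card_atLeastLessThan)
 moreover have "Min U < n" using assms(1) Min_in[OF fin False] by auto
 ultimately show ?thesis by simp
qed simp

text \<open>Order statistics are read off from counts above a level. Comparisons of populations
  become comparisons of such counts.\<close>

lemma sorted_nth_gt_iff:
 assumes "sorted q" "i < length q"
 shows "q ! i > c \<longleftrightarrow> length q - i <= card {j. j < length q \<and> q ! j > c}"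
proof -
 let ?U = "{j. j < length q \<and> q ! j > c}"
 have U: "?U = {length q - card ?U..<length q}"
  using sorted_nth_mono[OF assms(1)] by (intro upset_eq) (auto intro: less_le_trans)
 have "q ! i > c \<longleftrightarrow> i \<in> ?U" using assms by simp
 also have "... \<longleftrightarrow> length q - card ?U <= i" by (subst U) (use assms in simp)
 finally show ?thesis by linarith
qed

lemma length_children:
 "length [p ! (i - 1) + y (2 * i - j). i \<leftarrow> [1..<Suc N], j \<leftarrow> [0, 1]] = 2 * N" for p :: "real list"
 by (induction N) auto

lemma count_children:
 "length (filter (%z. z > c) [p ! (i - 1) + y (2 * i - j). i \<leftarrow> [1..<Suc N], j \<leftarrow> [0, 1]]) =
  card {k\<in>{1..2 * N}. child p y k > c}"
proof (induction N)
 case (Suc N)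
 let ?C = "{k\<in>{1..2 * N}. child p y k > c}"
 let ?A = "if child p y (2 * N + 1) > c then {2 * N + 1} else {}"
 let ?B = "if child p y (2 * N + 2) > c then {2 * N + 2} else {}"
 have "{k\<in>{1..2 * Suc N}. child p y k > c} = ?C \<union> (?A \<union> ?B)"
  by (auto simp: le_Suc_eq)
 also have "card ... = card ?C + (card ?A + card ?B)"
  by (subst card_Un_disjoint, auto)+
 finally show ?case using Suc by (simp add: child_def)
qed simp

lemma length_nbrw_step [simp]: "length (nbrw_step N p y) = N"
 unfolding nbrw_step_def length_drop length_sort length_children by simp

lemma sorted_nbrw_step: "sorted (nbrw_step N p y)"
 unfolding nbrw_step_def by (intro sorted_wrt_drop) simp

text \<open>Selecting the \<open>N\<close> largest children truncates the count above every level at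
  \<open>N\<close>. This replaces reasoning about sorting and ties.\<close>

lemma count_nbrw_step:
 "card {i. i < N \<and> nbrw_step N p y ! i > c} = min N (card {k\<in>{1..2 * N}. child p y k > c})"
proof -
 define ch where "ch = [p ! (i - 1) + y (2 * i - j). i \<leftarrow> [1..<Suc N], j \<leftarrow> [0, 1]]"
 have len: "length (sort ch) = 2 * N" unfolding ch_def length_sort by (rule length_children)
 let ?U = "{i. i < 2 * N \<and> sort ch ! i > c}"
 have U: "?U = {2 * N - card ?U..<2 * N}"
  using sorted_nth_mono[OF sorted_sort[of ch]] len by (intro upset_eq) (auto intro: less_le_trans)
 have "{i. i < N \<and> nbrw_step N p y ! i > c} = (%i. i - N) ` (?U \<inter> {N..})"
 proof (intro set_eqI iffI)
  fix i assume "i \<in> {i. i < N \<and> nbrw_step N p y ! i > c}"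
  then have "N + i \<in> ?U \<inter> {N..}" using len unfolding nbrw_step_def ch_def[symmetric] by simp
  then show "i \<in> (%i. i - N) ` (?U \<inter> {N..})" by (rule rev_image_eqI) simp
 next
  fix i assume "i \<in> (%i. i - N) ` (?U \<inter> {N..})"
  then show "i \<in> {i. i < N \<and> nbrw_step N p y ! i > c}"
   using len unfolding nbrw_step_def ch_def[symmetric] by auto
 qed
 also have "card ... = card (?U \<inter> {N..})" by (intro card_image) (auto simp: inj_on_def)
 also have "?U \<inter> {N..} = {max N (2 * N - card ?U)..<2 * N}" by (subst U) auto
 also have "card ... = min N (card ?U)" by simp
 also have "card ?U = length (filter (%z. z > c) (sort ch))" using len by (simp add: length_filter_conv_card)
 also have "... = length (filter (%z. z > c) ch)" by (simp add: filter_sort)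
 also have "... = card {k\<in>{1..2 * N}. child p y k > c}" unfolding ch_def by (rule count_children)
 finally show ?thesis .
qed

lemma nbrw_step_gt_iff:
 assumes "i < N"
 shows "nbrw_step N p y ! i > c \<longleftrightarrow> N - i <= card {k\<in>{1..2 * N}. child p y k > c}"
proof -
 have "nbrw_step N p y ! i > c \<longleftrightarrow> N - i <= card {j. j < N \<and> nbrw_step N p y ! j > c}"
  using sorted_nth_gt_iff[OF sorted_nbrw_step, of i N p y c] assms by simp
 then show ?thesis unfolding count_nbrw_step by linarith
qed

lemma parent_less: "k \<in> {1..2 * N} ==> (k - 1) div 2 < (N :: nat)"
 by auto

text \<open>A child above a level in the first population is, up to \<open>a + b\<close>, above it
  in the second, so the counts compare. The offsets allow for restarts from other positions and for
  thresholded jumps.\<close>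

lemma nbrw_step_mono:
 assumes p: "\<And>i. i < N ==> p ! i <= p' ! i + a"
  and y: "\<And>k. k \<in> {1..2 * N} ==> y k <= y' k + b" and i: "i < N"
 shows "nbrw_step N p y ! i <= nbrw_step N p' y' ! i + (a + b)"
proof (rule ccontr)
 let ?c = "nbrw_step N p' y' ! i"
 assume "\<not> nbrw_step N p y ! i <= ?c + (a + b)"
 then have "N - i <= card {k\<in>{1..2 * N}. child p y k > ?c + (a + b)}"
  unfolding not_le nbrw_step_gt_iff[OF i] .
 also have "... <= card {k\<in>{1..2 * N}. child p' y' k > ?c}"
 proof (intro card_mono subsetI)
  fix k assume "k \<in> {k\<in>{1..2 * N}. child p y k > ?c + (a + b)}"
  then show "k \<in> {k\<in>{1..2 * N}. child p' y' k > ?c}"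
   using p[OF parent_less[of k N]] y[of k] by (auto simp: child_def)
 qed simp
 finally have "nbrw_step N p' y' ! i > ?c" unfolding nbrw_step_gt_iff[OF i] .
 then show False by simp
qed

lemma length_nbrw_list [simp]: "length (nbrw_list N x n) = N"
 by (cases n) (simp_all add: nbrw_list_Suc)

lemma sorted_nbrw_list: "sorted (nbrw_list N x n)"
 by (cases n) (simp_all add: nbrw_list_Suc sorted_nbrw_step)

lemma nbrw_list_0_nth [simp]: "i < N ==> nbrw_list N x 0 ! i = 0"
 by simp

lemma nbrw_list_upto:
 assumes "\<And>s k. s < n ==> x s k = x' s k"
 shows "nbrw_list N x n = nbrw_list N x' n"
 using assms
proof (induction n)
 case (Suc n)
 then have "nbrw_list N x n = nbrw_list N x' n" "x n = x' n" by auto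
 then show ?case by (simp add: nbrw_list_Suc)
qed simp

lemma nbrw_cong:
 assumes "\<And>s k. s < n ==> k \<in> {1..2 * N} ==> x s k = x' s k" "i < N"
 shows "nbrw_list N x n ! i = nbrw_list N x' n ! i"
 using assms
proof (induction n arbitrary: i)
 case (Suc n)
 have "nbrw_step N (nbrw_list N x n) (x n) ! i <= nbrw_step N (nbrw_list N x' n) (x' n) ! i + (0 + 0)"
  using Suc by (intro nbrw_step_mono) auto
 moreover have "nbrw_step N (nbrw_list N x' n) (x' n) ! i <= nbrw_step N (nbrw_list N x n) (x n) ! i + (0 + 0)"
  using Suc by (intro nbrw_step_mono) auto
 ultimately show ?case by (simp add: nbrw_list_Suc)
qed simp

lemma real_card_eq_sum_indicator:
 "real (card {k\<in>{1..m}. f k > c}) = (\<Sum>k=1..m. indicator {z. z > c} (f k))"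
 for f :: "nat => real"
 by (simp only: real_of_card sum.inter_filter[OF finite_atLeastAtMost] indicator_def mem_Collect_eq of_bool_def)

text \<open>A position exceeds \<open>c\<close> iff a count is large, and the count is a sum of
  indicators of events about children.\<close>

lemma nbrw_measurable [measurable]:
 assumes x: "\<And>s k. k \<in> {1..2 * N} ==> (%w. x w s k) \<in> borel_measurable M" and "i < N"
 shows "(%w. nbrw_list N (x w) n ! i) \<in> borel_measurable M"
 using assms(2)
proof (induction n arbitrary: i)
 case (Suc n)
 have ch: "(%w. child (nbrw_list N (x w) n) (x w n) k) \<in> borel_measurable M" if "k \<in> {1..2 * N}" for k
  unfolding child_def by (intro borel_measurable_add Suc.IH[OF parent_less[OF that]] x[OF that])
 show ?case
 proof (rule borel_measurableI_greater)
  fix c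
  have "(%w. indicator {z. z > c} (child (nbrw_list N (x w) n) (x w n) k) :: real) \<in> borel_measurable M"
   if "k \<in> {1..2 * N}" for k
   by (rule measurable_compose[OF ch[OF that]]) simp
  then have [measurable]: "(%w. \<Sum>k=1..2 * N. indicator {z. z > c} (child (nbrw_list N (x w) n) (x w n) k) :: real)
   \<in> borel_measurable M" by (rule borel_measurable_sum)
  have "{w\<in>space M. N - i <= card {k\<in>{1..2 * N}. child (nbrw_list N (x w) n) (x w n) k > c}} =
   {w\<in>space M. real (N - i) <= (\<Sum>k=1..2 * N. indicator {z. z > c} (child (nbrw_list N (x w) n) (x w n) k))}"
   unfolding real_card_eq_sum_indicator[symmetric] of_nat_le_iff ..
  also have "... \<in> sets M" by measurable
  finally show "{w\<in>space M. c < nbrw_list N (x w) (Suc n) ! i} \<in> sets M"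
   unfolding nbrw_list_Suc nbrw_step_gt_iff[OF Suc.prems] .
 qed
qed simp

section \<open>The lowest and the highest particle\<close>

locale population =
 fixes N :: nat
 assumes N: "N >= 1"
begin

definition lowest :: "(nat => nat => real) => nat => real" where
 "lowest x n = nbrw_list N x n ! 0"

definition highest :: "(nat => nat => real) => nat => real" where
 "highest x n = nbrw_list N x n ! (N - 1)"

lemma lowest_0 [simp]: "lowest x 0 = 0" and highest_0 [simp]: "highest x 0 = 0"
 using N by (simp_all add: lowest_def highest_def)

lemma lowest_le: "i < N ==> lowest x n <= nbrw_list N x n ! i"
 unfolding lowest_def by (rule sorted_nth_mono[OF sorted_nbrw_list]) auto

lemma le_highest: "i < N ==> nbrw_list N x n ! i <= highest x n"
 unfolding highest_def by (rule sorted_nth_mono[OF sorted_nbrw_list]) auto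

lemma lowest_le_highest: "lowest x n <= highest x n"
 using lowest_le[of "N - 1" x n] N by (simp add: highest_def)

lemma nbrw_list_mono:
 assumes x: "\<And>s k. s < n ==> k \<in> {1..2 * N} ==> x s k <= x' s k + b s" and i: "i < N"
 shows "nbrw_list N x n ! i <= nbrw_list N x' n ! i + (\<Sum>s<n. b s)"
 using x i
proof (induction n arbitrary: i)
 case (Suc n)
 have "nbrw_step N (nbrw_list N x n) (x n) ! i <= nbrw_step N (nbrw_list N x' n) (x' n) ! i + ((\<Sum>s<n. b s) + b n)"
  using Suc by (intro nbrw_step_mono) auto
 then show ?case by (simp add: nbrw_list_Suc)
qed simp

lemma highest_mono: 
 "(\<And>s k. s < n ==> k \<in> {1..2 * N} ==> x s k <= x' s k + b s) ==> highest x n <= highest x' n + (\<Sum>s<n. b s)"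
 unfolding highest_def using N by (intro nbrw_list_mono) auto

text \<open>Moving all particles at time \<open>m\<close> to the highest, respectively lowest,
  position raises, respectively lowers, the later population, which then starts afresh from a single
  point.\<close>

lemma nbrw_list_restart:
 assumes "i < N"
 shows "nbrw_list N x (m + n) ! i <= nbrw_list N (shift m x) n ! i + highest x m"
  and "nbrw_list N (shift m x) n ! i + lowest x m <= nbrw_list N x (m + n) ! i"
 using assms
proof (induction n arbitrary: i)
 case 0
 { case 1 then show ?case by (simp add: le_highest) }
 { case 2 then show ?case by (simp add: lowest_le) }
next
 case (Suc n)
 { case 1
  have "nbrw_step N (nbrw_list N x (m + n)) (x (m + n)) ! i
   <= nbrw_step N (nbrw_list N (shift m x) n) (shift m x n) ! i + (highest x m + 0)"
   using Suc(1) 1 by (intro nbrw_step_mono) (auto simp: shift_def)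
  then show ?case by (simp add: nbrw_list_Suc) }
 { case 2
  have "nbrw_step N (nbrw_list N (shift m x) n) (shift m x n) ! i
   <= nbrw_step N (nbrw_list N x (m + n)) (x (m + n)) ! i + (- lowest x m + 0)"
   using Suc(2) 2 by (intro nbrw_step_mono) (auto simp: shift_def le_diff_eq)
  then show ?case by (simp add: nbrw_list_Suc) }
qed

lemma highest_subadd: "highest x (m + n) <= highest x m + highest (shift m x) n"
 using nbrw_list_restart(1)[of "N - 1" x m n] N by (simp add: highest_def)

lemma lowest_superadd: "lowest x m + lowest (shift m x) n <= lowest x (m + n)"
 using nbrw_list_restart(2)[of 0 m x n] N by (simp add: lowest_def)

lemma highest_Suc_le:
 assumes "\<And>k. k \<in> {1..2 * N} ==> child (nbrw_list N x n) (x n) k <= c"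
 shows "highest x (Suc n) <= c"
proof -
 have "{k\<in>{1..2 * N}. child (nbrw_list N x n) (x n) k > c} = {}" using assms by force
 then have "card {k\<in>{1..2 * N}. child (nbrw_list N x n) (x n) k > c} = 0" by (simp only: card.empty)
 then have "\<not> nbrw_step N (nbrw_list N x n) (x n) ! (N - 1) > c"
  using N by (subst nbrw_step_gt_iff) linarith+
 then show ?thesis by (simp add: highest_def nbrw_list_Suc)
qed

lemma child_le_highest:
 assumes "k \<in> {1..2 * N}"
 shows "child (nbrw_list N x n) (x n) k <= highest x (Suc n)"
proof (rule ccontr)
 assume *: "\<not> child (nbrw_list N x n) (x n) k <= highest x (Suc n)"
 then have "card {k} <= card {k\<in>{1..2 * N}. child (nbrw_list N x n) (x n) k > highest x (Suc n)}"
  using assms by (intro card_mono) auto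
 then have "N - (N - 1) <= card {k\<in>{1..2 * N}. child (nbrw_list N x n) (x n) k > highest x (Suc n)}"
  by simp
 then have "nbrw_step N (nbrw_list N x n) (x n) ! (N - 1) > highest x (Suc n)"
  using N by (subst nbrw_step_gt_iff) linarith+
 then show False by (simp add: highest_def nbrw_list_Suc)
qed

lemma highest_le_sum:
 assumes "\<And>s k. s < n ==> k \<in> {1..2 * N} ==> x s k <= b s"
 shows "highest x n <= (\<Sum>s<n. b s)"
 using assms
proof (induction n)
 case (Suc n)
 have "highest x (Suc n) <= (\<Sum>s<n. b s) + b n"
 proof (rule highest_Suc_le)
  fix k assume k: "k \<in> {1..2 * N}"
  have "highest x n <= (\<Sum>s<n. b s)" using Suc by auto
  then show "child (nbrw_list N x n) (x n) k <= (\<Sum>s<n. b s) + b n"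
   unfolding child_def using le_highest[OF parent_less[OF k], of x n] Suc.prems[of n k] k by auto
 qed
 then show ?case by simp
qed simp

definition count_above :: "(nat => nat => real) => nat => real => nat" where
 "count_above x n c = card {i. i < N \<and> nbrw_list N x n ! i > c}"

lemma count_above_Suc:
 "count_above x (Suc n) c = min N (card {k\<in>{1..2 * N}. child (nbrw_list N x n) (x n) k > c})"
 by (simp add: count_above_def nbrw_list_Suc count_nbrw_step)

lemma card_parents_above:
 "card {k\<in>{1..2 * N}. nbrw_list N x n ! ((k - 1) div 2) > c} = 2 * count_above x n c"
proof -
 let ?A = "{i. i < N \<and> nbrw_list N x n ! i > c}"
 have "{k\<in>{1..2 * N}. nbrw_list N x n ! ((k - 1) div 2) > c} = (%i. 2 * i + 1) ` ?A \<union> (%i. 2 * i + 2) ` ?A"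
  (is "?l = ?r")
 proof (intro set_eqI iffI)
  fix k assume k: "k \<in> ?l"
  then have i: "(k - 1) div 2 \<in> ?A" using parent_less[of k] by simp
  show "k \<in> ?r"
  proof (cases "even k")
   case True
   then have "k = 2 * ((k - 1) div 2) + 2" using k by (auto elim!: evenE)
   then show ?thesis using i by blast
  next
   case False
   then have "k = 2 * ((k - 1) div 2) + 1" by (auto elim!: oddE)
   then show ?thesis using i by blast
  qed
 qed auto
 moreover have "card ((%i. 2 * i + 1) ` ?A \<union> (%i. 2 * i + 2) ` ?A) = card ((%i. 2 * i + 1) ` ?A) + card ((%i. 2 * i + 2) ` ?A)"
 proof (rule card_Un_disjoint)
  have "2 * i + 1 \<noteq> 2 * j + 2" for i j :: nat by presburger
  then show "(%i. 2 * i + 1) ` ?A \<inter> (%i. 2 * i + 2) ` ?A = {}" by blast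
  have "finite ?A" by (rule finite_subset[of _ "{..<N}"]) auto
  then show "finite ((%i. 2 * i + 1) ` ?A)" "finite ((%i. 2 * i + 2) ` ?A)" by (rule finite_imageI)+
 qed
 moreover have "card ((%i. 2 * i + 1) ` ?A) = card ?A" by (rule card_image) (simp add: inj_on_def)
 moreover have "card ((%i. 2 * i + 2) ` ?A) = card ?A" by (rule card_image) (simp add: inj_on_def)
 ultimately show ?thesis unfolding count_above_def by (simp only: mult_2)
qed

lemma lowest_gt_iff: "lowest x n > c \<longleftrightarrow> N <= count_above x n c"
 using sorted_nth_gt_iff[OF sorted_nbrw_list, of 0 N x n c] N by (simp add: lowest_def count_above_def)

lemma highest_gt_iff: "highest x n > c \<longleftrightarrow> 1 <= count_above x n c"
 using sorted_nth_gt_iff[OF sorted_nbrw_list, of "N - 1" N x n c] N by (simp add: highest_def count_above_def)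

text \<open>A child above \<open>c\<close> has a parent above \<open>c\<close> or makes a positive
  jump.\<close>

lemma count_above_Suc_le:
 "count_above x (Suc n) c <= 2 * count_above x n c + card {k\<in>{1..2 * N}. x n k > 0}"
proof -
 have "card {k\<in>{1..2 * N}. child (nbrw_list N x n) (x n) k > c}
  <= card ({k\<in>{1..2 * N}. nbrw_list N x n ! ((k - 1) div 2) > c} \<union> {k\<in>{1..2 * N}. x n k > 0})"
  by (intro card_mono) (auto simp: child_def)
 also have "... <= 2 * count_above x n c + card {k\<in>{1..2 * N}. x n k > 0}"
  by (rule order_trans[OF card_Un_le]) (simp only: card_parents_above)
 finally show ?thesis by (simp add: count_above_Suc)
qed

end

section \<open>Takeover by a leading particle and the lower bound\<close>

locale nonneg_jumps = population +
 fixes x :: "nat => nat => real"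
 assumes nonneg: "0 <= x s k"
begin

lemma count_above_Suc_ge: "min N (2 * count_above x n c) <= count_above x (Suc n) c"
proof -
 have "card {k\<in>{1..2 * N}. nbrw_list N x n ! ((k - 1) div 2) > c}
  <= card {k\<in>{1..2 * N}. child (nbrw_list N x n) (x n) k > c}"
  using nonneg by (intro card_mono) (auto simp: child_def intro: add_strict_increasing2 less_le_trans)
 then show ?thesis unfolding card_parents_above count_above_Suc by linarith
qed

lemma count_above_add_ge: "min N (2 ^ m * count_above x n c) <= count_above x (n + m) c"
proof (induction m)
 case (Suc m)
 have "min N (2 ^ Suc m * count_above x n c) <= min N (2 * min N (2 ^ m * count_above x n c))" by auto
 also have "... <= min N (2 * count_above x (n + m) c)" using Suc by auto
 also have "... <= count_above x (n + Suc m) c" using count_above_Suc_ge[of "n + m" c] by simp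
 finally show ?case .
qed simp

lemma lowest_Suc: "lowest x n <= lowest x (Suc n)"
proof (rule ccontr)
 assume "\<not> lowest x n <= lowest x (Suc n)"
 then have "lowest x n > lowest x (Suc n)" by simp
 then have "N <= count_above x n (lowest x (Suc n))" unfolding lowest_gt_iff .
 then have "N <= count_above x (Suc n) (lowest x (Suc n))" using count_above_Suc_ge[of n "lowest x (Suc n)"] by linarith
 then show False unfolding lowest_gt_iff[symmetric] by simp
qed

lemma highest_Suc: "highest x n <= highest x (Suc n)"
proof (rule ccontr)
 assume "\<not> highest x n <= highest x (Suc n)"
 then have "highest x n > highest x (Suc n)" by simp
 then have "1 <= count_above x n (highest x (Suc n))" unfolding highest_gt_iff .
 then have "1 <= count_above x (Suc n) (highest x (Suc n))"
  using count_above_Suc_ge[of n "highest x (Suc n)"] N by linarith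
 then show False unfolding highest_gt_iff[symmetric] by simp
qed

lemma lowest_mono_le: "m <= n ==> lowest x m <= lowest x n"
 by (rule lift_Suc_mono_le[of "lowest x"]) (auto intro: lowest_Suc)

lemma lowest_nonneg: "0 <= lowest x n"
 using lowest_mono_le[of 0 n] by simp

text \<open>The number of particles above a level at least doubles per generation until it reaches
  \<open>N\<close>.\<close>

lemma highest_le_lowest:
 assumes "N <= 2 ^ l"
 shows "highest x n <= lowest x (n + l)"
proof (rule ccontr)
 let ?c = "lowest x (n + l)"
 assume "\<not> highest x n <= ?c"
 then have "1 <= count_above x n ?c" unfolding not_le highest_gt_iff .
 then have "2 ^ l * 1 <= 2 ^ l * count_above x n ?c" by (rule mult_le_mono2)
 then have "N <= count_above x (n + l) ?c" using count_above_add_ge[of l n ?c] assms by linarith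
 then show False by (simp add: lowest_gt_iff[symmetric])
qed

text \<open>A jump of generation \<open>i\<close> is realised at time \<open>i + 1\<close>, and at
  time \<open>i + 1 + l\<close> the whole population is at that height. With gap
  \<open>l + 1\<close> this happens no later than the next chosen jump, which therefore starts on
  top of all earlier ones.\<close>

lemma sep_max_le_lowest:
 assumes l: "N <= 2 ^ l" and a: "\<And>s. \<exists>k\<in>{1..2 * N}. a s <= x s k"
 shows "sep_max (Suc l) n a <= lowest x (n + l)"
proof (rule sep_max_leI)
 fix S assume "S \<subseteq> {..<n}" "separated (Suc l) S"
 then show "sum a S <= lowest x (n + l)"
 proof (induction n arbitrary: S rule: less_induct)
  case (less n)
  show ?case
  proof (cases n)
   case 0
   then show ?thesis using less.prems by (simp add: lowest_nonneg)
  next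
   case (Suc u)
   show ?thesis
   proof (cases "u \<in> S")
    case False
    then have "S \<subseteq> {..<u}" using less.prems(1) Suc less_Suc_eq by auto
    then have "sum a S <= lowest x (u + l)" using less.IH[of u S] Suc less.prems(2) by auto
    also have "... <= lowest x (n + l)" using Suc by (intro lowest_mono_le) simp
    finally show ?thesis .
   next
    case True
    \<comment> \<open>The earlier chosen times are at most \<open>u - l - 1\<close>, so the
      induction hypothesis with horizon \<open>u - l\<close> speaks about the population at time
      \<open>u\<close>.\<close>
    have sub: "i + Suc l <= u" if "i \<in> S - {u}" for i
    proof -
     have "i < u" using less.prems(1) Suc that by auto
     then show ?thesis using separatedD[OF less.prems(2), of i u] that True by auto
    qed
    have sum: "sum a (S - {u}) <= lowest x u"
    proof (cases "l <= u")
     case True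
     have "S - {u} \<subseteq> {..<u - l}" using sub by fastforce
     then have "sum a (S - {u}) <= lowest x (u - l + l)"
      using less.IH[of "u - l" "S - {u}"] Suc separated_subset[OF less.prems(2)] by auto
     then show ?thesis using True by simp
    next
     case False
     then have "S - {u} = {}" using sub by fastforce
     then show ?thesis by (metis lowest_nonneg sum.empty)
    qed
    obtain k where k: "k \<in> {1..2 * N}" "a u <= x u k" using a by blast
    have "lowest x u + a u <= child (nbrw_list N x u) (x u) k"
     unfolding child_def using k lowest_le[OF parent_less[OF k(1)], of x u] by simp
    also have "... <= highest x (Suc u)" by (rule child_le_highest[OF k(1)])
    also have "... <= lowest x (n + l)" using highest_le_lowest[OF l, of "Suc u"] Suc by simp
    finally have "lowest x u + a u <= lowest x (n + l)" .
    moreover have "sum a S = a u + sum a (S - {u})"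
     using True less.prems(1) finite_subset[OF less.prems(1)] by (simp add: sum.remove)
    ultimately show ?thesis using sum by linarith
   qed
  qed
 qed
qed

end

section \<open>Tainted particles and the upper bound\<close>

context nonneg_jumps
begin

definition top_jump :: "nat => real" where
 "top_jump s = Max (x s ` {1..2 * N})"

lemma top_jump_ge: "k \<in> {1..2 * N} ==> x s k <= top_jump s"
 unfolding top_jump_def by (intro Max_ge) auto

text \<open>A particle is tainted if it exceeds the bound that held \<open>d\<close> generations ago; then it has had a
 positive jump in the meantime. Its children contribute to the error \<open>taint_error\<close>, which makes it
 possible to work without genealogies.\<close>

fun taint_error :: "nat => nat => real" where
 "taint_error d u = (\<Sum>k=1..2 * N. if nbrw_list N x u ! ((k - 1) div 2) >
   sep_max (Suc d) (u - d) top_jump + (\<Sum>u'<u - d. taint_error d u') then x u k else 0)"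

declare taint_error.simps [simp del]

lemma taint_error_nonneg: "0 <= taint_error d u"
 by (subst taint_error.simps) (auto intro!: sum_nonneg nonneg)

text \<open>Bound and error depend on each other recursively, so \<open>taint_error\<close> is
  defined with this expression written out; \<open>taint_error_eq\<close> folds it back.\<close>

definition taint_bound :: "nat => nat => real" where
 "taint_bound d u = sep_max (Suc d) u top_jump + (\<Sum>u'<u. taint_error d u')"

lemma taint_error_eq:
 "taint_error d u = (\<Sum>k=1..2 * N. if nbrw_list N x u ! ((k - 1) div 2) > taint_bound d (u - d) then x u k else 0)"
 by (subst taint_error.simps) (simp add: taint_bound_def)

text \<open>An untainted parent is below the bound of \<open>d\<close> generations ago, so the jump
  of its child extends a set with gap \<open>d + 1\<close>. The jump of a child of a tainted parent
  is paid for by \<open>taint_error\<close>.\<close>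

lemma highest_le_taint_bound: "highest x u <= taint_bound d u"
proof (induction u)
 case 0
 then show ?case by (simp add: taint_bound_def)
next
 case (Suc u)
 show ?case
 proof (rule highest_Suc_le)
  fix k assume k: "k \<in> {1..2 * N}"
  let ?p = "nbrw_list N x u ! ((k - 1) div 2)"
  have Suc_eq: "taint_bound d (Suc u) = sep_max (Suc d) (Suc u) top_jump + (\<Sum>u'<u. taint_error d u') + taint_error d u"
   by (simp add: taint_bound_def)
  show "child (nbrw_list N x u) (x u) k <= taint_bound d (Suc u)"
  proof (cases "?p > taint_bound d (u - d)")
   case True
   have "x u k <= taint_error d u"
    unfolding taint_error_eq using k True nonneg
    by (intro order_trans[OF _ member_le_sum[of k]]) auto
   moreover have "?p <= taint_bound d u" using le_highest[OF parent_less[OF k], of x u] Suc by linarith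
   moreover have "sep_max (Suc d) u top_jump <= sep_max (Suc d) (Suc u) top_jump" by (rule sep_max_mono) auto
   ultimately show ?thesis unfolding child_def Suc_eq by (simp add: taint_bound_def)
  next
   case False
   have "sep_max (Suc d) (u - d) top_jump + top_jump u <= sep_max (Suc d) (Suc u) top_jump"
    using sep_max_step[of "Suc d" u top_jump] by simp
   moreover have "(\<Sum>u'<u - d. taint_error d u') <= (\<Sum>u'<u. taint_error d u')"
    by (intro sum_mono2) (auto intro: taint_error_nonneg)
   ultimately show ?thesis
    using False top_jump_ge[OF k, of u] taint_error_nonneg[of d u]
    unfolding child_def Suc_eq by (simp add: taint_bound_def)
  qed
 qed
qed

text \<open>No particle exceeded this bound \<open>d\<close> generations ago. Since then each
  positive jump has brought at most one further particle above it, and numbers at most double per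
  generation. For thresholded jumps, positive jumps are rare.\<close>

lemma count_tainted_le:
 "count_above x u (taint_bound d (u - d)) <= (\<Sum>s\<in>{u - d..<u}. 2 ^ (u - Suc s) * card {k\<in>{1..2 * N}. x s k > 0})"
proof -
 let ?c = "taint_bound d (u - d)"
 have "count_above x (u - d + m) ?c <= (\<Sum>s\<in>{u - d..<u - d + m}. 2 ^ (u - d + m - Suc s) * card {k\<in>{1..2 * N}. x s k > 0})" for m
 proof (induction m)
  case 0
  have "\<not> 1 <= count_above x (u - d) ?c"
   unfolding highest_gt_iff[symmetric] not_less by (rule highest_le_taint_bound)
  then show ?case by simp
 next
  case (Suc m)
  let ?n = "u - d + m"
  have "count_above x (Suc ?n) ?c <= 2 * count_above x ?n ?c + card {k\<in>{1..2 * N}. x ?n k > 0}"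
   by (rule count_above_Suc_le)
  also have "... <= 2 * (\<Sum>s\<in>{u - d..<?n}. 2 ^ (?n - Suc s) * card {k\<in>{1..2 * N}. x s k > 0}) + card {k\<in>{1..2 * N}. x ?n k > 0}"
   using Suc by simp
  also have "... = (\<Sum>s\<in>{u - d..<?n}. 2 ^ (Suc ?n - Suc s) * card {k\<in>{1..2 * N}. x s k > 0}) + card {k\<in>{1..2 * N}. x ?n k > 0}"
   unfolding sum_distrib_left by (intro arg_cong2[where f="(+)"] sum.cong refl)
    (simp add: Suc_diff_le mult.assoc[symmetric] flip: power_Suc Suc_diff_Suc)
  also have "... = (\<Sum>s\<in>{u - d..<Suc ?n}. 2 ^ (Suc ?n - Suc s) * card {k\<in>{1..2 * N}. x s k > 0})"
   by simp
  finally show ?case unfolding add_Suc_right .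
 qed
 from this[of "u - (u - d)"] show ?thesis by simp
qed

end

section \<open>Independent maxima over separated sets\<close>

definition esep :: "nat => nat => real measure => real" where
 "esep g n \<nu> = (\<integral>w. sep_max g n w \<partial>(\<Pi>\<^sub>M i\<in>UNIV. \<nu>))"

definition sep_speed :: "nat => real measure => real" where
 "sep_speed g \<nu> = (INF n\<in>{1..}. esep g n \<nu> / real n)"

lemma sep_max_measurable_PiM:
 assumes "sets \<nu> = sets borel" "{..<n} \<subseteq> I"
 shows "sep_max g n \<in> borel_measurable (\<Pi>\<^sub>M i\<in>I. \<nu>)"
proof -
 have "(%w. w i) \<in> borel_measurable (\<Pi>\<^sub>M i\<in>I. \<nu>)" if "i < n" for i
 proof -
  have "(%w. w i) \<in> measurable (\<Pi>\<^sub>M i\<in>I. \<nu>) \<nu>" using that assms(2) by (intro measurable_component_singleton) auto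
  then show ?thesis unfolding measurable_cong_sets[OF refl assms(1)] .
 qed
 then show ?thesis unfolding sep_max_def
  by (intro borel_measurable_Max finite_separated_sets borel_measurable_sum) blast
qed

text \<open>The expected maximal sum depends only on the joint law of the weights, so it may be
  computed on the canonical product space.\<close>

lemma (in prob_space) expectation_sep_max:
 assumes ind: "indep_vars (%_. borel) \<zeta> {..<n}" and law: "\<And>i. i < n ==> distr M borel (\<zeta> i) = \<nu>"
  and \<nu>: "prob_space \<nu>" "sets \<nu> = sets borel"
 shows "(LINT w|M. sep_max g n (%i. \<zeta> i w)) = esep g n \<nu>"
proof (cases "n = 0")
 case True
 then show ?thesis by (simp add: esep_def)
next
 case False
 interpret \<nu>: prob_space \<nu> by fact
 interpret Q: product_prob_space "%_. \<nu>" "UNIV :: nat set" by unfold_locales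
 have cong: "sets (\<Pi>\<^sub>M i\<in>{..<n}. \<nu>) = sets (\<Pi>\<^sub>M i\<in>{..<n}. (borel :: real measure))"
  by (intro sets_PiM_cong refl \<nu>(2))
 have meas: "sep_max g n \<in> borel_measurable (\<Pi>\<^sub>M i\<in>{..<n}. \<nu>)"
  by (rule sep_max_measurable_PiM[OF \<nu>(2)]) simp
 have restr: "sep_max g n (restrict a {..<n}) = sep_max g n a" for a by (rule sep_max_cong) simp
 have rv: "\<zeta> i \<in> borel_measurable M" if "i < n" for i using ind that by (auto simp: indep_vars_def)
 have X: "(%w. \<lambda>i\<in>{..<n}. \<zeta> i w) \<in> measurable M (\<Pi>\<^sub>M i\<in>{..<n}. borel)"
  using rv by (intro measurable_restrict) auto
 have "distr M (\<Pi>\<^sub>M i\<in>{..<n}. borel) (%w. \<lambda>i\<in>{..<n}. \<zeta> i w) = (\<Pi>\<^sub>M i\<in>{..<n}. distr M borel (\<zeta> i))"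
  using ind rv False by (subst indep_vars_iff_distr_eq_PiM'[symmetric]) auto
 also have "... = (\<Pi>\<^sub>M i\<in>{..<n}. \<nu>)" by (intro PiM_cong refl) (auto simp: law)
 finally have 1: "distr M (\<Pi>\<^sub>M i\<in>{..<n}. borel) (%w. \<lambda>i\<in>{..<n}. \<zeta> i w) = (\<Pi>\<^sub>M i\<in>{..<n}. \<nu>)" .
 have "(\<integral>w. sep_max g n w \<partial>(\<Pi>\<^sub>M i\<in>{..<n}. \<nu>)) = (LINT w|M. sep_max g n (%i. \<zeta> i w))"
  unfolding 1[symmetric]
  by (subst integral_distr[OF X]) (simp_all only: restr meas[unfolded measurable_cong_sets[OF cong refl]])
 moreover have "(\<integral>w. sep_max g n w \<partial>(\<Pi>\<^sub>M i\<in>{..<n}. \<nu>)) = esep g n \<nu>"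
  unfolding esep_def
 proof (subst Q.distr_PiM_restrict_finite[symmetric, of "{..<n}"])
  show "(\<integral>w. sep_max g n w \<partial>distr (Pi\<^sub>M UNIV (%_. \<nu>)) (Pi\<^sub>M {..<n} (%_. \<nu>)) (%x. restrict x {..<n})) =
   (\<integral>w. sep_max g n w \<partial>Pi\<^sub>M UNIV (%_. \<nu>))"
   by (subst integral_distr[OF measurable_restrict_subset meas]) (simp_all only: restr subset_UNIV)
 qed simp_all
 ultimately show ?thesis by simp
qed

locale sep_law =
 fixes \<nu> :: "real measure"
 assumes \<nu>_prob: "prob_space \<nu>" and sets_\<nu>: "sets \<nu> = sets borel" and \<nu>_integrable: "integrable \<nu> (%x. x)"
begin

lemma \<nu>_sequence_space: "sequence_space \<nu>"
proof -
 interpret prob_space \<nu> by (rule \<nu>_prob)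
 show ?thesis by unfold_locales
qed

sublocale sequence_space \<nu> by (rule \<nu>_sequence_space)

lemma integrable_component: "integrable S (%w. w i)" and expectation_component: "(LINT w|S. w i) = (LINT x|\<nu>. x)"
proof -
 have 1: "distr S \<nu> (%w. w i) = \<nu>" by (rule PiM_component) simp
 have [measurable_cong]: "sets \<nu> = sets borel" by (rule sets_\<nu>)
 have 2: "(%w. w i) \<in> measurable S \<nu>" by simp
 show "integrable S (%w. w i)"
  using integrable_distr[OF 2, of "%x. x :: real"] \<nu>_integrable unfolding 1 .
 show "(LINT w|S. w i) = (LINT x|\<nu>. x)"
  using integral_distr[OF 2, of "%x. x :: real"] unfolding 1 by simp
qed

lemma integrable_sep_max: "integrable S (sep_max g n)"
proof (rule L1_bound)
 show "integrable S (%w. \<Sum>i<n. \<bar>w i\<bar>)"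
  by (intro L1_sum integrable_abs integrable_component)
 show "sep_max g n \<in> borel_measurable S" by (rule sep_max_measurable_PiM[OF sets_\<nu>]) simp
 show "AE w in S. norm (sep_max g n w) <= norm (\<Sum>i<n. \<bar>w i\<bar>)"
 proof (rule AE_I2)
  fix w :: "nat => real"
  have "sep_max g n w <= sep_max g n (%i. \<bar>w i\<bar>)" by (rule sep_max_mono) auto
  also have "... <= (\<Sum>i<n. \<bar>w i\<bar>)" by (rule sep_max_le_sum) simp
  finally show "norm (sep_max g n w) <= norm (\<Sum>i<n. \<bar>w i\<bar>)"
   using sep_max_nonneg[of g n w] by (simp add: sum_nonneg)
 qed
qed

text \<open>The horizon shortened by \<open>g - 1\<close> is the superadditive minorant, and the
  lost indices are the time shift of \<open>speed_array\<close>.\<close>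

lemma speed_array_sep_max:
 assumes "g >= 1"
 shows "speed_array \<nu> (sep_max g) (%n. sep_max g (n - (g - 1))) (g - 1)"
proof unfold_locales
 show "integrable S (sep_max g n)" for n by (rule integrable_sep_max)
 show "sep_max g (n - (g - 1)) \<in> borel_measurable S" for n by (rule sep_max_measurable_PiM[OF sets_\<nu>]) simp
 show "sep_max g (m + n) w <= sep_max g m w + sep_max g n (shift m w)" for m n w by (rule sep_max_subadd)
 show "sep_max g (m - (g - 1)) w + sep_max g (n - (g - 1)) (shift m w) <= sep_max g (m + n - (g - 1)) w" for m n w
  by (rule sep_max_superadd[OF assms])
qed (auto intro: sep_max_nonneg sep_max_mono)

lemma speed_eq_sep_speed: "g >= 1 ==> speed_array.speed \<nu> (sep_max g) = sep_speed g \<nu>"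
 by (simp add: speed_array.speed_def[OF speed_array_sep_max] sep_speed_def esep_def)

lemma esep_tendsto: "g >= 1 ==> (%n. esep g n \<nu> / real n) ----> sep_speed g \<nu>"
 using speed_array.EH_over_n_tendsto[OF speed_array_sep_max, of g] by (simp add: speed_eq_sep_speed esep_def)

lemma AE_sep_max_tendsto:
 assumes "g >= 1"
 shows "AE w in S. (%n. sep_max g n w / real n) ----> sep_speed g \<nu>"
 using speed_array.AE_tendsto_speed[OF speed_array_sep_max[OF assms]]
 unfolding speed_eq_sep_speed[OF assms] by eventually_elim blast

lemma esep_nonneg: "0 <= esep g n \<nu>"
 unfolding esep_def by (intro LINT_nonneg sep_max_nonneg)

end

section \<open>Functions and block maxima of an iid sequence\<close>

context sequence_space
begin

lemma indep_vars_component: "indep_vars (%_. M) (%i w. w i) (UNIV :: nat set)"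
proof (subst indep_vars_iff_distr_eq_PiM)
 show "distr S S (%x. \<lambda>i\<in>UNIV. x i) = (\<Pi>\<^sub>M i\<in>UNIV. distr S M (%w. w i))"
  by (simp add: PiM_component restrict_UNIV distr_id2)
qed simp_all

lemma expectation_sep_max_function:
 assumes f [measurable]: "f \<in> borel_measurable M"
 shows "(LINT w|S. sep_max g n (%i. f (w i))) = esep g n (distr M borel f)"
proof (rule P.expectation_sep_max)
 show "indep_vars (%_. borel) (%i w. f (w i)) {..<n}"
  by (rule indep_vars_subset[OF indep_vars_compose2[OF indep_vars_component]]) auto
 show "distr S borel (%w. f (w i)) = distr M borel f" for i
  by (subst PiM_component[of i, symmetric], simp, subst distr_distr) (auto simp: comp_def)
 show "prob_space (distr M borel f)" by (rule M.prob_space_distr) simp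
qed simp

lemma integrable_component_function: "integrable M f ==> integrable S (%w. f (w i))"
 and expectation_component_function: "f \<in> borel_measurable M ==> (LINT w|S. f (w i)) = (LINT x|M. f x)"
 for f :: "'a => real"
proof -
 have 1: "distr S M (%w. w i) = M" by (rule PiM_component) simp
 have 2: "(%w. w i) \<in> measurable S M" by simp
 show "integrable M f ==> integrable S (%w. f (w i))"
  using integrable_distr[OF 2, of f] unfolding 1 .
 show "f \<in> borel_measurable M ==> (LINT w|S. f (w i)) = (LINT x|M. f x)"
  using integral_distr[OF 2, of f] unfolding 1 by simp
qed

lemma integrable_sep_max_function:
 assumes f: "integrable M f"
 shows "integrable S (%w. sep_max g n (%i. f (w i)))"
proof (rule L1_bound)
 have [measurable]: "f \<in> borel_measurable M" by (rule borel_measurable_integrable[OF f])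
 show "integrable S (%w. \<Sum>i<n. \<bar>f (w i)\<bar>)"
  by (intro L1_sum integrable_abs integrable_component_function f)
 show "(%w. sep_max g n (%i. f (w i))) \<in> borel_measurable S" by measurable
 show "AE w in S. norm (sep_max g n (%i. f (w i))) <= norm (\<Sum>i<n. \<bar>f (w i)\<bar>)"
 proof (rule AE_I2)
  fix w
  have "sep_max g n (%i. f (w i)) <= sep_max g n (%i. \<bar>f (w i)\<bar>)" by (rule sep_max_mono) auto
  also have "... <= (\<Sum>i<n. \<bar>f (w i)\<bar>)" by (rule sep_max_le_sum) simp
  finally show "norm (sep_max g n (%i. f (w i))) <= norm (\<Sum>i<n. \<bar>f (w i)\<bar>)"
   using sep_max_nonneg[of g n "%i. f (w i)"] by (simp add: sum_nonneg)
 qed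
qed

text \<open>Both laws are realised as functions of the same iid sequence, and the Lipschitz bound of
  \<open>sep_max\<close> is integrated.\<close>

lemma esep_coupling:
 assumes f: "integrable M f" and f': "integrable M f'"
 shows "\<bar>esep g n (distr M borel f) - esep g n (distr M borel f')\<bar> <= real n * (LINT x|M. \<bar>f x - f' x\<bar>)"
proof -
 note [measurable] = borel_measurable_integrable[OF f] borel_measurable_integrable[OF f']
 have int: "integrable S (%w. \<Sum>i<n. \<bar>f (w i) - f' (w i)\<bar>)"
  by (intro L1_sum integrable_abs L1_diff integrable_component_function f f')
 have "\<bar>esep g n (distr M borel f) - esep g n (distr M borel f')\<bar>
  = \<bar>\<integral>w. sep_max g n (%i. f (w i)) - sep_max g n (%i. f' (w i)) \<partial>S\<bar>"
  by (subst LINT_diff)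
   (simp_all add: integrable_sep_max_function f f' expectation_sep_max_function)
 also have "... <= (LINT w|S. \<bar>sep_max g n (%i. f (w i)) - sep_max g n (%i. f' (w i))\<bar>)"
  by (rule integral_abs_bound)
 also have "... <= (LINT w|S. (\<Sum>i<n. \<bar>f (w i) - f' (w i)\<bar>))"
  by (intro integral_mono int integrable_abs L1_diff integrable_sep_max_function f f'
    sep_max_lipschitz)
 also have "... = (\<Sum>i<n. \<integral>w. \<bar>f (w i) - f' (w i)\<bar> \<partial>S)"
  by (intro LINT_sum integrable_abs L1_diff integrable_component_function f f')
 also have "... = real n * (LINT x|M. \<bar>f x - f' x\<bar>)"
  by (subst expectation_component_function[of "%x. \<bar>f x - f' x\<bar>"]) simp_all
 finally show ?thesis .
qed

definition block_max :: "nat => ('a => real) => (nat => 'a) => nat => real" where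
 "block_max p f w j = Max ((%i. f (w i)) ` {j * p..<j * p + p})"

lemma block_max_le_iff: "p >= 1 ==> block_max p f w j <= z \<longleftrightarrow> (\<forall>i\<in>{j * p..<j * p + p}. f (w i) <= z)"
 unfolding block_max_def by (subst Max_le_iff) auto

lemma block_max_ge: "p >= 1 ==> f (w i) <= block_max p f w (i div p)"
 using block_max_le_iff[of p f w "i div p" "block_max p f w (i div p)"] div_times_less_eq_dividend[of i p]
  dividend_less_times_div[of p i] by (auto simp: mult.commute)

lemma block_max_attained:
 assumes "p >= 1"
 shows "\<exists>i. i div p = j \<and> block_max p f w j <= f (w i)"
proof -
 have "block_max p f w j \<in> (%i. f (w i)) ` {j * p..<j * p + p}"
  unfolding block_max_def using assms by (intro Max_in) auto
 then obtain i where i: "j * p <= i" "i < j * p + p" "block_max p f w j = f (w i)" by auto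
 have "i div p = j" using i(1,2) assms by (intro div_nat_eqI) (auto simp: mult.commute)
 then show ?thesis using i(3) by auto
qed

lemma distr_block_max:
 assumes f [measurable]: "f \<in> borel_measurable M" and p: "p >= 1"
  and \<nu>: "real_distribution \<nu>" "\<And>z. cdf \<nu> z = measure M {x\<in>space M. f x <= z} ^ p"
 shows "distr S borel (%w. block_max p f w j) = \<nu>"
proof (rule cdf_unique)
 interpret \<nu>: real_distribution \<nu> by fact
 let ?K = "%j. {j * p..<j * p + p}"
 have [measurable]: "(%w. block_max p f w j) \<in> borel_measurable S"
  unfolding block_max_def by (intro borel_measurable_Max) auto
 show "real_distribution (distr S borel (%w. block_max p f w j))"
  by (rule real_distribution_distr) measurable
 show "cdf (distr S borel (%w. block_max p f w j)) = cdf \<nu>"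
 proof
  fix z
  have "cdf (distr S borel (%w. block_max p f w j)) z = measure S {w\<in>space S. block_max p f w j <= z}"
   unfolding cdf_def by (subst measure_distr) (auto intro!: arg_cong[where f="measure S"])
  also have "{w\<in>space S. block_max p f w j <= z} = {w\<in>space S. \<forall>i\<in>?K j. w i \<in> {x\<in>space M. f x <= z}}"
   unfolding block_max_le_iff[OF p] by (auto simp: space_PiM PiE_iff)
  also have "measure S ... = (\<Prod>i\<in>?K j. measure M {x\<in>space M. f x <= z})"
   using emeasure_PiM_Collect[of "?K j" "%_. {x\<in>space M. f x <= z}"]
   by (simp add: P.emeasure_eq_measure M.emeasure_eq_measure ennreal_power)
  finally show "cdf (distr S borel (%w. block_max p f w j)) z = cdf \<nu> z"
   by (simp add: \<nu>(2))
 qed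
qed (rule \<nu>(1))

text \<open>Maxima over disjoint blocks are independent, and their law is identified by its cdf, a
  \<open>p\<close>-th power.\<close>

lemma expectation_sep_max_block_max:
 assumes f [measurable]: "f \<in> borel_measurable M" and p: "p >= 1"
  and \<nu>: "real_distribution \<nu>" "\<And>z. cdf \<nu> z = measure M {x\<in>space M. f x <= z} ^ p"
 shows "(LINT w|S. sep_max g m (block_max p f w)) = esep g m \<nu>"
proof -
 interpret \<nu>: real_distribution \<nu> by fact
 have "(LINT w|S. sep_max g m (%j. block_max p f w j)) = esep g m \<nu>"
 proof (rule P.expectation_sep_max)
  let ?K = "%j. {j * p..<j * p + p}"
  have dis: "disjoint_family_on ?K {..<m}"
   unfolding disjoint_family_on_def
  proof (intro ballI impI)
   fix a b :: nat assume "a \<noteq> b"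
   have "i div p = j" if "i \<in> ?K j" for i j using that p by (intro div_nat_eqI) (auto simp: mult.commute)
   then show "?K a \<inter> ?K b = {}" using \<open>a \<noteq> b\<close> by blast
  qed
  have ind: "indep_vars (%j. \<Pi>\<^sub>M i\<in>?K j. M) (%j w. restrict (%i. w i) (?K j)) {..<m}"
   by (rule indep_vars_restrict[OF indep_vars_component _ dis]) simp
  have "indep_vars (%_. borel) (%j w. (%v. Max ((%i. f (v i)) ` ?K j)) (restrict (%i. w i) (?K j))) {..<m}"
  proof (rule indep_vars_compose2[OF ind])
   fix j
   show "(%v. Max ((%i. f (v i)) ` ?K j)) \<in> borel_measurable (\<Pi>\<^sub>M i\<in>?K j. M)"
    by (intro borel_measurable_Max) auto
  qed
  then show "indep_vars (%_. borel) (%j w. block_max p f w j) {..<m}"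
   by (simp add: block_max_def)
  show "distr S borel (%w. block_max p f w j) = \<nu>" for j by (rule distr_block_max[OF f p \<nu>])
 qed (unfold_locales, simp)
 then show ?thesis .
qed

end

section \<open>Random jumps\<close>

declare One_nat_def [simp del]

text \<open>Applying \<open>\<phi>\<close> to a canonical sample lets the walk with all jumps and
  the walk with thresholded jumps live on the same sample.\<close>

definition jumps :: "(real => real) => (nat => nat => real) => nat => nat => real" where
 "jumps \<phi> w s k = \<phi> (w s k)"

lemma shift_jumps: "shift m (jumps \<phi> w) = jumps \<phi> (shift m w)"
 by (simp add: shift_def jumps_def fun_eq_iff)

locale nbrw_law = population +
 fixes \<nu> :: "real measure" and \<phi> :: "real => real"
 assumes \<nu>_prob: "prob_space \<nu>" and sets_\<nu>: "sets \<nu> = sets borel"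
  and \<phi>_measurable [measurable]: "\<phi> \<in> borel_measurable borel" and \<phi>_nonneg: "0 <= \<phi> x"
begin

text \<open>One coordinate of the sequence space is a whole generation of jumps, so that a time
  shift is a shift of the sequence.\<close>

abbreviation gen :: "(nat => real) measure" where
 "gen \<equiv> \<Pi>\<^sub>M k\<in>{1..2 * N}. \<nu>"

lemma gen_sequence_space: "sequence_space gen"
proof -
 interpret prob_space gen by (intro prob_space_PiM \<nu>_prob)
 show ?thesis by unfold_locales
qed

sublocale sequence_space gen by (rule gen_sequence_space)

sublocale J: nonneg_jumps N "jumps \<phi> w" for w
 by unfold_locales (simp add: jumps_def \<phi>_nonneg)

lemma gen_component [measurable]: "k \<in> {1..2 * N} ==> (%v. v k) \<in> borel_measurable gen"
 using measurable_component_singleton[of k "{1..2 * N}" "%_. \<nu>"]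
 unfolding measurable_cong_sets[OF refl sets_\<nu>] .

lemma component [measurable]: "k \<in> {1..2 * N} ==> (%w. w s k) \<in> borel_measurable S"
 by (rule measurable_compose[of "%w. w s" S gen "%v. v k"], rule measurable_component_singleton[OF UNIV_I], rule gen_component)

lemma jumps_measurable [measurable]: "k \<in> {1..2 * N} ==> (%w. jumps \<phi> w s k) \<in> borel_measurable S"
 unfolding jumps_def by (rule measurable_compose[OF component]) simp_all

lemma position_measurable [measurable]: "i < N ==> (%w. nbrw_list N (jumps \<phi> w) n ! i) \<in> borel_measurable S"
 by (intro nbrw_measurable jumps_measurable)

lemma highest_measurable [measurable]: "(%w. highest (jumps \<phi> w) n) \<in> borel_measurable S"
 unfolding highest_def using N by (intro position_measurable) simp

lemma lowest_measurable [measurable]: "(%w. lowest (jumps \<phi> w) n) \<in> borel_measurable S"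
 unfolding lowest_def using N by (intro position_measurable) simp

lemma nn_integral_gen_component:
 assumes "k \<in> {1..2 * N}" and g: "g \<in> borel_measurable borel"
 shows "(\<integral>\<^sup>+v. g (v k) \<partial>gen) = (\<integral>\<^sup>+x. g x \<partial>\<nu>)"
proof -
 have 1: "distr gen \<nu> (%v. v k) = \<nu>" by (rule distr_PiM_component[OF \<nu>_prob assms(1)])
 have 2: "(%v. v k) \<in> measurable gen \<nu>" using assms(1) by (rule measurable_component_singleton)
 have 3: "g \<in> borel_measurable \<nu>" using g unfolding measurable_cong_sets[OF sets_\<nu> refl] .
 show ?thesis using nn_integral_distr[OF 2, of g] 3 unfolding 1 by simp
qed

lemma nn_integral_component:
 assumes "k \<in> {1..2 * N}" and g: "g \<in> borel_measurable borel"
 shows "(\<integral>\<^sup>+w. g (w s k) \<partial>S) = (\<integral>\<^sup>+x. g x \<partial>\<nu>)"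
proof -
 have 1: "distr S gen (%w. w s) = gen" by (rule PiM_component) simp
 have 2: "(%w. w s) \<in> measurable S gen" by (rule measurable_component_singleton) simp
 have 3: "(%v. g (v k)) \<in> borel_measurable gen" by (rule measurable_compose[OF gen_component[OF assms(1)] g])
 show ?thesis
  using nn_integral_distr[OF 2, of "%v. g (v k)"] 3 unfolding 1 nn_integral_gen_component[OF assms] by simp
qed

definition total :: "(nat => nat => real) => nat => real" where
 "total w n = (\<Sum>s<n. \<Sum>k=1..2 * N. jumps \<phi> w s k)"

lemma total_measurable [measurable]: "(%w. total w n) \<in> borel_measurable S"
 unfolding total_def by (intro borel_measurable_sum jumps_measurable)

lemma highest_le_total: "highest (jumps \<phi> w) n <= total w n"
 unfolding total_def
proof (rule highest_le_sum)
 fix s k assume k: "k \<in> {1..2 * N}"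
 show "jumps \<phi> w s k <= (\<Sum>k=1..2 * N. jumps \<phi> w s k)"
  using k by (intro member_le_sum J.nonneg) auto
qed

lemma highest_nonneg: "0 <= highest (jumps \<phi> w) n"
 by (rule order_trans[OF J.lowest_nonneg lowest_le_highest])

lemma integrable_jump:
 fixes g :: "real => real"
 assumes g: "g \<in> borel_measurable borel" "integrable \<nu> g" and k: "k \<in> {1..2 * N}"
 shows "integrable S (%w. g (w s k))" "(LINT w|S. g (w s k)) = (LINT x|\<nu>. g x)"
proof -
 have m: "(%v. g (v k)) \<in> borel_measurable gen" by (rule measurable_compose[OF gen_component[OF k] g(1)])
 have 1: "distr gen \<nu> (%v. v k) = \<nu>" by (rule distr_PiM_component[OF \<nu>_prob k])
 have 2: "(%v. v k) \<in> measurable gen \<nu>" using k by (rule measurable_component_singleton)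
 have int: "integrable gen (%v. g (v k))"
  using integrable_distr[OF 2, of g] g(2) unfolding 1 by blast
 have "(LINT v|gen. g (v k)) = (LINT x|\<nu>. g x)"
  using integral_distr[OF 2, of g] borel_measurable_integrable[OF g(2)] unfolding 1 by simp
 then show "integrable S (%w. g (w s k))" "(LINT w|S. g (w s k)) = (LINT x|\<nu>. g x)"
  using integrable_component_function[OF int] expectation_component_function[OF m] by auto
qed

lemma integrable_total: "integrable \<nu> \<phi> ==> integrable S (%w. total w n)"
 unfolding total_def jumps_def
 by (intro L1_sum integrable_jump) auto

lemma integrable_highest:
 assumes "integrable \<nu> \<phi>"
 shows "integrable S (%w. highest (jumps \<phi> w) n)"
proof (rule L1_bound[OF integrable_total[OF assms, of n]])
 show "AE w in S. norm (highest (jumps \<phi> w) n) <= norm (total w n)"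
  using highest_le_total[of _ n] highest_nonneg[of _ n] order_trans[OF highest_nonneg highest_le_total, of _ n]
  by (intro AE_I2) simp
qed measurable

text \<open>The crude time shift \<open>N\<close>, admissible because \<open>N \<le> 2 ^ N\<close>,
  is enough: the limits do not depend on the size of the shift.\<close>

lemma speed_array_positions:
 assumes "integrable \<nu> \<phi>"
 shows "speed_array gen (%n w. highest (jumps \<phi> w) n) (%n w. lowest (jumps \<phi> w) n) N"
proof unfold_locales
 show "integrable S (%w. highest (jumps \<phi> w) n)" for n by (rule integrable_highest[OF assms])
 show "highest (jumps \<phi> w) n <= lowest (jumps \<phi> w) (n + N)" for n w
  by (rule J.highest_le_lowest) (simp add: less_imp_le less_exp)
 show "highest (jumps \<phi> w) (m + n) <= highest (jumps \<phi> w) m + highest (jumps \<phi> (shift m w)) n" for m n w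
  unfolding shift_jumps[symmetric] by (rule highest_subadd)
 show "lowest (jumps \<phi> w) m + lowest (jumps \<phi> (shift m w)) n <= lowest (jumps \<phi> w) (m + n)" for m n w
  unfolding shift_jumps[symmetric] by (rule lowest_superadd)
qed (simp_all add: J.lowest_nonneg lowest_le_highest J.highest_Suc J.lowest_Suc)

lemma top_jump_measurable [measurable]: "(%w. J.top_jump w s) \<in> borel_measurable S"
 unfolding J.top_jump_def by (intro borel_measurable_Max) auto

lemma taint_error_measurable [measurable]: "(%w. J.taint_error w d u) \<in> borel_measurable S"
proof (induction u rule: less_induct)
 case (less u)
 have [measurable]: "(%w. J.taint_bound w d (u - d)) \<in> borel_measurable S"
  unfolding J.taint_bound_def
  by (intro borel_measurable_add borel_measurable_sum sep_max_measurable top_jump_measurable less) auto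
 show ?case unfolding J.taint_error_eq
 proof (intro borel_measurable_sum)
  fix k assume k: "k \<in> {1..2 * N}"
  note [measurable] = jumps_measurable[OF k, of u] position_measurable[OF parent_less[OF k], of u]
  show "(%w. if nbrw_list N (jumps \<phi> w) u ! ((k - 1) div 2) > J.taint_bound w d (u - d) then jumps \<phi> w u k else 0) \<in> borel_measurable S"
   by measurable
 qed
qed

lemma taint_bound_measurable [measurable]: "(%w. J.taint_bound w d u) \<in> borel_measurable S"
 unfolding J.taint_bound_def by measurable

text \<open>This and the next three lemmas express that the quantities are determined by earlier
  generations, in the form asked for by \<open>nn_integral_past_times_present\<close>.\<close>

lemma top_jump_past: "s < u ==> J.top_jump (comb_seq u w w') s = J.top_jump w s"
 by (simp add: J.top_jump_def jumps_def comb_seq_less)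

lemma position_past: "s <= u ==> nbrw_list N (jumps \<phi> (comb_seq u w w')) s = nbrw_list N (jumps \<phi> w) s"
 by (intro nbrw_list_upto) (simp add: jumps_def comb_seq_less)

lemma taint_error_past: "s < u ==> J.taint_error (comb_seq u w w') d s = J.taint_error w d s"
proof (induction s rule: less_induct)
 case (less s)
 have "J.taint_bound (comb_seq u w w') d (s - d) = J.taint_bound w d (s - d)"
  unfolding J.taint_bound_def using less
  by (intro arg_cong2[where f="(+)"] sep_max_cong sum.cong) (auto simp: top_jump_past)
 then show ?case unfolding J.taint_error_eq using less.prems
  by (simp add: position_past jumps_def comb_seq_less cong: if_cong)
qed

lemma taint_bound_past: "s <= u ==> J.taint_bound (comb_seq u w w') d s = J.taint_bound w d s"
 unfolding J.taint_bound_def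
 by (intro arg_cong2[where f="(+)"] sep_max_cong sum.cong) (auto simp: top_jump_past taint_error_past)

lemma real_count_above:
 "real (2 * count_above x u c) = (\<Sum>k=1..2 * N. if nbrw_list N x u ! ((k - 1) div 2) > c then 1 else 0)"
 unfolding card_parents_above[symmetric] real_card_eq_sum_indicator by (simp only: indicator_def mem_Collect_eq of_bool_def)

lemma nn_integral_card_jumps:
 "(\<integral>\<^sup>+w. ennreal (real (card {k\<in>{1..2 * N}. jumps \<phi> w s k > c})) \<partial>S) = ennreal (real (2 * N) * measure \<nu> {x. \<phi> x > c})"
proof -
 interpret prob_space \<nu> by (rule \<nu>_prob)
 have "(\<integral>\<^sup>+w. ennreal (real (card {k\<in>{1..2 * N}. jumps \<phi> w s k > c})) \<partial>S)
  = (\<integral>\<^sup>+w. (\<Sum>k=1..2 * N. ennreal (indicator {z. z > c} (jumps \<phi> w s k))) \<partial>S)"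
  unfolding real_card_eq_sum_indicator by (subst sum_ennreal) simp_all
 also have "... = (\<Sum>k=1..2 * N. \<integral>\<^sup>+w. ennreal (indicator {z. z > c} (\<phi> (w s k))) \<partial>S)"
  unfolding jumps_def
  by (intro nn_integral_sum measurable_compose[OF component, of _ "%x. ennreal (indicator {z. z > c} (\<phi> x))"]) auto
 also have "... = (\<Sum>k=1..2 * N. \<integral>\<^sup>+x. ennreal (indicator {z. z > c} (\<phi> x)) \<partial>\<nu>)"
  by (intro sum.cong refl nn_integral_component[of _ "%x. ennreal (indicator {z. z > c} (\<phi> x))"]) auto
 also have "(\<integral>\<^sup>+x. ennreal (indicator {z. z > c} (\<phi> x)) \<partial>\<nu>) = (\<integral>\<^sup>+x. indicator {x. \<phi> x > c} x \<partial>\<nu>)"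
  by (intro nn_integral_cong) (simp add: indicator_def)
 also have "... = ennreal (measure \<nu> {x. \<phi> x > c})"
  by (subst nn_integral_indicator) (simp_all add: sets_\<nu> emeasure_eq_measure)
 finally show ?thesis by (simp add: ennreal_mult ennreal_of_nat_eq_real_of_nat)
qed

text \<open>Whether a parent is tainted depends on the past only, so the expected number of children
  of tainted parents is multiplied by the mean jump \<open>T\<close>. In the constant 4 one factor 2
  counts the children of a parent, the other comes from the \<open>2 * N\<close> jumps of a
  generation.\<close>

lemma nn_integral_taint_error:
 assumes T: "(\<integral>\<^sup>+x. ennreal (\<phi> x) \<partial>\<nu>) = ennreal T" "0 <= T"
 shows "(\<integral>\<^sup>+w. ennreal (J.taint_error w d u) \<partial>S) <= ennreal (4 * real N * 2 ^ d * measure \<nu> {x. \<phi> x > 0} * T)"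
proof -
 let ?A = "%k. {w. nbrw_list N (jumps \<phi> w) u ! ((k - 1) div 2) > J.taint_bound w d (u - d)}"
 let ?G = "measure \<nu> {x. \<phi> x > 0}"
 have A: "(%w. indicator (?A k) w :: ennreal) \<in> borel_measurable S" if k: "k \<in> {1..2 * N}" for k
 proof -
  note [measurable] = position_measurable[OF parent_less[OF k], of u]
  have "(%w. if nbrw_list N (jumps \<phi> w) u ! ((k - 1) div 2) > J.taint_bound w d (u - d) then 1 else 0 :: ennreal) \<in> borel_measurable S"
   by measurable
  then show ?thesis unfolding indicator_def[abs_def] mem_Collect_eq of_bool_def .
 qed
 have split_sum: "(\<Sum>s\<in>{u - d..<u}. ennreal (2 * 2 ^ (u - Suc s)) * ennreal (b s)) = ennreal (\<Sum>s\<in>{u - d..<u}. (2 * 2 ^ (u - Suc s)) * b s)"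
  if "\<And>s. b s >= 0" for b
 proof -
  have "(\<Sum>s\<in>{u - d..<u}. ennreal (2 * 2 ^ (u - Suc s)) * ennreal (b s)) = (\<Sum>s\<in>{u - d..<u}. ennreal ((2 * 2 ^ (u - Suc s)) * b s))"
   by (intro sum.cong refl ennreal_mult[symmetric] that) simp
  also have "... = ennreal (\<Sum>s\<in>{u - d..<u}. (2 * 2 ^ (u - Suc s)) * b s)"
   by (rule sum_ennreal) (simp add: that)
  finally show ?thesis .
 qed
 have "(\<integral>\<^sup>+w. (\<Sum>k=1..2 * N. indicator (?A k) w) \<partial>S) = (\<integral>\<^sup>+w. ennreal (real (2 * count_above (jumps \<phi> w) u (J.taint_bound w d (u - d)))) \<partial>S)"
 proof (rule nn_integral_cong)
  fix w
  let ?t = "%k. if nbrw_list N (jumps \<phi> w) u ! ((k - 1) div 2) > J.taint_bound w d (u - d) then 1 else (0 :: real)"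
  have "ennreal (\<Sum>k=1..2 * N. ?t k) = (\<Sum>k=1..2 * N. ennreal (?t k))" by (rule sum_ennreal[symmetric]) simp
  also have "... = (\<Sum>k=1..2 * N. indicator (?A k) w)" by (intro sum.cong refl) (simp add: indicator_def)
  finally show "(\<Sum>k=1..2 * N. indicator (?A k) w) = ennreal (real (2 * count_above (jumps \<phi> w) u (J.taint_bound w d (u - d))))"
   unfolding real_count_above by (rule sym)
 qed
 also have "... <= (\<integral>\<^sup>+w. (\<Sum>s\<in>{u - d..<u}. ennreal (2 * 2 ^ (u - Suc s)) * ennreal (real (card {k\<in>{1..2 * N}. jumps \<phi> w s k > 0}))) \<partial>S)"
 proof (intro nn_integral_mono)
  fix w
  have "real (2 * count_above (jumps \<phi> w) u (J.taint_bound w d (u - d)))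
   <= 2 * real (\<Sum>s\<in>{u - d..<u}. 2 ^ (u - Suc s) * card {k\<in>{1..2 * N}. jumps \<phi> w s k > 0})"
   unfolding of_nat_mult of_nat_numeral by (intro mult_left_mono of_nat_mono J.count_tainted_le) simp
  also have "... = (\<Sum>s\<in>{u - d..<u}. (2 * 2 ^ (u - Suc s)) * real (card {k\<in>{1..2 * N}. jumps \<phi> w s k > 0}))"
   by (simp only: of_nat_sum of_nat_mult of_nat_power of_nat_numeral sum_distrib_left mult.assoc)
  finally have "ennreal (real (2 * count_above (jumps \<phi> w) u (J.taint_bound w d (u - d))))
   <= ennreal (\<Sum>s\<in>{u - d..<u}. (2 * 2 ^ (u - Suc s)) * real (card {k\<in>{1..2 * N}. jumps \<phi> w s k > 0}))"
   by (rule ennreal_leI)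
  then show "ennreal (real (2 * count_above (jumps \<phi> w) u (J.taint_bound w d (u - d))))
   <= (\<Sum>s\<in>{u - d..<u}. ennreal (2 * 2 ^ (u - Suc s)) * ennreal (real (card {k\<in>{1..2 * N}. jumps \<phi> w s k > 0})))"
   unfolding split_sum[OF of_nat_0_le_iff] .
 qed
 also have "... = (\<Sum>s\<in>{u - d..<u}. ennreal (2 * 2 ^ (u - Suc s)) * ennreal (real (2 * N) * ?G))"
 proof -
  have [measurable]: "(%w. ennreal (real (card {k\<in>{1..2 * N}. jumps \<phi> w s k > 0}))) \<in> borel_measurable S" for s
   unfolding real_card_eq_sum_indicator
   by (intro measurable_compose[OF _ measurable_ennreal] borel_measurable_sum measurable_compose[OF jumps_measurable]) auto
  show ?thesis
   by (subst nn_integral_sum, measurable, intro sum.cong refl, subst nn_integral_cmult, measurable)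
    (simp only: nn_integral_card_jumps)
 qed
 also have "... = ennreal (\<Sum>s\<in>{u - d..<u}. (2 * 2 ^ (u - Suc s)) * (real (2 * N) * ?G))"
  by (rule split_sum) simp
 \<comment> \<open>The weights \<open>2 ^ (u - Suc s)\<close> form a geometric sum over at most
   \<open>d\<close> generations.\<close>
 also have "... <= ennreal (4 * real N * 2 ^ d * ?G)"
 proof (rule ennreal_leI)
  have "(\<Sum>s\<in>{u - d..<u}. 2 ^ (u - Suc s) :: real) = (\<Sum>i<min u d. 2 ^ i)"
   by (rule sum.reindex_bij_witness[of _ "%i. u - Suc i" "%s. u - Suc s"]) auto
  also have "... <= 2 ^ min u d" by (induction "min u d") (simp_all add: sum_gp_strict)
  also have "... <= 2 ^ d" by (intro power_increasing) auto
  finally have *: "(\<Sum>s\<in>{u - d..<u}. 2 ^ (u - Suc s) :: real) <= 2 ^ d" .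
  have "(\<Sum>s\<in>{u - d..<u}. (2 * 2 ^ (u - Suc s)) * (real (2 * N) * ?G)) = (4 * real N * ?G) * (\<Sum>s\<in>{u - d..<u}. 2 ^ (u - Suc s))"
   by (simp add: sum_distrib_left algebra_simps)
  also have "... <= (4 * real N * ?G) * 2 ^ d" by (intro mult_left_mono *) simp
  finally show "(\<Sum>s\<in>{u - d..<u}. (2 * 2 ^ (u - Suc s)) * (real (2 * N) * ?G)) <= 4 * real N * 2 ^ d * ?G"
   by (simp add: algebra_simps)
 qed
 finally have tainted: "(\<integral>\<^sup>+w. (\<Sum>k=1..2 * N. indicator (?A k) w) \<partial>S) <= ennreal (4 * real N * 2 ^ d * ?G)" .
 have "(\<integral>\<^sup>+w. ennreal (J.taint_error w d u) \<partial>S) = (\<integral>\<^sup>+w. (\<Sum>k=1..2 * N. indicator (?A k) w * ennreal (\<phi> (w u k))) \<partial>S)"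
 proof (rule nn_integral_cong)
  fix w
  have "ennreal (J.taint_error w d u) =
   (\<Sum>k=1..2 * N. ennreal (if nbrw_list N (jumps \<phi> w) u ! ((k - 1) div 2) > J.taint_bound w d (u - d) then jumps \<phi> w u k else 0))"
   unfolding J.taint_error_eq by (rule sum_ennreal[symmetric]) (simp add: jumps_def \<phi>_nonneg)
  also have "... = (\<Sum>k=1..2 * N. indicator (?A k) w * ennreal (\<phi> (w u k)))"
   by (intro sum.cong refl) (simp add: indicator_def jumps_def)
  finally show "ennreal (J.taint_error w d u) = (\<Sum>k=1..2 * N. indicator (?A k) w * ennreal (\<phi> (w u k)))" .
 qed
 also have "... = (\<Sum>k=1..2 * N. \<integral>\<^sup>+w. indicator (?A k) w * ennreal (\<phi> (w u k)) \<partial>S)"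
  by (intro nn_integral_sum borel_measurable_times A measurable_compose[OF component, of _ "%x. ennreal (\<phi> x)"]) auto
 also have "... = (\<Sum>k=1..2 * N. (\<integral>\<^sup>+w. indicator (?A k) w \<partial>S) * ennreal T)"
 proof (intro sum.cong refl)
  fix k assume k: "k \<in> {1..2 * N}"
  have "(\<integral>\<^sup>+w. indicator (?A k) w * ennreal (\<phi> (w u k)) \<partial>S) = (\<integral>\<^sup>+w. indicator (?A k) w \<partial>S) * (\<integral>\<^sup>+v. ennreal (\<phi> (v k)) \<partial>gen)"
  proof (rule nn_integral_past_times_present[OF A[OF k]])
   show "(%v. ennreal (\<phi> (v k))) \<in> borel_measurable gen"
    by (rule measurable_compose[OF gen_component[OF k]]) simp
  qed (simp add: indicator_def position_past taint_bound_past)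
  also have "(\<integral>\<^sup>+v. ennreal (\<phi> (v k)) \<partial>gen) = ennreal T"
   using nn_integral_gen_component[OF k, of "%x. ennreal (\<phi> x)"] T by simp
  finally show "(\<integral>\<^sup>+w. indicator (?A k) w * ennreal (\<phi> (w u k)) \<partial>S) = (\<integral>\<^sup>+w. indicator (?A k) w \<partial>S) * ennreal T" .
 qed
 also have "... = (\<integral>\<^sup>+w. (\<Sum>k=1..2 * N. indicator (?A k) w) \<partial>S) * ennreal T"
  unfolding sum_distrib_right[symmetric] by (subst nn_integral_sum) (use A in auto)
 also have "... <= ennreal (4 * real N * 2 ^ d * ?G) * ennreal T" by (rule mult_right_mono[OF tainted]) simp
 also have "... = ennreal (4 * real N * 2 ^ d * ?G * T)" by (rule ennreal_mult[symmetric]) (simp_all add: T(2))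
 finally show ?thesis .
qed

end

section \<open>The speed of the walk and thresholded jumps\<close>

context nbrw_law
begin

text \<open>The \<open>speed\<close> of \<open>speed_array_positions\<close>, written out so that it
  can be named before integrability of the jumps is established.\<close>

definition brw_speed :: real where
 "brw_speed = (INF n\<in>{1..}. (LINT w|S. highest (jumps \<phi> w) n) / real n)"

lemma brw_speed_le: "integrable \<nu> \<phi> ==> brw_speed * real n <= (LINT w|S. highest (jumps \<phi> w) n)"
 using speed_array.speed_le[OF speed_array_positions, of n]
 by (simp add: brw_speed_def speed_array.speed_def[OF speed_array_positions])

lemma le_brw_speed: "integrable \<nu> \<phi> ==> (LINT w|S. lowest (jumps \<phi> w) n) <= brw_speed * real n"
 using speed_array.le_speed[OF speed_array_positions, of n]
 by (simp add: brw_speed_def speed_array.speed_def[OF speed_array_positions])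

lemma positions_tendsto_speed:
 assumes "integrable \<nu> \<phi>"
 shows "tendsto_AE_and_L1 S (%n w. highest (jumps \<phi> w) n / real n) brw_speed sequentially"
  and "tendsto_AE_and_L1 S (%n w. lowest (jumps \<phi> w) n / real n) brw_speed sequentially"
 using speed_array.H_tendsto_speed[OF speed_array_positions[OF assms]]
  speed_array.L_tendsto_speed[OF speed_array_positions[OF assms]]
 by (simp_all add: brw_speed_def speed_array.speed_def[OF speed_array_positions[OF assms]])

definition gen_max :: "(nat => real) => real" where
 "gen_max v = Max ((%k. \<phi> (v k)) ` {1..2 * N})"

lemma top_jump_eq: "J.top_jump w s = gen_max (w s)"
 by (simp add: J.top_jump_def gen_max_def jumps_def)

lemma gen_max_measurable [measurable]: "gen_max \<in> borel_measurable gen"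
 unfolding gen_max_def[abs_def]
 by (intro borel_measurable_Max measurable_compose[OF gen_component]) auto

lemma gen_max_le_iff: "gen_max v <= z \<longleftrightarrow> (\<forall>k\<in>{1..2 * N}. \<phi> (v k) <= z)"
 unfolding gen_max_def using N by (subst Max_le_iff) auto

lemma measure_gen_max: "measure gen {v\<in>space gen. gen_max v <= z} = measure \<nu> {x. \<phi> x <= z} ^ (2 * N)"
proof -
 interpret prob_space \<nu> by (rule \<nu>_prob)
 interpret F: finite_product_prob_space "%_. \<nu>" "{1..2 * N}" by unfold_locales simp
 have sp: "space \<nu> = UNIV" using sets_eq_imp_space_eq[OF sets_\<nu>] by simp
 have m: "{x. \<phi> x <= z} \<in> sets \<nu>" unfolding sets_\<nu> by measurable
 have "{v\<in>space gen. gen_max v <= z} = (\<Pi>\<^sub>E k\<in>{1..2 * N}. {x. \<phi> x <= z})"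
  unfolding gen_max_le_iff by (auto simp: space_PiM sp PiE_iff extensional_def)
 then show ?thesis using m by (simp add: F.finite_measure_PiM_emb)
qed

lemma gen_max_nonneg: "0 <= gen_max v"
proof -
 have "0 <= \<phi> (v 1)" by (rule \<phi>_nonneg)
 also have "... <= gen_max v" unfolding gen_max_def using N by (intro Max_ge) auto
 finally show ?thesis .
qed

lemma integrable_gen_max:
 assumes "integrable \<nu> \<phi>"
 shows "integrable gen gen_max"
proof (rule L1_bound)
 show "integrable gen (%v. \<Sum>k=1..2 * N. \<phi> (v k))"
 proof (rule L1_sum)
  fix k assume k: "k \<in> {1..2 * N}"
  have 1: "distr gen \<nu> (%v. v k) = \<nu>" by (rule distr_PiM_component[OF \<nu>_prob k])
  have 2: "(%v. v k) \<in> measurable gen \<nu>" using k by (rule measurable_component_singleton)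
  show "integrable gen (%v. \<phi> (v k))"
   using integrable_distr[OF 2, of \<phi>] assms unfolding 1 by blast
 qed
 show "AE v in gen. norm (gen_max v) <= norm (\<Sum>k=1..2 * N. \<phi> (v k))"
 proof (rule AE_I2)
  fix v
  have "gen_max v <= (\<Sum>k=1..2 * N. \<phi> (v k))"
   unfolding gen_max_le_iff by (auto intro!: member_le_sum \<phi>_nonneg)
  then show "norm (gen_max v) <= norm (\<Sum>k=1..2 * N. \<phi> (v k))" using gen_max_nonneg[of v] by simp
 qed
qed simp

lemma integrable_taint_error:
 assumes "integrable \<nu> \<phi>"
 shows "integrable S (%w. J.taint_error w d u)"
  and "(LINT w|S. J.taint_error w d u) <= 4 * real N * 2 ^ d * measure \<nu> {x. \<phi> x > 0} * (LINT x|\<nu>. \<phi> x)"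
proof -
 let ?b = "4 * real N * 2 ^ d * measure \<nu> {x. \<phi> x > 0} * (LINT x|\<nu>. \<phi> x)"
 have T0: "0 <= (LINT x|\<nu>. \<phi> x)" by (intro LINT_nonneg \<phi>_nonneg)
 have T: "(\<integral>\<^sup>+x. ennreal (\<phi> x) \<partial>\<nu>) = ennreal (LINT x|\<nu>. \<phi> x)"
  using assms by (intro nn_integral_eq_integral) (simp_all add: \<phi>_nonneg)
 have le: "(\<integral>\<^sup>+w. ennreal (J.taint_error w d u) \<partial>S) <= ennreal ?b"
  by (rule nn_integral_taint_error[OF T T0])
 show int: "integrable S (%w. J.taint_error w d u)"
  using le by (intro integrableI_bounded) (simp_all add: J.taint_error_nonneg order_le_less_trans)
 have "ennreal (LINT w|S. J.taint_error w d u) = (\<integral>\<^sup>+w. ennreal (J.taint_error w d u) \<partial>S)"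
  by (rule nn_integral_eq_integral[symmetric, OF int]) (simp add: J.taint_error_nonneg)
 with le have "ennreal (LINT w|S. J.taint_error w d u) <= ennreal ?b" by simp
 then show "(LINT w|S. J.taint_error w d u) <= ?b"
  using T0 by (subst (asm) ennreal_le_iff) (auto intro!: mult_nonneg_nonneg)
qed

text \<open>The error contains the tail twice: once for the jump that taints a particle and once,
  through the mean, for the jump made by its children.\<close>

theorem expectation_highest_le:
 assumes "integrable \<nu> \<phi>"
 shows "(LINT w|S. highest (jumps \<phi> w) n) <= (LINT w|S. sep_max (Suc d) n (J.top_jump w))
  + real n * (4 * real N * 2 ^ d * measure \<nu> {x. \<phi> x > 0} * (LINT x|\<nu>. \<phi> x))"
proof -
 have int: "integrable S (%w. sep_max (Suc d) n (J.top_jump w))"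
  using integrable_sep_max_function[OF integrable_gen_max[OF assms]] by (simp add: top_jump_eq[abs_def])
 have int': "integrable S (%w. \<Sum>u<n. J.taint_error w d u)"
  by (intro L1_sum integrable_taint_error assms)
 have "(LINT w|S. highest (jumps \<phi> w) n) <= (LINT w|S. sep_max (Suc d) n (J.top_jump w) + (\<Sum>u<n. J.taint_error w d u))"
  using J.highest_le_taint_bound
  by (intro integral_mono integrable_highest assms L1_add int int')
   (simp add: J.taint_bound_def)
 also have "... = (LINT w|S. sep_max (Suc d) n (J.top_jump w)) + (\<Sum>u<n. \<integral>w. J.taint_error w d u \<partial>S)"
  by (subst LINT_add[OF int int'], subst LINT_sum)
   (simp_all add: integrable_taint_error assms)
 also have "(\<Sum>u<n. \<integral>w. J.taint_error w d u \<partial>S) <= (\<Sum>u<n. 4 * real N * 2 ^ d * measure \<nu> {x. \<phi> x > 0} * (LINT x|\<nu>. \<phi> x))"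
  by (intro sum_mono integrable_taint_error assms)
 finally show ?thesis by simp
qed

text \<open>A uniform surplus \<open>D\<close> of the jumps shifts the whole population by at most
  \<open>D\<close> per generation, however many particles are concerned.\<close>

lemma highest_le_highest_plus:
 assumes le: "\<And>x. \<phi> x <= \<phi>' x + D + \<psi> x" and \<psi>: "\<And>x. 0 <= \<psi> x"
 shows "highest (jumps \<phi> w) n <= highest (jumps \<phi>' w) n + (real n * D + (\<Sum>s<n. \<Sum>k=1..2 * N. \<psi> (w s k)))"
proof -
 have "highest (jumps \<phi> w) n <= highest (jumps \<phi>' w) n + (\<Sum>s<n. D + (\<Sum>k=1..2 * N. \<psi> (w s k)))"
 proof (rule highest_mono)
  fix s k assume "k \<in> {1..2 * N}"
  then have "\<psi> (w s k) <= (\<Sum>k=1..2 * N. \<psi> (w s k))" by (intro member_le_sum \<psi>) auto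
  then show "jumps \<phi> w s k <= jumps \<phi>' w s k + (D + (\<Sum>k=1..2 * N. \<psi> (w s k)))"
   using le[of "w s k"] by (simp add: jumps_def)
 qed
 then show ?thesis by (simp add: sum.distrib)
qed

end

section \<open>Regularly varying tails\<close>

text \<open>The doubling inequality is iterated and monotonicity interpolates between powers of 2.
  Rounding the logarithm of \<open>s\<close> up costs the factor
  \<open>2 powr \<beta>\<close>.\<close>

lemma doubling_upper:
 fixes f :: "real => real"
 assumes x0: "0 < x0" and mono: "\<And>x y. x0 <= x ==> x <= y ==> f x <= f y" and nonneg: "\<And>x. x0 <= x ==> 0 <= f x"
  and dbl: "\<And>x. x0 <= x ==> f (2 * x) <= 2 powr \<beta> * f x" and \<beta>: "0 <= \<beta>"
  and x: "x0 <= x" and s: "1 <= s"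
 shows "f (s * x) <= 2 powr \<beta> * s powr \<beta> * f x"
proof -
 have it: "f (2 ^ n * x) <= (2 ^ n) powr \<beta> * f x" for n
 proof (induction n)
  case (Suc n)
  have "1 * x <= 2 ^ n * x" using x x0 by (intro mult_right_mono) auto
  then have "x0 <= 2 ^ n * x" using x by linarith
  from dbl[OF this] have "f (2 ^ Suc n * x) <= 2 powr \<beta> * f (2 ^ n * x)" by (simp add: mult.assoc)
  also have "... <= 2 powr \<beta> * ((2 ^ n) powr \<beta> * f x)" by (intro mult_left_mono Suc) simp
  also have "... = (2 ^ Suc n) powr \<beta> * f x" by (simp add: powr_mult)
  finally show ?case .
 qed simp
 define n where "n = nat \<lceil>log 2 s\<rceil>"
 have n: "log 2 s <= real n" "real n <= log 2 s + 1"
  using s unfolding n_def by (auto simp: of_nat_nat)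
 have "s = 2 powr (log 2 s)" using s by simp
 also have "... <= 2 powr real n" using n by (intro powr_mono) auto
 finally have sn: "s <= 2 ^ n" by (simp add: powr_realpow)
 have "2 powr real n <= 2 powr (log 2 s + 1)" using n by (intro powr_mono) auto
 then have ns: "2 ^ n <= 2 * s" using s by (simp add: powr_realpow powr_add)
 have "1 * x <= s * x" using x x0 s by (intro mult_right_mono) auto
 then have "x0 <= s * x" using x by linarith
 then have "f (s * x) <= f (2 ^ n * x)" using sn x x0 by (intro mono mult_right_mono) auto
 also have "... <= (2 ^ n) powr \<beta> * f x" by (rule it)
 also have "... <= (2 * s) powr \<beta> * f x" using ns \<beta> by (intro mult_right_mono powr_mono2 nonneg x) auto
 finally show ?thesis using s by (simp add: powr_mult)
qed

lemma doubling_lower: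
 fixes f :: "real => real"
 assumes x0: "0 < x0" and mono: "\<And>x y. x0 <= x ==> x <= y ==> f x <= f y" and nonneg: "\<And>x. x0 <= x ==> 0 <= f x"
  and dbl: "\<And>x. x0 <= x ==> 2 powr \<beta> * f x <= f (2 * x)" and \<beta>: "0 <= \<beta>"
  and x: "x0 <= x" and s: "1 <= s"
 shows "s powr \<beta> * f x <= 2 powr \<beta> * f (s * x)"
proof -
 have it: "(2 ^ n) powr \<beta> * f x <= f (2 ^ n * x)" for n
 proof (induction n)
  case (Suc n)
  have "1 * x <= 2 ^ n * x" using x x0 by (intro mult_right_mono) auto
  then have "x0 <= 2 ^ n * x" using x by linarith
  from dbl[OF this] have "2 powr \<beta> * f (2 ^ n * x) <= f (2 ^ Suc n * x)" by (simp add: mult.assoc)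
  moreover have "2 powr \<beta> * ((2 ^ n) powr \<beta> * f x) <= 2 powr \<beta> * f (2 ^ n * x)" by (intro mult_left_mono Suc) simp
  moreover have "2 powr \<beta> * ((2 ^ n) powr \<beta> * f x) = (2 ^ Suc n) powr \<beta> * f x" by (simp add: powr_mult)
  ultimately show ?case by linarith
 qed simp
 define n where "n = nat \<lfloor>log 2 s\<rfloor>"
 have l0: "0 <= log 2 s" using s by simp
 have n: "real n <= log 2 s" "log 2 s <= real n + 1"
  using l0 unfolding n_def by (auto simp: of_nat_nat)
 have "2 powr real n <= 2 powr (log 2 s)" using n by (intro powr_mono) auto
 then have ns: "2 ^ n <= s" using s by (simp add: powr_realpow)
 have "2 powr (log 2 s) <= 2 powr (real n + 1)" using n by (intro powr_mono) auto
 then have sn: "s <= 2 * 2 ^ n" using s by (simp add: powr_realpow powr_add)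
 have "s powr \<beta> * f x <= (2 * 2 ^ n) powr \<beta> * f x" using sn s \<beta> by (intro mult_right_mono powr_mono2 nonneg x) auto
 also have "... = 2 powr \<beta> * ((2 ^ n) powr \<beta> * f x)" by (simp add: powr_mult)
 also have "... <= 2 powr \<beta> * f (2 ^ n * x)" by (intro mult_left_mono it) simp
 also have "... <= 2 powr \<beta> * f (s * x)"
 proof (intro mult_left_mono mono mult_right_mono ns)
  have "1 * x <= 2 ^ n * x" using x x0 by (intro mult_right_mono) auto
  then show "x0 <= 2 ^ n * x" using x by linarith
 qed (use x x0 in auto)
 finally show ?thesis .
qed

locale heavy_tail = real_distribution \<nu> for \<nu> :: "real measure" +
 fixes h :: "real => real" and \<alpha> :: real
 assumes \<alpha>: "\<alpha> > 0" and rv: "regularly_varying h \<alpha>"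
  and tail: "0 <= x ==> measure \<nu> {x<..} = 1 / h x"
begin

definition G :: "real => real" where
 "G x = measure \<nu> {x<..}"

lemma G_nonneg: "0 <= G x" by (simp add: G_def)

lemma G_le_1: "G x <= 1" by (simp add: G_def)

lemma G_antimono: "x <= y ==> G y <= G x"
 unfolding G_def by (rule finite_measure_mono) auto

lemma h_ratio: "t > 0 ==> ((%x. h (t * x) / h x) ---> t powr \<alpha>) at_top"
 using rv by (simp add: regularly_varying_def)

text \<open>By regular variation \<open>h\<close> is positive far out, and the tail decreases. This
  rules out zeros of \<open>h\<close>, where \<open>1 / h x\<close> would be 0 by
  convention.\<close>

lemma G_pos: "0 < G x"
proof -
 have "\<forall>\<^sub>F y in at_top. h y > 0" using rv by (simp add: regularly_varying_def)
 then have "\<forall>\<^sub>F y in at_top. h y > 0 \<and> y >= max 0 x"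
  by (intro eventually_conj eventually_ge_at_top)
 then obtain y where y: "h y > 0" "y >= max 0 x" unfolding eventually_at_top_linorder by blast
 have "G y = 1 / h y" unfolding G_def by (rule tail) (use y in simp)
 then have "0 < G y" using y(1) by simp
 also have "... <= G x" using y by (intro G_antimono) auto
 finally show ?thesis .
qed

lemma h_eq: "0 <= x ==> h x = 1 / G x"
 using tail[of x] by (simp add: G_def)

lemma h_pos: "0 <= x ==> 0 < h x"
 by (simp add: h_eq G_pos)

lemma G_eq_cdf: "G x = 1 - cdf \<nu> x"
proof -
 have "{x<..} = space \<nu> - {..x}" by auto
 then show ?thesis unfolding G_def cdf_def using prob_compl[of "{..x}"] by (simp only: space_eq_univ) simp
qed

lemma G_measurable [measurable]: "G \<in> borel_measurable borel"
proof -
 have "mono (cdf \<nu>)" by (rule monoI) (rule cdf_nondecreasing)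
 then have "cdf \<nu> \<in> borel_measurable borel" by (rule borel_measurable_mono)
 then show ?thesis unfolding G_eq_cdf[abs_def] by simp
qed

lemma G_tendsto_0: "(G ---> 0) at_top"
proof -
 have "((%x. 1 - cdf \<nu> x) ---> 1 - 1) at_top" by (intro tendsto_intros cdf_lim_at_top_prob)
 then show ?thesis by (simp add: G_eq_cdf[abs_def])
qed

lemma G_right_continuous: "(G ---> G x) (at_right x)"
proof -
 have "(cdf \<nu> ---> cdf \<nu> x) (at_right x)" using cdf_is_right_cont[of x] by (simp add: continuous_within)
 then have "((%x. 1 - cdf \<nu> x) ---> 1 - cdf \<nu> x) (at_right x)" by (intro tendsto_intros)
 then show ?thesis by (simp add: G_eq_cdf[abs_def])
qed

lemma G_ratio:
 assumes t: "t > 0"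
 shows "((%x. G (t * x) / G x) ---> t powr (- \<alpha>)) at_top"
proof -
 have "((%x. inverse (h (t * x) / h x)) ---> inverse (t powr \<alpha>)) at_top"
  using t by (intro tendsto_inverse h_ratio) auto
 moreover have "\<forall>\<^sub>F x in at_top. inverse (h (t * x) / h x) = G (t * x) / G x"
  using eventually_ge_at_top[of 0] by eventually_elim (use t in \<open>simp add: h_eq divide_simps\<close>)
 ultimately show ?thesis by (subst (asm) tendsto_cong) (auto simp: powr_minus)
qed

text \<open>Potter's bound, extended to all s \<ge> 1: below \<open>x0\<close>, where regular
  variation says nothing, the trivial bound 1 for the tail is used at the price of the constant
  \<open>1 / G x0\<close>.\<close>

lemma G_potter_lower:
 assumes "\<beta> > \<alpha>"
 obtains C x0 where "C > 0" "x0 > 0" "\<And>x s. x0 <= x ==> 1 <= s ==> G (x / s) <= C * s powr \<beta> * G x"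
proof -
 have "((%x. h (2 * x) / h x) ---> 2 powr \<alpha>) at_top" by (rule h_ratio) simp
 then have "\<forall>\<^sub>F x in at_top. h (2 * x) / h x < 2 powr \<beta> \<and> x >= 1"
  using assms by (intro eventually_conj order_tendstoD eventually_ge_at_top) auto
 then obtain x0 where x0: "\<And>x. x >= x0 ==> h (2 * x) / h x < 2 powr \<beta> \<and> x >= 1"
  by (auto simp: eventually_at_top_linorder)
 have x1: "x0 >= 1" using x0[of x0] by simp
 have pot: "h (s * x) <= 2 powr \<beta> * s powr \<beta> * h x" if "x0 <= x" "1 <= s" for x s
 proof (rule doubling_upper[OF _ _ _ _ _ that])
  fix x assume x: "x0 <= x"
  show "0 <= h x" using h_pos[of x] x1 x by simp
  show "h (2 * x) <= 2 powr \<beta> * h x" using x0[OF x] h_pos[of x] x1 x by (simp add: divide_simps split: if_splits)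
  fix y assume y: "x <= y"
  show "h x <= h y" using G_antimono[OF y] G_pos x1 x y by (simp add: h_eq frac_le)
 qed (use x1 \<alpha> assms in auto)
 have pot': "G x <= 2 powr \<beta> * s powr \<beta> * G (s * x)" if "x0 <= x" "1 <= s" for x s
  using pot[OF that] that x1 G_pos[of x] G_pos[of "s * x"] by (simp add: h_eq divide_simps mult_ac)
 show ?thesis
 proof (rule that[of "2 powr \<beta> / G x0" x0])
  show "0 < 2 powr \<beta> / G x0" "0 < x0" using x1 G_pos[of x0] by auto
  fix x s :: real assume x: "x0 <= x" and s: "1 <= s"
  have G0: "G x0 <= 1" by (rule G_le_1)
  show "G (x / s) <= 2 powr \<beta> / G x0 * s powr \<beta> * G x"
  proof (cases "x0 <= x / s")
   case True
   have "G (x / s) <= 2 powr \<beta> * s powr \<beta> * G x" using pot'[OF True s] s by simp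
   also have "... <= 2 powr \<beta> * s powr \<beta> * G x / G x0"
   proof -
    have "2 powr \<beta> * s powr \<beta> * G x * G x0 <= 2 powr \<beta> * s powr \<beta> * G x * 1"
     by (intro mult_left_mono G0 mult_nonneg_nonneg G_nonneg) auto
    then show ?thesis using G_pos[of x0] by (simp add: pos_le_divide_eq)
   qed
   finally show ?thesis by (simp add: mult_ac)
  next
   \<comment> \<open>Here s \<ge> x / x0, so the bound between \<open>x0\<close> and
     \<open>x\<close> already shows that the right-hand side is at least 1.\<close>
   case False
   then have xs: "x / x0 <= s" using s x1 by (simp add: field_simps)
   have "G x0 <= 2 powr \<beta> * (x / x0) powr \<beta> * G x" using pot'[of x0 "x / x0"] x x1 by simp
   also have "... <= 2 powr \<beta> * s powr \<beta> * G x"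
    using xs x x1 \<alpha> assms G_nonneg by (intro mult_right_mono mult_left_mono powr_mono2) auto
   finally have "1 <= 2 powr \<beta> / G x0 * s powr \<beta> * G x" using G_pos[of x0] by (simp add: field_simps)
   then show ?thesis using G_le_1[of "x / s"] by linarith
  qed
 qed
qed

lemma G_potter_upper:
 assumes "0 <= \<beta>" "\<beta> < \<alpha>"
 obtains x0 where "x0 > 0" "\<And>x s. x0 <= x ==> 1 <= s ==> G (s * x) <= 2 powr \<beta> * s powr (- \<beta>) * G x"
proof -
 have "((%x. h (2 * x) / h x) ---> 2 powr \<alpha>) at_top" by (rule h_ratio) simp
 then have "\<forall>\<^sub>F x in at_top. 2 powr \<beta> < h (2 * x) / h x \<and> x >= 1"
  using assms by (intro eventually_conj order_tendstoD eventually_ge_at_top) auto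
 then obtain x0 where x0: "\<And>x. x >= x0 ==> 2 powr \<beta> < h (2 * x) / h x \<and> x >= 1"
  by (auto simp: eventually_at_top_linorder)
 have x1: "x0 >= 1" using x0[of x0] by simp
 have pot: "s powr \<beta> * h x <= 2 powr \<beta> * h (s * x)" if "x0 <= x" "1 <= s" for x s
 proof (rule doubling_lower[OF _ _ _ _ _ that])
  fix x assume x: "x0 <= x"
  show "0 <= h x" using h_pos[of x] x1 x by simp
  show "2 powr \<beta> * h x <= h (2 * x)" using x0[OF x] h_pos[of x] x1 x by (simp add: divide_simps split: if_splits)
  fix y assume y: "x <= y"
  show "h x <= h y" using G_antimono[OF y] G_pos x1 x y by (simp add: h_eq frac_le)
 qed (use x1 assms in auto)
 show ?thesis
 proof (rule that[of x0])
  show "0 < x0" using x1 by simp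
  fix x s :: real assume x: "x0 <= x" and s: "1 <= s"
  show "G (s * x) <= 2 powr \<beta> * s powr (- \<beta>) * G x"
   using pot[OF x s] x1 x s G_pos[of x] G_pos[of "s * x"] by (simp add: h_eq powr_minus divide_simps mult_ac)
 qed
qed

section \<open>The generalised inverse of h\<close>

abbreviation a :: "real => real" where
 "a \<equiv> gen_inverse h"

lemma a_set_nonempty: "\<exists>x\<ge>0. h x > y"
proof -
 define m where "m = max y 1"
 have m: "m >= 1" "y <= m" by (auto simp: m_def)
 have "\<forall>\<^sub>F x in at_top. G x < 1 / m \<and> x >= 0"
  using m by (intro eventually_conj order_tendstoD(2)[OF G_tendsto_0] eventually_ge_at_top) simp
 then obtain x where x: "G x < 1 / m" "x >= 0" unfolding eventually_at_top_linorder by blast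
 then have "m < h x" using G_pos[of x] m by (simp add: h_eq field_simps)
 then show ?thesis using x m by (intro exI[of _ x]) auto
qed

lemma a_le: "0 <= x ==> h x > y ==> a y <= x"
 unfolding gen_inverse_def by (intro cInf_lower bdd_belowI[of _ 0]) auto

lemma le_a: "(\<And>x. 0 <= x ==> h x > y ==> z <= x) ==> z <= a y"
 unfolding gen_inverse_def using a_set_nonempty[of y] by (intro cInf_greatest) auto

lemma a_nonneg: "0 <= a y"
 by (rule le_a)

lemma less_a: "0 <= x ==> x < a y ==> h x <= y"
 using a_le[of x y] by linarith

lemma h_mono: "0 <= x ==> x <= y ==> h x <= h y"
 using G_antimono[of x y] G_pos by (simp add: h_eq frac_le)

lemma le_a':
 assumes "0 <= z" "h z <= y"
 shows "z <= a y"
proof (rule le_a)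
 fix x assume x: "0 <= x" "h x > y"
 show "z <= x"
 proof (rule ccontr)
  assume "\<not> z <= x"
  then have "h x <= h z" using x by (intro h_mono) auto
  then show False using x assms by simp
 qed
qed

text \<open>The infimum \<open>a y\<close> need not belong to its set, but every larger point
  satisfies \<open>h > y\<close>, and the tail is right continuous.\<close>

lemma G_a_le:
 assumes y: "y > 0"
 shows "G (a y) <= 1 / y"
proof (rule tendsto_upperbound[OF G_right_continuous])
 show "\<forall>\<^sub>F x in at_right (a y). G x <= 1 / y"
  unfolding eventually_at_right_field
 proof (intro exI[of _ "a y + 1"] conjI allI impI)
  fix x assume x: "a y < x"
  have "\<exists>x'. 0 <= x' \<and> h x' > y \<and> x' < x"
  proof (rule ccontr)
   assume "\<nexists>x'. 0 <= x' \<and> h x' > y \<and> x' < x"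
   then have "x <= a y" by (intro le_a) (meson not_le)
   then show False using x by simp
  qed
  then obtain x' where "0 <= x'" "h x' > y" "x' < x" by blast
  then have "y < h x" using h_mono[of x' x] by simp
  then show "G x <= 1 / y" using y G_pos[of x] a_nonneg[of y] x by (simp add: h_eq field_simps)
 qed simp
qed simp

lemma a_at_top: "filterlim a at_top at_top"
 unfolding filterlim_at_top
proof
 fix Z
 show "\<forall>\<^sub>F y in at_top. Z <= a y"
  using eventually_ge_at_top[of "h (max Z 0)"]
 proof eventually_elim
  case (elim y)
  then have "max Z 0 <= a y" by (intro le_a') auto
  then show ?case by simp
 qed
qed

text \<open>\<open>h\<close> may jump at \<open>a y\<close>, so the lower bound is taken slightly
  below it: there \<open>h\<close> is at most \<open>y\<close>, and regular variation compares the
  tails at \<open>e * a y\<close> and \<open>a y\<close> for \<open>e\<close> close to 1.\<close>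

lemma G_a: "((%y. y * G (a y)) ---> 1) at_top"
proof (rule order_tendstoI)
 fix c :: real assume "1 < c"
 show "\<forall>\<^sub>F y in at_top. y * G (a y) < c"
  using eventually_gt_at_top[of 0]
 proof eventually_elim
  case (elim y)
  then have "y * G (a y) <= 1" using G_a_le[of y] by (simp add: field_simps)
  then show ?case using \<open>1 < c\<close> by simp
 qed
next
 fix c :: real assume "c < 1"
 define c' where "c' = max c (1 / 2)"
 have c': "0 < c'" "c' < 1" "c <= c'" using \<open>c < 1\<close> by (auto simp: c'_def)
 \<comment> \<open>Chosen such that \<open>e powr (- \<alpha>) = 2 / (1 + c')\<close>, which is less
   than \<open>1 / c'\<close> because c' < 1.\<close>
 define e where "e = ((1 + c') / 2) powr (1 / \<alpha>)"
 have e: "0 < e" "e < 1" "e powr (- \<alpha>) < 1 / c'"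
 proof -
  show "0 < e" using c' by (simp add: e_def)
  have "e < 1 powr (1 / \<alpha>)" unfolding e_def using c' \<alpha> by (intro powr_less_mono2) auto
  then show "e < 1" by simp
  have "e powr (- \<alpha>) = 1 / ((1 + c') / 2)"
   unfolding e_def using c' \<alpha> by (simp add: powr_powr powr_minus_divide)
  also have "... < 1 / c'" using c' by (intro divide_strict_left_mono) auto
  finally show "e powr (- \<alpha>) < 1 / c'" .
 qed
 have "\<forall>\<^sub>F x in at_top. G (e * x) / G x < 1 / c'" by (rule order_tendstoD(2)[OF G_ratio[OF e(1)] e(3)])
 then have "\<forall>\<^sub>F y in at_top. G (e * a y) / G (a y) < 1 / c'" by (rule eventually_compose_filterlim[OF _ a_at_top])
 moreover have "\<forall>\<^sub>F y in at_top. a y > 0" using a_at_top by (simp add: filterlim_at_top_dense)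
 ultimately show "\<forall>\<^sub>F y in at_top. c < y * G (a y)"
  using eventually_gt_at_top[of 0]
 proof eventually_elim
  case (elim y)
  have "e * a y < a y" using elim e by simp
  then have "h (e * a y) <= y" using less_a[of "e * a y" y] e elim by simp
  then have "1 <= y * G (e * a y)" using G_pos[of "e * a y"] e elim by (simp add: h_eq field_simps)
  moreover have "G (e * a y) * c' < G (a y)" using elim(1) G_pos[of "a y"] c' by (simp add: field_simps)
  then have "y * (G (e * a y) * c') < y * G (a y)" using elim(3) by (intro mult_strict_left_mono) auto
  moreover have "1 * c' <= (y * G (e * a y)) * c'" if "1 <= y * G (e * a y)"
   using that c' by (intro mult_right_mono) auto
  ultimately have "c' < y * G (a y)" by (simp add: mult.assoc)
  then show ?case using c' by simp
 qed
qed

lemma G_scaled_a: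
 assumes c: "c > 0"
 shows "((%y. y * G (c * a y)) ---> c powr (- \<alpha>)) at_top"
proof -
 have "((%y. (y * G (a y)) * (G (c * a y) / G (a y))) ---> 1 * c powr (- \<alpha>)) at_top"
  by (intro tendsto_mult G_a filterlim_compose[OF G_ratio[OF c] a_at_top])
 then show ?thesis using G_pos by (simp add: less_imp_neq[THEN not_sym])
qed

end

text \<open>Indicators as \<open>f\<close> yield means, an exponential density yields Laplace
  transforms. Being stated for \<sigma>-finite measures, it also covers the infinite Levy measure of
  the stable law.\<close>

lemma layer_cake:
 fixes f :: "real => ennreal"
 assumes sf: "sigma_finite_measure \<mu>" and sets: "sets \<mu> = sets borel" and f [measurable]: "f \<in> borel_measurable borel"
 shows "(\<integral>\<^sup>+x. (\<integral>\<^sup>+y. f y * indicator {..<x} y \<partial>lborel) \<partial>\<mu>) = (\<integral>\<^sup>+y. f y * emeasure \<mu> {y<..} \<partial>lborel)"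
proof -
 interpret sigma_finite_measure \<mu> by fact
 interpret pair_sigma_finite \<mu> lborel ..
 have [measurable_cong]: "sets \<mu> = sets borel" by fact
 have m: "(%(x, y). f y * (if y < x then 1 else 0)) \<in> borel_measurable (\<mu> \<Otimes>\<^sub>M lborel)" by measurable
 have "(\<integral>\<^sup>+x. (\<integral>\<^sup>+y. f y * indicator {..<x} y \<partial>lborel) \<partial>\<mu>) = (\<integral>\<^sup>+x. (\<integral>\<^sup>+y. f y * (if y < x then 1 else 0) \<partial>lborel) \<partial>\<mu>)"
  by (intro nn_integral_cong) (simp add: indicator_def)
 also have "... = (\<integral>\<^sup>+y. (\<integral>\<^sup>+x. f y * (if y < x then 1 else 0) \<partial>\<mu>) \<partial>lborel)"
  using m by (intro Fubini'[symmetric]) simp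
 also have "... = (\<integral>\<^sup>+y. f y * emeasure \<mu> {y<..} \<partial>lborel)"
 proof (rule nn_integral_cong)
  fix y
  have "(\<integral>\<^sup>+x. f y * (if y < x then 1 else 0) \<partial>\<mu>) = (\<integral>\<^sup>+x. f y * indicator {y<..} x \<partial>\<mu>)"
   by (intro nn_integral_cong) (simp add: indicator_def)
  also have "... = f y * emeasure \<mu> {y<..}" by (rule nn_integral_cmult_indicator) (simp add: sets)
  finally show "(\<integral>\<^sup>+x. f y * (if y < x then 1 else 0) \<partial>\<mu>) = f y * emeasure \<mu> {y<..}" by simp
 qed
 finally show ?thesis .
qed

section \<open>Excess means and truncated means\<close>

context heavy_tail
begin

lemma \<nu>_sigma_finite: "sigma_finite_measure \<nu>" ..

lemma emeasure_tail: "emeasure \<nu> {y<..} = ennreal (G y)"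
 by (simp add: G_def emeasure_eq_measure)

lemma expectation_add_indicator:
 fixes f :: "real => real"
 assumes f: "integrable \<nu> f"
 shows "integrable \<nu> (%x. f x + c * indicator {d<..} x)" "(LINT x|\<nu>. f x + c * indicator {d<..} x) = (LINT x|\<nu>. f x) + c * G d"
proof -
 have i: "integrable \<nu> (%x. c * indicator {d<..} x)" by (intro integrable_mult_right integrable_real_indicator) (simp_all add: emeasure_eq_measure)
 show "integrable \<nu> (%x. f x + c * indicator {d<..} x)" by (rule L1_add[OF f i])
 show "(LINT x|\<nu>. f x + c * indicator {d<..} x) = (LINT x|\<nu>. f x) + c * G d"
  by (subst LINT_add[OF f i]) (simp add: G_def)
qed

text \<open>This and \<open>trunc\<close> are the integrals of \<open>G\<close> over (c,
  \<infinity>) and (0, A), written as expectations so that they can be estimated by pointwise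
  comparisons.\<close>

definition excess :: "real => real" where
 "excess c = (LINT x|\<nu>. max 0 (x - c))"

definition trunc :: "real => real" where
 "trunc A = (LINT x|\<nu>. max 0 (min x A))"

lemma nn_integral_excess: "(\<integral>\<^sup>+x. ennreal (max 0 (x - c)) \<partial>\<nu>) = (\<integral>\<^sup>+y. ennreal (G y) * indicator {c<..} y \<partial>lborel)"
proof -
 have "(\<integral>\<^sup>+x. ennreal (max 0 (x - c)) \<partial>\<nu>) = (\<integral>\<^sup>+x. (\<integral>\<^sup>+y. indicator {c<..} y * indicator {..<x} y \<partial>lborel) \<partial>\<nu>)"
 proof (rule nn_integral_cong)
  fix x
  have "(\<integral>\<^sup>+y. indicator {c<..} y * indicator {..<x} y \<partial>lborel) = (\<integral>\<^sup>+y. indicator {c<..<x} y \<partial>lborel)"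
   by (intro nn_integral_cong) (auto simp: indicator_def)
  also have "... = emeasure lborel {c<..<x}" by (rule nn_integral_indicator) simp
  also have "... = ennreal (max 0 (x - c))" by (cases "c <= x") auto
  finally show "ennreal (max 0 (x - c)) = (\<integral>\<^sup>+y. indicator {c<..} y * indicator {..<x} y \<partial>lborel)" by simp
 qed
 also have "... = (\<integral>\<^sup>+y. indicator {c<..} y * emeasure \<nu> {y<..} \<partial>lborel)"
  by (rule layer_cake[OF \<nu>_sigma_finite events_eq_borel]) measurable
 finally show ?thesis by (simp add: emeasure_tail mult.commute)
qed

lemma nn_integral_trunc:
 assumes "0 <= A"
 shows "ennreal (trunc A) = (\<integral>\<^sup>+y. ennreal (G y) * indicator {0<..<A} y \<partial>lborel)"
proof -
 have "integrable \<nu> (%x. max 0 (min x A))"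
  by (rule integrable_const_bound[where B=A]) (use assms in auto)
 then have "ennreal (trunc A) = (\<integral>\<^sup>+x. ennreal (max 0 (min x A)) \<partial>\<nu>)"
  unfolding trunc_def by (rule nn_integral_eq_integral[symmetric]) simp
 also have "... = (\<integral>\<^sup>+x. (\<integral>\<^sup>+y. indicator {0<..<A} y * indicator {..<x} y \<partial>lborel) \<partial>\<nu>)"
 proof (rule nn_integral_cong)
  fix x
  have "(\<integral>\<^sup>+y. indicator {0<..<A} y * indicator {..<x} y \<partial>lborel) = (\<integral>\<^sup>+y. indicator {0<..<min x A} y \<partial>lborel)"
   by (intro nn_integral_cong) (auto simp: indicator_def)
  also have "... = emeasure lborel {0<..<min x A}" by (rule nn_integral_indicator) simp
  also have "... = ennreal (max 0 (min x A))" by (cases "0 <= min x A") (auto simp: ennreal_neg min_def)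
  finally show "ennreal (max 0 (min x A)) = (\<integral>\<^sup>+y. indicator {0<..<A} y * indicator {..<x} y \<partial>lborel)" by simp
 qed
 also have "... = (\<integral>\<^sup>+y. indicator {0<..<A} y * emeasure \<nu> {y<..} \<partial>lborel)"
  by (rule layer_cake[OF \<nu>_sigma_finite events_eq_borel]) measurable
 finally show ?thesis by (simp add: emeasure_tail mult.commute)
qed

lemma trunc_integrable: "integrable \<nu> (%x. max 0 (min x A))"
 by (rule integrable_const_bound[where B="\<bar>A\<bar>"]) auto

lemma trunc_nonneg: "0 <= trunc A"
 unfolding trunc_def by (intro LINT_nonneg) simp

lemma trunc_mono: "A <= B ==> trunc A <= trunc B"
 unfolding trunc_def by (intro integral_mono trunc_integrable) auto

lemma trunc_step: "0 <= A ==> trunc A + A * G (2 * A) <= trunc (2 * A)"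
proof -
 assume A: "0 <= A"
 have "trunc A + A * G (2 * A) = (LINT x|\<nu>. max 0 (min x A) + A * indicator {2 * A<..} x)"
  unfolding trunc_def by (rule expectation_add_indicator(2)[symmetric, OF trunc_integrable])
 also have "... <= trunc (2 * A)"
  unfolding trunc_def using A
  by (intro integral_mono expectation_add_indicator(1) trunc_integrable) (auto simp: indicator_def)
 finally show ?thesis .
qed

text \<open>Summation of the dyadic contributions to \<open>trunc\<close>, each of which is of order \<open>A * G A\<close> for \<open>\<alpha> = 1\<close>.\<close>

lemma trunc_dominates:
 assumes "\<alpha> = 1"
 shows "filterlim (%A. trunc A / (A * G A)) at_top at_top"
proof -
 have half: "filterlim (%A::real. A / 2) at_top at_top" by real_asymp
 \<comment> \<open>The ratio r satisfies r(A) \<ge> 1/2 + r(A/2) G(A/2) / (2 G(A)), where G(A/2) /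
   G(A) tends to 2. Asking for a gain of 1/8 instead of 1/2 per step leaves room for the
   limit.\<close>
 have "\<forall>\<^sub>F A in at_top. real k / 8 <= trunc A / (A * G A)" for k
 proof (induction k)
  case 0
  show ?case using eventually_ge_at_top[of 0]
   by eventually_elim (auto intro!: divide_nonneg_nonneg mult_nonneg_nonneg trunc_nonneg G_nonneg)
 next
  case (Suc k)
  have lim: "((%A. 1 / 2 + (real k / 8) * (G (1 / 2 * A) / G A) / 2) ---> 1 / 2 + (real k / 8) * (1 / 2) powr (- \<alpha>) / 2) at_top"
   by (intro tendsto_intros G_ratio) auto
  have "\<forall>\<^sub>F A in at_top. real (Suc k) / 8 < 1 / 2 + (real k / 8) * (G (1 / 2 * A) / G A) / 2"
   using order_tendstoD(1)[OF lim, of "real (Suc k) / 8"] assms by (simp add: powr_minus)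
  then show ?case
   using eventually_compose_filterlim[OF Suc half] eventually_gt_at_top[of 0]
  proof eventually_elim
   case (elim A)
   have "trunc (A / 2) + A / 2 * G A <= trunc A" using trunc_step[of "A / 2"] elim by simp
   then have "(trunc (A / 2) + A / 2 * G A) / (A * G A) <= trunc A / (A * G A)"
    using elim G_pos[of A] by (intro divide_right_mono) auto
   moreover have "A / 2 * G A / (A * G A) = 1 / 2" using elim G_pos[of A] by (simp add: less_imp_neq[THEN not_sym])
   ultimately have "trunc (A / 2) / (A * G A) + 1 / 2 <= trunc A / (A * G A)" by (simp only: add_divide_distrib)
   moreover have "(real k / 8) * (G (1 / 2 * A) / G A) / 2 <= trunc (A / 2) / (A * G A)"
   proof -
    have "(real k / 8) * (A / 2 * G (A / 2)) <= trunc (A / 2)"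
     using elim(2) by (subst (asm) pos_le_divide_eq) (use elim(3) G_pos[of "A / 2"] in auto)
    then have "(real k / 8) * (A / 2 * G (A / 2)) / (A * G A) <= trunc (A / 2) / (A * G A)"
     using elim G_pos[of A] by (intro divide_right_mono) auto
    then show ?thesis using elim by (simp add: field_simps)
   qed
   ultimately show ?case using elim(1) by linarith
  qed
 qed
 then show ?thesis unfolding filterlim_at_top
 proof (intro allI)
  fix Z :: real
  obtain k :: nat where "8 * Z <= real k" using real_arch_simple by blast
  then show "\<forall>\<^sub>F A in at_top. Z <= trunc A / (A * G A)"
   using \<open>\<And>k. \<forall>\<^sub>F A in at_top. real k / 8 <= trunc A / (A * G A)\<close>[of k]
   by (elim eventually_mono) linarith
 qed
qed

lemma excess_integrable:
 assumes "integrable \<nu> (%x. max 0 x)"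
 shows "integrable \<nu> (%x. max 0 (x - c))"
proof (rule L1_bound)
 show "integrable \<nu> (%x. max 0 x + \<bar>c\<bar>)" by (intro L1_add assms) simp
qed auto

lemma excess_nonneg: "0 <= excess c"
 unfolding excess_def by (intro LINT_nonneg) simp

lemma ennreal_excess:
 assumes "integrable \<nu> (%x. max 0 x)"
 shows "ennreal (excess c) = (\<integral>\<^sup>+y. ennreal (G y) * indicator {c<..} y \<partial>lborel)"
 unfolding nn_integral_excess[symmetric] excess_def
 by (rule nn_integral_eq_integral[symmetric, OF excess_integrable[OF assms]]) simp

lemma excess_step:
 assumes int: "integrable \<nu> (%x. max 0 x)" and c: "0 <= c"
 shows "c * G (2 * c) + excess (2 * c) <= excess c"
proof -
 have "c * G (2 * c) + excess (2 * c) = (LINT x|\<nu>. max 0 (x - 2 * c) + c * indicator {2 * c<..} x)"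
  unfolding excess_def expectation_add_indicator(2)[OF excess_integrable[OF int]] by simp
 also have "... <= excess c"
  unfolding excess_def using c
  by (intro integral_mono expectation_add_indicator(1) excess_integrable[OF int]) (auto simp: indicator_def)
 finally show ?thesis .
qed

text \<open>Lowering the level from \<open>d\<close> to \<open>c\<close> adds at most
  \<open>d - c\<close>, and only above \<open>c\<close>.\<close>

lemma excess_ge:
 assumes int: "integrable \<nu> (%x. max 0 x)" and c: "0 <= c" "c <= d"
 shows "excess c <= excess d + (d - c) * G c"
proof -
 have "excess c <= (LINT x|\<nu>. max 0 (x - d) + (d - c) * indicator {c<..} x)"
  unfolding excess_def using c
  by (intro integral_mono expectation_add_indicator(1) excess_integrable[OF int]) (auto simp: indicator_def)
 also have "... = excess d + (d - c) * G c"
  unfolding excess_def by (rule expectation_add_indicator(2)[OF excess_integrable[OF int]])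
 finally show ?thesis .
qed

lemma expectation_above:
 assumes int: "integrable \<nu> (%x. max 0 x)" and D: "0 <= D"
 shows "(LINT x|\<nu>. (if max 0 x > D then max 0 x else 0)) = D * G D + excess D"
proof -
 have "(LINT x|\<nu>. (if max 0 x > D then max 0 x else 0)) = (LINT x|\<nu>. max 0 (x - D) + D * indicator {D<..} x)"
  using D by (intro LINT_cong) (auto simp: indicator_def max_def)
 also have "... = D * G D + excess D"
  unfolding excess_def expectation_add_indicator(2)[OF excess_integrable[OF int]] by simp
 finally show ?thesis .
qed

text \<open>Dual to \<open>trunc_dominates\<close>, with scales doubled instead of halved: a ratio
  of at least k/8 at 2c gives at least (G(2c) / G(c)) (1 + k/4) at c, which tends to 1/2 +
  k/8.\<close>

lemma excess_dominates:
 assumes int: "integrable \<nu> (%x. max 0 x)" and \<alpha>1: "\<alpha> = 1"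
 shows "filterlim (%c. excess c / (c * G c)) at_top at_top"
proof -
 have double: "filterlim (%A::real. 2 * A) at_top at_top" by real_asymp
 have "\<forall>\<^sub>F c in at_top. real k / 8 <= excess c / (c * G c)" for k
 proof (induction k)
  case 0
  show ?case using eventually_ge_at_top[of 0]
   by eventually_elim (auto intro!: divide_nonneg_nonneg mult_nonneg_nonneg excess_nonneg G_nonneg)
 next
  case (Suc k)
  have lim: "((%c. (G (2 * c) / G c) * (1 + 2 * (real k / 8))) ---> 2 powr (- \<alpha>) * (1 + 2 * (real k / 8))) at_top"
   by (intro tendsto_intros G_ratio) auto
  have "\<forall>\<^sub>F c in at_top. real (Suc k) / 8 < (G (2 * c) / G c) * (1 + 2 * (real k / 8))"
   using order_tendstoD(1)[OF lim, of "real (Suc k) / 8"] \<alpha>1 by (simp add: powr_minus field_simps)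
  then show ?case
   using eventually_compose_filterlim[OF Suc double] eventually_gt_at_top[of 0]
  proof eventually_elim
   case (elim c)
   have "c * G (2 * c) + excess (2 * c) <= excess c" using excess_step[OF int, of c] elim by simp
   moreover have "(real k / 8) * (2 * c * G (2 * c)) <= excess (2 * c)"
    using elim(2) by (subst (asm) pos_le_divide_eq) (use elim(3) G_pos[of "2 * c"] in auto)
   ultimately have "c * G (2 * c) * (1 + 2 * (real k / 8)) <= excess c" by (simp add: algebra_simps)
   then have "c * G (2 * c) * (1 + 2 * (real k / 8)) / (c * G c) <= excess c / (c * G c)"
    using elim G_pos[of c] by (intro divide_right_mono) auto
   moreover have "c * G (2 * c) * (1 + 2 * (real k / 8)) / (c * G c) = (G (2 * c) / G c) * (1 + 2 * (real k / 8))"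
    using elim(3) by simp
   ultimately show ?case using elim(1) by linarith
  qed
 qed
 then show ?thesis unfolding filterlim_at_top
 proof (intro allI)
  fix Z :: real
  obtain k :: nat where "8 * Z <= real k" using real_arch_simple by blast
  then show "\<forall>\<^sub>F c in at_top. Z <= excess c / (c * G c)"
   using \<open>\<And>k. \<forall>\<^sub>F c in at_top. real k / 8 <= excess c / (c * G c)\<close>[of k]
   by (elim eventually_mono) linarith
 qed
qed

text \<open>One half of Karamata's theorem: Potter's bound with an exponent strictly between 1 and
  \<alpha> is integrated over (D, \<infinity>). Integrability of the jumps is a by-product.\<close>

lemma excess_le:
 assumes "\<alpha> > 1"
 obtains C x0 where "C > 0" "x0 > 0" "integrable \<nu> (%x. max 0 x)" "\<And>D. x0 <= D ==> excess D <= C * (D * G D)"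
proof -
 define \<beta> where "\<beta> = (1 + \<alpha>) / 2"
 have \<beta>: "1 < \<beta>" "\<beta> < \<alpha>" using assms by (auto simp: \<beta>_def)
 obtain x0 where x0: "x0 > 0" "\<And>x s. x0 <= x ==> 1 <= s ==> G (s * x) <= 2 powr \<beta> * s powr (- \<beta>) * G x"
  using G_potter_upper[of \<beta>] \<beta> by auto
 define C where "C = 2 powr \<beta> / (\<beta> - 1)"
 have C: "C > 0" using \<beta> by (simp add: C_def)
 have nn: "(\<integral>\<^sup>+x. ennreal (max 0 (x - D)) \<partial>\<nu>) <= ennreal (C * (D * G D))" if D: "x0 <= D" for D
 proof -
  define K where "K = 2 powr \<beta> * D powr \<beta> * G D"
  have K: "K >= 0" using G_nonneg[of D] by (simp add: K_def)
  have D0: "D > 0" using x0 D by simp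
  have "(\<integral>\<^sup>+x. ennreal (max 0 (x - D)) \<partial>\<nu>) = (\<integral>\<^sup>+y. ennreal (G y) * indicator {D<..} y \<partial>lborel)"
   by (rule nn_integral_excess)
  also have "... <= (\<integral>\<^sup>+y. ennreal K * (ennreal (y powr (- \<beta>)) * indicator {D..} y) \<partial>lborel)"
  proof (rule nn_integral_mono)
   fix y
   show "ennreal (G y) * indicator {D<..} y <= ennreal K * (ennreal (y powr (- \<beta>)) * indicator {D..} y)"
   proof (cases "D < y")
    case True
    have "G y <= 2 powr \<beta> * (y / D) powr (- \<beta>) * G D" using x0(2)[OF D, of "y / D"] True D0 by simp
    also have "... = K * y powr (- \<beta>)"
     using True D0 by (simp add: K_def powr_divide powr_minus field_simps)
    finally show ?thesis using True K by (simp add: ennreal_mult[symmetric] ennreal_leI)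
   qed simp
  qed
  also have "... = ennreal K * (\<integral>\<^sup>+y. ennreal (y powr (- \<beta>)) * indicator {D..} y \<partial>lborel)"
   by (rule nn_integral_cmult) measurable
  also have "(\<integral>\<^sup>+y. ennreal (y powr (- \<beta>)) * indicator {D..} y \<partial>lborel) = ennreal (- (D powr (- \<beta> + 1)) / (- \<beta> + 1))"
   using \<beta> D0 by (intro nn_integral_has_integral_lebesgue' has_integral_powr_to_inf) auto
  also have "ennreal K * ennreal (- (D powr (- \<beta> + 1)) / (- \<beta> + 1)) = ennreal (K * (- (D powr (- \<beta> + 1)) / (- \<beta> + 1)))"
   using K \<beta> by (intro ennreal_mult[symmetric]) (auto simp: divide_simps)
  also have "K * (- (D powr (- \<beta> + 1)) / (- \<beta> + 1)) = C * (D * G D)"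
  proof -
   have "D powr \<beta> * D powr (- \<beta> + 1) = D" using D0 by (simp add: powr_add[symmetric])
   moreover have "- (D powr (- \<beta> + 1)) / (- \<beta> + 1) = D powr (- \<beta> + 1) / (\<beta> - 1)"
   proof -
    have "- \<beta> + 1 = - (\<beta> - 1)" by simp
    then have "- y / (- \<beta> + 1) = y / (\<beta> - 1)" for y by (simp only: minus_divide_divide)
    then show ?thesis .
   qed
   ultimately have "K * (- (D powr (- \<beta> + 1)) / (- \<beta> + 1)) = 2 powr \<beta> * D * G D / (\<beta> - 1)"
    unfolding K_def by (metis (no_types) mult.assoc mult.commute times_divide_eq_right)
   then show ?thesis by (simp add: C_def)
  qed
  finally show ?thesis .
 qed
 have int0: "integrable \<nu> (%x. max 0 (x - x0))"
 proof (rule integrableI_bounded)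
  have "(\<integral>\<^sup>+x. ennreal (max 0 (x - x0)) \<partial>\<nu>) < \<infinity>" by (rule order_le_less_trans[OF nn[of x0]]) simp_all
  then show "(\<integral>\<^sup>+x. ennreal (norm (max 0 (x - x0))) \<partial>\<nu>) < \<infinity>" by simp
 qed measurable
 have int: "integrable \<nu> (%x. max 0 x)"
 proof (rule L1_bound)
  show "integrable \<nu> (%x. max 0 (x - x0) + x0)" by (intro L1_add int0) simp
 qed (use x0 in auto)
 have "excess D <= C * (D * G D)" if D: "x0 <= D" for D
 proof -
  have "ennreal (excess D) = (\<integral>\<^sup>+x. ennreal (max 0 (x - D)) \<partial>\<nu>)"
   unfolding excess_def by (rule nn_integral_eq_integral[symmetric, OF excess_integrable[OF int]]) simp
  with nn[OF D] have "ennreal (excess D) <= ennreal (C * (D * G D))" by simp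
  then show ?thesis using C D x0 G_nonneg[of D] by (subst (asm) ennreal_le_iff) auto
 qed
 then show ?thesis using that C x0(1) int by blast
qed

text \<open>The counterpart for \<alpha> < 1: an exponent between \<alpha> and 1 is integrable at
  0.\<close>

lemma trunc_le:
 assumes "\<alpha> < 1"
 obtains C x0 where "C > 0" "x0 > 0" "\<And>A. x0 <= A ==> trunc A <= C * (A * G A)"
proof -
 define \<beta> where "\<beta> = (1 + \<alpha>) / 2"
 have \<beta>: "\<alpha> < \<beta>" "\<beta> < 1" "0 < \<beta>" using assms \<alpha> by (auto simp: \<beta>_def)
 obtain C x0 where x0: "C > 0" "x0 > 0" "\<And>x s. x0 <= x ==> 1 <= s ==> G (x / s) <= C * s powr \<beta> * G x"
  using G_potter_lower[OF \<beta>(1)] by blast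
 have "trunc A <= (C / (1 - \<beta>)) * (A * G A)" if A: "x0 <= A" for A
 proof -
  define K where "K = C * A powr \<beta> * G A"
  have K: "K >= 0" using G_nonneg[of A] x0 by (simp add: K_def)
  have A0: "A > 0" using x0 A by simp
  have "ennreal (trunc A) = (\<integral>\<^sup>+y. ennreal (G y) * indicator {0<..<A} y \<partial>lborel)"
   by (rule nn_integral_trunc) (use A0 in simp)
  also have "... <= (\<integral>\<^sup>+y. ennreal K * (ennreal (y powr (- \<beta>)) * indicator {0..A} y) \<partial>lborel)"
  proof (rule nn_integral_mono)
   fix y
   show "ennreal (G y) * indicator {0<..<A} y <= ennreal K * (ennreal (y powr (- \<beta>)) * indicator {0..A} y)"
   proof (cases "0 < y \<and> y < A")
    case True
    have "G y <= C * (A / y) powr \<beta> * G A" using x0(3)[OF A, of "A / y"] True A0 by simp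
    also have "... = K * y powr (- \<beta>)"
     using True A0 by (simp add: K_def powr_divide powr_minus field_simps)
    finally show ?thesis using True K by (simp add: ennreal_mult[symmetric] ennreal_leI)
   qed simp
  qed
  also have "... = ennreal K * (\<integral>\<^sup>+y. ennreal (y powr (- \<beta>)) * indicator {0..A} y \<partial>lborel)"
   by (rule nn_integral_cmult) measurable
  also have "(\<integral>\<^sup>+y. ennreal (y powr (- \<beta>)) * indicator {0..A} y \<partial>lborel) = ennreal (A powr (- \<beta> + 1) / (- \<beta> + 1))"
   using \<beta> A0 by (intro nn_integral_has_integral_lebesgue' has_integral_powr_from_0) auto
  also have "ennreal K * ennreal (A powr (- \<beta> + 1) / (- \<beta> + 1)) = ennreal (K * (A powr (- \<beta> + 1) / (- \<beta> + 1)))"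
   using K \<beta> by (intro ennreal_mult[symmetric]) auto
  also have "K * (A powr (- \<beta> + 1) / (- \<beta> + 1)) = (C / (1 - \<beta>)) * (A * G A)"
  proof -
   have "A powr \<beta> * A powr (- \<beta> + 1) = A" using A0 by (simp add: powr_add[symmetric])
   then have "K * (A powr (- \<beta> + 1) / (- \<beta> + 1)) = C * A * G A / (1 - \<beta>)"
    using \<beta> by (simp add: K_def divide_simps)
   then show ?thesis by (simp add: mult.assoc)
  qed
  finally show ?thesis
   using \<beta> x0(1) A0 G_nonneg[of A] by (subst (asm) ennreal_le_iff) (auto intro!: mult_nonneg_nonneg divide_nonneg_nonneg)
 qed
 then show ?thesis using that[of "C / (1 - \<beta>)" x0] x0 \<beta> by auto
qed

end

section \<open>The boundary case with finite mean\<close>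

context heavy_tail
begin

lemma nbrw_lawI: "N >= 1 ==> \<phi> \<in> borel_measurable borel ==> (\<And>x. 0 <= \<phi> x) ==> nbrw_law N \<nu> \<phi>"
 by unfold_locales simp_all

text \<open>\<open>nbrw_law\<close> asks for jumps that are nonnegative everywhere;
  \<open>max 0\<close> provides them and changes nothing almost surely for a law on the nonnegative
  half-line.\<close>

definition v :: "nat => real" where
 "v N = nbrw_law.brw_speed N \<nu> (%x. max 0 x)"

abbreviation scale :: "nat => real" where
 "scale N \<equiv> 2 * real N * log 2 (real N)"

lemma scale_at_top: "filterlim scale at_top sequentially"
 by real_asymp

lemma c_scale_eq: "c_scale h N = a (scale N)"
 by (simp add: c_scale_def)

lemma c_scale_at_top: "filterlim (c_scale h) at_top sequentially"
 unfolding c_scale_eq[abs_def] by (rule filterlim_compose[OF a_at_top scale_at_top])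

lemma G_c_scale: "t > 0 ==> (%N. scale N * G (t * c_scale h N)) ----> t powr (- \<alpha>)"
 unfolding c_scale_eq by (rule filterlim_compose[OF G_scaled_a scale_at_top])

end

section \<open>Positions and the sum of all jumps\<close>

context nbrw_law
begin

lemma nn_integral_exp_total:
 assumes t: "t >= 0"
 shows "(\<integral>\<^sup>+w. ennreal (exp (- t * total w n)) \<partial>S) = (\<integral>\<^sup>+x. ennreal (exp (- t * \<phi> x)) \<partial>\<nu>) ^ (2 * N * n)"
proof (induction n)
 case 0
 then show ?case by (simp add: total_def P.emeasure_space_1)
next
 case (Suc n)
 interpret F: product_sigma_finite "%_. \<nu>"
  by (intro product_sigma_finite.intro prob_space_imp_sigma_finite \<nu>_prob)
 let ?e = "%x. ennreal (exp (- t * \<phi> x))" and ?g = "%v. \<Prod>k=1..2 * N. ennreal (exp (- t * \<phi> (v k)))"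
 have e: "?e \<in> borel_measurable borel" by measurable
 have ek: "(%v. ?e (v k)) \<in> borel_measurable gen" if "k \<in> {1..2 * N}" for k
  by (rule measurable_compose[OF gen_component[OF that] e])
 have "(\<integral>\<^sup>+w. ennreal (exp (- t * total w (Suc n))) \<partial>S) = (\<integral>\<^sup>+w. ennreal (exp (- t * total w n)) * ?g (w n) \<partial>S)"
 proof (rule nn_integral_cong)
  fix w
  have "exp (- t * total w (Suc n)) = exp (- t * total w n) * exp (\<Sum>k=1..2 * N. - t * \<phi> (w n k))"
   by (simp add: total_def jumps_def exp_add[symmetric] sum_negf sum_distrib_left algebra_simps)
  also have "exp (\<Sum>k=1..2 * N. - t * \<phi> (w n k)) = (\<Prod>k=1..2 * N. exp (- t * \<phi> (w n k)))"
   by (rule exp_sum) simp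
  finally have "ennreal (exp (- t * total w (Suc n))) = ennreal (exp (- t * total w n) * (\<Prod>k=1..2 * N. exp (- t * \<phi> (w n k))))"
   by (rule arg_cong)
  also have "... = ennreal (exp (- t * total w n)) * ennreal (\<Prod>k=1..2 * N. exp (- t * \<phi> (w n k)))"
   by (intro ennreal_mult prod_nonneg) auto
  also have "ennreal (\<Prod>k=1..2 * N. exp (- t * \<phi> (w n k))) = ?g (w n)"
   by (rule prod_ennreal[symmetric]) simp
  finally show "ennreal (exp (- t * total w (Suc n))) = ennreal (exp (- t * total w n)) * ?g (w n)" .
 qed
 also have "... = (\<integral>\<^sup>+w. ennreal (exp (- t * total w n)) \<partial>S) * (\<integral>\<^sup>+v. ?g v \<partial>gen)"
 proof (rule nn_integral_past_times_present)
  show "?g \<in> borel_measurable gen" by (intro borel_measurable_prod_ennreal ek)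
  show "ennreal (exp (- t * total (comb_seq n w w') n)) = ennreal (exp (- t * total w n))" for w w'
   by (simp add: total_def jumps_def comb_seq_less)
 qed measurable
 also have "(\<integral>\<^sup>+v. ?g v \<partial>gen) = (\<Prod>k=1..2 * N. \<integral>\<^sup>+x. ?e x \<partial>\<nu>)"
  using e unfolding measurable_cong_sets[OF sets_\<nu>[symmetric] refl]
  by (intro F.product_nn_integral_prod) auto
 also have "... = (\<integral>\<^sup>+x. ?e x \<partial>\<nu>) ^ (2 * N)" by simp
 finally show ?case unfolding Suc by (simp add: power_add[symmetric] add.commute)
qed

lemma expectation_exp_total:
 assumes t: "t >= 0"
 shows "(LINT w|S. exp (- t * total w n)) = (LINT x|\<nu>. exp (- t * \<phi> x)) ^ (2 * N * n)"
proof -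
 interpret \<nu>: prob_space \<nu> by (rule \<nu>_prob)
 have e: "(%x. exp (- t * \<phi> x)) \<in> borel_measurable \<nu>"
  unfolding measurable_cong_sets[OF sets_\<nu> refl] by measurable
 have le: "exp (- t * \<phi> x) <= 1" for x using t \<phi>_nonneg[of x] by simp
 have i1: "integrable \<nu> (%x. exp (- t * \<phi> x))"
  using le by (intro \<nu>.integrable_const_bound[where B=1] e) auto
 have tot: "total w n >= 0" for w unfolding total_def jumps_def by (intro sum_nonneg \<phi>_nonneg)
 have i2: "integrable S (%w. exp (- t * total w n))"
  using t tot by (intro P.integrable_const_bound[where B=1]) (auto intro!: AE_I2 mult_nonneg_nonneg)
 have "ennreal (LINT w|S. exp (- t * total w n)) = (\<integral>\<^sup>+w. ennreal (exp (- t * total w n)) \<partial>S)"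
  by (rule nn_integral_eq_integral[symmetric, OF i2]) simp
 also have "... = (\<integral>\<^sup>+x. ennreal (exp (- t * \<phi> x)) \<partial>\<nu>) ^ (2 * N * n)" by (rule nn_integral_exp_total[OF t])
 also have "(\<integral>\<^sup>+x. ennreal (exp (- t * \<phi> x)) \<partial>\<nu>) = ennreal (LINT x|\<nu>. exp (- t * \<phi> x))"
  by (rule nn_integral_eq_integral[OF i1]) simp
 also have "ennreal (LINT x|\<nu>. exp (- t * \<phi> x)) ^ (2 * N * n) = ennreal ((LINT x|\<nu>. exp (- t * \<phi> x)) ^ (2 * N * n))"
  by (rule ennreal_power) (intro LINT_nonneg, simp)
 finally show ?thesis
  by (subst (asm) ennreal_inj) (auto intro!: LINT_nonneg zero_le_power)
qed

end

text \<open>For small p, 1 - p lies between exp (- p / (1 - p)) and exp (- p).\<close>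

lemma power_exp_limit:
 fixes p :: "nat => real"
 assumes np: "(%n. real n * p n) ----> \<theta>" and p: "\<And>n. 0 <= p n"
 shows "(%n. (1 - p n) ^ (m * n)) ----> exp (- real m * \<theta>)"
proof (rule tendsto_sandwich)
 have p0: "p ----> 0"
 proof -
  have "(%n. (real n * p n) * inverse (real n)) ----> \<theta> * 0" by (intro tendsto_mult np lim_inverse_n)
  moreover have "EV n. (real n * p n) * inverse (real n) = p n"
   using eventually_gt_at_top[of 0] by eventually_elim simp
  ultimately show ?thesis by (subst (asm) tendsto_cong) auto
 qed
 then have small: "EV n. p n < 1 / 2" by (rule order_tendstoD) simp
 show "EV n. exp (- real m * (real n * p n) / (1 - p n)) <= (1 - p n) ^ (m * n)"
  using small
 proof eventually_elim
  case (elim n)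
  have "1 + p n / (1 - p n) <= exp (p n / (1 - p n))" by (rule exp_ge_add_one_self)
  moreover have "1 + p n / (1 - p n) = inverse (1 - p n)" using elim by (simp add: field_simps)
  ultimately have "inverse (1 - p n) <= exp (p n / (1 - p n))" by simp
  then have "inverse (exp (p n / (1 - p n))) <= inverse (inverse (1 - p n))"
   using elim by (intro le_imp_inverse_le) auto
  then have "exp (- (p n / (1 - p n))) <= 1 - p n" by (simp add: exp_minus)
  then have "exp (- (p n / (1 - p n))) ^ (m * n) <= (1 - p n) ^ (m * n)" by (intro power_mono) auto
  moreover have "exp (- (p n / (1 - p n))) ^ (m * n) = exp (- real m * (real n * p n) / (1 - p n))"
   by (simp add: exp_of_nat_mult[symmetric])
  ultimately show ?case by simp
 qed
 show "EV n. (1 - p n) ^ (m * n) <= exp (- real m * (real n * p n))"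
  using small
 proof eventually_elim
  case (elim n)
  have "1 - p n <= exp (- p n)" using exp_ge_add_one_self[of "- p n"] by simp
  then have "(1 - p n) ^ (m * n) <= exp (- p n) ^ (m * n)" using elim by (intro power_mono) auto
  also have "... = exp (- real m * (real n * p n))" by (simp add: exp_of_nat_mult[symmetric])
  finally show ?case .
 qed
 have "(%n. exp (- real m * (real n * p n) / (1 - p n))) ----> exp (- real m * \<theta> / (1 - 0))"
  by (intro tendsto_intros np p0) auto
 then show "(%n. exp (- real m * (real n * p n) / (1 - p n))) ----> exp (- real m * \<theta>)" by simp
 show "(%n. exp (- real m * (real n * p n))) ----> exp (- real m * \<theta>)" by (intro tendsto_intros np)
qed

section \<open>Norming for an infinite mean\<close>

context heavy_tail
begin

text \<open>The norming of the weak law for \<alpha> = 1: \<open>n\<close> times the mean of a jump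
  truncated at the typical size of the largest of \<open>n\<close> jumps.\<close>

definition s :: "nat => real" where
 "s n = real n * trunc (a (real n))"

lemma a_nat_at_top: "filterlim (%n. a (real n)) at_top sequentially"
 by (rule filterlim_compose[OF a_at_top filterlim_real_sequentially])

lemma trunc_pos: "0 < A ==> 0 < trunc A"
proof -
 assume A: "0 < A"
 have "0 < A / 2 * G (2 * (A / 2))" using A G_pos by simp
 also have "... <= trunc (2 * (A / 2))" using trunc_step[of "A / 2"] trunc_nonneg[of "A / 2"] A by linarith
 finally show ?thesis by simp
qed

lemma trunc_at_top:
 assumes inf: "(\<integral>\<^sup>+x. ennreal (max 0 x) \<partial>\<nu>) = \<infinity>"
 shows "filterlim trunc at_top at_top"
proof -
 have lim: "(%n. \<integral>\<^sup>+x. ennreal (max 0 (min x (real n))) \<partial>\<nu>) ----> (\<integral>\<^sup>+x. ennreal (max 0 x) \<partial>\<nu>)"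
 proof (rule nn_integral_LIMSEQ)
  show "incseq (%n x. ennreal (max 0 (min x (real n))))"
   by (auto simp: incseq_def le_fun_def intro!: ennreal_leI)
  show "(%n. ennreal (max 0 (min x (real n)))) ----> ennreal (max 0 x)" for x
  proof (rule tendsto_eventually)
   obtain k :: nat where k: "x <= real k" using real_arch_simple by blast
   show "EV n. ennreal (max 0 (min x (real n))) = ennreal (max 0 x)"
    using eventually_ge_at_top[of k] by eventually_elim (use k in \<open>simp add: min_def\<close>)
  qed
 qed measurable
 have eq: "(\<integral>\<^sup>+x. ennreal (max 0 (min x (real n))) \<partial>\<nu>) = ennreal (trunc (real n))" for n
  unfolding trunc_def by (rule nn_integral_eq_integral[OF trunc_integrable]) simp
 have "\<exists>n. Z < trunc (real n)" for Z
 proof -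
  have "EV n. ennreal Z < ennreal (trunc (real n))"
   using lim unfolding inf eq by (rule order_tendstoD) simp
  then obtain n where "ennreal Z < ennreal (trunc (real n))" by (auto simp: eventually_sequentially)
  then have "Z < trunc (real n)" by (metis ennreal_leI not_le)
  then show ?thesis ..
 qed
 then show ?thesis unfolding filterlim_at_top
  by (metis (no_types, lifting) eventually_at_top_linorder less_imp_le order_trans trunc_mono)
qed

lemma s_at_top:
 assumes inf: "(\<integral>\<^sup>+x. ennreal (max 0 x) \<partial>\<nu>) = \<infinity>"
 shows "filterlim s at_top sequentially"
 unfolding s_def[abs_def]
 by (rule filterlim_at_top_mult_at_top[OF filterlim_real_sequentially
   filterlim_compose[OF trunc_at_top[OF inf] a_nat_at_top]])

end

lemma nn_integral_exp_density:
 assumes "t > 0"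
 shows "(\<integral>\<^sup>+y. ennreal (t * exp (- t * y)) * indicator {0<..} y * indicator {..<x} y \<partial>lborel) = ennreal (1 - exp (- t * max 0 x))"
proof (cases "x > 0")
 case True
 have "(\<integral>\<^sup>+y. ennreal (t * exp (- t * y)) * indicator {0<..} y * indicator {..<x} y \<partial>lborel)
  = (\<integral>\<^sup>+y. ennreal (t * exp (- t * y)) * indicator {0..x} y \<partial>lborel)"
 proof (rule nn_integral_cong_AE)
  have "AE y in lborel. y \<noteq> 0 \<and> y \<noteq> x" by (intro AE_conjI AE_lborel_singleton)
  then show "AE y in lborel. ennreal (t * exp (- t * y)) * indicator {0<..} y * indicator {..<x} y = ennreal (t * exp (- t * y)) * indicator {0..x} y"
   by eventually_elim (auto simp: indicator_def)
 qed
 also have "... = ennreal (- exp (- t * x) - - exp (- t * 0))"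
  using True assms by (intro nn_integral_FTC_Icc) (auto intro!: derivative_eq_intros)
 finally show ?thesis using True by simp
next
 case False
 then have "ennreal (t * exp (- t * y)) * indicator {0<..} y * indicator {..<x} y = 0" for y
  by (auto simp: indicator_def)
 then have "(\<integral>\<^sup>+y. ennreal (t * exp (- t * y)) * indicator {0<..} y * indicator {..<x} y \<partial>lborel) = (\<integral>\<^sup>+y. 0 \<partial>(lborel :: real measure))"
  by (intro nn_integral_cong)
 moreover have "max 0 x = 0" using False by simp
 ultimately show ?thesis by simp
qed

lemma (in real_distribution) emeasure_Ioi: "emeasure M {y<..} = ennreal (1 - cdf M y)"
proof -
 have "{y<..} = space M - {..y}" by auto
 then show ?thesis
  unfolding cdf_def using prob_compl[of "{..y}"] by (simp only: emeasure_eq_measure space_eq_univ) simp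
qed

lemma (in real_distribution) nn_integral_laplace:
 assumes "t > 0"
 shows "(\<integral>\<^sup>+x. ennreal (1 - exp (- t * max 0 x)) \<partial>M) = (\<integral>\<^sup>+y. ennreal (t * exp (- t * y) * (1 - cdf M y)) * indicator {0<..} y \<partial>lborel)"
proof -
 have "(\<integral>\<^sup>+x. ennreal (1 - exp (- t * max 0 x)) \<partial>M)
  = (\<integral>\<^sup>+x. (\<integral>\<^sup>+y. (ennreal (t * exp (- t * y)) * indicator {0<..} y) * indicator {..<x} y \<partial>lborel) \<partial>M)"
  unfolding nn_integral_exp_density[OF assms] ..
 also have "... = (\<integral>\<^sup>+y. (ennreal (t * exp (- t * y)) * indicator {0<..} y) * emeasure M {y<..} \<partial>lborel)"
  by (rule layer_cake[OF _ events_eq_borel]) (unfold_locales, measurable)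
 also have "... = (\<integral>\<^sup>+y. ennreal (t * exp (- t * y) * (1 - cdf M y)) * indicator {0<..} y \<partial>lborel)"
  using assms cdf_bounded_prob by (intro nn_integral_cong) (auto simp: emeasure_Ioi indicator_def ennreal_mult[symmetric])
 finally show ?thesis .
qed

section \<open>Laplace transform of a single jump near 0\<close>

context heavy_tail
begin

definition lap_exp :: "real => real" where
 "lap_exp t = (LINT x|\<nu>. 1 - exp (- t * max 0 x))"

lemma lap_exp_integrable: "t >= 0 ==> integrable \<nu> (%x. 1 - exp (- t * max 0 x))"
 by (rule integrable_const_bound[where B=1]) auto

lemma lap_exp_nonneg: "t >= 0 ==> 0 <= lap_exp t"
 unfolding lap_exp_def by (intro LINT_nonneg) simp

text \<open>\<open>trunc (c * A)\<close> exceeds \<open>trunc A\<close> by at most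
  \<open>(c - 1) * A * G A\<close>, which is negligible by \<open>trunc_dominates\<close>.\<close>

lemma trunc_slowly_varying:
 assumes \<alpha>1: "\<alpha> = 1" and c: "c >= 1"
 shows "((%A. trunc (c * A) / trunc A) ---> 1) at_top"
proof -
 have pos: "\<forall>\<^sub>F A in at_top. 0 < trunc A \<and> A > 0" using eventually_gt_at_top[of 0] by eventually_elim (simp add: trunc_pos)
 have "((%A. 1 + (c - 1) * inverse (trunc A / (A * G A))) ---> 1 + (c - 1) * 0) at_top"
  by (intro tendsto_add tendsto_mult tendsto_const tendsto_inverse_0_at_top trunc_dominates \<alpha>1)
 then have up: "((%A. 1 + (c - 1) * inverse (trunc A / (A * G A))) ---> 1) at_top" by simp
 show ?thesis
 proof (rule tendsto_sandwich[OF _ _ tendsto_const up])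
  show "\<forall>\<^sub>F A in at_top. 1 <= trunc (c * A) / trunc A"
   using pos
  proof eventually_elim
   case (elim A)
   then have "trunc A <= trunc (c * A)" using c by (intro trunc_mono) simp
   then show ?case using elim by (simp add: le_divide_eq)
  qed
  show "\<forall>\<^sub>F A in at_top. trunc (c * A) / trunc A <= 1 + (c - 1) * inverse (trunc A / (A * G A))"
   using pos
  proof eventually_elim
   case (elim A)
   then have A: "0 <= A" "A <= c * A" using c by simp_all
   have "trunc (c * A) <= (LINT x|\<nu>. max 0 (min x A) + ((c - 1) * A) * indicator {A<..} x)"
    unfolding trunc_def using A c
    by (intro integral_mono expectation_add_indicator(1) trunc_integrable) (auto simp: indicator_def algebra_simps)
   also have "... = trunc A + (c - 1) * A * G A" unfolding trunc_def by (rule expectation_add_indicator(2)[OF trunc_integrable])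
   finally have "trunc (c * A) / trunc A <= (trunc A + (c - 1) * A * G A) / trunc A" using elim by (intro divide_right_mono) auto
   also have "... = 1 + (c - 1) * inverse (trunc A / (A * G A))" using elim by (simp add: add_divide_distrib)
   finally show ?case .
  qed
 qed
qed

text \<open>Up to \<open>B\<close> the integrand is at most linear, beyond \<open>B\<close> it is at
  most 1.\<close>

lemma lap_exp_le:
 assumes u: "u >= 0" and B: "B >= 0"
 shows "lap_exp u <= u * trunc B + G B"
proof -
 have "lap_exp u <= (LINT x|\<nu>. u * max 0 (min x B) + 1 * indicator {B<..} x)"
  unfolding lap_exp_def
 proof (intro integral_mono lap_exp_integrable expectation_add_indicator(1) integrable_mult_right trunc_integrable u)
  fix x
  have "1 - exp (- u * max 0 x) <= u * max 0 x" using exp_ge_add_one_self[of "- u * max 0 x"] by simp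
  then show "1 - exp (- u * max 0 x) <= u * max 0 (min x B) + 1 * indicator {B<..} x"
  proof (cases "x <= B")
   case False
   have "0 <= u * max 0 (min x B)" "0 < exp (- u * max 0 x)" using u by auto
   then have "1 - exp (- u * max 0 x) <= u * max 0 (min x B) + 1" by linarith
   then show ?thesis using False by simp
  qed simp
 qed
 also have "... = u * trunc B + G B"
  unfolding expectation_add_indicator(2)[OF integrable_mult_right[OF trunc_integrable]] trunc_def by simp
 finally show ?thesis .
qed

text \<open>Integrates \<open>y * exp (- y) \<le> 1 - exp (- y)\<close> for the truncated jump,
  where y \<le> u A.\<close>

lemma lap_exp_ge:
 assumes u: "u >= 0" and A: "A >= 0"
 shows "u * exp (- u * A) * trunc A <= lap_exp u"
proof -
 have "u * exp (- u * A) * trunc A = (LINT x|\<nu>. u * exp (- u * A) * max 0 (min x A))" by (simp add: trunc_def)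
 also have "... <= lap_exp u"
  unfolding lap_exp_def
 proof (intro integral_mono integrable_mult_right trunc_integrable lap_exp_integrable u)
  fix x
  define y where "y = u * max 0 (min x A)"
  have y: "0 <= y" "y <= u * A" "y <= u * max 0 x" using u A by (auto simp: y_def intro!: mult_left_mono)
  have "exp (- y) * (1 + y) <= exp (- y) * exp y" by (intro mult_left_mono exp_ge_add_one_self) simp
  then have "y * exp (- y) <= 1 - exp (- y)" by (simp add: exp_add[symmetric] algebra_simps)
  moreover have "y * exp (- (u * A)) <= y * exp (- y)" using y by (intro mult_left_mono) auto
  moreover have "exp (- (u * max 0 x)) <= exp (- y)" using y by simp
  ultimately have "y * exp (- (u * A)) <= 1 - exp (- (u * max 0 x))" by linarith
  then show "u * exp (- u * A) * max 0 (min x A) <= 1 - exp (- u * max 0 x)" by (simp add: y_def mult_ac)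
 qed
 finally show ?thesis .
qed

text \<open>Lower bound: truncation at \<open>a n\<close>, where \<open>u n * a n\<close> tends to 0
  because \<open>a n * G (a n)\<close> is negligible against \<open>trunc (a n)\<close>. Upper
  bound: truncation at \<open>K * a n\<close>, which changes \<open>trunc\<close> by a factor
  tending to 1.\<close>

lemma lap_exp_boundary:
 assumes \<alpha>1: "\<alpha> = 1" and u: "\<And>n. u n >= 0" and su: "(%n. s n * u n) ----> t"
 shows "(%n. real n * lap_exp (u n)) ----> t"
proof -
 let ?A = "%n. a (real n)"
 have apos: "EV n. ?A n > 0 \<and> n > 0"
  using a_nat_at_top by (intro eventually_conj eventually_gt_at_top) (simp add: filterlim_at_top_dense)
 have Gn: "(%n. real n * G (?A n)) ----> 1" by (rule filterlim_compose[OF G_a filterlim_real_sequentially])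
 have r0: "(%n. ?A n * G (?A n) / trunc (?A n)) ----> 0"
  using tendsto_inverse_0_at_top[OF filterlim_compose[OF trunc_dominates[OF \<alpha>1] a_nat_at_top]] by simp
 have "(%n. (s n * u n) * exp (- ((s n * u n) * ((?A n * G (?A n) / trunc (?A n)) / (real n * G (?A n)))))) ----> t * exp (- (t * (0 / 1)))"
  by (intro tendsto_mult tendsto_exp tendsto_minus tendsto_divide su r0 Gn) simp
 then have low: "(%n. (s n * u n) * exp (- ((s n * u n) * ((?A n * G (?A n) / trunc (?A n)) / (real n * G (?A n)))))) ----> t" by simp
 have lower: "EV n. (s n * u n) * exp (- ((s n * u n) * ((?A n * G (?A n) / trunc (?A n)) / (real n * G (?A n))))) <= real n * lap_exp (u n)"
  using apos
 proof eventually_elim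
  case (elim n)
  have Tp: "trunc (?A n) > 0" using elim by (intro trunc_pos) simp
  have "real n * (u n * exp (- u n * ?A n) * trunc (?A n)) <= real n * lap_exp (u n)"
   using elim by (intro mult_left_mono lap_exp_ge u) auto
  moreover have eq: "(s n * u n) * ((?A n * G (?A n) / trunc (?A n)) / (real n * G (?A n))) = u n * ?A n"
   using elim Tp G_pos[of "?A n"] by (simp add: s_def)
  ultimately show ?case unfolding eq by (simp add: s_def mult_ac)
 qed
 show ?thesis
 proof (rule order_tendstoI)
  fix y assume "y < t"
  with low have "EV n. y < (s n * u n) * exp (- ((s n * u n) * ((?A n * G (?A n) / trunc (?A n)) / (real n * G (?A n)))))"
   by (rule order_tendstoD)
  with lower show "EV n. y < real n * lap_exp (u n)" by eventually_elim linarith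
 next
  fix y assume y: "t < y"
  \<comment> \<open>\<open>K\<close> is taken so large that jumps beyond \<open>K * a n\<close>
    contribute less than \<open>y - t\<close> in the limit.\<close>
  have "((%K::real. K powr (- \<alpha>)) ---> 0) at_top" using \<alpha> by (intro tendsto_neg_powr filterlim_ident) auto
  then have "\<forall>\<^sub>F K in at_top. K powr (- \<alpha>) < y - t \<and> K >= 1"
   using y by (intro eventually_conj order_tendstoD eventually_ge_at_top) auto
  then obtain K where K: "K powr (- \<alpha>) < y - t" "K >= 1" unfolding eventually_at_top_linorder by blast
  have "(%n. (s n * u n) * (trunc (K * ?A n) / trunc (?A n)) + real n * G (K * ?A n)) ----> t * 1 + K powr (- \<alpha>)"
   using K by (intro tendsto_add tendsto_mult su filterlim_compose[OF trunc_slowly_varying[OF \<alpha>1] a_nat_at_top]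
    filterlim_compose[OF G_scaled_a filterlim_real_sequentially]) auto
  then have "EV n. (s n * u n) * (trunc (K * ?A n) / trunc (?A n)) + real n * G (K * ?A n) < y"
   using K by (intro order_tendstoD) auto
  with apos show "EV n. real n * lap_exp (u n) < y"
  proof eventually_elim
   case (elim n)
   have Tp: "trunc (?A n) > 0" using elim by (intro trunc_pos) simp
   have "real n * lap_exp (u n) <= real n * (u n * trunc (K * ?A n) + G (K * ?A n))"
    using elim K by (intro mult_left_mono lap_exp_le u) auto
   also have "... = (s n * u n) * (trunc (K * ?A n) / trunc (?A n)) + real n * G (K * ?A n)"
    using Tp by (simp add: s_def algebra_simps)
   finally show ?case using elim by linarith
  qed
 qed
qed

text \<open>The Laplace exponent of the one-sided stable law after integration by parts, which is
  the form in which the limit of \<open>lap_exp_eq_integral\<close> appears.\<close>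

definition stable_exp :: "real => real" where
 "stable_exp t = (LINT u|lborel. t * exp (- t * u) * (u powr (- \<alpha>)) * indicator {0<..} u)"

lemma stable_dominator:
 fixes t \<beta> :: real
 assumes t: "t > 0" and \<beta>: "0 < \<beta>" "\<beta> < 1"
 shows "integrable lborel (%u. t * exp (- t * u) * max 1 (u powr (- \<beta>)) * indicator {0<..} u)"
proof (rule L1_bound)
 have "(\<integral>\<^sup>+u. ennreal (u powr (- \<beta>)) * indicator {0..1} u \<partial>lborel) = ennreal (1 powr (- \<beta> + 1) / (- \<beta> + 1))"
  using \<beta> by (intro nn_integral_has_integral_lebesgue' has_integral_powr_from_0) auto
 then have i1: "integrable lborel (%u. u powr (- \<beta>) * indicator {0..1} u)"
  by (intro integrableI_nonneg) (auto simp: ennreal_mult'' ennreal_indicator)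
 have "(\<integral>\<^sup>+u. ennreal (t * exp (- t * u)) * indicator {0..} u \<partial>lborel) = ennreal (0 - - exp (- t * 0))"
 proof (rule nn_integral_FTC_atLeast)
  show "((%a. - exp (- t * a)) ---> 0) at_top" using t by real_asymp
 qed (use t in \<open>auto intro!: derivative_eq_intros\<close>)
 then have i2: "integrable lborel (%u. t * exp (- t * u) * indicator {0..} u)"
  using t by (intro integrableI_nonneg) (auto simp: ennreal_mult'' ennreal_indicator)
 show "integrable lborel (%u. t * (u powr (- \<beta>) * indicator {0..1} u) + t * exp (- t * u) * indicator {0..} u)"
  by (intro L1_add integrable_mult_right i1 i2)
 show "AE u in lborel. norm (t * exp (- t * u) * max 1 (u powr (- \<beta>)) * indicator {0<..} u)
  <= norm (t * (u powr (- \<beta>) * indicator {0..1} u) + t * exp (- t * u) * indicator {0..} u)"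
 proof (rule AE_I2)
  fix u :: real
  show "norm (t * exp (- t * u) * max 1 (u powr (- \<beta>)) * indicator {0<..} u)
   <= norm (t * (u powr (- \<beta>) * indicator {0..1} u) + t * exp (- t * u) * indicator {0..} u)"
  proof (cases "0 < u")
   case True
   have e1: "exp (- t * u) <= 1" using t True by simp
   show ?thesis
   proof (cases "u <= 1")
    case le: True
    have "1 <= u powr (- \<beta>)" using True le \<beta> powr_mono2'[of "- \<beta>" u 1] by simp
    then have "t * exp (- t * u) * max 1 (u powr (- \<beta>)) = t * exp (- t * u) * (u powr (- \<beta>))" by simp
    also have "... <= t * 1 * (u powr (- \<beta>))" using e1 t by (intro mult_right_mono mult_left_mono) auto
    also have "... <= t * (u powr (- \<beta>)) + t * exp (- t * u)" using t by simp
    finally show ?thesis using True le t by (simp add: indicator_def)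
   next
    case gt: False
    have "u powr (- \<beta>) <= 1" using gt \<beta> powr_mono2'[of "- \<beta>" 1 u] by simp
    then show ?thesis using True gt t by (simp add: indicator_def max_def)
   qed
  qed simp
 qed
qed measurable

lemma lap_exp_eq_integral:
 assumes r: "r > 0"
 shows "lap_exp r = (LINT y|lborel. r * exp (- r * y) * G y * indicator {0<..} y)"
proof -
 have "lap_exp r = enn2real (\<integral>\<^sup>+x. ennreal (1 - exp (- r * max 0 x)) \<partial>\<nu>)"
  unfolding lap_exp_def using r by (intro integral_eq_nn_integral) (auto intro!: AE_I2 mult_nonneg_nonneg)
 also have "(\<integral>\<^sup>+x. ennreal (1 - exp (- r * max 0 x)) \<partial>\<nu>) = (\<integral>\<^sup>+y. ennreal (r * exp (- r * y) * G y * indicator {0<..} y) \<partial>lborel)"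
  unfolding nn_integral_laplace[OF r, folded G_eq_cdf] by (intro nn_integral_cong) (simp add: indicator_def)
 also have "enn2real ... = (LINT y|lborel. r * exp (- r * y) * G y * indicator {0<..} y)"
  using r G_nonneg by (intro integral_eq_nn_integral[symmetric]) (auto intro!: AE_I2 simp: indicator_def)
 finally show ?thesis .
qed

text \<open>After the substitution y = a(n) u the integrand converges because n G(u a(n)) tends to
  u^(-\<alpha>). Domination: Potter's bound with exponent \<beta> < 1 for u \<le> 1, monotonicity of
  the tail for u > 1; both from some \<open>n0\<close> on.\<close>

theorem lap_exp_stable:
 assumes \<alpha>1: "\<alpha> < 1" and t: "t > 0"
 shows "(%n. real n * lap_exp (t / a (real n))) ----> stable_exp t"
proof -
 let ?A = "%n. a (real n)"
 let ?f = "%n u. t * exp (- t * u) * (real n * G (?A n * u)) * indicator {0<..} u"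
 define \<beta> where "\<beta> = (1 + \<alpha>) / 2"
 have \<beta>: "\<alpha> < \<beta>" "\<beta> < 1" "0 < \<beta>" using \<alpha>1 \<alpha> by (auto simp: \<beta>_def)
 obtain C x0 where C: "C > 0" "x0 > 0" "\<And>x s. x0 <= x ==> 1 <= s ==> G (x / s) <= C * s powr \<beta> * G x"
  using G_potter_lower[OF \<beta>(1)] by blast
 have big: "EV n. x0 <= ?A n \<and> n > 0"
  using a_nat_at_top by (intro eventually_conj eventually_gt_at_top) (auto simp: filterlim_at_top)
 obtain n0 where n0: "\<And>n. n >= n0 ==> x0 <= ?A n \<and> n > 0" using big by (auto simp: eventually_sequentially)
 let ?D = "%u. max C 1 * (t * exp (- t * u) * max 1 (u powr (- \<beta>)) * indicator {0<..} u)"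
 have dom: "norm (?f n u) <= ?D u" if n: "n >= n0" for n u
 proof (cases "0 < u")
  case True
  have A: "x0 <= ?A n" "n > 0" "?A n > 0" using n0[OF n] C by auto
  have nG: "real n * G (?A n) <= 1" using G_a_le[of "real n"] A by (simp add: field_simps)
  have "real n * G (?A n * u) <= max C 1 * max 1 (u powr (- \<beta>))"
  proof (cases "u <= 1")
   case le: True
   have "G (?A n * u) <= C * (1 / u) powr \<beta> * G (?A n)" using C(3)[OF A(1), of "1 / u"] True le by simp
   then have "real n * G (?A n * u) <= real n * (C * (1 / u) powr \<beta> * G (?A n))" by (intro mult_left_mono) auto
   also have "... = C * (1 / u) powr \<beta> * (real n * G (?A n))" by simp
   also have "... <= C * (1 / u) powr \<beta> * 1" using nG C by (intro mult_left_mono) auto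
   also have "... = C * u powr (- \<beta>)" using True by (simp add: powr_divide powr_minus_divide)
   also have "... <= max C 1 * max 1 (u powr (- \<beta>))" using C by (intro mult_mono) auto
   finally show ?thesis .
  next
   case False
   have "?A n <= ?A n * u" using mult_left_mono[of 1 u "?A n"] False A by simp
   then have "real n * G (?A n * u) <= real n * G (?A n)" by (intro mult_left_mono G_antimono) auto
   also have "... <= 1 * 1" using nG by simp
   also have "... <= max C 1 * max 1 (u powr (- \<beta>))" by (intro mult_mono) auto
   finally show ?thesis .
  qed
  then have "t * exp (- t * u) * (real n * G (?A n * u)) <= t * exp (- t * u) * (max C 1 * max 1 (u powr (- \<beta>)))"
   using t by (intro mult_left_mono) auto
  then show ?thesis using True t G_nonneg by (simp add: abs_mult mult_ac)
 qed simp
 have iD: "integrable lborel ?D" by (intro integrable_mult_right stable_dominator t \<beta>)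
 have lim: "(%n. \<integral>u. ?f (n + n0) u \<partial>lborel) ----> stable_exp t"
  unfolding stable_exp_def
 proof (rule integral_dominated_convergence[OF _ _ iD])
  show "AE u in lborel. (%n. ?f (n + n0) u) ----> t * exp (- t * u) * (u powr (- \<alpha>)) * indicator {0<..} u"
  proof (rule AE_I2, cases)
   fix u :: real assume u: "0 < u"
   have "(%n. real n * G (u * ?A n)) ----> u powr (- \<alpha>)"
    by (rule filterlim_compose[OF G_scaled_a[OF u] filterlim_real_sequentially])
   then have "(%n. ?f n u) ----> t * exp (- t * u) * (u powr (- \<alpha>)) * indicator {0<..} u"
    by (intro tendsto_intros) (simp add: mult.commute)
   then show "(%n. ?f (n + n0) u) ----> t * exp (- t * u) * (u powr (- \<alpha>)) * indicator {0<..} u"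
    by (rule LIMSEQ_ignore_initial_segment)
  qed simp
  show "AE u in lborel. norm (?f (n + n0) u) <= ?D u" for n by (intro AE_I2 dom) simp
 qed measurable
 have eq: "real n * lap_exp (t / ?A n) = (LINT u|lborel. ?f n u)" if n: "n >= n0" for n
 proof -
  have A: "?A n > 0" using n0[OF n] C by linarith
  define r where "r = t / ?A n"
  have r: "r > 0" "t = r * ?A n" using t A by (simp_all add: r_def)
  have "lap_exp r = ?A n * (LINT u|lborel. r * exp (- r * (?A n * u)) * G (?A n * u) * indicator {0<..} (?A n * u))"
   unfolding lap_exp_eq_integral[OF r(1)] using A by (subst lborel_integral_real_affine[where c="?A n" and t=0]) auto
  then have "real n * lap_exp r = (LINT u|lborel. real n * (?A n * (r * exp (- r * (?A n * u)) * G (?A n * u) * indicator {0<..} (?A n * u))))"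
   by simp
  also have "... = (LINT u|lborel. ?f n u)"
   using A by (intro LINT_cong refl) (simp add: r(2) indicator_def zero_less_mult_iff mult_ac)
  finally show ?thesis unfolding r_def .
 qed
 have "(%n. real (n + n0) * lap_exp (t / ?A (n + n0))) ----> stable_exp t"
  using lim by (simp only: eq le_add2)
 then show ?thesis by (rule LIMSEQ_offset)
qed

end

section \<open>Laplace transforms and the Prokhorov metric\<close>

lemma prokhorov_dist_nonneg: 
 assumes "prob_space \<mu>" "prob_space \<nu>"
 shows "0 <= prokhorov_dist \<mu> \<nu>"
 unfolding prokhorov_dist_def
proof (rule cInf_greatest)
 interpret \<mu>: prob_space \<mu> by fact
 interpret \<nu>: prob_space \<nu> by fact
 have "measure \<mu> A <= measure \<nu> B + 1" "measure \<nu> A <= measure \<mu> B + 1" for A B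
  using \<mu>.prob_le_1[of A] \<nu>.prob_le_1[of A] by (simp_all add: add_increasing)
 then show "{\<epsilon>. \<epsilon> > 0 \<and> (\<forall>A\<in>sets borel. measure \<mu> A <= measure \<nu> (\<Union>a\<in>A. ball a \<epsilon>) + \<epsilon> \<and>
    measure \<nu> A <= measure \<mu> (\<Union>a\<in>A. ball a \<epsilon>) + \<epsilon>)} \<noteq> {}"
  by (intro ex_in_conv[THEN iffD1] exI[of _ 1]) simp
qed simp

lemma prokhorov_dist_leI:
 assumes "\<epsilon> > 0" and "\<And>A. A \<in> sets borel ==> measure \<mu> A <= measure \<nu> (\<Union>a\<in>A. ball a \<epsilon>) + \<epsilon>"
  and "\<And>A. A \<in> sets borel ==> measure \<nu> A <= measure \<mu> (\<Union>a\<in>A. ball a \<epsilon>) + \<epsilon>"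
 shows "prokhorov_dist \<mu> \<nu> <= \<epsilon>"
 unfolding prokhorov_dist_def
 by (rule cInf_lower) (use assms in \<open>auto intro!: bdd_belowI[of _ 0]\<close>)

text \<open>The Ky Fan bound: a coupling that is close in probability bounds the distance of the
  laws.\<close>

lemma (in prob_space) prokhorov_dist_distr_le:
 assumes Y: "random_variable borel Y" and W: "random_variable borel W" and \<epsilon>: "\<epsilon> > 0"
  and close: "prob {w\<in>space M. \<epsilon> <= \<bar>Y w - W w\<bar>} <= \<epsilon>"
 shows "prokhorov_dist (distr M borel Y) (distr M borel W) <= \<epsilon>"
proof -
 have *: "measure (distr M borel Y) A <= measure (distr M borel W) (\<Union>a\<in>A. ball a \<epsilon>) + \<epsilon>"
  if A: "A \<in> sets borel" and Y [measurable]: "random_variable borel Y" and W [measurable]: "random_variable borel W"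
   and close: "prob {w\<in>space M. \<epsilon> <= \<bar>Y w - W w\<bar>} <= \<epsilon>" for A Y W
 proof -
  note [measurable] = A
  have o: "(\<Union>a\<in>A. ball a \<epsilon>) \<in> sets borel" by (intro borel_open open_UN) simp
  note [measurable] = o
  have "measure (distr M borel Y) A = prob (Y -` A \<inter> space M)" by (rule measure_distr) measurable
  also have "... <= prob ((W -` (\<Union>a\<in>A. ball a \<epsilon>) \<inter> space M) \<union> {w\<in>space M. \<epsilon> <= \<bar>Y w - W w\<bar>})"
  proof (rule finite_measure_mono)
   show "Y -` A \<inter> space M \<subseteq> (W -` (\<Union>a\<in>A. ball a \<epsilon>) \<inter> space M) \<union> {w\<in>space M. \<epsilon> <= \<bar>Y w - W w\<bar>}"
    by (auto simp: dist_real_def not_less)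
  qed measurable
  also have "... <= prob (W -` (\<Union>a\<in>A. ball a \<epsilon>) \<inter> space M) + prob {w\<in>space M. \<epsilon> <= \<bar>Y w - W w\<bar>}"
   by (rule measure_Un_le) measurable
  also have "prob (W -` (\<Union>a\<in>A. ball a \<epsilon>) \<inter> space M) = measure (distr M borel W) (\<Union>a\<in>A. ball a \<epsilon>)"
   by (rule measure_distr[symmetric]) measurable
  finally show ?thesis using close by linarith
 qed
 show ?thesis
  using *[OF _ Y W close] *[OF _ W Y] close by (intro prokhorov_dist_leI \<epsilon>) (auto simp: abs_minus_commute)
qed

lemma Skorohod_coupling:
 assumes "\<And>n. real_distribution (\<mu> n)" "real_distribution \<nu>" "weak_conv_m \<mu> \<nu>"
 obtains \<Omega> :: "real measure" and Y W
 where "prob_space \<Omega>" "\<And>n. Y n \<in> borel_measurable \<Omega>" "W \<in> borel_measurable \<Omega>"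
  "\<And>n. \<mu> n = distr \<Omega> borel (Y n)" "\<nu> = distr \<Omega> borel W" "\<And>x. x \<in> space \<Omega> ==> (%n. Y n x) ----> W x"
proof -
 from Skorohod[OF assms] obtain \<Omega> :: "real measure" and Y W where *: "prob_space \<Omega> \<and> (\<forall>n. Y n \<in> measurable \<Omega> borel) \<and>
  (\<forall>n. distr \<Omega> borel (Y n) = \<mu> n) \<and> W \<in> measurable \<Omega> lborel \<and> distr \<Omega> borel W = \<nu> \<and>
  (\<forall>x\<in>space \<Omega>. (%n. Y n x) ----> W x)" by blast
 then have "W \<in> borel_measurable \<Omega>" by simp
 with * show ?thesis by (intro that[of \<Omega> Y W]) simp_all
qed

text \<open>Skorohod's coupling turns weak convergence into pointwise convergence, hence into
  convergence in probability.\<close>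

lemma prokhorov_dist_tendsto_if_weak_conv:
 assumes \<mu>: "\<And>n. real_distribution (\<mu> n)" and \<nu>: "real_distribution \<nu>" and conv: "weak_conv_m \<mu> \<nu>"
 shows "(%n. prokhorov_dist (\<mu> n) \<nu>) ----> 0"
proof -
 obtain \<Omega> :: "real measure" and Y W where \<Omega>: "prob_space \<Omega>"
  and Y [measurable]: "\<And>n. Y n \<in> borel_measurable \<Omega>" and W [measurable]: "W \<in> borel_measurable \<Omega>"
  and law: "\<And>n. \<mu> n = distr \<Omega> borel (Y n)" "\<nu> = distr \<Omega> borel W"
  and lim: "\<And>x. x \<in> space \<Omega> ==> (%n. Y n x) ----> W x"
  by (rule Skorohod_coupling[OF \<mu> \<nu> conv]) blast
 interpret \<Omega>: prob_space \<Omega> by fact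
 have p0: "(%n. \<Omega>.prob {w\<in>space \<Omega>. e <= \<bar>Y n w - W w\<bar>}) ----> 0" if e: "e > 0" for e
 proof -
  have "(%n. \<integral>w. indicator {w\<in>space \<Omega>. e <= \<bar>Y n w - W w\<bar>} w \<partial>\<Omega>) ----> (\<integral>w. 0 \<partial>\<Omega> :: real)"
  proof (rule integral_dominated_convergence[where w="%_. 1"])
   show "AE w in \<Omega>. (%n. indicator {w\<in>space \<Omega>. e <= \<bar>Y n w - W w\<bar>} w :: real) ----> 0"
   proof (rule AE_I2)
    fix w assume w: "w \<in> space \<Omega>"
    have "EV n. dist (Y n w) (W w) < e" by (rule tendstoD[OF lim[OF w] e])
    then have "EV n. (indicator {w\<in>space \<Omega>. e <= \<bar>Y n w - W w\<bar>} w :: real) = 0"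
     by eventually_elim (simp add: dist_real_def)
    then show "(%n. indicator {w\<in>space \<Omega>. e <= \<bar>Y n w - W w\<bar>} w :: real) ----> 0" by (rule tendsto_eventually)
   qed
  qed (simp_all add: indicator_def)
  then show ?thesis by simp
 qed
 show ?thesis
 proof (rule order_tendstoI)
  fix e :: real assume "e < 0"
  then show "EV n. e < prokhorov_dist (\<mu> n) \<nu>"
   using prokhorov_dist_nonneg[of "\<mu> _" \<nu>] \<mu> \<nu> by (intro always_eventually allI) (auto simp: real_distribution_def intro: less_le_trans)
 next
  fix e :: real assume e: "0 < e"
  have "EV n. \<Omega>.prob {w\<in>space \<Omega>. e / 2 <= \<bar>Y n w - W w\<bar>} < e / 2"
   using e by (intro order_tendstoD(2)[OF p0]) auto
  then show "EV n. prokhorov_dist (\<mu> n) \<nu> < e"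
  proof eventually_elim
   case (elim n)
   have "prokhorov_dist (distr \<Omega> borel (Y n)) (distr \<Omega> borel W) <= e / 2"
    using e elim by (intro \<Omega>.prokhorov_dist_distr_le) auto
   then show ?case using e unfolding law by simp
  qed
 qed
qed

text \<open>A test function of \<open>x >= 0\<close> that vanishes far out is a continuous function of \<open>exp (- x)\<close>, so that by
 Weierstrass the Laplace transforms at the natural numbers determine convergence.\<close>

lemma weak_conv_if_laplace:
 assumes \<mu>: "\<And>n. real_distribution (\<mu> n)" and \<nu>: "real_distribution \<nu>"
  and nonneg: "\<And>n. AE x in \<mu> n. 0 <= x" "AE x in \<nu>. 0 <= x"
  and lap: "\<And>k::nat. (%n. \<integral>x. exp (- real k * x) \<partial>\<mu> n) ----> (LINT x|\<nu>. exp (- real k * x))"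
 shows "weak_conv_m \<mu> \<nu>"
proof (rule integral_cts_step_conv_imp_weak_conv[OF \<mu> \<nu>])
 interpret \<mu>: real_distribution "\<mu> n" for n by (rule \<mu>)
 interpret \<nu>: real_distribution \<nu> by (rule \<nu>)
 fix x y :: real assume xy: "x < y"
 \<comment> \<open>The maximum keeps the logarithm away from 0, and it changes nothing because the
   step function vanishes beyond \<open>y\<close>.\<close>
 define g where "g z = cts_step x y (- ln (max z (exp (- y))))" for z
 have cts: "continuous_on UNIV (cts_step x y)"
  using cts_step_uniformly_continuous[OF xy] by (rule uniformly_continuous_imp_continuous)
 have g: "continuous_on {0..1} g"
  unfolding g_def by (intro continuous_on_compose2[OF cts] continuous_intros) (auto simp: max_def split: if_splits)
 have geq: "cts_step x y t = g (exp (- t))" for t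
  by (cases "t <= y") (use xy in \<open>auto simp: g_def max_def cts_step_def\<close>)
 have approx: "\<exists>(c :: nat => real) m. \<forall>z\<in>{0..1}. \<bar>g z - (\<Sum>i\<le>m. c i * z ^ i)\<bar> < e" if e: "e > 0" for e
 proof -
  obtain p where p: "real_polynomial_function p" "\<And>z. z \<in> {0..1} ==> \<bar>g z - p z\<bar> < e"
   using Stone_Weierstrass_real_polynomial_function[OF compact_Icc g e] by blast
  then show ?thesis unfolding real_polynomial_function_iff_sum by blast
 qed
 show "(%n. integral\<^sup>L (\<mu> n) (cts_step x y)) ----> integral\<^sup>L \<nu> (cts_step x y)"
 proof (rule LIMSEQ_I)
  fix e :: real assume e: "0 < e"
  obtain c :: "nat => real" and m where c: "\<And>z. z \<in> {0..1} ==> \<bar>g z - (\<Sum>i\<le>m. c i * z ^ i)\<bar> < e / 3"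
  proof -
   have "e / 3 > 0" using e by simp
   from approx[OF this] show ?thesis using that by blast
  qed
  define P where "P t = (\<Sum>i\<le>m. c i * exp (- real i * t))" for t
  have ex: "exp (- t) ^ i = exp (- real i * t)" for t i by (simp add: exp_of_nat_mult[symmetric])
  have close: "\<bar>integral\<^sup>L \<kappa> (cts_step x y) - (\<Sum>i\<le>m. c i * (LINT t|\<kappa>. exp (- real i * t)))\<bar> <= e / 3"
   if \<kappa>: "real_distribution \<kappa>" "AE t in \<kappa>. 0 <= t" for \<kappa>
  proof -
   interpret \<kappa>: real_distribution \<kappa> by fact
   have i: "integrable \<kappa> (%t. exp (- real i * t))" for i
    using \<kappa>(2) by (intro \<kappa>.integrable_const_bound[where B=1]) (auto elim!: eventually_mono)
   have iP: "integrable \<kappa> P" unfolding P_def by (intro L1_sum integrable_mult_right i)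
   have EP: "(LINT t|\<kappa>. P t) = (\<Sum>i\<le>m. c i * (LINT t|\<kappa>. exp (- real i * t)))"
    unfolding P_def by (subst LINT_sum) (intro integrable_mult_right i, simp)
   have ic: "integrable \<kappa> (cts_step x y)" by (rule \<kappa>.integrable_cts_step[OF xy])
   have "integral\<^sup>L \<kappa> (cts_step x y) - (LINT t|\<kappa>. P t) = (LINT t|\<kappa>. cts_step x y t - P t)"
    by (rule LINT_diff[OF ic iP, symmetric])
   also have "\<bar>...\<bar> <= (LINT t|\<kappa>. \<bar>cts_step x y t - P t\<bar>)" by (rule integral_abs_bound)
   also have "... <= (LINT t|\<kappa>. e / 3)"
   proof (rule integral_mono_AE)
    show "AE t in \<kappa>. \<bar>cts_step x y t - P t\<bar> <= e / 3"
     using \<kappa>(2)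
    proof eventually_elim
     case (elim t)
     then have "\<bar>g (exp (- t)) - (\<Sum>i\<le>m. c i * exp (- t) ^ i)\<bar> < e / 3" by (intro c) auto
     then show ?case unfolding geq P_def ex by simp
    qed
   qed (auto intro!: integrable_abs L1_diff ic iP)
   also have "... = e / 3" using \<kappa>.prob_space by simp
   finally show ?thesis unfolding EP .
  qed
  have "(%n. \<Sum>i\<le>m. c i * (LINT t|(\<mu> n). exp (- real i * t))) ----> (\<Sum>i\<le>m. c i * (LINT t|\<nu>. exp (- real i * t)))"
   by (intro tendsto_sum tendsto_mult tendsto_const lap)
  then obtain n0 where n0: "\<And>n. n >= n0 ==> \<bar>(\<Sum>i\<le>m. c i * (LINT t|(\<mu> n). exp (- real i * t))) - (\<Sum>i\<le>m. c i * (LINT t|\<nu>. exp (- real i * t)))\<bar> < e / 3"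
  proof -
   assume lim: "(%n. \<Sum>i\<le>m. c i * (LINT t|(\<mu> n). exp (- real i * t))) ----> (\<Sum>i\<le>m. c i * (LINT t|\<nu>. exp (- real i * t)))"
   have "0 < e / 3" using e by simp
   from LIMSEQ_D[OF lim this] obtain n0 where n0: "\<forall>n\<ge>n0. norm ((\<Sum>i\<le>m. c i * (LINT t|(\<mu> n). exp (- real i * t))) - (\<Sum>i\<le>m. c i * (LINT t|\<nu>. exp (- real i * t)))) < e / 3" by (rule exE)
   show ?thesis by (rule that) (rule n0[unfolded real_norm_def, rule_format])
  qed
  show "\<exists>n0. \<forall>n\<ge>n0. norm (integral\<^sup>L (\<mu> n) (cts_step x y) - integral\<^sup>L \<nu> (cts_step x y)) < e"
  proof (intro exI allI impI)
   fix n assume "n >= n0"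
   from n0[OF this] close[OF \<mu> nonneg(1), of n] close[OF \<nu> nonneg(2)]
   show "norm (integral\<^sup>L (\<mu> n) (cts_step x y) - integral\<^sup>L \<nu> (cts_step x y)) < e"
    unfolding real_norm_def by linarith
  qed
 qed
qed

theorem prokhorov_dist_tendsto_if_laplace:
 fixes Y :: "nat => 'a => real" and W :: "'b => real"
 assumes M: "prob_space M" and Q: "prob_space Q"
  and Y: "\<And>n. Y n \<in> borel_measurable M" and W: "W \<in> borel_measurable Q"
  and nonneg: "\<And>n. AE w in M. 0 <= Y n w" "AE w in Q. 0 <= W w"
  and lap: "\<And>k::nat. (%n. \<integral>w. exp (- real k * Y n w) \<partial>M) ----> (LINT w|Q. exp (- real k * W w))"
 shows "(%n. prokhorov_dist (distr M borel (Y n)) (distr Q borel W)) ----> 0"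
proof (rule prokhorov_dist_tendsto_if_weak_conv)
 show \<mu>: "real_distribution (distr M borel (Y n))" for n using prob_space.real_distribution_distr[OF M Y] .
 show \<nu>: "real_distribution (distr Q borel W)" using prob_space.real_distribution_distr[OF Q W] .
 show "weak_conv_m (%n. distr M borel (Y n)) (distr Q borel W)"
 proof (rule weak_conv_if_laplace[OF \<mu> \<nu>])
  show "AE x in distr M borel (Y n). 0 <= x" for n using nonneg(1)[of n] by (subst AE_distr_iff) (auto simp: Y)
  show "AE x in distr Q borel W. 0 <= x" using nonneg(2) by (subst AE_distr_iff) (auto simp: W)
  show "(%n. \<integral>x. exp (- real k * x) \<partial>distr M borel (Y n)) ----> (LINT x|(distr Q borel W). exp (- real k * x))" for k
   using lap[of k] by (simp add: integral_distr Y W)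
 qed
qed

text \<open>The stable variable is known only through its Laplace transform. Mass on (-\<infinity>,
  -1/j] would make the transform grow exponentially. The strict lower bound in \<open>lap\<close>
  guarantees integrability, as the integral of a non-integrable function is 0.\<close>

lemma (in prob_space) AE_nonneg_if_laplace:
 assumes W [measurable]: "random_variable borel W" and lap: "\<And>k::nat. 0 < expectation (%w. exp (- real k * W w))"
  "\<And>k::nat. expectation (%w. exp (- real k * W w)) <= 1"
 shows "AE w in M. 0 <= W w"
proof -
 have "AE w in M. - 1 / real (Suc j) < W w" for j
 proof -
  let ?A = "{w\<in>space M. W w <= - 1 / real (Suc j)}"
  have "prob ?A <= exp (- (1 / real (Suc j))) ^ k" for k
  proof -
   have int: "integrable M (%w. exp (- real k * W w))" using lap(1)[of k] not_integrable_integral_eq by fastforce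
   have "exp (real k / real (Suc j)) * prob ?A = (LINT w|M. exp (real k / real (Suc j)) * indicator ?A w)" by simp
   also have "... <= expectation (%w. exp (- real k * W w))"
   proof (rule integral_mono[OF _ int])
    fix w
    show "exp (real k / real (Suc j)) * indicator ?A w <= exp (- real k * W w)"
    proof (cases "w \<in> ?A")
     case True
     then have "real k * W w <= real k * (- 1 / real (Suc j))" by (intro mult_left_mono) auto
     then show ?thesis using True by simp
    qed simp
   qed (intro integrable_mult_right integrable_real_indicator, measurable, simp add: emeasure_eq_measure)
   finally have "exp (real k / real (Suc j)) * prob ?A <= 1" using lap(2)[of k] by linarith
   then have "prob ?A <= inverse (exp (real k / real (Suc j)))" by (simp add: field_simps)
   also have "... = exp (- (1 / real (Suc j))) ^ k" by (simp add: exp_minus[symmetric] exp_of_nat_mult[symmetric])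
   finally show ?thesis .
  qed
  moreover have "(%k. exp (- (1 / real (Suc j))) ^ k) ----> 0" by (rule LIMSEQ_realpow_zero) auto
  ultimately have "prob ?A <= 0" by (intro LIMSEQ_le_const) auto
  then have "prob ?A = 0" by (simp add: measure_le_0_iff)
  then have "AE w in M. w \<notin> ?A" by (subst (asm) prob_eq_0) simp_all
  then show ?thesis using AE_space by eventually_elim auto
 qed
 then have "AE w in M. \<forall>j. - 1 / real (Suc j) < W w" by (simp add: AE_all_countable)
 then show ?thesis
 proof eventually_elim
  case (elim w)
  show ?case
  proof (rule ccontr)
   assume "\<not> 0 <= W w"
   then obtain j where "inverse (real (Suc j)) < - W w" using reals_Archimedean[of "- W w"] by auto
   with elim[rule_format, of j] show False by (simp add: inverse_eq_divide)
  qed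
 qed
qed

text \<open>The triangle inequality in the only case that occurs, a displaced point mass. For fixed
  \<open>N\<close> the limit in the boundary case is a point mass near 1 but not at 1.\<close>

lemma prokhorov_dist_return_le:
 assumes \<mu>: "prob_space \<mu>" "sets \<mu> = sets borel"
 shows "prokhorov_dist \<mu> (return borel x) <= prokhorov_dist \<mu> (return borel y) + \<bar>x - y\<bar>"
proof -
 interpret \<mu>: prob_space \<mu> by fact
 have sub: "(\<Union>a\<in>A. ball a e) \<subseteq> (\<Union>a\<in>A. ball a (e + \<bar>x - y\<bar>))" for A :: "real set" and e
  by (auto simp: subset_ball)
 have o: "(\<Union>a\<in>A. ball a e) \<in> sets borel" for A :: "real set" and e by (intro borel_open open_UN) simp
 have le: "prokhorov_dist \<mu> (return borel x) <= e + \<bar>x - y\<bar>"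
  if e: "e > 0" and 1: "\<And>A. A \<in> sets borel ==> measure \<mu> A <= measure (return borel y) (\<Union>a\<in>A. ball a e) + e"
   and 2: "\<And>A. A \<in> sets borel ==> measure (return borel y) A <= measure \<mu> (\<Union>a\<in>A. ball a e) + e" for e
 proof (rule prokhorov_dist_leI)
  show "0 < e + \<bar>x - y\<bar>" using e by simp
  fix A :: "real set" assume A: "A \<in> sets borel"
  have "y \<in> (\<Union>a\<in>A. ball a e) ==> x \<in> (\<Union>a\<in>A. ball a (e + \<bar>x - y\<bar>))"
   by (fastforce simp: dist_real_def)
  then have "measure (return borel y) (\<Union>a\<in>A. ball a e) <= measure (return borel x) (\<Union>a\<in>A. ball a (e + \<bar>x - y\<bar>))"
   by (simp add: measure_return o indicator_def)
  then show "measure \<mu> A <= measure (return borel x) (\<Union>a\<in>A. ball a (e + \<bar>x - y\<bar>)) + (e + \<bar>x - y\<bar>)"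
   using 1[OF A] by linarith
  show "measure (return borel x) A <= measure \<mu> (\<Union>a\<in>A. ball a (e + \<bar>x - y\<bar>)) + (e + \<bar>x - y\<bar>)"
  proof (cases "x \<in> A")
   case True
   \<comment> \<open>Testing with the singleton \<open>{y}\<close> suffices, since the ball around
     \<open>y\<close> lies in the enlarged ball around \<open>x\<close>.\<close>
   have "1 <= measure \<mu> (ball y e) + e" using 2[of "{y}"] by (simp add: measure_return)
   also have "measure \<mu> (ball y e) <= measure \<mu> (\<Union>a\<in>A. ball a (e + \<bar>x - y\<bar>))"
   proof (rule \<mu>.finite_measure_mono)
    show "ball y e \<subseteq> (\<Union>a\<in>A. ball a (e + \<bar>x - y\<bar>))"
     using True by (auto simp: dist_real_def intro!: bexI[of _ x])
   qed (simp add: \<mu>(2) o)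
   finally show ?thesis using True A by (simp add: measure_return)
  qed (use A e in \<open>simp add: measure_return add_nonneg_nonneg\<close>)
 qed
 have "prokhorov_dist \<mu> (return borel x) - \<bar>x - y\<bar> <= prokhorov_dist \<mu> (return borel y)"
  unfolding prokhorov_dist_def[of \<mu> "return borel y"]
 proof (rule cInf_greatest)
  interpret r: prob_space "return borel y" by (rule prob_space_return) simp
  have "measure \<mu> A <= measure (return borel y) B + 1" "measure (return borel y) A <= measure \<mu> B + 1" for A B
   using \<mu>.prob_le_1[of A] r.prob_le_1[of A] by (simp_all add: add_increasing)
  then show "{\<epsilon>. \<epsilon> > 0 \<and> (\<forall>A\<in>sets borel. measure \<mu> A <= measure (return borel y) (\<Union>a\<in>A. ball a \<epsilon>) + \<epsilon> \<and>
    measure (return borel y) A <= measure \<mu> (\<Union>a\<in>A. ball a \<epsilon>) + \<epsilon>)} \<noteq> {}"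
   by (intro ex_in_conv[THEN iffD1] exI[of _ 1]) simp
 qed (use le in \<open>auto simp: diff_le_eq\<close>)
 then show ?thesis by linarith
qed

section \<open>Maxima of heavy-tailed variables and Frechet laws\<close>

lemma (in real_distribution) cdf_measurable [measurable]: "cdf M \<in> borel_measurable borel"
 by (intro borel_measurable_mono monoI cdf_nondecreasing)

lemma (in real_distribution) nn_integral_pos_part:
 "(\<integral>\<^sup>+x. ennreal (max 0 (x - c)) \<partial>M) = (\<integral>\<^sup>+y. ennreal (1 - cdf M y) * indicator {c<..} y \<partial>lborel)"
proof -
 have "(\<integral>\<^sup>+x. ennreal (max 0 (x - c)) \<partial>M) = (\<integral>\<^sup>+x. (\<integral>\<^sup>+y. indicator {c<..} y * indicator {..<x} y \<partial>lborel) \<partial>M)"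
 proof (rule nn_integral_cong)
  fix x
  have "(\<integral>\<^sup>+y. indicator {c<..} y * indicator {..<x} y \<partial>lborel) = (\<integral>\<^sup>+y. indicator {c<..<x} y \<partial>lborel)"
   by (intro nn_integral_cong) (auto simp: indicator_def)
  also have "... = emeasure lborel {c<..<x}" by (rule nn_integral_indicator) simp
  also have "... = ennreal (max 0 (x - c))" by (cases "c <= x") auto
  finally show "ennreal (max 0 (x - c)) = (\<integral>\<^sup>+y. indicator {c<..} y * indicator {..<x} y \<partial>lborel)" by simp
 qed
 also have "... = (\<integral>\<^sup>+y. indicator {c<..} y * emeasure M {y<..} \<partial>lborel)"
  by (rule layer_cake[OF _ events_eq_borel]) (unfold_locales, measurable)
 also have "... = (\<integral>\<^sup>+y. ennreal (1 - cdf M y) * indicator {c<..} y \<partial>lborel)"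
  by (simp add: emeasure_Ioi mult.commute)
 finally show ?thesis .
qed

lemma (in real_distribution) AE_nonneg_if_cdf:
 assumes "\<And>z. z < 0 ==> cdf M z = 0"
 shows "AE x in M. 0 <= x"
proof -
 have "AE x in M. - inverse (real (Suc n)) < x" for n
 proof -
  have "prob {.. - inverse (real (Suc n))} = 0" using assms[of "- inverse (real (Suc n))"] by (simp add: cdf_def)
  then have "AE x in M. x \<notin> {.. - inverse (real (Suc n))}" by (subst (asm) prob_eq_0) (simp_all)
  then show ?thesis by eventually_elim auto
 qed
 then have "AE x in M. \<forall>n. - inverse (real (Suc n)) < x" by (simp add: AE_all_countable)
 then show ?thesis
 proof eventually_elim
  case (elim x)
  show ?case
  proof (rule ccontr)
   assume "\<not> 0 <= x"
   then obtain n where "inverse (real (Suc n)) < - x" using reals_Archimedean[of "- x"] by auto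
   with elim[rule_format, of n] show False by simp
  qed
 qed
qed

lemma (in real_distribution) integrable_if_pos_part:
 assumes "AE x in M. 0 <= x" "(\<integral>\<^sup>+x. ennreal (max 0 (x - c)) \<partial>M) < \<infinity>"
 shows "integrable M (%x. x)"
proof (rule L1_bound)
 have i: "integrable M (%x. max 0 (x - c))"
  by (rule integrableI_bounded) (use assms(2) in \<open>simp_all\<close>)
 show "integrable M (%x. max 0 (x - c) + \<bar>c\<bar>)" by (intro L1_add i) simp
 show "AE x in M. norm x <= norm (max 0 (x - c) + \<bar>c\<bar>)" using assms(1) by eventually_elim auto
qed simp

definition max_law :: "real measure => nat => real measure" where
 "max_law \<mu> m = interval_measure (%z. cdf \<mu> z ^ m)"

lemma
 assumes \<mu>: "real_distribution \<mu>" and m: "m >= 1"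
 shows real_distribution_max_law: "real_distribution (max_law \<mu> m)"
  and cdf_max_law: "cdf (max_law \<mu> m) z = cdf \<mu> z ^ m"
proof -
 interpret \<mu>: real_distribution \<mu> by fact
 have mono: "cdf \<mu> x ^ m <= cdf \<mu> y ^ m" if "x <= y" for x y
  using that by (intro power_mono \<mu>.cdf_nondecreasing \<mu>.cdf_nonneg)
 have cts: "continuous (at_right x) (%z. cdf \<mu> z ^ m)" for x
  by (intro continuous_power \<mu>.cdf_is_right_cont)
 have "((%z. cdf \<mu> z ^ m) ---> 0 ^ m) at_bot" by (intro tendsto_power \<mu>.cdf_lim_at_bot)
 then have bot: "((%z. cdf \<mu> z ^ m) ---> 0) at_bot" using m by (simp add: power_0_left)
 have "((%z. cdf \<mu> z ^ m) ---> 1 ^ m) at_top" by (intro tendsto_power \<mu>.cdf_lim_at_top_prob)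
 then have top: "((%z. cdf \<mu> z ^ m) ---> 1) at_top" by simp
 show "real_distribution (max_law \<mu> m)"
  unfolding max_law_def by (rule real_distribution_interval_measure[OF mono cts bot top])
 show "cdf (max_law \<mu> m) z = cdf \<mu> z ^ m"
  unfolding max_law_def by (subst cdf_interval_measure[OF mono cts bot]) simp_all
qed

text \<open>The parameter \<open>s\<close> is a length of time: this is the law of the largest atom
  of the process with intensity \<open>\<mu>_\<alpha>\<close> during a time interval of length
  \<open>s\<close>.\<close>

definition frechet :: "real => real => real measure" where
 "frechet \<alpha> s = interval_measure (%z. if z <= 0 then 0 else exp (- s * z powr (- \<alpha>)))"

lemma
 assumes \<alpha>: "\<alpha> > 0" and s: "s > 0"
 shows real_distribution_frechet: "real_distribution (frechet \<alpha> s)"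
  and cdf_frechet: "cdf (frechet \<alpha> s) = (%z. if z <= 0 then 0 else exp (- s * z powr (- \<alpha>)))"
proof -
 let ?F = "%z::real. if z <= 0 then 0 else exp (- s * z powr (- \<alpha>))"
 have mono: "?F x <= ?F y" if "x <= y" for x y
 proof (cases "x <= 0")
  case False
  then have "y powr (- \<alpha>) <= x powr (- \<alpha>)" using that \<alpha> by (intro powr_mono2') auto
  then show ?thesis using False that s by simp
 qed simp
 have cts: "continuous (at_right x) ?F" for x
 proof -
  consider "x < 0" | "x = 0" | "x > 0" by linarith
  then have "(?F ---> ?F x) (at_right x)"
  proof cases
   case 1
   have "\<forall>\<^sub>F z in at_right x. ?F z = ?F x" unfolding eventually_at_right_field using 1 by (intro exI[of _ 0]) auto
   then show ?thesis by (rule tendsto_eventually)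
  next
   case 2
   have "((%z. exp (- s * z powr (- \<alpha>))) ---> 0) (at_right 0)" using \<alpha> s by real_asymp
   moreover have "\<forall>\<^sub>F z in at_right 0. exp (- s * z powr (- \<alpha>)) = ?F z"
    unfolding eventually_at_right_field by (intro exI[of _ 1]) auto
   ultimately show ?thesis using 2 by (subst (asm) tendsto_cong) simp_all
  next
   case 3
   then have "((%z. exp (- s * z powr (- \<alpha>))) ---> exp (- s * x powr (- \<alpha>))) (at_right x)"
    by (intro tendsto_intros) auto
   moreover have "\<forall>\<^sub>F z in at_right x. exp (- s * z powr (- \<alpha>)) = ?F z"
    unfolding eventually_at_right_field using 3 by (intro exI[of _ "x + 1"]) auto
   ultimately show ?thesis using 3 by (subst (asm) tendsto_cong) simp_all
  qed
  then show ?thesis by (simp add: continuous_within)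
 qed
 have bot: "(?F ---> 0) at_bot"
  by (rule tendsto_eventually) (use eventually_le_at_bot[of 0] in eventually_elim, simp)
 have "((%z. exp (- s * z powr (- \<alpha>))) ---> 1) at_top" using \<alpha> s by real_asymp
 moreover have "\<forall>\<^sub>F z in at_top. exp (- s * z powr (- \<alpha>)) = ?F z"
  using eventually_gt_at_top[of 0] by eventually_elim simp
 ultimately have top: "(?F ---> 1) at_top" by (subst (asm) tendsto_cong) simp_all
 show "real_distribution (frechet \<alpha> s)"
  unfolding frechet_def by (rule real_distribution_interval_measure[OF mono cts bot top])
 show "cdf (frechet \<alpha> s) = ?F"
  unfolding frechet_def by (rule cdf_interval_measure[OF mono cts bot])
qed

lemma AE_nonneg_frechet: "\<alpha> > 0 ==> s > 0 ==> AE x in frechet \<alpha> s. 0 <= x"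
 by (rule real_distribution.AE_nonneg_if_cdf[OF real_distribution_frechet]) (simp_all add: cdf_frechet)

lemma integrable_frechet:
 assumes \<alpha>: "\<alpha> > 1" and s: "s > 0"
 shows "integrable (frechet \<alpha> s) (%x. x)"
proof (rule real_distribution.integrable_if_pos_part)
 show rd: "real_distribution (frechet \<alpha> s)" using assms by (intro real_distribution_frechet) auto
 interpret real_distribution "frechet \<alpha> s" by fact
 show "AE x in frechet \<alpha> s. 0 <= x" using assms by (intro AE_nonneg_frechet) auto
 have "(\<integral>\<^sup>+x. ennreal (max 0 (x - 1)) \<partial>frechet \<alpha> s) <= (\<integral>\<^sup>+y. ennreal s * (ennreal (y powr (- \<alpha>)) * indicator {1..} y) \<partial>lborel)"
  unfolding nn_integral_pos_part
 proof (rule nn_integral_mono)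
  fix y :: real
  show "ennreal (1 - cdf (frechet \<alpha> s) y) * indicator {1<..} y <= ennreal s * (ennreal (y powr (- \<alpha>)) * indicator {1..} y)"
  proof (cases "1 < y")
   case True
   have "1 - exp (- s * y powr (- \<alpha>)) <= s * y powr (- \<alpha>)"
    using exp_ge_add_one_self[of "- s * y powr (- \<alpha>)"] by linarith
   then show ?thesis using True \<alpha> s by (simp add: cdf_frechet ennreal_mult[symmetric] ennreal_leI)
  qed simp
 qed
 also have "... = ennreal s * (\<integral>\<^sup>+y. ennreal (y powr (- \<alpha>)) * indicator {1..} y \<partial>lborel)"
  by (rule nn_integral_cmult) measurable
 also have "(\<integral>\<^sup>+y. ennreal (y powr (- \<alpha>)) * indicator {1..} y \<partial>lborel) = ennreal (- (1 powr (- \<alpha> + 1)) / (- \<alpha> + 1))"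
  using \<alpha> by (intro nn_integral_has_integral_lebesgue' has_integral_powr_to_inf) auto
 also have "ennreal s * ... < \<infinity>" by (simp add: ennreal_mult_less_top)
 finally show "(\<integral>\<^sup>+x. ennreal (max 0 (x - 1)) \<partial>frechet \<alpha> s) < \<infinity>" .
qed

lemma sep_law_frechet: "\<alpha> > 1 ==> s > 0 ==> sep_law (frechet \<alpha> s)"
 using real_distribution_frechet[of \<alpha> s] integrable_frechet[of \<alpha> s]
 by (simp add: sep_law_def real_distribution_def real_distribution_axioms_def)

lemma max_law_frechet:
 assumes "\<alpha> > 0" "s > 0" "p >= 1"
 shows "max_law (frechet \<alpha> s) p = frechet \<alpha> (s * real p)"
proof (rule cdf_unique)
 show "real_distribution (max_law (frechet \<alpha> s) p)" "real_distribution (frechet \<alpha> (s * real p))"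
  using assms by (auto intro!: real_distribution_max_law real_distribution_frechet)
 show "cdf (max_law (frechet \<alpha> s) p) = cdf (frechet \<alpha> (s * real p))"
  using assms by (intro ext)
   (simp add: cdf_max_law real_distribution_frechet cdf_frechet power_0_left exp_of_nat_mult[symmetric] mult_ac)
qed

lemma (in real_distribution)
 assumes "c > 0"
 shows real_distribution_scale: "real_distribution (distr M borel (%x. c * x))"
  and cdf_scale: "cdf (distr M borel (%x. c * x)) z = cdf M (z / c)"
proof -
 show "real_distribution (distr M borel (%x. c * x))" by (rule real_distribution_distr) simp
 have "(%x. c * x) -` {..z} \<inter> space M = {..z / c}"
  using assms by (auto simp: field_simps)
 then show "cdf (distr M borel (%x. c * x)) z = cdf M (z / c)"
  unfolding cdf_def by (subst measure_distr) simp_all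
qed

lemma frechet_scale:
 assumes "\<alpha> > 0" "s > 0" "c > 0"
 shows "distr (frechet \<alpha> s) borel (%x. c * x) = frechet \<alpha> (s * c powr \<alpha>)"
proof (rule cdf_unique)
 interpret real_distribution "frechet \<alpha> s" using assms by (intro real_distribution_frechet)
 show "real_distribution (distr (frechet \<alpha> s) borel (%x. c * x))" by (rule real_distribution_scale) (rule assms)
 show "real_distribution (frechet \<alpha> (s * c powr \<alpha>))" using assms by (intro real_distribution_frechet) auto
 show "cdf (distr (frechet \<alpha> s) borel (%x. c * x)) = cdf (frechet \<alpha> (s * c powr \<alpha>))"
 proof
  fix z
  have "s * (z / c) powr (- \<alpha>) = s * c powr \<alpha> * z powr (- \<alpha>)" if "0 < z"
   using that assms by (simp add: powr_divide powr_minus field_simps)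
  then show "cdf (distr (frechet \<alpha> s) borel (%x. c * x)) z = cdf (frechet \<alpha> (s * c powr \<alpha>)) z"
   using assms by (auto simp: cdf_scale cdf_frechet divide_le_0_iff)
 qed
qed

lemma esep_scale:
 assumes "prob_space \<mu>" "sets \<mu> = sets borel" "c >= 0"
 shows "esep g n (distr \<mu> borel (%x. c * x)) = c * esep g n \<mu>"
proof -
 interpret prob_space \<mu> by fact
 interpret sequence_space \<mu> by unfold_locales
 have [measurable_cong]: "sets \<mu> = sets borel" by fact
 have "esep g n (distr \<mu> borel (%x. c * x)) = (LINT w|S. sep_max g n (%i. c * w i))"
  by (rule expectation_sep_max_function[symmetric]) measurable
 also have "... = c * esep g n \<mu>" unfolding esep_def sep_max_scale[OF assms(3)] by simp
 finally show ?thesis .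
qed

lemma sep_speed_scale:
 assumes \<mu>: "sep_law \<mu>" and c: "c > 0" and g: "g >= 1"
 shows "sep_speed g (distr \<mu> borel (%x. c * x)) = c * sep_speed g \<mu>"
proof -
 interpret \<mu>: sep_law \<mu> by fact
 have [measurable_cong]: "sets \<mu> = sets borel" by (rule \<mu>.sets_\<nu>)
 have m: "(%x. c * x) \<in> borel_measurable \<mu>" by measurable
 have i: "integrable (distr \<mu> borel (%x. c * x)) (%x. x)"
  by (subst integrable_distr_eq[OF m]) (simp, rule integrable_mult_right[OF \<mu>.\<nu>_integrable])
 have "sep_law (distr \<mu> borel (%x. c * x))"
  by (intro sep_law.intro i \<mu>.M.prob_space_distr m) simp
 then have "(%n. esep g n (distr \<mu> borel (%x. c * x)) / real n) ----> sep_speed g (distr \<mu> borel (%x. c * x))"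
  using g by (rule sep_law.esep_tendsto)
 moreover have "(%n. esep g n (distr \<mu> borel (%x. c * x)) / real n) ----> c * sep_speed g \<mu>"
  using tendsto_mult[OF tendsto_const[of c] \<mu>.esep_tendsto[OF g]] c \<mu>.\<nu>_prob \<mu>.sets_\<nu> by (simp add: esep_scale)
 ultimately show ?thesis by (rule LIMSEQ_unique)
qed

text \<open>The multiples of \<open>g\<close> form a separated set that does not look at the
  weights.\<close>

lemma sep_speed_lower:
 assumes \<mu>: "sep_law \<mu>" and g: "g >= 1" and nonneg: "0 <= (LINT x|\<mu>. x)"
 shows "(LINT x|\<mu>. x) / real g <= sep_speed g \<mu>"
 unfolding sep_speed_def
proof (rule cINF_greatest)
 interpret \<mu>: sep_law \<mu> by fact
 fix n :: nat assume "n \<in> {1..}"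
 then have n: "n >= 1" by simp
 define q where "q = Suc ((n - 1) div g)"
 have nq: "real n <= real q * real g"
 proof -
  have "n - 1 < q * g" using dividend_less_times_div[of g "n - 1"] g by (simp add: q_def mult.commute)
  then have "n <= q * g" using n by linarith
  then show ?thesis by (metis of_nat_le_iff of_nat_mult)
 qed
 define T where "T = (%j. g * j) ` {..<q}"
 have T: "T \<subseteq> {..<n}"
 proof -
  have "g * j < n" if "j < q" for j
  proof -
   have "g * j <= g * ((n - 1) div g)" using that by (simp add: q_def)
   also have "... <= n - 1" by simp
   finally show ?thesis using n by linarith
  qed
  then show ?thesis by (auto simp: T_def)
 qed
 have "g * i + g <= g * j" if "g * i < g * j" for i j
 proof -
  have "g * Suc i <= g * j" using that by (intro mult_le_mono2) simp
  then show ?thesis by simp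
 qed
 then have sep: "separated g T" by (auto simp: separated_def T_def)
 have "inj_on (%j. g * j) {..<q}" using g by (auto simp: inj_on_def)
 then have cT: "card T = q" unfolding T_def by (simp add: card_image)
 have "(LINT x|\<mu>. x) * real n <= (LINT x|\<mu>. x) * (real q * real g)" by (intro mult_left_mono nq nonneg)
 moreover have "real q * (LINT x|\<mu>. x) = (LINT w|\<mu>.S. (\<Sum>i\<in>T. w i))"
  by (subst LINT_sum) (simp_all add: \<mu>.integrable_component \<mu>.expectation_component cT)
 moreover have "... <= esep g n \<mu>"
  unfolding esep_def by (intro integral_mono L1_sum \<mu>.integrable_component \<mu>.integrable_sep_max sep_max_ge T sep)
 ultimately have "(LINT x|\<mu>. x) * real n <= esep g n \<mu> * real g"
  using mult_right_mono[of "real q * (LINT x|\<mu>. x)" "esep g n \<mu>" "real g"] by (simp add: mult_ac)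
 then show "(LINT x|\<mu>. x) / real g <= esep g n \<mu> / real n" using n g by (simp add: field_simps)
qed simp

text \<open>Skorohod's coupling and the uniform integrability \<open>ui\<close> give L1 convergence
  of the weights, which \<open>esep_coupling\<close> transfers. The cut at \<open>K\<close> uses
  \<open>\<bar>y - w\<bar> \<le> max 0 (y - K) + \<bar>min y K - w\<bar>\<close>.\<close>

lemma esep_tendsto_if_weak_conv:
 assumes \<mu>: "\<And>n. real_distribution (\<mu> n)" and \<nu>: "real_distribution \<nu>" and conv: "weak_conv_m \<mu> \<nu>"
  and nonneg: "\<And>n. AE x in \<mu> n. 0 <= x" "AE x in \<nu>. 0 <= x"
  and int: "\<And>n. integrable (\<mu> n) (%x. x)" "integrable \<nu> (%x. x)"
  and ui: "\<And>e. e > 0 ==> \<forall>\<^sub>F K in at_top. EV n. (LINT x|(\<mu> n). max 0 (x - K)) <= e"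
 shows "(%n. esep g m (\<mu> n)) ----> esep g m \<nu>"
proof -
 obtain \<Omega> :: "real measure" and Y W where \<Omega>: "prob_space \<Omega>"
  and Y [measurable]: "\<And>n. Y n \<in> borel_measurable \<Omega>" and W [measurable]: "W \<in> borel_measurable \<Omega>"
  and law: "\<And>n. \<mu> n = distr \<Omega> borel (Y n)" "\<nu> = distr \<Omega> borel W"
  and lim: "\<And>x. x \<in> space \<Omega> ==> (%n. Y n x) ----> W x"
  by (rule Skorohod_coupling[OF \<mu> \<nu> conv]) blast
 interpret \<Omega>: prob_space \<Omega> by fact
 interpret O: sequence_space \<Omega> by unfold_locales
 have iY: "integrable \<Omega> (Y n)" and nY: "AE x in \<Omega>. 0 <= Y n x" for n
  using int(1)[of n] nonneg(1)[of n] unfolding law by (simp_all add: integrable_distr_eq AE_distr_iff)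
 have iW: "integrable \<Omega> W" and nW: "AE x in \<Omega>. 0 <= W x"
  using int(2) nonneg(2) unfolding law by (simp_all add: integrable_distr_eq AE_distr_iff)
 have iP: "integrable \<Omega> (%x. max 0 (f x - K))" if "integrable \<Omega> f" for f and K :: real
  by (intro integrable_max integrable_zero L1_diff that) simp
 have L1: "(%n. \<integral>x. \<bar>Y n x - W x\<bar> \<partial>\<Omega>) ----> 0"
 proof (rule order_tendstoI)
  fix e :: real assume "e < 0"
  then show "EV n. e < (LINT x|\<Omega>. \<bar>Y n x - W x\<bar>)"
   by (intro always_eventually allI less_le_trans[OF _ LINT_nonneg]) auto
 next
  fix e :: real assume e: "0 < e"
  have "((%K. \<integral>x. max 0 (W x - K) \<partial>\<Omega>) ---> (LINT x|\<Omega>. 0)) at_top"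
  proof (rule integral_dominated_convergence_at_top[OF _ _ integrable_abs[OF iW]])
   show "\<forall>\<^sub>F K in at_top. AE x in \<Omega>. norm (max 0 (W x - K)) <= \<bar>W x\<bar>"
    using eventually_ge_at_top[of 0] by eventually_elim (auto intro!: AE_I2)
   show "AE x in \<Omega>. ((%K. max 0 (W x - K)) ---> 0) at_top"
   proof (intro AE_I2 tendsto_eventually)
    fix x show "\<forall>\<^sub>F K in at_top. max 0 (W x - K) = 0" using eventually_ge_at_top[of "W x"] by eventually_elim simp
   qed
  qed auto
  then have "\<forall>\<^sub>F K in at_top. (LINT x|\<Omega>. max 0 (W x - K)) < e / 2"
   by (rule order_tendstoD(2)) (use e in simp)
  with ui[of "e / 2"] e have "\<forall>\<^sub>F K in at_top. (EV n. (LINT x|(\<mu> n). max 0 (x - K)) <= e / 2)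
   \<and> (LINT x|\<Omega>. max 0 (W x - K)) < e / 2 \<and> K >= 0"
   by (intro eventually_conj eventually_ge_at_top) auto
  then obtain K where K: "EV n. (LINT x|(\<mu> n). max 0 (x - K)) <= e / 2" "(LINT x|\<Omega>. max 0 (W x - K)) < e / 2" "K >= 0"
   by (auto dest: eventually_happens)
  have "(%n. \<integral>x. \<bar>min (Y n x) K - W x\<bar> \<partial>\<Omega>) ----> (LINT x|\<Omega>. \<bar>min (W x) K - W x\<bar>)"
  proof (rule integral_dominated_convergence[where w="%x. K + \<bar>W x\<bar>"])
   show "AE x in \<Omega>. (%n. \<bar>min (Y n x) K - W x\<bar>) ----> \<bar>min (W x) K - W x\<bar>"
    by (intro AE_I2 tendsto_intros lim)
   show "AE x in \<Omega>. norm \<bar>min (Y n x) K - W x\<bar> <= K + \<bar>W x\<bar>" for n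
    using nY[of n] by eventually_elim (use K(3) in auto)
  qed (use iW in \<open>auto intro!: L1_add\<close>)
  also have "(%x. \<bar>min (W x) K - W x\<bar>) = (%x. max 0 (W x - K))" by (auto simp: fun_eq_iff)
  finally have "EV n. (LINT x|\<Omega>. \<bar>min (Y n x) K - W x\<bar>) < e / 2" using K(2) by (rule order_tendstoD(2))
  with K(1) show "EV n. (LINT x|\<Omega>. \<bar>Y n x - W x\<bar>) < e"
  proof eventually_elim
   case (elim n)
   have iM: "integrable \<Omega> (%x. \<bar>min (Y n x) K - W x\<bar>)"
    by (intro integrable_abs L1_diff integrable_min iY iW) simp
   have "(LINT x|\<Omega>. \<bar>Y n x - W x\<bar>) <= (LINT x|\<Omega>. max 0 (Y n x - K) + \<bar>min (Y n x) K - W x\<bar>)"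
    by (intro integral_mono integrable_abs L1_diff L1_add iY iW iP iM) auto
   also have "... = (LINT x|\<Omega>. max 0 (Y n x - K)) + (LINT x|\<Omega>. \<bar>min (Y n x) K - W x\<bar>)"
    by (rule LINT_add[OF iP[OF iY] iM])
   also have "(LINT x|\<Omega>. max 0 (Y n x - K)) = (LINT x|(\<mu> n). max 0 (x - K))" unfolding law by (subst integral_distr) simp_all
   finally show ?case using elim by linarith
  qed
 qed
 have "(%n. esep g m (\<mu> n) - esep g m \<nu>) ----> 0"
  by (rule Lim_null_comparison[where g="%n. real m * (LINT x|\<Omega>. \<bar>Y n x - W x\<bar>)"])
   (use O.esep_coupling[OF iY iW, of g m] tendsto_mult_left[OF L1, of "real m"] in \<open>simp_all add: law\<close>)
 then show ?thesis by (simp add: LIM_zero_iff)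
qed

lemma power_exp_tendsto:
 fixes p :: "nat => real"
 assumes p0: "p ----> 0" and p: "\<And>n. 0 < p n" and mp: "(%n. real (m n) * p n) ----> \<theta>"
 shows "(%n. (1 - p n) ^ m n) ----> exp (- \<theta>)"
proof -
 have "((%x::real. ln (1 - x) / x) ---> - 1) (at_right 0)" by real_asymp
 moreover have "filterlim p (at_right 0) sequentially"
  unfolding filterlim_at by (intro conjI p0 always_eventually) (use p in \<open>auto simp: less_imp_neq[THEN not_sym]\<close>)
 ultimately have "(%n. ln (1 - p n) / p n) ----> - 1" by (rule filterlim_compose)
 then have "(%n. exp ((real (m n) * p n) * (ln (1 - p n) / p n))) ----> exp (\<theta> * (- 1))"
  by (intro tendsto_exp tendsto_mult mp)
 moreover have "EV n. p n < 1" by (rule order_tendstoD(2)[OF p0]) simp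
 then have "EV n. exp ((real (m n) * p n) * (ln (1 - p n) / p n)) = (1 - p n) ^ m n"
 proof eventually_elim
  case (elim n)
  have "(real (m n) * p n) * (ln (1 - p n) / p n) = real (m n) * ln (1 - p n)" using p[of n] by simp
  then show ?case using elim by (simp add: exp_of_nat_mult)
 qed
 ultimately show ?thesis by (subst (asm) tendsto_cong) simp_all
qed

section \<open>Convergence of scaled maxima to Frechet laws\<close>

context heavy_tail
begin

definition \<nu>0 :: "real measure" where
 "\<nu>0 = distr \<nu> borel (%x. max 0 x)"

lemma real_distribution_\<nu>0: "real_distribution \<nu>0"
 unfolding \<nu>0_def by (rule real_distribution_distr) simp

lemma measure_pos_part_le: "measure \<nu> {x. max 0 x <= z} = (if z < 0 then 0 else 1 - G z)"
proof (cases "z < 0")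
 case True
 then have "{x. max 0 x <= z} = {}" by auto
 then show ?thesis using True by simp
next
 case False
 then have "{x. max 0 x <= z} = {..z}" by auto
 then show ?thesis using False G_eq_cdf[of z] by (simp add: cdf_def)
qed

lemma cdf_\<nu>0: "cdf \<nu>0 z = (if z < 0 then 0 else 1 - G z)"
proof -
 have "cdf \<nu>0 z = measure \<nu> ((%x. max 0 x) -` {..z} \<inter> space \<nu>)"
  unfolding \<nu>0_def cdf_def by (rule measure_distr) simp_all
 also have "(%x. max 0 x) -` {..z} \<inter> space \<nu> = {x. max 0 x <= z}" by auto
 finally show ?thesis unfolding measure_pos_part_le .
qed

text \<open>The union bound, as Bernoulli's inequality for the cdf of the maximum, reduces
  everything to a single jump.\<close>

lemma
 assumes int: "integrable \<nu> (%x. max 0 x)" and m: "m >= 1" and K: "K >= 0"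
 shows integrable_max_law: "integrable (max_law \<nu>0 m) (%x. x)"
  and excess_max_law: "(LINT x|(max_law \<nu>0 m). max 0 (x - K)) <= real m * excess K"
  and AE_nonneg_max_law: "AE x in max_law \<nu>0 m. 0 <= x"
proof -
 interpret L: real_distribution "max_law \<nu>0 m" by (rule real_distribution_max_law[OF real_distribution_\<nu>0 m])
 have e0: "0 <= excess K" unfolding excess_def by (rule LINT_nonneg) simp
 have nn: "(\<integral>\<^sup>+x. ennreal (max 0 (x - K)) \<partial>max_law \<nu>0 m) <= ennreal (real m * excess K)"
 proof -
  have "(\<integral>\<^sup>+x. ennreal (max 0 (x - K)) \<partial>max_law \<nu>0 m) <= (\<integral>\<^sup>+y. ennreal (real m) * (ennreal (G y) * indicator {K<..} y) \<partial>lborel)"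
   unfolding L.nn_integral_pos_part
  proof (rule nn_integral_mono)
   fix y :: real
   show "ennreal (1 - cdf (max_law \<nu>0 m) y) * indicator {K<..} y <= ennreal (real m) * (ennreal (G y) * indicator {K<..} y)"
   proof (cases "K < y")
    case True
    have "1 + real m * (- G y) <= (1 + (- G y)) ^ m" by (rule Bernoulli_inequality) (use G_le_1[of y] in simp)
    then have "1 - (1 - G y) ^ m <= real m * G y" by simp
    then have "1 - cdf (max_law \<nu>0 m) y <= real m * G y"
     using True K by (simp add: cdf_max_law[OF real_distribution_\<nu>0 m] cdf_\<nu>0)
    then show ?thesis using True by (simp add: ennreal_mult[symmetric] G_nonneg ennreal_leI)
   qed simp
  qed
  also have "... = ennreal (real m) * (\<integral>\<^sup>+y. ennreal (G y) * indicator {K<..} y \<partial>lborel)"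
   by (rule nn_integral_cmult) measurable
  also have "... = ennreal (real m * excess K)"
   unfolding ennreal_excess[OF int, symmetric] using e0 by (simp add: ennreal_mult)
  finally show ?thesis .
 qed
 show ae: "AE x in max_law \<nu>0 m. 0 <= x"
  using m by (intro L.AE_nonneg_if_cdf) (simp add: cdf_max_law[OF real_distribution_\<nu>0 m] cdf_\<nu>0 power_0_left)
 show i: "integrable (max_law \<nu>0 m) (%x. x)"
  by (rule L.integrable_if_pos_part[OF ae order_le_less_trans[OF nn]]) simp
 have "integrable (max_law \<nu>0 m) (%x. max 0 (x - K))"
  by (intro integrable_max integrable_zero L1_diff i) simp
 then have "(\<integral>\<^sup>+x. ennreal (max 0 (x - K)) \<partial>max_law \<nu>0 m) = ennreal (LINT x|(max_law \<nu>0 m). max 0 (x - K))"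
  by (rule nn_integral_eq_integral) simp
 with nn show "(LINT x|(max_law \<nu>0 m). max 0 (x - K)) <= real m * excess K"
  using e0 by (simp add: ennreal_le_iff)
qed

text \<open>The cdf of the scaled maximum at \<open>z\<close> is (1 - G(z c))^m, where m G(z c)
  tends to \<sigma> z^(-\<alpha>). Uniform integrability comes from
  \<open>excess_le\<close>.\<close>

theorem esep_max_law_tendsto:
 assumes \<alpha>1: "\<alpha> > 1" and m: "\<And>N. m N >= 1" and s: "\<sigma> > 0" and ms: "(%N. real (m N) / scale N) ----> \<sigma>"
 shows "(%N. esep g n (max_law \<nu>0 (m N)) / c_scale h N) ----> esep g n (frechet \<alpha> \<sigma>)"
proof -
 obtain C x0 where C: "C > 0" "x0 > 0" "\<And>D. x0 <= D ==> excess D <= C * (D * G D)" and int: "integrable \<nu> (%x. max 0 x)"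
  using excess_le[OF \<alpha>1] by blast
 \<comment> \<open>For small \<open>N\<close> the scale may be 0; the maximum makes every scaled law
   well defined.\<close>
 define c where "c N = max 1 (c_scale h N)" for N
 have c: "c N > 0" for N by (simp add: c_def)
 have cev: "EV N. c N = c_scale h N"
 proof -
  have "EV N. 1 <= c_scale h N" using c_scale_at_top unfolding filterlim_at_top by blast
  then show ?thesis by eventually_elim (simp add: c_def)
 qed
 have ctop: "filterlim c at_top sequentially"
  using c_scale_at_top by (rule filterlim_at_top_mono) (simp add: c_def)
 have L: "real_distribution (max_law \<nu>0 (m N))" for N by (rule real_distribution_max_law[OF real_distribution_\<nu>0 m])
 have mG: "(%N. real (m N) * G (z * c N)) ----> \<sigma> * z powr (- \<alpha>)" if z: "z > 0" for z
 proof -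
  have "(%N. (real (m N) / scale N) * (scale N * G (z * c_scale h N))) ----> \<sigma> * z powr (- \<alpha>)"
   by (intro tendsto_mult ms G_c_scale z)
  moreover have "EV N. scale N > 0"
   using scale_at_top unfolding filterlim_at_top_dense by blast
  then have "EV N. (real (m N) / scale N) * (scale N * G (z * c_scale h N)) = real (m N) * G (z * c N)"
   using cev
  proof eventually_elim
   case (elim N)
   define k where "k = scale N"
   have "(real (m N) / k) * (k * G (z * c_scale h N)) = real (m N) * G (z * c N)" if "k > 0"
    using that elim(2) by simp
   then show ?case using elim(1) unfolding k_def .
  qed
  ultimately show ?thesis by (subst (asm) tendsto_cong) simp_all
 qed
 define \<mu> where "\<mu> N = distr (max_law \<nu>0 (m N)) borel (%x. (1 / c N) * x)" for N
 have rd: "real_distribution (\<mu> N)" for N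
  unfolding \<mu>_def using c[of N] by (intro real_distribution.real_distribution_scale[OF L]) simp
 have cdf: "cdf (\<mu> N) z = (if z < 0 then 0 else (1 - G (z * c N)) ^ m N)" for N z
  using c[of N] m[of N] unfolding \<mu>_def
  by (subst real_distribution.cdf_scale[OF L]) (auto simp: cdf_max_law[OF real_distribution_\<nu>0 m] cdf_\<nu>0 mult_less_0_iff power_0_left)
 have mtop: "filterlim (%N. real (m N)) at_top sequentially"
 proof -
  have "filterlim (%N. (real (m N) / scale N) * scale N) at_top sequentially"
   by (rule filterlim_tendsto_pos_mult_at_top[OF ms s scale_at_top])
  moreover have "EV N. scale N > 0"
   using scale_at_top unfolding filterlim_at_top_dense by blast
  then have "EV N. (real (m N) / scale N) * scale N = real (m N)"
   by eventually_elim (rule nonzero_eq_divide_eq[THEN iffD1, OF _ refl], linarith)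
  ultimately show ?thesis by (subst (asm) filterlim_cong[OF refl refl]) simp_all
 qed
 have "(%N. esep g n (\<mu> N)) ----> esep g n (frechet \<alpha> \<sigma>)"
 proof (rule esep_tendsto_if_weak_conv[OF rd])
  show "real_distribution (frechet \<alpha> \<sigma>)" using \<alpha> s by (intro real_distribution_frechet)
  show "AE x in frechet \<alpha> \<sigma>. 0 <= x" using \<alpha> s by (rule AE_nonneg_frechet)
  show "integrable (frechet \<alpha> \<sigma>) (%x. x)" using \<alpha>1 s by (rule integrable_frechet)
  show "AE x in \<mu> N. 0 <= x" for N
   by (rule real_distribution.AE_nonneg_if_cdf[OF rd]) (simp add: cdf)
  have Lm: "sets (max_law \<nu>0 (m N)) = sets borel" for N
   using L[of N] by (simp add: real_distribution_def real_distribution_axioms_def)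
  have meas: "(%x. (1 / c N) * x) \<in> borel_measurable (max_law \<nu>0 (m N))" for N
   unfolding measurable_cong_sets[OF Lm refl] by measurable
  show "integrable (\<mu> N) (%x. x)" for N
   unfolding \<mu>_def by (subst integrable_distr_eq[OF meas]) (simp, intro integrable_mult_right integrable_max_law[OF int m order_refl])
  show "weak_conv_m \<mu> (frechet \<alpha> \<sigma>)"
   unfolding weak_conv_m_def weak_conv_def
  proof (intro allI impI)
   fix z :: real
   consider "z < 0" | "z = 0" | "z > 0" by linarith
   then show "(%N. cdf (\<mu> N) z) ----> cdf (frechet \<alpha> \<sigma>) z"
   proof cases
    case 1
    then show ?thesis using \<alpha> s by (simp add: cdf cdf_frechet)
   next
    case 2
    \<comment> \<open>The jumps may have an atom at 0, but the maximum leaves 0 because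
      \<open>G 0 > 0\<close> and \<open>m N\<close> tends to infinity.\<close>
    have "(%N. (1 - G 0) ^ m N) ----> 0"
    proof (rule filterlim_compose[of "%k. (1 - G 0) ^ k"])
     show "(%k. (1 - G 0) ^ k) ----> 0" using G_pos[of 0] G_le_1[of 0] by (intro LIMSEQ_realpow_zero) auto
     show "filterlim m sequentially sequentially" using mtop by (simp add: filterlim_sequentially_iff_filterlim_real)
    qed
    then show ?thesis using 2 \<alpha> s by (simp add: cdf cdf_frechet)
   next
    case 3
    have "filterlim (%N. z * c N) at_top sequentially"
     by (rule filterlim_tendsto_pos_mult_at_top[OF tendsto_const 3 ctop])
    then have "(%N. G (z * c N)) ----> 0" by (rule filterlim_compose[OF G_tendsto_0])
    then have "(%N. (1 - G (z * c N)) ^ m N) ----> exp (- (\<sigma> * z powr (- \<alpha>)))"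
     by (intro power_exp_tendsto mG 3 G_pos)
    then show ?thesis using 3 \<alpha> s by (simp add: cdf cdf_frechet)
   qed
  qed
  fix e :: real assume e: "e > 0"
  \<comment> \<open>The limit in \<open>N\<close> of the bound for the excess of the scaled maximum
    over \<open>K\<close>; it vanishes as \<open>K\<close> grows since \<alpha> > 1.\<close>
  have "((%K. (C * \<sigma>) * K powr (1 - \<alpha>)) ---> 0) at_top" using \<alpha>1 by real_asymp
  then have "\<forall>\<^sub>F K in at_top. (C * \<sigma>) * K powr (1 - \<alpha>) < e" using e by (rule order_tendstoD(2))
  then show "\<forall>\<^sub>F K in at_top. EV N. (LINT x|(\<mu> N). max 0 (x - K)) <= e"
   using eventually_ge_at_top[of 1] eventually_ge_at_top[of x0]
  proof eventually_elim
   case K: (elim K)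
   have "(%N. C * K * (real (m N) * G (K * c N))) ----> C * K * (\<sigma> * K powr (- \<alpha>))"
    using K by (intro tendsto_mult tendsto_const mG) auto
   also have "C * K * (\<sigma> * K powr (- \<alpha>)) = (C * \<sigma>) * K powr (1 - \<alpha>)"
    using K by (simp add: powr_diff powr_minus field_simps)
   finally have "EV N. C * K * (real (m N) * G (K * c N)) < e" using K(1) by (rule order_tendstoD(2))
   then show ?case
   proof eventually_elim
    case (elim N)
    have c1: "c N >= 1" by (simp add: c_def)
    have Kc: "K * 1 <= K * c N" using K c1 by (intro mult_left_mono) auto
    have "(LINT x|(\<mu> N). max 0 (x - K)) = (\<integral>x. max 0 ((1 / c N) * x - K) \<partial>max_law \<nu>0 (m N))"
     unfolding \<mu>_def by (rule integral_distr[OF meas]) measurable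
    also have "... = (\<integral>x. (1 / c N) * max 0 (x - K * c N) \<partial>max_law \<nu>0 (m N))"
    proof (rule LINT_cong[OF refl])
     fix x
     have "(1 / c N) * max 0 (x - K * c N) = max ((1 / c N) * 0) ((1 / c N) * (x - K * c N))"
      using c[of N] by (intro max_mult_distrib_left[THEN trans]) auto
     also have "(1 / c N) * (x - K * c N) = (1 / c N) * x - K" using c[of N] by (simp add: field_simps)
     finally show "max 0 ((1 / c N) * x - K) = (1 / c N) * max 0 (x - K * c N)" by simp
    qed
    also have "... = (1 / c N) * (\<integral>x. max 0 (x - K * c N) \<partial>max_law \<nu>0 (m N))" by simp
    also have "... <= (1 / c N) * (real (m N) * (C * ((K * c N) * G (K * c N))))"
    proof (intro mult_left_mono order_trans[OF excess_max_law[OF int m]] C(3))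
     show "0 <= K * c N" "x0 <= K * c N" using Kc K by linarith+
    qed (use c[of N] in auto)
    also have "... = C * K * (real (m N) * G (K * c N))" using c[of N] by simp
    finally show ?case using elim by linarith
   qed
  qed
 qed
 moreover have "EV N. esep g n (\<mu> N) = esep g n (max_law \<nu>0 (m N)) / c_scale h N"
  using cev
 proof eventually_elim
  case (elim N)
  have "esep g n (\<mu> N) = (1 / c N) * esep g n (max_law \<nu>0 (m N))"
   unfolding \<mu>_def using L[of N] c[of N] by (intro esep_scale) (auto simp: real_distribution_def real_distribution_axioms_def)
  then show ?case using elim by simp
 qed
 ultimately show ?thesis by (subst (asm) tendsto_cong) simp_all
qed

end

section \<open>The speed of the stairs process as a limit of discrete speeds\<close>

lemma (in sequence_space) integrable_sep_max_block_max:
 assumes f: "integrable M f"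
 shows "integrable S (%w. sep_max g m (block_max p f w))"
proof (cases "p = 0")
 case True
 then show ?thesis unfolding block_max_def by simp
next
 case False
 have m: "f \<in> borel_measurable M" by (rule borel_measurable_integrable[OF f])
 have fm: "(%w. f (w i)) \<in> borel_measurable S" for i using m by (rule measurable_compose_rev) simp
 show ?thesis
 proof (rule L1_bound)
  show "integrable S (%w. \<Sum>j<m. \<Sum>i\<in>{j * p..<j * p + p}. \<bar>f (w i)\<bar>)"
   by (intro L1_sum integrable_abs integrable_component_function f)
  show "(%w. sep_max g m (block_max p f w)) \<in> borel_measurable S"
   unfolding block_max_def[abs_def] by (intro sep_max_measurable borel_measurable_Max fm) simp
  show "AE w in S. norm (sep_max g m (block_max p f w)) <= norm (\<Sum>j<m. \<Sum>i\<in>{j * p..<j * p + p}. \<bar>f (w i)\<bar>)"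
  proof (rule AE_I2)
   fix w
   have "block_max p f w j <= (\<Sum>i\<in>{j * p..<j * p + p}. \<bar>f (w i)\<bar>)" for j
   proof -
    have "f (w i) <= (\<Sum>i\<in>{j * p..<j * p + p}. \<bar>f (w i)\<bar>)" if "i \<in> {j * p..<j * p + p}" for i
     using that member_le_sum[of i "{j * p..<j * p + p}" "%i. \<bar>f (w i)\<bar>"] by auto
    then show ?thesis using False by (simp add: block_max_le_iff)
   qed
   then have "sep_max g m (block_max p f w) <= sep_max g m (%j. \<Sum>i\<in>{j * p..<j * p + p}. \<bar>f (w i)\<bar>)"
    by (intro sep_max_mono) auto
   also have "... <= (\<Sum>j<m. \<Sum>i\<in>{j * p..<j * p + p}. \<bar>f (w i)\<bar>)" by (intro sep_max_le_sum sum_nonneg) simp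
   finally show "norm (sep_max g m (block_max p f w)) <= norm (\<Sum>j<m. \<Sum>i\<in>{j * p..<j * p + p}. \<bar>f (w i)\<bar>)"
    using sep_max_nonneg[of g m "block_max p f w"] by (simp add: sum_nonneg)
  qed
 qed
qed

text \<open>Max-stability: the maximum of \<open>p\<close> consecutive weights is Frechet with
  parameter \<open>s * p\<close>, so the two sides are two meshes of the same process.\<close>

lemma
 assumes \<alpha>: "\<alpha> > 1" and s: "s > 0" and p: "p >= 1" and q: "q >= 1"
 shows esep_frechet_refine: "esep (Suc q) m (frechet \<alpha> (s * real p)) <= esep (Suc (p * q)) (p * m) (frechet \<alpha> s)"
  and esep_frechet_coarsen: "esep (p * q) (p * m) (frechet \<alpha> s) <= esep q m (frechet \<alpha> (s * real p))"
proof -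
 interpret F: sep_law "frechet \<alpha> s" by (rule sep_law_frechet[OF \<alpha> s])
 have rd: "real_distribution (frechet \<alpha> s)" "real_distribution (frechet \<alpha> (s * real p))"
  using \<alpha> s p by (auto intro!: real_distribution_frechet)
 have sp: "space (frechet \<alpha> s) = UNIV" using real_distribution.space_eq_univ[OF rd(1)] .
 have \<alpha>0: "\<alpha> > 0" using \<alpha> by simp
 have cdf: "cdf (frechet \<alpha> (s * real p)) z = measure (frechet \<alpha> s) {x\<in>space (frechet \<alpha> s). x <= z} ^ p" for z
 proof -
  have "{x\<in>space (frechet \<alpha> s). x <= z} = {..z}" using sp by auto
  then show ?thesis
   using cdf_max_law[OF rd(1) p, of z] unfolding max_law_frechet[OF \<alpha>0 s p] by (simp add: cdf_def)
 qed
 have e: "(LINT w|F.S. sep_max g m (F.block_max p (%x. x) w)) = esep g m (frechet \<alpha> (s * real p))" for g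
  by (rule F.expectation_sep_max_block_max[OF borel_measurable_integrable[OF F.\<nu>_integrable] p rd(2) cdf])
 note i = F.integrable_sep_max_block_max[OF F.\<nu>_integrable]
 have "(LINT w|F.S. sep_max (Suc q) m (F.block_max p (%x. x) w)) <= esep (Suc (p * q)) (p * m) (frechet \<alpha> s)"
  unfolding esep_def by (intro integral_mono i F.integrable_sep_max sep_max_refine p F.block_max_attained)
 then show "esep (Suc q) m (frechet \<alpha> (s * real p)) <= esep (Suc (p * q)) (p * m) (frechet \<alpha> s)" unfolding e .
 have "esep (p * q) (p * m) (frechet \<alpha> s) <= (LINT w|F.S. sep_max q m (F.block_max p (%x. x) w))"
  unfolding esep_def by (intro integral_mono i F.integrable_sep_max sep_max_coarsen p q F.block_max_ge)
 then show "esep (p * q) (p * m) (frechet \<alpha> s) <= esep q m (frechet \<alpha> (s * real p))" unfolding e .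
qed

lemma sep_speed_antimono:
 assumes "sep_law \<mu>" "1 <= g" "g <= g'"
 shows "sep_speed g' \<mu> <= sep_speed g \<mu>"
proof (rule LIMSEQ_le)
 interpret sep_law \<mu> by fact
 show "(%n. esep g' n \<mu> / real n) ----> sep_speed g' \<mu>" "(%n. esep g n \<mu> / real n) ----> sep_speed g \<mu>"
  using assms by (auto intro!: esep_tendsto)
 have "esep g' n \<mu> <= esep g n \<mu>" for n
  unfolding esep_def by (intro integral_mono integrable_sep_max sep_max_antimono assms(3))
 then show "\<exists>N. \<forall>n\<ge>N. esep g' n \<mu> / real n <= esep g n \<mu> / real n" by (auto intro!: divide_right_mono)
qed

lemma tendsto_along_multiples:
 fixes f :: "nat => real"
 assumes "(%n. f n / real n) ----> l" "p >= 1"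
 shows "(%m. f (p * m) / real m) ----> real p * l"
proof -
 have "filterlim (%m. p * m) sequentially sequentially"
  using assms(2) by (intro mult_nat_left_at_top) simp
 from filterlim_compose[OF assms(1) this]
 have "(%m. real p * (f (p * m) / real (p * m))) ----> real p * l" by (intro tendsto_mult tendsto_const)
 then show ?thesis using assms(2) by simp
qed

text \<open>Cells of length \<open>1 / q\<close>: points of distance at least \<open>1\<close> lie in cells with indices at least \<open>q\<close> apart, and
 cells whose indices are at least \<open>q + 1\<close> apart contain only points of distance at least \<open>1\<close>.\<close>

definition upper_speed :: "real => nat => real" where
 "upper_speed \<alpha> q = real q * sep_speed q (frechet \<alpha> (1 / real q))"

definition lower_speed :: "real => nat => real" where
 "lower_speed \<alpha> q = real q * sep_speed (Suc q) (frechet \<alpha> (1 / real q))"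

text \<open>The constant \<rho>_\<alpha>, defined without a probability space so that one value
  serves the walk and all realisations of the stairs process.\<close>

definition stairs_speed :: "real => real" where
 "stairs_speed \<alpha> = (INF q\<in>{1..}. upper_speed \<alpha> q)"

context
 fixes \<alpha> :: real
 assumes \<alpha>: "\<alpha> > 1"
begin

lemma fr_law: "q >= 1 ==> sep_law (frechet \<alpha> (1 / real q))"
 using \<alpha> by (intro sep_law_frechet) auto

text \<open>Both bounds improve when the mesh is refined by an integer factor.\<close>

lemma lower_speed_mono: "p >= 1 ==> q >= 1 ==> lower_speed \<alpha> p <= lower_speed \<alpha> (q * p)"
 and upper_speed_antimono: "p >= 1 ==> q >= 1 ==> upper_speed \<alpha> (q * p) <= upper_speed \<alpha> p"
proof -
 assume p: "p >= 1" and q: "q >= 1"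
 have eq: "1 / real (q * p) * real q = 1 / real p" using q by simp
 have pos: "0 < 1 / real (q * p)" using p q by simp
 have qp: "q * p >= 1" using p q by (metis mult_le_mono nat_mult_1)
 have "sep_speed (Suc p) (frechet \<alpha> (1 / real p)) <= real q * sep_speed (Suc (q * p)) (frechet \<alpha> (1 / real (q * p)))"
 proof (rule LIMSEQ_le)
  show "(%m. esep (Suc p) m (frechet \<alpha> (1 / real p)) / real m) ----> sep_speed (Suc p) (frechet \<alpha> (1 / real p))"
   by (intro sep_law.esep_tendsto fr_law p) simp
  show "(%m. esep (Suc (q * p)) (q * m) (frechet \<alpha> (1 / real (q * p))) / real m)
   ----> real q * sep_speed (Suc (q * p)) (frechet \<alpha> (1 / real (q * p)))"
   by (intro tendsto_along_multiples[of "%n. esep _ n _"] sep_law.esep_tendsto fr_law q qp) simp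
  show "\<exists>N. \<forall>m\<ge>N. esep (Suc p) m (frechet \<alpha> (1 / real p)) / real m
   <= esep (Suc (q * p)) (q * m) (frechet \<alpha> (1 / real (q * p))) / real m"
   using esep_frechet_refine[OF \<alpha> pos q p] unfolding eq by (auto intro!: divide_right_mono)
 qed
 from mult_left_mono[OF this, of "real p"] show "lower_speed \<alpha> p <= lower_speed \<alpha> (q * p)"
  by (simp add: lower_speed_def mult_ac)
 have "real q * sep_speed (q * p) (frechet \<alpha> (1 / real (q * p))) <= sep_speed p (frechet \<alpha> (1 / real p))"
 proof (rule LIMSEQ_le)
  show "(%m. esep p m (frechet \<alpha> (1 / real p)) / real m) ----> sep_speed p (frechet \<alpha> (1 / real p))"
   by (intro sep_law.esep_tendsto fr_law p)
  show "(%m. esep (q * p) (q * m) (frechet \<alpha> (1 / real (q * p))) / real m)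
   ----> real q * sep_speed (q * p) (frechet \<alpha> (1 / real (q * p)))"
   by (intro tendsto_along_multiples[of "%n. esep _ n _"] sep_law.esep_tendsto fr_law q qp)
  show "\<exists>N. \<forall>m\<ge>N. esep (q * p) (q * m) (frechet \<alpha> (1 / real (q * p))) / real m
   <= esep p m (frechet \<alpha> (1 / real p)) / real m"
   using esep_frechet_coarsen[OF \<alpha> pos q p] unfolding eq by (auto intro!: divide_right_mono)
 qed
 from mult_left_mono[OF this, of "real p"] show "upper_speed \<alpha> (q * p) <= upper_speed \<alpha> p"
  by (simp add: upper_speed_def mult_ac)
qed

text \<open>Compared on the common refinement \<open>q * p\<close>, where the larger gap gives the
  smaller sum.\<close>

lemma lower_le_upper:
 assumes "p >= 1" "q >= 1"
 shows "lower_speed \<alpha> p <= upper_speed \<alpha> q"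
proof -
 have pq: "q * p >= 1" using assms by (metis mult_le_mono nat_mult_1)
 have "lower_speed \<alpha> p <= lower_speed \<alpha> (q * p)" by (rule lower_speed_mono[OF assms])
 also have "... <= upper_speed \<alpha> (q * p)"
  unfolding lower_speed_def upper_speed_def by (intro mult_left_mono sep_speed_antimono fr_law pq) auto
 also have "... <= upper_speed \<alpha> q" using upper_speed_antimono[OF assms(2,1)] by (simp add: mult.commute)
 finally show ?thesis .
qed

text \<open>Both sides have gap \<open>q + 1\<close>; only the length of a cell differs, 1/q against
  1/(q + 1), and Frechet laws of different time lengths are multiples of each other.\<close>

lemma lower_speed_eq:
 assumes q: "q >= 1"
 shows "lower_speed \<alpha> q = (real q / real (Suc q)) powr (1 - 1 / \<alpha>) * upper_speed \<alpha> (Suc q)"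
proof -
 define c where "c = (real (Suc q) / real q) powr (1 / \<alpha>)"
 have c: "c > 0" using q by (simp add: c_def)
 have "c powr \<alpha> = real (Suc q) / real q" using \<alpha> q by (simp add: c_def powr_powr)
 then have "1 / real (Suc q) * c powr \<alpha> = 1 / real q" by (simp del: of_nat_Suc)
 then have "frechet \<alpha> (1 / real q) = distr (frechet \<alpha> (1 / real (Suc q))) borel (%x. c * x)"
  using \<alpha> c frechet_scale[of \<alpha> "1 / real (Suc q)" c] by simp
 then have "lower_speed \<alpha> q = real q * (c * sep_speed (Suc q) (frechet \<alpha> (1 / real (Suc q))))"
  unfolding lower_speed_def using c by (simp add: sep_speed_scale fr_law del: of_nat_Suc)
 also have "... = (real q / real (Suc q) * c) * upper_speed \<alpha> (Suc q)" by (simp add: upper_speed_def del: of_nat_Suc)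
 also have "real q / real (Suc q) * c = (real q / real (Suc q)) powr (1 - 1 / \<alpha>)"
  using q by (simp add: c_def powr_diff powr_divide del: of_nat_Suc)
 finally show ?thesis .
qed

text \<open>The Frechet law does not charge 0, so its mean is positive and
  \<open>sep_speed_lower\<close> applies.\<close>

lemma lower_speed_pos: "lower_speed \<alpha> 1 > 0"
proof -
 have \<alpha>0: "\<alpha> > 0" using \<alpha> by simp
 interpret F: sep_law "frechet \<alpha> 1" using sep_law_frechet[OF \<alpha>] by simp
 interpret R: real_distribution "frechet \<alpha> 1" using \<alpha>0 by (intro real_distribution_frechet) auto
 have nn: "AE x in frechet \<alpha> 1. 0 <= x" using \<alpha>0 by (intro AE_nonneg_frechet) auto
 have "(LINT x|(frechet \<alpha> 1). x) \<noteq> 0"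
 proof
  assume "(LINT x|(frechet \<alpha> 1). x) = 0"
  then have "AE x in frechet \<alpha> 1. x = 0" using integral_nonneg_eq_0_iff_AE[OF F.\<nu>_integrable nn] by simp
  then have "AE x in frechet \<alpha> 1. x \<in> {..0}" by eventually_elim simp
  then have "measure (frechet \<alpha> 1) {..0} = 1" by (subst F.M.prob_eq_1) simp_all
  moreover have "cdf (frechet \<alpha> 1) 0 = 0" using \<alpha>0 by (simp add: cdf_frechet)
  ultimately show False by (simp add: cdf_def)
 qed
 moreover have E0: "0 <= (LINT x|(frechet \<alpha> 1). x)" by (rule integral_nonneg_AE[OF nn])
 ultimately have "0 < (LINT x|(frechet \<alpha> 1). x) / real (Suc 1)" by (intro divide_pos_pos) (linarith, simp)
 then have "0 < sep_speed (Suc 1) (frechet \<alpha> 1)"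
  by (rule less_le_trans) (rule sep_speed_lower[OF F.sep_law_axioms _ E0], simp)
 then show ?thesis unfolding lower_speed_def by (simp only: of_nat_1 div_by_1 mult_1)
qed

lemma lower_le_stairs_speed: "q >= 1 ==> lower_speed \<alpha> q <= stairs_speed \<alpha>"
 unfolding stairs_speed_def by (rule cINF_greatest) (auto intro: lower_le_upper)

lemma stairs_speed_le_upper: "q >= 1 ==> stairs_speed \<alpha> <= upper_speed \<alpha> q"
 unfolding stairs_speed_def by (rule cINF_lower) (auto intro!: bdd_belowI[of _ "lower_speed \<alpha> 1"] lower_le_upper)

lemma stairs_speed_pos: "stairs_speed \<alpha> > 0"
 using lower_speed_pos lower_le_stairs_speed[of 1] by simp

lemma upper_speed_tendsto: "(%q. upper_speed \<alpha> (Suc q)) ----> stairs_speed \<alpha>"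
 and lower_speed_tendsto: "(%q. lower_speed \<alpha> q) ----> stairs_speed \<alpha>"
proof -
 let ?f = "%q::nat. (real q / real (Suc q)) powr (1 - 1 / \<alpha>)"
 have f1: "?f ----> 1" using \<alpha> by real_asymp
 have "(%q. stairs_speed \<alpha> / ?f q) ----> stairs_speed \<alpha> / 1" by (intro tendsto_divide tendsto_const f1) simp
 then have 1: "(%q. stairs_speed \<alpha> / ?f q) ----> stairs_speed \<alpha>" by (simp only: div_by_1)
 have 2: "EV q. upper_speed \<alpha> (Suc q) <= stairs_speed \<alpha> / ?f q"
  using eventually_ge_at_top[of 1]
 proof eventually_elim
  case (elim q)
  have "?f q > 0" using elim by simp
  then show ?case using lower_le_stairs_speed[OF elim] unfolding lower_speed_eq[OF elim] by (subst pos_le_divide_eq) (simp_all only: mult.commute)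
 qed
 have "stairs_speed \<alpha> <= upper_speed \<alpha> (Suc q)" for q by (rule stairs_speed_le_upper) simp
 then show u: "(%q. upper_speed \<alpha> (Suc q)) ----> stairs_speed \<alpha>"
  by (intro tendsto_sandwich[OF always_eventually 2 tendsto_const 1] allI)
 have "(%q. ?f q * upper_speed \<alpha> (Suc q)) ----> 1 * stairs_speed \<alpha>" by (intro tendsto_mult f1 u)
 moreover have "EV q. ?f q * upper_speed \<alpha> (Suc q) = lower_speed \<alpha> q"
  using eventually_ge_at_top[of 1] by eventually_elim (rule lower_speed_eq[symmetric])
 ultimately show "(%q. lower_speed \<alpha> q) ----> stairs_speed \<alpha>" by (subst (asm) tendsto_cong) simp_all
qed

end

section \<open>The speed of the branching random walk with a thin tail\<close>

context heavy_tail
begin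

text \<open>There are \<open>M\<close> blocks of \<open>r\<close> generations, about
  \<open>q\<close> of them to a takeover time. Lower bound: as L \<le> r q, jumps in blocks
  \<open>q + 1\<close> apart are more than \<open>L\<close> generations apart. Upper bound: jumps up
  to \<open>D\<close> are charged separately and tainted particles are counted for gap
  \<open>r * q\<close>.\<close>

lemma
 assumes int: "integrable \<nu> (%x. max 0 x)" and N: "N >= 1" and r: "r >= 1" and q: "q >= 1"
 shows speed_lower_blocks: "N <= 2 ^ L ==> L <= r * q ==> esep (Suc q) M (max_law \<nu>0 (2 * N * r)) <= v N * real (r * M + L)"
  and speed_upper_blocks: "0 <= D ==> v N * real (r * M) <= real (r * M) * D + esep q M (max_law \<nu>0 (2 * N * r))
   + real (r * M) * (4 * real N * 2 ^ (r * q) * (G D * (D * G D + excess D)))"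
proof -
 interpret X: nbrw_law N \<nu> "%x. max 0 x" using N by (intro nbrw_lawI) auto
 have m1: "2 * N * r >= 1" using N r by (metis mult_le_mono nat_mult_1 one_le_numeral)
 have cdf: "cdf (max_law \<nu>0 (2 * N * r)) z = measure X.gen {x\<in>space X.gen. X.gen_max x <= z} ^ r" for z
  unfolding X.measure_gen_max measure_pos_part_le by (simp only: cdf_max_law[OF real_distribution_\<nu>0 m1] cdf_\<nu>0 power_mult)
 have e: "(LINT w|X.S. sep_max g M (X.block_max r X.gen_max w)) = esep g M (max_law \<nu>0 (2 * N * r))" for g
  by (rule X.expectation_sep_max_block_max[OF X.gen_max_measurable r real_distribution_max_law[OF real_distribution_\<nu>0 m1] cdf])
 note ib = X.integrable_sep_max_block_max[OF X.integrable_gen_max[OF int]]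
 { assume NL: "N <= 2 ^ L" and Lrq: "L <= r * q"
  have "esep (Suc q) M (max_law \<nu>0 (2 * N * r)) <= (LINT w|X.S. X.lowest (jumps (%x. max 0 x) w) (r * M + L))"
   unfolding e[symmetric]
  proof (rule integral_mono[OF ib])
   show "integrable X.S (%w. X.lowest (jumps (%x. max 0 x) w) (r * M + L))"
    by (rule speed_array.L_integrable[OF X.speed_array_positions[OF int]])
   fix w
   have "sep_max (Suc q) M (X.block_max r X.gen_max w) <= sep_max (Suc (r * q)) (r * M) (%i. X.gen_max (w i))"
    by (intro sep_max_refine r X.block_max_attained)
   also have "... <= sep_max (Suc L) (r * M) (%i. X.gen_max (w i))" using Lrq by (intro sep_max_antimono) simp
   also have "... <= X.lowest (jumps (%x. max 0 x) w) (r * M + L)"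
   proof (rule X.J.sep_max_le_lowest[OF NL])
    fix s
    have "X.gen_max (w s) \<in> (%k. max 0 (w s k)) ` {1..2 * N}" unfolding X.gen_max_def using N by (intro Max_in) auto
    then show "\<exists>k\<in>{1..2 * N}. X.gen_max (w s) <= jumps (%x. max 0 x) w s k" unfolding jumps_def by (metis (no_types, lifting) imageE order_refl)
   qed
   finally show "sep_max (Suc q) M (X.block_max r X.gen_max w) <= X.lowest (jumps (%x. max 0 x) w) (r * M + L)" .
  qed
  also have "... <= v N * real (r * M + L)" unfolding v_def by (rule X.le_brw_speed[OF int])
  finally show "esep (Suc q) M (max_law \<nu>0 (2 * N * r)) <= v N * real (r * M + L)" . }
 assume D: "0 <= D"
 define \<phi> where "\<phi> x = (if D < x then x else 0)" for x :: real
 have \<phi>_meas: "\<phi> \<in> borel_measurable borel" unfolding \<phi>_def[abs_def] by measurable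
 interpret Y: nbrw_law N \<nu> \<phi> using D by (intro nbrw_lawI N \<phi>_meas) (simp add: \<phi>_def)
 have \<phi>_int: "integrable \<nu> \<phi>"
 proof (rule L1_bound[OF int])
  show "\<phi> \<in> borel_measurable \<nu>" using \<phi>_meas by simp
 qed (use D in \<open>auto simp: \<phi>_def\<close>)
 have \<phi>_alt: "\<phi> = (%x. if max 0 x > D then max 0 x else 0)" using D by (auto simp: \<phi>_def fun_eq_iff)
 have T: "(LINT x|\<nu>. \<phi> x) = D * G D + excess D" unfolding \<phi>_alt by (rule expectation_above[OF int D])
 have "{x. \<phi> x > 0} \<subseteq> {D<..}" by (auto simp: \<phi>_def split: if_splits)
 then have Gp: "measure \<nu> {x. \<phi> x > 0} <= G D" unfolding G_def by (intro finite_measure_mono) auto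
 have iy: "integrable X.S (%w. X.highest (jumps \<phi> w) n)" for n by (rule Y.integrable_highest[OF \<phi>_int])
 \<comment> \<open>The taint parameter \<open>d\<close> corresponds to the gap
   \<open>d + 1\<close>.\<close>
 have d: "Suc (r * q - 1) = r * q" using r q by (simp add: Suc_le_eq)
 have T0: "0 <= D * G D + excess D" unfolding T[symmetric] by (intro LINT_nonneg Y.\<phi>_nonneg)
 have "v N * real (r * M) <= (LINT w|X.S. X.highest (jumps (%x. max 0 x) w) (r * M))"
  unfolding v_def by (rule X.brw_speed_le[OF int])
 also have "... <= (LINT w|X.S. X.highest (jumps \<phi> w) (r * M) + (real (r * M) * D + (\<Sum>s<r * M. \<Sum>k=1..2 * N. 0)))"
 proof (intro integral_mono X.integrable_highest int L1_add iy)
  show "X.highest (jumps (%x. max 0 x) w) (r * M) <= X.highest (jumps \<phi> w) (r * M) + (real (r * M) * D + (\<Sum>s<r * M. \<Sum>k=1..2 * N. 0))" for w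
   using D by (intro X.highest_le_highest_plus[of \<phi> D "%_. 0"]) (auto simp: \<phi>_def)
 qed simp_all
 also have "... = (LINT w|X.S. X.highest (jumps \<phi> w) (r * M)) + real (r * M) * D"
  by (subst LINT_add[OF iy]) (simp_all add: X.P.prob_space)
 also have "(LINT w|X.S. X.highest (jumps \<phi> w) (r * M)) <= (LINT w|X.S. sep_max (Suc (r * q - 1)) (r * M) (Y.J.top_jump w))
   + real (r * M) * (4 * real N * 2 ^ (r * q - 1) * measure \<nu> {x. \<phi> x > 0} * (LINT x|\<nu>. \<phi> x))"
  by (rule Y.expectation_highest_le[OF \<phi>_int])
 also have "(LINT w|X.S. sep_max (Suc (r * q - 1)) (r * M) (Y.J.top_jump w)) <= esep q M (max_law \<nu>0 (2 * N * r))"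
  unfolding e[symmetric] d
 proof (intro integral_mono ib)
  show "integrable X.S (%w. sep_max (r * q) (r * M) (Y.J.top_jump w))"
   using X.integrable_sep_max_function[OF Y.integrable_gen_max[OF \<phi>_int], of "r * q" "r * M"]
   unfolding Y.top_jump_eq[abs_def] .
  fix w
  have "Y.J.top_jump w i <= X.block_max r X.gen_max w (i div r)" for i
  proof -
   have "\<phi> (w i k) <= X.gen_max (w i)" if "k \<in> {1..2 * N}" for k
    using that X.gen_max_le_iff[of "w i" "X.gen_max (w i)"] by (auto simp: \<phi>_def)
   then have "Y.gen_max (w i) <= X.gen_max (w i)" by (simp add: Y.gen_max_le_iff)
   also have "... <= X.block_max r X.gen_max w (i div r)" by (rule X.block_max_ge[OF r])
   finally show ?thesis unfolding Y.top_jump_eq .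
  qed
  then show "sep_max (r * q) (r * M) (Y.J.top_jump w) <= sep_max q M (X.block_max r X.gen_max w)"
   by (intro sep_max_coarsen r q)
 qed
 also have "real (r * M) * (4 * real N * 2 ^ (r * q - 1) * measure \<nu> {x. \<phi> x > 0} * (LINT x|\<nu>. \<phi> x))
  <= real (r * M) * (4 * real N * 2 ^ (r * q) * (G D * (D * G D + excess D)))"
 proof (rule mult_left_mono)
  have "4 * real N * (2 ^ (r * q - 1) * (measure \<nu> {x. \<phi> x > 0} * (D * G D + excess D)))
   <= 4 * real N * (2 ^ (r * q) * (G D * (D * G D + excess D)))"
   by (intro mult_left_mono mult_mono mult_right_mono Gp T0 mult_nonneg_nonneg power_increasing) auto
  then show "4 * real N * 2 ^ (r * q - 1) * measure \<nu> {x. \<phi> x > 0} * (LINT x|\<nu>. \<phi> x)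
   <= 4 * real N * 2 ^ (r * q) * (G D * (D * G D + excess D))" unfolding T by (simp only: mult.assoc)
 qed simp
 finally show "v N * real (r * M) <= real (r * M) * D + esep q M (max_law \<nu>0 (2 * N * r))
   + real (r * M) * (4 * real N * 2 ^ (r * q) * (G D * (D * G D + excess D)))" by linarith
qed

lemma esep_blocks_tendsto:
 assumes \<alpha>1: "\<alpha> > 1" and s: "\<sigma> > 0" and r: "(%N. real (r N) / log 2 (real N)) ----> \<sigma>"
 shows "(%N. esep g n (max_law \<nu>0 (2 * N * r N)) / c_scale h N) ----> esep g n (frechet \<alpha> \<sigma>)"
  and "EV N. r N >= 1 \<and> N >= 2 \<and> c_scale h N > 0 \<and> log 2 (real N) >= 1"
proof -
 have "EV N. real (r N) / log 2 (real N) > 0" by (rule order_tendstoD(1)[OF r s])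
 moreover have "EV N. N >= 2" by (rule eventually_ge_at_top)
 moreover have "EV N. c_scale h N > 0" using c_scale_at_top by (simp add: filterlim_at_top_dense)
 ultimately show ev: "EV N. r N >= 1 \<and> N >= 2 \<and> c_scale h N > 0 \<and> log 2 (real N) >= 1"
 proof eventually_elim
  case (elim N)
  then have "r N \<noteq> 0" by (intro notI) simp
  then show ?case using elim by (simp add: le_log_iff)
 qed
 \<comment> \<open>Makes the number of jumps positive for all \<open>N\<close>; eventually it is
   \<open>2 * N * r N\<close>.\<close>
 define m where "m N = max 1 (2 * N * r N)" for N
 have ev': "EV N. m N = 2 * N * r N \<and> real (r N) / log 2 (real N) = real (m N) / scale N"
  using ev
 proof eventually_elim
  case (elim N)
  then have "1 * 1 <= 2 * N * r N" by (intro mult_le_mono) auto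
  then have "m N = 2 * N * r N" by (simp add: m_def)
  then show ?case using elim by simp
 qed
 have "(%N. real (m N) / scale N) ----> \<sigma>"
  using r by (rule Lim_transform_eventually) (use ev' in eventually_elim, blast)
 then have "(%N. esep g n (max_law \<nu>0 (m N)) / c_scale h N) ----> esep g n (frechet \<alpha> \<sigma>)"
  by (intro esep_max_law_tendsto \<alpha>1 s) (simp add: m_def)
 then show "(%N. esep g n (max_law \<nu>0 (2 * N * r N)) / c_scale h N) ----> esep g n (frechet \<alpha> \<sigma>)"
  by (rule Lim_transform_eventually) (use ev' in \<open>eventually_elim, simp\<close>)
qed

lemma speed_eventually_greater:
 assumes \<alpha>1: "\<alpha> > 1" and int: "integrable \<nu> (%x. max 0 x)" and x: "x < stairs_speed \<alpha>"
 shows "EV N. x < v N * log 2 (real N) / c_scale h N"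
proof -
 have "EV q. x < lower_speed \<alpha> q \<and> q >= 1"
  by (intro eventually_conj order_tendstoD(1)[OF lower_speed_tendsto[OF \<alpha>1] x] eventually_ge_at_top)
 then obtain q where q: "x < lower_speed \<alpha> q" "q >= 1" by (auto dest: eventually_happens)
 let ?E = "%M. esep (Suc q) M (frechet \<alpha> (1 / real q))"
 \<comment> \<open>The final waiting time of one takeover amounts to \<open>q\<close> further
   blocks, hence the factor M / (M + q).\<close>
 have "(%M. real q * (?E M / real M) * (real M / (real M + real q))) ----> lower_speed \<alpha> q * 1"
 proof (intro tendsto_mult)
  show "(%M. real M / (real M + real q)) ----> 1" by real_asymp
  show "(%M. real q * (?E M / real M)) ----> lower_speed \<alpha> q"
   unfolding lower_speed_def by (intro tendsto_mult tendsto_const sep_law.esep_tendsto fr_law[OF \<alpha>1] q(2)) simp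
 qed
 then have "EV M. x < real q * (?E M / real M) * (real M / (real M + real q)) \<and> M >= 1"
  using q by (intro eventually_conj order_tendstoD(1) eventually_ge_at_top) auto
 then obtain M where M: "x < real q * (?E M / real M) * (real M / (real M + real q))" "M >= 1" by (auto dest: eventually_happens)
 \<comment> \<open>The added 1 and the rounding up ensure \<open>L N \<le> r N * q\<close>.\<close>
 define r where "r N = nat \<lceil>(log 2 (real N) + 1) / real q\<rceil>" for N
 define L where "L N = nat \<lceil>log 2 (real N)\<rceil>" for N
 have q0: "real q > 0" using q by simp
 have r: "(%N. real (r N) / log 2 (real N)) ----> 1 / real q" unfolding r_def using q0 by real_asymp (simp add: field_simps)
 have L: "(%N. real (L N) / log 2 (real N)) ----> 1" unfolding L_def by real_asymp
 have "(%N. (esep (Suc q) M (max_law \<nu>0 (2 * N * r N)) / c_scale h N) / ((real (r N) / log 2 (real N)) * real M + real (L N) / log 2 (real N)))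
  ----> ?E M / (1 / real q * real M + 1)"
  using q0 by (intro tendsto_divide esep_blocks_tendsto(1)[OF \<alpha>1 _ r] tendsto_add tendsto_mult tendsto_const r L) (auto simp: field_simps add_nonneg_eq_0_iff)
 moreover have "x < ?E M / (1 / real q * real M + 1)"
 proof -
  have "?E M / (1 / real q * real M + 1) = ?E M / ((real M + real q) / real q)" using q0 by (simp add: add_divide_distrib)
  also have "... = real q * (?E M / real M) * (real M / (real M + real q))" using q0 M by simp
  finally show ?thesis using M by simp
 qed
 ultimately have "EV N. x < (esep (Suc q) M (max_law \<nu>0 (2 * N * r N)) / c_scale h N) / ((real (r N) / log 2 (real N)) * real M + real (L N) / log 2 (real N))"
  by (rule order_tendstoD(1))
 moreover have "EV N. r N >= 1 \<and> N >= 2 \<and> c_scale h N > 0 \<and> log 2 (real N) >= 1"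
  using q0 by (intro esep_blocks_tendsto(2)[OF \<alpha>1 _ r]) simp
 ultimately show ?thesis
 proof eventually_elim
  case (elim N)
  let ?l = "log 2 (real N)"
  have "real N = 2 powr ?l" using elim by simp
  also have "... <= 2 powr real (L N)" using elim by (intro powr_mono) (auto simp: L_def)
  finally have NL: "N <= 2 ^ L N" by (simp add: powr_realpow)
  have "real (L N) <= ?l + 1" using elim unfolding L_def by linarith
  also have "?l + 1 = (?l + 1) / real q * real q" using q0 by simp
  also have "... <= real (r N) * real q" unfolding r_def by (intro mult_right_mono) (linarith, simp)
  finally have "real (L N) <= real (r N * q)" by simp
  then have Lr: "L N <= r N * q" by (simp only: of_nat_le_iff)
  define Z where "Z = real (r N * M + L N)"
  have "1 * 1 <= r N * M" using elim M by (intro mult_le_mono) auto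
  then have Z: "Z > 0" unfolding Z_def by linarith
  have "esep (Suc q) M (max_law \<nu>0 (2 * N * r N)) <= v N * Z"
   unfolding Z_def using elim by (intro speed_lower_blocks int q(2) NL Lr) auto
  then have "esep (Suc q) M (max_law \<nu>0 (2 * N * r N)) * ?l / (Z * c_scale h N) <= (v N * Z) * ?l / (Z * c_scale h N)"
   using elim Z by (intro divide_right_mono mult_right_mono) auto
  also have "... = v N * ?l / c_scale h N" using Z by simp
  also have "esep (Suc q) M (max_law \<nu>0 (2 * N * r N)) * ?l / (Z * c_scale h N)
   = (esep (Suc q) M (max_law \<nu>0 (2 * N * r N)) / c_scale h N) / ((real (r N) / ?l) * real M + real (L N) / ?l)"
  proof -
   have "(real (r N) / ?l) * real M + real (L N) / ?l = Z / ?l" by (simp add: Z_def add_divide_distrib)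
   then show ?thesis by simp
  qed
  finally show ?case using elim(1) by linarith
 qed
qed

lemma speed_eventually_less:
 assumes \<alpha>1: "\<alpha> > 1" and int: "integrable \<nu> (%x. max 0 x)" and x: "stairs_speed \<alpha> < x"
 shows "EV N. v N * log 2 (real N) / c_scale h N < x"
proof -
 have "(%k. 1 / real (k + 2) + upper_speed \<alpha> (Suc k) / (1 - 1 / real (k + 2))) ----> 0 + stairs_speed \<alpha> / (1 - 0)"
 proof (intro tendsto_add tendsto_divide tendsto_diff tendsto_const upper_speed_tendsto \<alpha>1)
  show "(%k. 1 / real (k + 2)) ----> 0" by real_asymp
  then show "(%k. 1 / real (k + 2)) ----> 0" .
 qed simp
 then have "EV k. 1 / real (k + 2) + upper_speed \<alpha> (Suc k) / (1 - 1 / real (k + 2)) < x"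
  using x by (intro order_tendstoD(2)) simp_all
 then obtain k where k: "1 / real (k + 2) + upper_speed \<alpha> (Suc k) / (1 - 1 / real (k + 2)) < x" by (auto dest: eventually_happens)
 \<comment> \<open>One index drives both parameters: the relative shortening \<open>e\<close> of the
   gap vanishes while the mesh \<open>q\<close> gets finer.\<close>
 define e where "e = 1 / real (k + 2)"
 define q where "q = Suc k"
 have e: "0 < e" "e < 1" and q: "q >= 1" and kx: "e + upper_speed \<alpha> q / (1 - e) < x" and q0: "real q > 0"
  using k by (auto simp: e_def q_def divide_less_eq)
 let ?E = "%M. esep q M (frechet \<alpha> (1 / real q))"
 have "(%M. e + real q * (?E M / real M) / (1 - e)) ----> e + upper_speed \<alpha> q / (1 - e)"
  unfolding upper_speed_def using e
  by (intro tendsto_add tendsto_divide tendsto_mult tendsto_const sep_law.esep_tendsto fr_law[OF \<alpha>1] q) auto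
 then have "EV M. e + real q * (?E M / real M) / (1 - e) < x \<and> M >= 1"
  using kx by (intro eventually_conj order_tendstoD(2) eventually_ge_at_top)
 then obtain M where M: "e + real q * (?E M / real M) / (1 - e) < x" "M >= 1" by (auto dest: eventually_happens)
 \<comment> \<open>Rounding down keeps \<open>r N * q\<close> below (1 - e) log2 N, so that
   \<open>2 ^ (r N * q)\<close> is at most N^(1 - e).\<close>
 define r where "r N = nat \<lfloor>(1 - e) * log 2 (real N) / real q\<rfloor>" for N
 have r: "(%N. real (r N) / log 2 (real N)) ----> (1 - e) / real q" unfolding r_def using q0 e by real_asymp (simp add: field_simps)
 have s: "0 < (1 - e) / real q" using e q0 by simp
 obtain C x0 where C: "C > 0" "x0 > 0" "\<And>D. x0 <= D ==> excess D <= C * (D * G D)" using excess_le[OF \<alpha>1] by blast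
 define \<beta> where "\<beta> = \<alpha> + 1"
 have \<beta>: "\<beta> > \<alpha>" "\<beta> > 0" using \<alpha> by (auto simp: \<beta>_def)
 obtain C' x1 where C': "C' > 0" "x1 > 0" "\<And>x s. x1 <= x ==> 1 <= s ==> G (x / s) <= C' * s powr \<beta> * G x"
  using G_potter_lower[OF \<beta>(1)] by blast
 \<comment> \<open>A bound for the taint error relative to \<open>c_scale h N / log 2 N\<close>. Two
   tails at \<open>D\<close> are each replaced by a power of log N times the tail at
   \<open>c_scale h N\<close> and normalised by \<open>scale N\<close>; what remains is N^(-e) up to
   logarithms.\<close>
 define err where "err N = (scale N * G (c_scale h N)) * (scale N * G (c_scale h N)) * ((2 + C) * C' * C' *
   (4 * real N * real N powr (1 - e) * log 2 (real N) * ((log 2 (real N) / e) powr \<beta> * (log 2 (real N) / e) powr \<beta>) / (scale N * scale N)))" for N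
 have err0: "err ----> (1 * 1) * ((2 + C) * C' * C' * 0)"
  unfolding err_def[abs_def]
 proof (intro tendsto_mult[of "%N. scale N * G (c_scale h N) * _ N"] tendsto_mult[of "%N. (2 + C) * C' * C'"] tendsto_const)
  have Gc: "(%N. scale N * G (c_scale h N)) ----> 1" using G_c_scale[of 1] by simp
  show "(%N. (scale N * G (c_scale h N)) * (scale N * G (c_scale h N))) ----> 1 * 1" by (intro tendsto_mult Gc)
  show "(%N. 4 * real N * real N powr (1 - e) * log 2 (real N) * ((log 2 (real N) / e) powr \<beta> * (log 2 (real N) / e) powr \<beta>) / (scale N * scale N)) ----> 0"
   using e \<beta> by real_asymp
 qed
 have "(%N. e + (esep q M (max_law \<nu>0 (2 * N * r N)) / c_scale h N) / ((real (r N) / log 2 (real N)) * real M) + err N)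
  ----> e + esep q M (frechet \<alpha> ((1 - e) / real q)) / ((1 - e) / real q * real M) + (1 * 1) * ((2 + C) * C' * C' * 0)"
  using s M q by (intro tendsto_divide esep_blocks_tendsto(1)[OF \<alpha>1 s r] tendsto_add tendsto_mult[OF r] tendsto_const err0) auto
 moreover have "e + esep q M (frechet \<alpha> ((1 - e) / real q)) / ((1 - e) / real q * real M) + (1 * 1) * ((2 + C) * C' * C' * 0) < x"
 proof -
  \<comment> \<open>The shortened blocks scale the weights by \<open>c\<close>; estimating
    \<open>c\<close> by 1 leaves only the factor 1 / (1 - e) from the shorter time.\<close>
  define c where "c = (1 - e) powr (1 / \<alpha>)"
  have c: "c > 0" "c <= 1" "c powr \<alpha> = 1 - e" using e \<alpha> by (auto simp: c_def powr_powr powr_le1)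
  interpret F: sep_law "frechet \<alpha> (1 / real q)" by (rule fr_law[OF \<alpha>1 q])
  have "frechet \<alpha> ((1 - e) / real q) = distr (frechet \<alpha> (1 / real q)) borel (%x. c * x)"
   using frechet_scale[of \<alpha> "1 / real q" c] c q0 \<alpha> by simp
  then have "esep q M (frechet \<alpha> ((1 - e) / real q)) = c * ?E M"
   using esep_scale[OF F.\<nu>_prob F.sets_\<nu>, of c] c by simp
  also have "... <= 1 * ?E M" using c by (intro mult_right_mono F.esep_nonneg) auto
  finally have "esep q M (frechet \<alpha> ((1 - e) / real q)) / ((1 - e) / real q * real M) <= ?E M / ((1 - e) / real q * real M)"
   using e by (intro divide_right_mono) auto
  also have "... = real q * (?E M / real M) / (1 - e)" using q0 by (simp add: mult.commute)
  finally show ?thesis using M(1) by simp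
 qed
 ultimately have "EV N. e + (esep q M (max_law \<nu>0 (2 * N * r N)) / c_scale h N) / ((real (r N) / log 2 (real N)) * real M) + err N < x"
  by (rule order_tendstoD(2))
 moreover have "EV N. r N >= 1 \<and> N >= 2 \<and> c_scale h N > 0 \<and> log 2 (real N) >= 1"
  by (rule esep_blocks_tendsto(2)[OF \<alpha>1 s r])
 moreover have "EV N. c_scale h N >= max x0 x1" using c_scale_at_top unfolding filterlim_at_top by blast
 ultimately show ?thesis
 proof eventually_elim
  case (elim N)
  define l where "l = log 2 (real N)"
  define c where "c = c_scale h N"
  \<comment> \<open>This threshold contributes exactly \<open>e\<close> to the normalised
    speed.\<close>
  define D where "D = e * c / l"
  define Z where "Z = real (r N * M)"
  have N: "N >= 2" and l: "l >= 1" and c: "c > 0" "c >= x0" "c >= x1" and rN: "r N >= 1" using elim by (auto simp: l_def c_def)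
  have D: "0 <= D" "D <= c"
  proof -
   have "e * c <= l * c" using e l c by (intro mult_right_mono) auto
   then show "D <= c" using l by (simp add: D_def divide_le_eq mult.commute)
  qed (use e c l in \<open>simp add: D_def\<close>)
  have GD: "G D <= C' * (l / e) powr \<beta> * G c"
  proof -
   have "G (c / (l / e)) <= C' * (l / e) powr \<beta> * G c" using C'(3)[OF c(3), of "l / e"] e l by (simp add: le_divide_eq)
   then show ?thesis by (simp add: D_def mult.commute)
  qed
  have "excess D <= excess c + (c - D) * G D" by (rule excess_ge[OF int D])
  moreover have "C * (c * G c) <= C * (c * G D)" using C c D by (intro mult_left_mono G_antimono) auto
  moreover have "0 <= c * G D" using c G_nonneg by simp
  ultimately have T: "D * G D + excess D <= (2 + C) * (c * G D)"
   using C(3)[OF c(2)] by (simp add: algebra_simps)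
  have "real (r N) * real q <= (1 - e) * l / real q * real q"
   using e l q0 unfolding r_def l_def[symmetric] by (intro mult_right_mono) (simp_all add: of_nat_nat)
  then have "real (r N * q) <= (1 - e) * l" using q0 by simp
  then have "2 powr real (r N * q) <= 2 powr ((1 - e) * l)" by (intro powr_mono) auto
  also have "... = (2 powr l) powr (1 - e)" by (simp add: powr_powr mult.commute)
  also have "2 powr l = real N" using N by (simp add: l_def)
  finally have P: "2 ^ (r N * q) <= real N powr (1 - e)" by (simp add: powr_realpow del: of_nat_mult)
  define Y where "Y = 4 * real N * 2 ^ (r N * q) * (G D * (D * G D + excess D))"
  have "Y <= 4 * real N * real N powr (1 - e) * (G D * ((2 + C) * (c * G D)))"
  proof -
   have "0 <= excess D" unfolding excess_def by (rule LINT_nonneg) simp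
   then show ?thesis unfolding Y_def
    using T P G_nonneg[of D] D C c by (intro mult_mono mult_left_mono mult_nonneg_nonneg add_nonneg_nonneg) auto
  qed
  also have "... = 4 * real N * real N powr (1 - e) * ((2 + C) * c) * (G D * G D)" by (simp add: mult_ac)
  also have "... <= 4 * real N * real N powr (1 - e) * ((2 + C) * c) * ((C' * (l / e) powr \<beta> * G c) * (C' * (l / e) powr \<beta> * G c))"
   using GD G_nonneg[of D] C c by (intro mult_left_mono mult_mono) (auto intro: order_trans)
  also have "... = err N * c / l"
   using l N unfolding err_def l_def[symmetric] c_def[symmetric] by (simp add: field_simps)
  finally have Y: "Y * l / c <= err N" using l c by (simp add: field_simps)
  have "1 * 1 <= r N * M" using rN M by (intro mult_le_mono) auto
  then have Z: "Z > 0" unfolding Z_def by linarith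
  have "v N * Z <= Z * D + esep q M (max_law \<nu>0 (2 * N * r N)) + Z * Y"
   unfolding Z_def Y_def using N rN by (intro speed_upper_blocks int q D(1)) auto
  then have "(v N * Z) * l / (Z * c) <= (Z * D + esep q M (max_law \<nu>0 (2 * N * r N)) + Z * Y) * l / (Z * c)"
   using l c Z by (intro divide_right_mono mult_right_mono) auto
  also have "... = e + (esep q M (max_law \<nu>0 (2 * N * r N)) / c) / (Z / l) + Y * l / c"
   using Z l c by (simp add: D_def add_divide_distrib distrib_right)
  also have "Z / l = (real (r N) / l) * real M" by (simp add: Z_def)
  finally have "v N * l / c <= e + (esep q M (max_law \<nu>0 (2 * N * r N)) / c) / ((real (r N) / l) * real M) + Y * l / c"
   using Z by simp
  then show ?case using Y elim(1) unfolding l_def c_def by linarith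
 qed
qed

theorem speed_thin:
 assumes \<alpha>1: "\<alpha> > 1" and int: "integrable \<nu> (%x. max 0 x)"
 shows "(%N. v N / (stairs_speed \<alpha> * c_scale h N / log 2 (real N))) ----> 1"
proof -
 have "(%N. v N * log 2 (real N) / c_scale h N) ----> stairs_speed \<alpha>"
  by (rule order_tendstoI) (auto intro: speed_eventually_greater speed_eventually_less assms)
 then have "(%N. v N * log 2 (real N) / c_scale h N / stairs_speed \<alpha>) ----> stairs_speed \<alpha> / stairs_speed \<alpha>"
  using stairs_speed_pos[OF \<alpha>1] by (intro tendsto_divide tendsto_const) auto
 then show ?thesis using stairs_speed_pos[OF \<alpha>1] by (simp add: mult.commute)
qed

end

section \<open>Maxima over blocks of generations\<close>

text \<open>Superadditivity splits the minimum into increments over disjoint, hence independent,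
  blocks of \<open>b\<close> generations.\<close>

lemma (in nbrw_law) laplace_lowest_le_power:
 assumes t: "0 <= t"
 shows "(\<integral>\<^sup>+w. ennreal (exp (- t * lowest (jumps \<phi> w) (k * b))) \<partial>S)
  <= (\<integral>\<^sup>+w. ennreal (exp (- t * lowest (jumps \<phi> w) b)) \<partial>S) ^ k"
proof (induction k)
 case 0
 then show ?case by (simp add: P.emeasure_space_1)
next
 case (Suc k)
 let ?e = "%w n. ennreal (exp (- t * lowest (jumps \<phi> w) n))"
 have "(\<integral>\<^sup>+w. ?e w (Suc k * b) \<partial>S) <= (\<integral>\<^sup>+w. ?e w b * ?e (shift b w) (k * b) \<partial>S)"
 proof (rule nn_integral_mono)
  fix w
  have "lowest (jumps \<phi> w) b + lowest (jumps \<phi> (shift b w)) (k * b) <= lowest (jumps \<phi> w) (Suc k * b)"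
   using lowest_superadd[of "jumps \<phi> w" b "k * b"] by (simp add: shift_jumps)
  then have "t * (lowest (jumps \<phi> w) b + lowest (jumps \<phi> (shift b w)) (k * b)) <= t * lowest (jumps \<phi> w) (Suc k * b)"
   using t by (rule mult_left_mono)
  then show "?e w (Suc k * b) <= ?e w b * ?e (shift b w) (k * b)"
   by (simp add: ennreal_mult[symmetric] exp_add[symmetric] distrib_left ennreal_leI)
 qed
 also have "... = (\<integral>\<^sup>+w. \<integral>\<^sup>+w'. ?e (comb_seq b w w') b * ?e (shift b (comb_seq b w w')) (k * b) \<partial>S \<partial>S)"
  by (rule nn_integral_comb_seq) measurable
 also have "... = (\<integral>\<^sup>+w. \<integral>\<^sup>+w'. ?e w b * ?e w' (k * b) \<partial>S \<partial>S)"
 proof (intro nn_integral_cong)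
  fix w w'
  have "lowest (jumps \<phi> (comb_seq b w w')) b = lowest (jumps \<phi> w) b"
   unfolding lowest_def using N by (intro nbrw_cong) (auto simp: jumps_def comb_seq_less)
  moreover have "shift b (comb_seq b w w') = w'" by (auto simp: shift_def comb_seq_def)
  ultimately show "?e (comb_seq b w w') b * ?e (shift b (comb_seq b w w')) (k * b) = ?e w b * ?e w' (k * b)" by simp
 qed
 also have "... = (\<integral>\<^sup>+w. ?e w b \<partial>S) * (\<integral>\<^sup>+w'. ?e w' (k * b) \<partial>S)"
  by (subst nn_integral_cmult, measurable, subst nn_integral_multc, measurable)
 also have "... <= (\<integral>\<^sup>+w. ?e w b \<partial>S) * (\<integral>\<^sup>+w. ?e w b \<partial>S) ^ k" by (intro mult_left_mono Suc) simp
 finally show ?case by simp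
qed

lemma (in nbrw_law) block_max_le_lowest:
 assumes l: "N <= 2 ^ l" and p: "p >= 1"
 shows "block_max p gen_max w 0 <= lowest (jumps \<phi> w) (p + l)"
 unfolding block_max_le_iff[OF p]
proof
 fix s assume "s \<in> {0 * p..<0 * p + p}"
 then have "(\<Sum>i\<in>{s}. gen_max (w i)) <= sep_max (Suc l) p (%i. gen_max (w i))"
  by (intro sep_max_ge) (auto simp: separated_def)
 also have "... <= lowest (jumps \<phi> w) (p + l)"
 proof (rule J.sep_max_le_lowest[OF l])
  fix s
  have "gen_max (w s) \<in> (%k. \<phi> (w s k)) ` {1..2 * N}" unfolding gen_max_def using N by (intro Max_in) auto
  then obtain k where k: "k \<in> {1..2 * N}" "gen_max (w s) = \<phi> (w s k)" by blast
  show "\<exists>k\<in>{1..2 * N}. gen_max (w s) <= jumps \<phi> w s k" by (rule bexI[OF _ k(1)]) (simp add: jumps_def k(2))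
 qed
 finally show "gen_max (w s) <= lowest (jumps \<phi> w) (p + l)" by simp
qed

section \<open>Bounds from a single block maximum\<close>

context heavy_tail
begin

text \<open>A Bonferroni bound: 1 - (1 - g)^m is g times a geometric sum whose \<open>m\<close>
  terms are all at least 1 - m g.\<close>

lemma max_law_tail:
 assumes m: "m >= 1" and B: "0 <= B" "B <= y"
 shows "real m * (1 - real m * G B) * G y <= 1 - cdf (max_law \<nu>0 m) y"
proof -
 have "(1 - real m * G y) * (real m * G y) = (\<Sum>j<m. 1 - real m * G y) * G y" by simp
 also have "... <= (\<Sum>j<m. (1 - G y) ^ j) * G y"
 proof (intro mult_right_mono sum_mono G_nonneg)
  fix j assume "j \<in> {..<m}"
  then have "real j * G y <= real m * G y" by (intro mult_right_mono G_nonneg) simp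
  moreover have "1 + real j * (- G y) <= (1 + (- G y)) ^ j" by (rule Bernoulli_inequality) (use G_le_1[of y] in simp)
  ultimately show "1 - real m * G y <= (1 - G y) ^ j" by simp
 qed
 also have "... = 1 - (1 - G y) ^ m" using one_diff_power_eq[of "1 - G y" m] by (simp add: mult.commute)
 also have "... = 1 - cdf (max_law \<nu>0 m) y" using B by (simp add: cdf_max_law[OF real_distribution_\<nu>0 m] cdf_\<nu>0)
 finally have "(1 - real m * G y) * (real m * G y) <= 1 - cdf (max_law \<nu>0 m) y" .
 moreover have "real m * G y <= real m * G B" using B by (intro mult_left_mono G_antimono) auto
 then have "(1 - real m * G B) * (real m * G y) <= (1 - real m * G y) * (real m * G y)"
  by (intro mult_right_mono mult_nonneg_nonneg G_nonneg) auto
 ultimately show ?thesis by (simp add: mult_ac)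
qed

lemma expectation_max_law_ge:
 assumes int: "integrable \<nu> (%x. max 0 x)" and m: "m >= 1" and B: "0 <= B" "real m * G B <= 1"
 shows "real m * (1 - real m * G B) * excess B <= (LINT x|(max_law \<nu>0 m). x)"
proof -
 interpret L: real_distribution "max_law \<nu>0 m" by (rule real_distribution_max_law[OF real_distribution_\<nu>0 m])
 have e0: "0 <= excess B" unfolding excess_def by (rule LINT_nonneg) simp
 note i = integrable_max_law[OF int m order_refl] and ae = AE_nonneg_max_law[OF int m order_refl]
 have iB: "integrable (max_law \<nu>0 m) (%x. max 0 (x - B))"
  by (intro integrable_max integrable_zero L1_diff i) simp
 have "ennreal (real m * (1 - real m * G B) * excess B) = (\<integral>\<^sup>+y. ennreal (real m * (1 - real m * G B)) * (ennreal (G y) * indicator {B<..} y) \<partial>lborel)"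
  using B e0 by (subst nn_integral_cmult) (simp_all add: ennreal_excess[OF int, symmetric] ennreal_mult)
 also have "... <= (\<integral>\<^sup>+y. ennreal (1 - cdf (max_law \<nu>0 m) y) * indicator {B<..} y \<partial>lborel)"
  using B by (intro nn_integral_mono) (auto simp: indicator_def ennreal_mult[symmetric] G_nonneg intro!: ennreal_leI max_law_tail[OF m])
 also have "... = ennreal (LINT x|(max_law \<nu>0 m). max 0 (x - B))"
  unfolding L.nn_integral_pos_part[symmetric] by (rule nn_integral_eq_integral[OF iB]) simp
 finally have "real m * (1 - real m * G B) * excess B <= (LINT x|(max_law \<nu>0 m). max 0 (x - B))"
  by (subst (asm) ennreal_le_iff) (auto intro!: LINT_nonneg)
 also have "... <= (LINT x|(max_law \<nu>0 m). x)"
  by (rule integral_mono_AE[OF iB i]) (use ae B in \<open>auto elim: eventually_mono\<close>)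
 finally show ?thesis .
qed

lemma speed_lower_max:
 assumes int: "integrable \<nu> (%x. max 0 x)" and N: "N >= 1" and L: "N <= 2 ^ L" and r: "r >= 1"
  and B: "0 <= B" "2 * real N * real r * G B <= 1"
 shows "2 * real N * real r * (1 - 2 * real N * real r * G B) * excess B <= v N * real (r + L)"
proof -
 have m: "2 * N * r >= 1" using N r by (metis mult_le_mono nat_mult_1 one_le_numeral)
 \<comment> \<open>A single block meets no gap condition, so \<open>speed_lower_blocks\<close> may
   be used with \<open>q = Suc L\<close>, for which this inequality holds.\<close>
 have L': "L <= r * Suc L" using r mult_le_mono1[of 1 r "Suc L"] by simp
 interpret F: sep_law "max_law \<nu>0 (2 * N * r)"
  using real_distribution_max_law[OF real_distribution_\<nu>0 m] integrable_max_law[OF int m order_refl]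
  by (simp add: sep_law_def real_distribution_def real_distribution_axioms_def)
 have "2 * real N * real r * (1 - 2 * real N * real r * G B) * excess B <= (\<integral>x. x \<partial>max_law \<nu>0 (2 * N * r))"
  using expectation_max_law_ge[OF int m B(1)] B(2) by simp
 also have "... = (LINT w|F.S. (\<Sum>i\<in>{0}. w i))" by (simp add: F.expectation_component)
 also have "... <= esep (Suc (Suc L)) 1 (max_law \<nu>0 (2 * N * r))"
  unfolding esep_def by (intro integral_mono L1_sum F.integrable_component F.integrable_sep_max sep_max_ge)
   (auto simp: separated_def)
 also have "... <= v N * real (r * 1 + L)" by (rule speed_lower_blocks[OF int N r _ L L']) simp
 finally show ?thesis by simp
qed

theorem speed_boundary:
 assumes int: "integrable \<nu> (%x. max 0 x)" and \<alpha>1: "\<alpha> = 1"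
 shows "(%N. v N / (2 * real N * excess (c_scale h N))) ----> 1"
proof -
 let ?c = "c_scale h" and ?l = "%N. log 2 (real N)"
 let ?r = "%N. ?c N * G (?c N) / excess (?c N)"
 have r0: "?r ----> 0"
  using tendsto_inverse_0_at_top[OF filterlim_compose[OF excess_dominates[OF int \<alpha>1] c_scale_at_top]] by simp
 have Gc: "(%N. scale N * G (?c N)) ----> 1" using G_c_scale[of 1] by simp
 have cpos: "EV N. ?c N > 0" using c_scale_at_top by (simp add: filterlim_at_top_dense)
 have "filterlim (%N. excess (?c N) / (?c N * G (?c N))) at_top sequentially"
  by (rule filterlim_compose[OF excess_dominates[OF int \<alpha>1] c_scale_at_top])
 then have "EV N. excess (?c N) / (?c N * G (?c N)) > 0" by (simp add: filterlim_at_top_dense)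
 with cpos have epos: "EV N. excess (?c N) > 0"
 proof eventually_elim
  case (elim N)
  have "0 < ?c N * G (?c N)" using elim G_pos by (intro mult_pos_pos) auto
  then show ?case using elim(2) by (simp only: zero_less_divide_iff) linarith
 qed
 have N2: "EV N. N >= 2" by (rule eventually_ge_at_top)
 obtain C x0 where C: "C > 0" "x0 > 0" "\<And>x s. x0 <= x ==> 1 <= s ==> G (x / s) <= C * s powr 2 * G x"
  using G_potter_lower[of 2] \<alpha>1 by auto
 \<comment> \<open>Blocks of half a takeover time: \<open>2 ^ q N\<close> is of order sqrt N, which
   the factor 1 / N from the second tail beats. The gap need not be sharp here, because
   \<open>c / q N\<close> is negligible against \<open>2 * N * excess c\<close>.\<close>
 define q where "q N = nat \<lceil>?l N / 2\<rceil>" for N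
 define E where "E N = (?r N / (scale N * G (?c N))) * 3
  + 4 * C * sqrt (real N) * (?l N)\<^sup>2 * ((scale N * G (?c N)) / scale N) * (2 * C * (?l N)\<^sup>2 * ?r N + 1)" for N
 have upper: "EV N. v N / (2 * real N * excess (?c N)) <= 1 + E N"
  using cpos epos N2 filterlim_at_top[THEN iffD1, OF c_scale_at_top, rule_format, of x0]
 proof eventually_elim
  case (elim N)
  define l where "l = ?l N"
  define c where "c = ?c N"
  define D where "D = c / l"
  have l: "l >= 1" and c: "c > 0" "x0 <= c" and e: "excess c > 0" and N: "N >= 2" using elim by (auto simp: l_def c_def le_log_iff)
  have q: "q N >= 1" "l / 2 <= real (q N)" "real (q N) <= l / 2 + 1" using l unfolding q_def l_def by linarith+
  have D: "0 <= D" "D <= c" using c l mult_left_mono[OF l, of c] by (auto simp: D_def divide_le_eq)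
  have "2 ^ q N = 2 powr real (q N)" by (simp add: powr_realpow)
  also have "... <= 2 powr (l / 2 + 1)" using q by (intro powr_mono) auto
  also have "... = 2 * (2 powr l) powr (1 / 2)" by (simp add: powr_powr powr_add)
  also have "... = 2 * sqrt (real N)" using N by (simp add: l_def powr_half_sqrt)
  finally have 2: "2 ^ q N <= 2 * sqrt (real N)" .
  have GD: "G D <= C * l\<^sup>2 * G c" using C(3)[OF c(2) l] l by (simp add: D_def powr_numeral)
  have "excess D <= excess c + (c - D) * G D" by (rule excess_ge[OF int D])
  then have T: "D * G D + excess D <= c * G D + excess c" by (simp add: algebra_simps)
  also have "... <= c * (C * l\<^sup>2 * G c) + excess c" using GD c by (intro add_right_mono mult_left_mono) auto
  finally have T: "D * G D + excess D <= c * (C * l\<^sup>2 * G c) + excess c" .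
  have m: "2 * N * q N >= 1" using N q by (metis mult_le_mono nat_mult_1 one_le_numeral order_trans)
  interpret F: sep_law "max_law \<nu>0 (2 * N * q N)"
   using real_distribution_max_law[OF real_distribution_\<nu>0 m] integrable_max_law[OF int m order_refl]
   by (simp add: sep_law_def real_distribution_def real_distribution_axioms_def)
  have ic: "integrable (max_law \<nu>0 (2 * N * q N)) (%x. max 0 (x - c))"
   by (intro integrable_max integrable_zero L1_diff F.\<nu>_integrable) simp
  \<comment> \<open>With one block the separated sum is a single maximum. It is split at
    \<open>c\<close>, so that only its excess counts, which is at most the sum of the excesses of
    the jumps.\<close>
  have "esep 1 1 (max_law \<nu>0 (2 * N * q N)) <= (LINT w|F.S. c + max 0 (w 0 - c))"
   unfolding esep_def
  proof (rule integral_mono[OF F.integrable_sep_max])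
   show "integrable F.S (%w. c + max 0 (w 0 - c))"
    by (intro L1_add F.integrable_component_function[OF ic]) simp
   show "sep_max 1 1 w <= c + max 0 (w 0 - c)" for w :: "nat => real"
    by (rule sep_max_leI) (use c in \<open>auto simp: subset_singleton_iff lessThan_Suc One_nat_def max_def\<close>)
  qed
  also have "... = c + (\<integral>x. max 0 (x - c) \<partial>max_law \<nu>0 (2 * N * q N))"
   by (subst LINT_add[OF _ F.integrable_component_function[OF ic]])
    (simp_all add: F.P.prob_space F.expectation_component_function[OF borel_measurable_integrable[OF ic]])
  also have "... <= c + 2 * real N * real (q N) * excess c"
   using excess_max_law[OF int m less_imp_le[OF c(1)]] by simp
  finally have es: "esep 1 1 (max_law \<nu>0 (2 * N * q N)) <= c + 2 * real N * real (q N) * excess c" .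
  have "4 * real N * 2 ^ (q N * 1) * (G D * (D * G D + excess D)) <= 4 * real N * (2 * sqrt (real N)) * ((C * l\<^sup>2 * G c) * (c * (C * l\<^sup>2 * G c) + excess c))"
   using 2 GD T D c e C G_nonneg[of c] G_nonneg[of D] excess_nonneg[of D]
   by (intro mult_mono mult_nonneg_nonneg add_nonneg_nonneg) auto
  then have "real (q N) * (4 * real N * 2 ^ (q N * 1) * (G D * (D * G D + excess D)))
   <= real (q N) * (4 * real N * (2 * sqrt (real N)) * ((C * l\<^sup>2 * G c) * (c * (C * l\<^sup>2 * G c) + excess c)))"
   by (rule mult_left_mono) simp
  moreover have "v N * real (q N * 1) <= real (q N * 1) * D + esep 1 1 (max_law \<nu>0 (2 * N * q N)) + real (q N * 1) * (4 * real N * 2 ^ (q N * 1) * (G D * (D * G D + excess D)))"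
   using N q D by (intro speed_upper_blocks int) auto
  ultimately have "v N * real (q N) <= real (q N) * (D + c / real (q N) + 2 * real N * excess c
   + 4 * real N * (2 * sqrt (real N)) * ((C * l\<^sup>2 * G c) * (c * (C * l\<^sup>2 * G c) + excess c)))"
   using es q by (simp add: distrib_left mult_ac)
  then have "v N <= D + c / real (q N) + 2 * real N * excess c + 4 * real N * (2 * sqrt (real N)) * ((C * l\<^sup>2 * G c) * (c * (C * l\<^sup>2 * G c) + excess c))"
   using q by (simp add: mult.commute)
  also have "c / real (q N) <= c / (l / 2)" using q l c by (intro divide_left_mono) auto
  finally have "v N / (2 * real N * excess c) <= (D + c / (l / 2) + 2 * real N * excess c + 4 * real N * (2 * sqrt (real N)) * ((C * l\<^sup>2 * G c) * (c * (C * l\<^sup>2 * G c) + excess c))) / (2 * real N * excess c)"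
   using e N by (intro divide_right_mono) auto
  also have "... <= 1 + E N"
  proof -
   have Gc0: "G c > 0" by (rule G_pos)
   have 1: "(D + c / (l / 2)) / (2 * real N * excess c) = (c * G c / excess c / (2 * real N * l * G c)) * 3"
    using l e N Gc0 by (simp add: D_def field_simps)
   have 3: "4 * real N * (2 * sqrt (real N)) * ((C * l\<^sup>2 * G c) * (c * (C * l\<^sup>2 * G c) + excess c)) / (2 * real N * excess c)
    = 4 * C * sqrt (real N) * l\<^sup>2 * G c * (C * l\<^sup>2 * (c * G c / excess c) + 1)"
    using e N by (simp add: field_simps)
   have "C * l\<^sup>2 * (c * G c / excess c) <= 2 * C * l\<^sup>2 * (c * G c / excess c)"
    using C c e Gc0 by (intro mult_right_mono) auto
   then have "4 * C * sqrt (real N) * l\<^sup>2 * G c * (C * l\<^sup>2 * (c * G c / excess c) + 1) <= 4 * C * sqrt (real N) * l\<^sup>2 * G c * (2 * C * l\<^sup>2 * (c * G c / excess c) + 1)"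
    using C Gc0 by (intro mult_left_mono) auto
   then show ?thesis
    using l e N unfolding E_def c_def[symmetric] l_def[symmetric] add_divide_distrib 3 1[unfolded add_divide_distrib] by simp
  qed
  finally show ?case unfolding c_def .
 qed
 have E0: "E ----> 0"
 proof -
  have s1: "(%N. sqrt (real N) * (?l N)\<^sup>2 / scale N) ----> 0" and s2: "(%N. sqrt (real N) * (?l N)\<^sup>2 / scale N * (?l N)\<^sup>2) ----> 0" by real_asymp+
  have "(%N. (?r N / (scale N * G (?c N))) * 3 + 4 * C * (scale N * G (?c N)) * (2 * C * ?r N * (sqrt (real N) * (?l N)\<^sup>2 / scale N * (?l N)\<^sup>2) + sqrt (real N) * (?l N)\<^sup>2 / scale N))
   ----> (0 / 1) * 3 + 4 * C * 1 * (2 * C * 0 * 0 + 0)"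
   by (intro tendsto_add tendsto_mult tendsto_divide tendsto_const r0 Gc s1 s2) simp
  moreover have "4 * C * q * L * (X / S) * (2 * C * L * r + 1) = 4 * C * X * (2 * C * r * (q * L / S * L) + q * L / S)" for q L X S r
   by (simp add: algebra_simps add_divide_distrib)
  ultimately show ?thesis
   unfolding E_def[abs_def] by (simp only: div_by_1 mult_zero_left mult_zero_right add_0_right)
 qed
 show ?thesis
 proof (rule order_tendstoI)
  fix x :: real assume "1 < x"
  then have "EV N. E N < x - 1" by (intro order_tendstoD(2)[OF E0]) auto
  with upper show "EV N. v N / (2 * real N * excess (?c N)) < x"
   by eventually_elim linarith
 next
  fix x :: real assume x: "x < 1"
  have "(%k::nat. real k / (real k + 1) * (1 - 1 / real k)) ----> 1" by real_asymp
  then have "EV k. x < real k / (real k + 1) * (1 - 1 / real k) \<and> k >= 2"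
   using x by (intro eventually_conj order_tendstoD(1) eventually_ge_at_top)
  then obtain k where k: "x < real k / (real k + 1) * (1 - 1 / real k)" "k >= 2" by (auto dest: eventually_happens)
  \<comment> \<open>Blocks of \<open>k\<close> takeover times lose the fraction 1 / (k + 1) to
    waiting. With level \<open>K * c\<close> the expected number of larger jumps in a block is about
    k / K = 1 / k, while the excess at \<open>K * c\<close> is still asymptotic to that at
    \<open>c\<close>.\<close>
  define K where "K = real k ^ 2"
  have K: "K >= 1" using k by (simp add: K_def)
  define L where "L N = nat \<lceil>?l N\<rceil>" for N
  define g where "g N = (scale N * G (K * ?c N)) * (real k * (real (L N) / ?l N))" for N
  have "(%N. real (L N) / ?l N) ----> 1" unfolding L_def by real_asymp
  then have "g ----> K powr (- \<alpha>) * (real k * 1)"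
   unfolding g_def[abs_def] using K by (intro tendsto_mult tendsto_const G_c_scale) auto
  also have "K powr (- \<alpha>) * (real k * 1) = 1 / real k" using K k \<alpha>1 by (simp add: powr_minus K_def power2_eq_square divide_inverse)
  finally have g: "g ----> 1 / real k" .
  have "(%N. real k / (real k + 1) * (1 - g N) * (1 - (K - 1) * ?r N)) ----> real k / (real k + 1) * (1 - 1 / real k) * (1 - (K - 1) * 0)"
   by (intro tendsto_mult tendsto_diff tendsto_const g r0)
  then have "EV N. x < real k / (real k + 1) * (1 - g N) * (1 - (K - 1) * ?r N)"
   by (rule order_tendstoD(1)) (use k in simp)
  moreover have "EV N. g N < 1" by (rule order_tendstoD(2)[OF g]) (use k in simp)
  ultimately show "EV N. x < v N / (2 * real N * excess (?c N))"
   using cpos epos N2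
  proof eventually_elim
   case (elim N)
   have l1: "?l N >= 1" using elim by (simp add: le_log_iff)
   have "real N = 2 powr ?l N" using elim by simp
   also have "... <= 2 powr real (L N)" using l1 by (intro powr_mono) (auto simp: L_def)
   finally have NL: "N <= 2 ^ L N" by (simp add: powr_realpow)
   have L1: "L N >= 1" using l1 unfolding L_def by linarith
   define r where "r = k * L N"
   have "1 * 1 <= k * L N" using k L1 by (intro mult_le_mono) auto
   then have r1: "r >= 1" by (simp add: r_def)
   have gr: "2 * real N * real r * G (K * ?c N) = g N" using l1 by (simp add: g_def r_def)
   have 1: "excess (?c N) - (K - 1) * ?c N * G (?c N) <= excess (K * ?c N)"
   proof -
    have "?c N <= K * ?c N" using mult_right_mono[of 1 K "?c N"] K elim by simp
    then have "excess (?c N) <= excess (K * ?c N) + (K * ?c N - ?c N) * G (?c N)"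
     using elim by (intro excess_ge int) auto
    then show ?thesis by (simp add: algebra_simps)
   qed
   define D where "D = 2 * real N * real r * (1 - g N)"
   have D: "0 <= D" using elim by (simp add: D_def)
   have "D * (excess (?c N) - (K - 1) * ?c N * G (?c N)) <= D * excess (K * ?c N)" by (rule mult_left_mono[OF 1 D])
   also have "... <= v N * real (r + L N)"
    using speed_lower_max[OF int _ NL r1, of "K * ?c N"] elim K unfolding gr D_def by simp
   also have "real (r + L N) = real r * ((real k + 1) / real k)" using k by (simp add: r_def field_simps)
   finally have "D * (excess (?c N) - (K - 1) * ?c N * G (?c N)) / (real r * ((real k + 1) / real k)) <= v N"
    using r1 k by (subst pos_divide_le_eq) (auto intro!: mult_pos_pos)
   then have "D * (excess (?c N) - (K - 1) * ?c N * G (?c N)) / (real r * ((real k + 1) / real k)) / (2 * real N * excess (?c N)) <= v N / (2 * real N * excess (?c N))"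
    using elim by (intro divide_right_mono) auto
   also have "D * (excess (?c N) - (K - 1) * ?c N * G (?c N)) / (real r * ((real k + 1) / real k)) / (2 * real N * excess (?c N))
    = real k / (real k + 1) * (1 - g N) * ((excess (?c N) - (K - 1) * ?c N * G (?c N)) / excess (?c N))"
    using elim r1 by (simp add: D_def)
   also have "(excess (?c N) - (K - 1) * ?c N * G (?c N)) / excess (?c N) = 1 - (K - 1) * ?r N"
    using elim by (simp add: diff_divide_distrib)
   finally show ?case using elim(1) by linarith
  qed
 qed
qed

text \<open>Layer cake with the density t exp (- t y): above \<open>B\<close> the tail of the
  maximum is nearly \<open>m\<close> times that of a jump, and the part below \<open>B\<close> costs
  at most \<open>t * B\<close>.\<close>

lemma laplace_max_law_ge:
 assumes m: "m >= 1" and t: "t > 0" and B: "0 <= B" "real m * G B <= 1"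
 shows "real m * (1 - real m * G B) * (lap_exp t - t * B) <= (LINT x|(max_law \<nu>0 m). 1 - exp (- t * max 0 x))"
proof -
 interpret L: real_distribution "max_law \<nu>0 m" by (rule real_distribution_max_law[OF real_distribution_\<nu>0 m])
 define \<delta> where "\<delta> = real m * (1 - real m * G B)"
 have \<delta>: "0 <= \<delta>" using B by (simp add: \<delta>_def)
 define \<Lambda> where "\<Lambda> = (LINT x|(max_law \<nu>0 m). 1 - exp (- t * max 0 x))"
 have iL: "integrable (max_law \<nu>0 m) (%x. 1 - exp (- t * max 0 x))"
  using t by (intro L.integrable_const_bound[where B=1]) (auto simp: mult_nonneg_nonneg)
 have "ennreal (\<delta> * lap_exp t) = (\<integral>\<^sup>+y. ennreal \<delta> * (ennreal (t * exp (- t * y) * G y) * indicator {0<..} y) \<partial>lborel)"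
  unfolding ennreal_mult[OF \<delta> lap_exp_nonneg[OF less_imp_le[OF t]]]
  using nn_integral_eq_integral[OF lap_exp_integrable[OF less_imp_le[OF t]]] t nn_integral_laplace[OF t, folded G_eq_cdf]
  by (subst nn_integral_cmult) (simp_all add: lap_exp_def)
 also have "... <= (\<integral>\<^sup>+y. ennreal (t * exp (- t * y) * (1 - cdf (max_law \<nu>0 m) y)) * indicator {0<..} y + ennreal (\<delta> * t) * indicator {0<..B} y \<partial>lborel)"
 proof (rule nn_integral_mono)
  fix y :: real
  consider "y <= 0" | "0 < y" "y <= B" | "0 < y" "B < y" by linarith
  then show "ennreal \<delta> * (ennreal (t * exp (- t * y) * G y) * indicator {0<..} y)
   <= ennreal (t * exp (- t * y) * (1 - cdf (max_law \<nu>0 m) y)) * indicator {0<..} y + ennreal (\<delta> * t) * indicator {0<..B} y"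
  proof cases
   case 2
   have "exp (- t * y) * G y <= 1 * 1" using t 2 by (intro mult_mono G_le_1 G_nonneg) (auto simp: mult_nonneg_nonneg)
   then have "\<delta> * (t * (exp (- t * y) * G y)) <= \<delta> * (t * 1)" using t \<delta> by (intro mult_left_mono) auto
   then have "ennreal \<delta> * ennreal (t * exp (- t * y) * G y) <= ennreal (\<delta> * t)"
    using t \<delta> by (simp add: ennreal_mult[symmetric] G_nonneg ennreal_leI mult_ac)
   then show ?thesis using 2 by (simp add: add_increasing)
  next
   case 3
   have "\<delta> * G y <= 1 - cdf (max_law \<nu>0 m) y" unfolding \<delta>_def using 3 B by (intro max_law_tail[OF m]) auto
   then have "t * exp (- t * y) * (\<delta> * G y) <= t * exp (- t * y) * (1 - cdf (max_law \<nu>0 m) y)" using t by (intro mult_left_mono) auto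
   then show ?thesis using 3 t \<delta> by (simp add: ennreal_mult[symmetric] G_nonneg ennreal_leI mult_ac)
  qed simp
 qed
 also have "... = ennreal \<Lambda> + ennreal (\<delta> * t * B)"
 proof -
  have "(\<integral>\<^sup>+y. ennreal (\<delta> * t) * indicator {0<..B} y \<partial>lborel) = ennreal (\<delta> * t * B)"
   using B \<delta> t by (simp add: nn_integral_cmult_indicator ennreal_mult[symmetric])
  moreover have "(\<integral>\<^sup>+y. ennreal (t * exp (- t * y) * (1 - cdf (max_law \<nu>0 m) y)) * indicator {0<..} y \<partial>lborel) = ennreal \<Lambda>"
   unfolding L.nn_integral_laplace[OF t, symmetric] \<Lambda>_def using t by (intro nn_integral_eq_integral[OF iL]) simp
  ultimately show ?thesis by (subst nn_integral_add) (use L.cdf_measurable in simp_all)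
 qed
 finally have low: "\<delta> * (lap_exp t - t * B) <= \<Lambda>"
 proof -
  have L0: "0 <= \<Lambda>" unfolding \<Lambda>_def using t by (intro LINT_nonneg) simp
  assume "ennreal (\<delta> * lap_exp t) <= ennreal \<Lambda> + ennreal (\<delta> * t * B)"
  then have "\<delta> * lap_exp t <= \<Lambda> + \<delta> * t * B" using L0 \<delta> t B by (simp add: ennreal_plus[symmetric] del: ennreal_plus)
  then show ?thesis by (simp add: algebra_simps)
 qed
 then show ?thesis unfolding \<delta>_def \<Lambda>_def .
qed

text \<open>A block consists of \<open>p\<close> generations, of which the largest jump is used, and
  of \<open>N\<close> generations for the takeover, enough since
  \<open>N \<le> 2 ^ N\<close>.\<close>

lemma laplace_lowest_le:
 assumes N: "N >= 1" and p: "p >= 1" and t: "t > 0" and B: "0 <= B" "2 * real N * real p * G B <= 1"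
 shows "(\<integral>w. exp (- t * population.lowest N (jumps (%x. max 0 x) w) (k * (p + N))) \<partial>(\<Pi>\<^sub>M i\<in>UNIV. \<Pi>\<^sub>M k\<in>{1..2 * N}. \<nu>))
  <= exp (- (real k * (2 * real N * real p * (1 - 2 * real N * real p * G B) * (lap_exp t - t * B))))"
proof -
 have em: "(%x. ennreal (exp (- t * max 0 x))) \<in> borel_measurable borel" by measurable
 interpret X: nbrw_law N \<nu> "%x. max 0 x" using N by (intro nbrw_lawI) auto
 let ?J = "jumps (%x. max 0 x)"
 define m where "m = 2 * N * p"
 have m: "m >= 1" unfolding m_def using N p by (metis mult_le_mono nat_mult_1 one_le_numeral)
 have rm: "real m = 2 * real N * real p" by (simp add: m_def)
 interpret L: real_distribution "max_law \<nu>0 m" by (rule real_distribution_max_law[OF real_distribution_\<nu>0 m])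
 define \<delta> where "\<delta> = real m * (1 - real m * G B)"
 define \<Lambda> where "\<Lambda> = (LINT x|(max_law \<nu>0 m). 1 - exp (- t * max 0 x))"
 have low: "\<delta> * (lap_exp t - t * B) <= \<Lambda>"
  unfolding \<delta>_def \<Lambda>_def by (rule laplace_max_law_ge[OF m t B(1)]) (simp add: rm B)
 have cdf: "cdf (max_law \<nu>0 m) z = measure X.gen {x\<in>space X.gen. X.gen_max x <= z} ^ p" for z
  unfolding X.measure_gen_max measure_pos_part_le cdf_max_law[OF real_distribution_\<nu>0 m] cdf_\<nu>0 by (simp only: m_def power_mult)
 have bm: "(%w. X.block_max p X.gen_max w 0) \<in> borel_measurable X.S"
  unfolding X.block_max_def by (intro borel_measurable_Max) auto
 have "(\<integral>\<^sup>+w. ennreal (exp (- t * X.lowest (?J w) (p + N))) \<partial>X.S) <= (\<integral>\<^sup>+w. ennreal (exp (- t * max 0 (X.block_max p X.gen_max w 0))) \<partial>X.S)"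
  using X.block_max_le_lowest[OF less_imp_le[OF less_exp] p] X.J.lowest_nonneg t
  by (intro nn_integral_mono ennreal_leI) (simp add: mult_left_mono)
 also have "... = (\<integral>\<^sup>+x. ennreal (exp (- t * max 0 x)) \<partial>max_law \<nu>0 m)"
  unfolding X.distr_block_max[OF X.gen_max_measurable p L.real_distribution_axioms cdf, of 0, symmetric]
  using em by (intro nn_integral_distr[OF bm, symmetric]) (simp only: measurable_distr_eq1)
 also have "... = ennreal (1 - \<Lambda>)"
 proof -
  have i: "integrable (max_law \<nu>0 m) (%x. exp (- t * max 0 x))"
   using t by (intro L.integrable_const_bound[where B=1]) (auto simp: mult_nonneg_nonneg)
  have "\<Lambda> = 1 - (LINT x|(max_law \<nu>0 m). exp (- t * max 0 x))"
   unfolding \<Lambda>_def by (subst LINT_diff[OF _ i]) (simp_all add: L.prob_space[unfolded L.space_eq_univ])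
  then show ?thesis by (subst nn_integral_eq_integral[OF i]) simp_all
 qed
 also have "1 - \<Lambda> <= exp (- (\<delta> * (lap_exp t - t * B)))"
  using exp_ge_add_one_self[of "- (\<delta> * (lap_exp t - t * B))"] low by linarith
 finally have one: "(\<integral>\<^sup>+w. ennreal (exp (- t * X.lowest (?J w) (p + N))) \<partial>X.S) <= ennreal (exp (- (\<delta> * (lap_exp t - t * B))))"
  by (simp add: ennreal_leI)
 have i: "integrable X.S (%w. exp (- t * X.lowest (?J w) (k * (p + N))))"
  using t by (intro X.P.integrable_const_bound[where B=1]) (auto simp: mult_nonneg_nonneg X.J.lowest_nonneg)
 have "ennreal (LINT w|X.S. exp (- t * X.lowest (?J w) (k * (p + N)))) = (\<integral>\<^sup>+w. ennreal (exp (- t * X.lowest (?J w) (k * (p + N)))) \<partial>X.S)"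
  by (rule nn_integral_eq_integral[OF i, symmetric]) simp
 also have "... <= (\<integral>\<^sup>+w. ennreal (exp (- t * X.lowest (?J w) (p + N))) \<partial>X.S) ^ k"
  using t by (intro X.laplace_lowest_le_power) simp
 also have "... <= ennreal (exp (- (\<delta> * (lap_exp t - t * B)))) ^ k" by (intro power_mono one) simp
 also have "... = ennreal (exp (- (real k * (\<delta> * (lap_exp t - t * B)))))"
  by (simp add: ennreal_power exp_of_nat_mult[symmetric])
 finally show ?thesis unfolding \<delta>_def rm by simp
qed

text \<open>The abstract norming \<open>r\<close> and limit \<open>\<theta>\<close> treat the
  boundary and the stable case together. The condition \<open>s n \<le> C * r n\<close> makes the
  norming large compared with \<open>n\<close>.\<close>

theorem positions_laplace:
 assumes N: "N >= 1" and inf: "(\<integral>\<^sup>+x. ennreal (max 0 x) \<partial>\<nu>) = \<infinity>"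
  and r: "EV n. r n > 0 \<and> s n <= C * r n" and C: "C > 0" and t: "t > 0"
  and lim: "(%n. real n * lap_exp (t / r n)) ----> \<theta>"
  and pos: "pos = population.lowest N \<or> pos = population.highest N"
 shows "(%n. \<integral>w. exp (- t * (pos (jumps (%x. max 0 x) w) n / r n))
  \<partial>(\<Pi>\<^sub>M i\<in>UNIV. \<Pi>\<^sub>M k\<in>{1..2 * N}. \<nu>)) ----> exp (- 2 * real N * \<theta>)"
proof -
 interpret X: nbrw_law N \<nu> "%x. max 0 x" using N by (intro nbrw_lawI) auto
 let ?J = "jumps (%x. max 0 x)"
 have [measurable]: "(%w. pos (?J w) n) \<in> borel_measurable X.S" for n using pos by auto
 have b: "X.lowest (?J w) n <= pos (?J w) n" "pos (?J w) n <= X.total w n" for w n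
  using pos X.lowest_le_highest[of "?J w" n] X.highest_le_total[of w n] by auto
 have p0: "0 <= pos (?J w) n" for w n by (rule order_trans[OF X.J.lowest_nonneg b(1)])
 have i: "integrable X.S (%w. exp (- u * f w))" if "f \<in> borel_measurable X.S" "\<And>w. 0 <= f w" "0 <= u" for f and u :: real
  using that by (intro X.P.integrable_const_bound[where B=1]) (auto simp: mult_nonneg_nonneg)
 have rp: "EV n. r n > 0" using r by eventually_elim simp
 show ?thesis
 proof (rule order_tendstoI)
  fix x assume x: "x < exp (- 2 * real N * \<theta>)"
  \<comment> \<open>The case distinction makes \<open>p\<close> nonnegative for all
    \<open>n\<close>.\<close>
  define p where "p n = (if r n > 0 then lap_exp (t / r n) else 0)" for n
  have "(%n. real n * p n) ----> \<theta>"
   using lim by (rule Lim_transform_eventually) (use rp in \<open>eventually_elim, simp add: p_def\<close>)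
  moreover have "0 <= p n" for n using t by (simp add: p_def lap_exp_nonneg)
  ultimately have "(%n. (1 - p n) ^ (2 * N * n)) ----> exp (- real (2 * N) * \<theta>)" by (rule power_exp_limit)
  then have "EV n. x < (1 - p n) ^ (2 * N * n)" using x by (intro order_tendstoD(1)) auto
  with rp show "EV n. x < (LINT w|X.S. exp (- t * (pos (?J w) n / r n)))"
  proof eventually_elim
   case (elim n)
   define u where "u = t / r n"
   have u: "u >= 0" using t elim by (simp add: u_def)
   have "(LINT x|\<nu>. exp (- u * max 0 x)) = 1 - p n"
    using elim u integrable_const_bound[where B=1 and f="%x. exp (- u * max 0 x)"] unfolding p_def lap_exp_def u_def[symmetric]
    by (subst LINT_diff) (simp_all add: prob_space[unfolded space_eq_univ] mult_nonneg_nonneg)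
   then have "(1 - p n) ^ (2 * N * n) = (LINT w|X.S. exp (- u * X.total w n))"
    using X.expectation_exp_total[OF u, of n] by simp
   also have "... <= (LINT w|X.S. exp (- u * pos (?J w) n))"
    using u b(2) order_trans[OF p0 b(2)] by (intro integral_mono i p0) (auto intro: mult_left_mono)
   finally show ?case using elim by (simp add: u_def)
  qed
 next
  fix x assume x: "exp (- 2 * real N * \<theta>) < x"
  \<comment> \<open>Since \<open>N\<close> is fixed, the share of generations lost to takeovers is
    made small first, by the choice of \<open>p\<close>; the level \<open>B\<close> is chosen
    afterwards.\<close>
  have "(%p. exp (- (real p / real (p + N) * (2 * real N * \<theta>)))) ----> exp (- (1 * (2 * real N * \<theta>)))"
  proof (intro tendsto_exp tendsto_minus tendsto_mult tendsto_const)
   show "(%p. real p / real (p + N)) ----> 1" by real_asymp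
  qed
  then have "EV p. exp (- (real p / real (p + N) * (2 * real N * \<theta>))) < x \<and> p >= 1"
   using x by (intro eventually_conj order_tendstoD(2) eventually_ge_at_top) auto
  then obtain p where p: "exp (- (real p / real (p + N) * (2 * real N * \<theta>))) < x" "p >= 1" by (auto dest: eventually_happens)
  define d where "d = p + N"
  have d: "d >= 1" using p by (simp add: d_def)
  define g where "g B = 2 * real N * real p * (1 - 2 * real N * real p * G B)" for B
  have "((%B. exp (- (1 / real d * (g B * (\<theta> - t * 0 * B))))) ---> exp (- (1 / real d * (2 * real N * real p * (1 - 2 * real N * real p * 0) * \<theta>)))) at_top"
   unfolding g_def mult_zero_right mult_zero_left diff_zero
   by (intro tendsto_intros) (use G_tendsto_0 in \<open>auto intro!: tendsto_eq_intros\<close>)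
  moreover have "exp (- (1 / real d * (2 * real N * real p * (1 - 2 * real N * real p * 0) * \<theta>))) < x" using p by (simp add: d_def mult_ac)
  ultimately have "\<forall>\<^sub>F B in at_top. exp (- (1 / real d * (g B * (\<theta> - t * 0 * B)))) < x" by (rule order_tendstoD(2))
  moreover have "((%B. 2 * real N * real p * G B) ---> 2 * real N * real p * 0) at_top" by (intro tendsto_mult tendsto_const G_tendsto_0)
  then have "\<forall>\<^sub>F B in at_top. 2 * real N * real p * G B < 1" by (intro order_tendstoD(2)) auto
  ultimately have "\<forall>\<^sub>F B in at_top. exp (- (1 / real d * (g B * (\<theta> - t * 0 * B)))) < x \<and> 2 * real N * real p * G B < 1 \<and> B >= 0"
   using eventually_ge_at_top[of 0] by eventually_elim blast
  then obtain B where B: "exp (- (1 / real d * (g B * (\<theta> - t * 0 * B)))) < x" "2 * real N * real p * G B < 1" "B >= 0"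
   by (auto simp: eventually_at_top_linorder)
  \<comment> \<open>The infinite mean enters here: n / r(n) tends to 0, so the loss
    \<open>t * B / r n\<close> per block is negligible.\<close>
  have "(%n. C * inverse (trunc (a (real n)))) ----> C * 0"
   by (intro tendsto_mult tendsto_const tendsto_inverse_0_at_top filterlim_compose[OF trunc_at_top[OF inf] a_nat_at_top])
  then have nr: "(%n. real n / r n) ----> 0"
  proof (intro Lim_null_comparison[of "%n. real n / r n"])
   have "EV n. s n > 0" using s_at_top[OF inf] unfolding filterlim_at_top_dense by blast
   with r show "EV n. norm (real n / r n) <= C * inverse (trunc (a (real n)))"
   proof eventually_elim
    case (elim n)
    have "trunc (a (real n)) > 0" using elim(2) trunc_nonneg[of "a (real n)"] by (auto simp: s_def zero_less_mult_iff)
    then show ?case using elim by (simp add: s_def field_simps)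
   qed
  qed simp
  have dn: "(%n. real (n div d) / real n) ----> 1 / real d"
  proof (rule tendsto_sandwich)
   have d0: "real d > 0" using d by simp
   show "(%n. (real n / real d - 1) / real n) ----> 1 / real d" "(%n. (real n / real d) / real n) ----> 1 / real d"
    using d0 by (real_asymp simp: field_simps)+
   show "EV n. (real n / real d - 1) / real n <= real (n div d) / real n"
    "EV n. real (n div d) / real n <= (real n / real d) / real n"
    by (intro always_eventually allI divide_right_mono; use real_div_bounds[of _ d] in \<open>simp add: diff_le_eq\<close>)+
  qed
  have "(%n. exp (- (real (n div d) / real n * (g B * (real n * lap_exp (t / r n) - t * (real n / r n) * B)))))
   ----> exp (- (1 / real d * (g B * (\<theta> - t * 0 * B))))"
   by (intro tendsto_exp tendsto_minus tendsto_mult tendsto_diff tendsto_const dn lim nr)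
  then have "EV n. exp (- (real (n div d) / real n * (g B * (real n * lap_exp (t / r n) - t * (real n / r n) * B)))) < x"
   using B(1) by (rule order_tendstoD(2))
  with rp eventually_gt_at_top[of 0] show "EV n. (LINT w|X.S. exp (- t * (pos (?J w) n / r n))) < x"
  proof eventually_elim
   case (elim n)
   define u where "u = t / r n"
   have u: "u > 0" using t elim by (simp add: u_def)
   have "X.lowest (?J w) (n div d * d) <= pos (?J w) n" for w
    by (rule order_trans[OF lift_Suc_mono_le[of "X.lowest (?J w)", OF X.J.lowest_Suc] b(1)]) simp
   then have "(LINT w|X.S. exp (- u * pos (?J w) n)) <= (LINT w|X.S. exp (- u * X.lowest (?J w) (n div d * d)))"
    using u by (intro integral_mono i p0 X.J.lowest_nonneg) (auto intro: mult_left_mono)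
   also have "... <= exp (- (real (n div d) * (g B * (lap_exp u - u * B))))"
    unfolding d_def g_def using laplace_lowest_le[OF N p(2) u B(3) less_imp_le[OF B(2)], of "n div (p + N)"] by simp
   also have "real (n div d) * (g B * (lap_exp u - u * B)) = real (n div d) / real n * (g B * (real n * lap_exp (t / r n) - t * (real n / r n) * B))"
    using elim by (simp add: u_def right_diff_distrib)
   finally show ?case using elim by (simp add: u_def)
  qed
 qed
qed

end

section \<open>Stairs functions\<close>

text \<open>Such a set can accumulate only at 0, so adding 0 makes its supremum attained.\<close>

lemma
 fixes Y :: "real set"
 assumes nonneg: "\<And>y. y \<in> Y ==> 0 <= y" and fin: "\<And>a. a > 0 ==> finite {y\<in>Y. a <= y}"
 shows Sup_insert_0_attained: "Sup (insert 0 Y) \<in> insert 0 Y" (is ?A)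
  and le_Sup_insert_0: "y \<in> Y ==> y <= Sup (insert 0 Y)"
proof -
 have "?A \<and> (\<forall>y\<in>Y. y <= Sup (insert 0 Y))"
 proof (cases "\<exists>u\<in>Y. u > 0")
  case True
  then obtain u where u: "u \<in> Y" "u > 0" by blast
  define m where "m = Max {y\<in>Y. u <= y}"
  have "m \<in> {y\<in>Y. u <= y}" unfolding m_def using u by (intro Max_in fin) auto
  moreover have "y <= m" if "y \<in> Y" "u <= y" for y unfolding m_def using that u by (intro Max_ge fin) auto
  ultimately have m: "m \<in> Y" "\<And>y. y \<in> Y ==> y <= m" by force+
  have "Sup (insert 0 Y) = m" by (rule cSup_eq_maximum) (use m nonneg in auto)
  then show ?thesis using m by simp
 next
  case False
  then have "insert 0 Y = {0}" using nonneg by (force intro: antisym)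
  then show ?thesis by (auto simp only: cSup_singleton)
 qed
 then show ?A "y \<in> Y ==> y <= Sup (insert 0 Y)" by auto
qed

text \<open>Left-open, so that the cells partition the positive times, where all atoms lie.\<close>

definition cell :: "nat => nat => real set" where
 "cell q i = {real i / real q<..real (Suc i) / real q}"

lemma cell_bounds: "q >= 1 ==> u \<in> cell q i ==> real i < u * real q \<and> u * real q <= real (Suc i)"
 by (auto simp: cell_def divide_less_eq le_divide_eq)

lemma cell_pos: "u \<in> cell q i ==> 0 < u"
 unfolding cell_def greaterThanAtMost_iff using divide_nonneg_nonneg[of "real i" "real q"] by linarith

locale stairs_function =
 fixes \<xi> :: "real => real"
 assumes \<xi>_nonneg: "0 <= \<xi> t" and \<xi>_0: "t <= 0 ==> \<xi> t = 0"
  and locally_finite: "a > 0 ==> finite {t. t <= T \<and> a <= \<xi> t}"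
begin

abbreviation R :: "real => real" where
 "R \<equiv> stairs \<xi>"

definition cell_max :: "nat => nat => real" where
 "cell_max q i = Sup (insert 0 (\<xi> ` cell q i))"

lemma cell_max_attained: "cell_max q i = 0 \<or> (\<exists>t\<in>cell q i. \<xi> t = cell_max q i)"
 and le_cell_max: "t \<in> cell q i ==> \<xi> t <= cell_max q i"
proof -
 have fin: "finite {y \<in> \<xi> ` cell q i. a <= y}" if "a > 0" for a
 proof (rule finite_subset)
  show "{y \<in> \<xi> ` cell q i. a <= y} \<subseteq> \<xi> ` {t. t <= real (Suc i) / real q \<and> a <= \<xi> t}" by (auto simp: cell_def)
 qed (intro finite_imageI locally_finite that)
 show "cell_max q i = 0 \<or> (\<exists>t\<in>cell q i. \<xi> t = cell_max q i)"
 proof -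
  have "cell_max q i \<in> insert 0 (\<xi> ` cell q i)"
   unfolding cell_max_def using \<xi>_nonneg by (intro Sup_insert_0_attained fin) auto
  then show ?thesis by (elim insertE imageE) (blast, metis)
 qed
 show "t \<in> cell q i ==> \<xi> t <= cell_max q i"
  unfolding cell_max_def using \<xi>_nonneg by (intro le_Sup_insert_0 fin) auto
qed

lemma cell_max_nonneg: "0 <= cell_max q i"
 using cell_max_attained[of q i] \<xi>_nonneg by (metis order_refl)

lemma R_0: "t <= 0 ==> R t = 0"
 by (subst stairs.simps) simp

lemma cell_of:
 assumes "q >= 1" "0 < t"
 obtains i where "t \<in> cell q i"
proof -
 have q: "real q > 0" using assms by simp
 define i where "i = nat (\<lceil>t * real q\<rceil> - 1)"
 have "0 < t * real q" using assms q by simp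
 then have i: "real i < t * real q" "t * real q <= real (Suc i)" unfolding i_def by linarith+
 have "t \<in> cell q i" using i q unfolding cell_def by (simp only: greaterThanAtMost_iff divide_less_eq le_divide_eq) auto
 then show ?thesis by (rule that)
qed

text \<open>For \<open>u\<close> in cell \<open>i\<close> the time \<open>u - 1\<close> is covered
  by the first \<open>i + 1 - q\<close> cells, which is the situation of
  \<open>sep_max_step\<close>. The second bound shows that the suprema in the recursion are bounded,
  as \<open>le_R\<close> needs.\<close>

lemma R_le_sep_max:
 assumes q: "q >= 1"
 shows "t * real q <= real n ==> R t <= sep_max q n (cell_max q)"
  and "t * real q <= real n ==> u <= t ==> R (u - 1) + \<xi> u <= sep_max q n (cell_max q)"
proof -
 have q0: "real q > 0" using q by simp
 have step: "R (u - 1) + \<xi> u <= sep_max q n (cell_max q)"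
  if IH: "\<And>m s. m < n ==> s * real q <= real m ==> R s <= sep_max q m (cell_max q)" and n: "u * real q <= real n" for u n
 proof (cases "u <= 0")
  case True
  then show ?thesis by (simp add: R_0 \<xi>_0 sep_max_nonneg)
 next
  case False
  then obtain i where i: "u \<in> cell q i" using cell_of[OF q, of u] by auto
  then have u: "real i < u * real q" "u * real q <= real (Suc i)" using cell_bounds[OF q i] by auto
  have "real i < real n" using u n by linarith
  then have "Suc i <= n" by simp
  have "R (u - 1) <= sep_max q (Suc i - q) (cell_max q)"
  proof (cases "q <= Suc i")
   case True
   then have "(u - 1) * real q <= real (Suc i - q)" using u by (simp add: of_nat_diff algebra_simps)
   then show ?thesis using \<open>Suc i <= n\<close> q by (intro IH) auto
  next
   case False
   have "real (Suc i) <= real q" using False by linarith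
   then have "u * real q <= 1 * real q" using u by linarith
   then have "u <= 1" using q0 by (simp only: mult_le_cancel_right_pos)
   then show ?thesis by (simp add: R_0 sep_max_nonneg)
  qed
  then have "R (u - 1) + \<xi> u <= sep_max q (Suc i - q) (cell_max q) + cell_max q i" using le_cell_max[OF i] by linarith
  also have "... <= sep_max q (Suc i) (cell_max q)" by (rule sep_max_step[OF q])
  also have "... <= sep_max q n (cell_max q)" by (rule sep_max_mono) (use \<open>Suc i <= n\<close> in auto)
  finally show ?thesis .
 qed
 have main: "R t <= sep_max q n (cell_max q)" if "t * real q <= real n" for t n
  using that
 proof (induction n arbitrary: t rule: less_induct)
  case (less n)
  show ?case
  proof (cases "t <= 0")
   case False
   have "(SUP s\<in>{0..1}. R (t - s - 1) + \<xi> (t - s)) <= sep_max q n (cell_max q)"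
   proof (rule cSUP_least)
    fix s :: real assume s: "s \<in> {0..1}"
    have "(t - s) * real q <= t * real q" using s by (intro mult_right_mono) auto
    then show "R (t - s - 1) + \<xi> (t - s) <= sep_max q n (cell_max q)"
     using less by (intro step) auto
   qed simp
   then show ?thesis using False by (subst stairs.simps) simp
  qed (simp add: R_0 sep_max_nonneg)
 qed
 show "t * real q <= real n ==> R t <= sep_max q n (cell_max q)" by (rule main)
 assume "t * real q <= real n" "u <= t"
 then show "R (u - 1) + \<xi> u <= sep_max q n (cell_max q)"
  using mult_right_mono[of u t "real q"] by (intro step main) auto
qed

lemma le_R:
 assumes "0 < t" "t - 1 <= u" "u <= t"
 shows "R (u - 1) + \<xi> u <= R t"
proof -
 have "R (t - (t - u) - 1) + \<xi> (t - (t - u)) <= (SUP s\<in>{0..1}. R (t - s - 1) + \<xi> (t - s))"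
 proof (rule cSUP_upper)
  have "R (t - s - 1) + \<xi> (t - s) <= sep_max 1 (nat \<lceil>t\<rceil>) (cell_max 1)" if "s \<in> {0..1}" for s
   using that assms by (intro R_le_sep_max(2)[of 1 t]) auto
  then show "bdd_above ((%s. R (t - s - 1) + \<xi> (t - s)) ` {0..1})" by (rule bdd_aboveI2)
 qed (use assms in auto)
 then show ?thesis using assms by (subst (2) stairs.simps) simp
qed

text \<open>Induction over unit intervals: a jump time before \<open>t - 1\<close> is absorbed into
  \<open>R (t - 1)\<close>, and \<open>R (t - 1) \<le> R t\<close> since waiting is allowed.\<close>

lemma R_nonneg_mono: "0 <= R t \<and> (\<forall>u\<le>t. R u <= R t)"
proof (induction "nat \<lceil>t\<rceil>" arbitrary: t rule: less_induct)
 case less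
 show ?case
 proof (cases "t <= 0")
  case False
  then have t: "0 < t" by simp
  have IH: "0 <= R (t - 1) \<and> (\<forall>u\<le>t - 1. R u <= R (t - 1))" by (rule less) (use t in linarith)
  have 1: "R (t - 1) <= R t" using le_R[OF t, of t] \<xi>_nonneg[of t] by simp
  have "R u <= R t" if u: "u <= t" for u
  proof (cases "u <= 0")
   case False
   have "(SUP s\<in>{0..1}. R (u - s - 1) + \<xi> (u - s)) <= R t"
   proof (rule cSUP_least)
    fix s :: real assume s: "s \<in> {0..1}"
    define v where "v = u - s"
    have "R (v - 1) + \<xi> v <= R t"
    proof (cases "t - 1 <= v")
     case True
     then show ?thesis using u s by (intro le_R t) (auto simp: v_def)
    next
     case vt: False
     have "R (v - 1) + \<xi> v <= R v"
     proof (cases "v <= 0")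
      case False
      then show ?thesis by (intro le_R) auto
     qed (simp add: R_0 \<xi>_0)
     also have "... <= R (t - 1)" using IH vt by auto
     finally show ?thesis using 1 by linarith
    qed
    then show "R (u - s - 1) + \<xi> (u - s) <= R t" by (simp add: v_def)
   qed simp
   then show ?thesis using False by (subst stairs.simps) simp
  qed (use IH 1 in \<open>simp add: R_0\<close>)
  moreover have "0 <= R t" using IH 1 by linarith
  ultimately show ?thesis by blast
 qed (simp add: R_0)
qed

lemma R_nonneg: "0 <= R t" and R_mono: "u <= t ==> R u <= R t"
 using R_nonneg_mono[of t] by auto

lemma sum_le_R:
 assumes "finite T" "T \<subseteq> {0<..t}" "\<And>u v. u \<in> T ==> v \<in> T ==> u < v ==> u + 1 <= v"
 shows "sum \<xi> T <= R t"
 using assms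
proof (induction "card T" arbitrary: T t)
 case 0
 then show ?case by (simp add: R_nonneg)
next
 case (Suc k)
 then have ne: "T \<noteq> {}" by auto
 define m where "m = Max T"
 have m: "m \<in> T" "\<And>u. u \<in> T ==> u <= m" using Suc.prems(1) ne by (auto simp: m_def)
 have "sum \<xi> (T - {m}) <= R (m - 1)"
 proof (rule Suc.hyps(1))
  show "k = card (T - {m})" using Suc.hyps(2) Suc.prems(1) m by simp
  have "u + 1 <= m" if "u \<in> T - {m}" for u using that m(2)[of u] Suc.prems(3)[of u m] m(1) by auto
  then show "T - {m} \<subseteq> {0<..m - 1}" using Suc.prems(2) by fastforce
 qed (use Suc.prems in auto)
 also have "R (m - 1) + \<xi> m <= R m" using m Suc.prems(2) by (intro le_R) auto
 also have "... <= R t" using m Suc.prems(2) by (intro R_mono) auto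
 finally show ?case using m Suc.prems(1) by (simp add: sum.remove[of T m] add.commute)
qed

text \<open>In each cell with positive maximum a time attaining it is selected; the selected times
  form a set as in \<open>sum_le_R\<close>.\<close>

lemma sep_max_cells_le:
 assumes "S \<subseteq> {..<n}" and in_t: "\<And>i u. i \<in> S ==> u \<in> cell q i ==> \<xi> u = cell_max q i ==> 0 < cell_max q i ==> u <= t"
  and gap: "\<And>i j u v. i \<in> S ==> j \<in> S ==> i < j ==> u \<in> cell q i ==> v \<in> cell q j ==> 0 < cell_max q i ==> 0 < cell_max q j
   ==> \<xi> u = cell_max q i ==> \<xi> v = cell_max q j ==> u + 1 <= v"
 shows "sum (cell_max q) S <= R t"
proof -
 define S' where "S' = {i\<in>S. 0 < cell_max q i}"
 have fin: "finite S" using assms(1) finite_subset by blast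
 obtain f where f: "\<And>i. i \<in> S' ==> f i \<in> cell q i \<and> \<xi> (f i) = cell_max q i"
  using cell_max_attained[of q] unfolding S'_def by (metis (no_types, lifting) mem_Collect_eq less_irrefl)
 have lt: "f i + 1 <= f j" if "i \<in> S'" "j \<in> S'" "i < j" for i j
  using that f[of i] f[of j] gap[of i j "f i" "f j"] by (auto simp: S'_def)
 have inj: "inj_on f S'"
 proof (rule inj_onI)
  fix i j assume "i \<in> S'" "j \<in> S'" "f i = f j"
  then show "i = j" using lt[of i j] lt[of j i] by (cases i j rule: linorder_cases) auto
 qed
 have "sum (cell_max q) S = sum (cell_max q) S'"
  unfolding S'_def using fin cell_max_nonneg by (intro sum.mono_neutral_right) (auto simp: not_less intro: antisym)
 also have "... = (\<Sum>i\<in>S'. \<xi> (f i))" using f by (intro sum.cong) auto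
 also have "... = sum \<xi> (f ` S')" using inj by (simp add: sum.reindex)
 also have "... <= R t"
 proof (rule sum_le_R)
  show "finite (f ` S')" using fin by (simp add: S'_def)
  have "0 < f i \<and> f i <= t" if i: "i \<in> S'" for i
  proof -
   have "0 < f i" using f[OF i] cell_pos by blast
   then show ?thesis using f[OF i] i in_t[of i "f i"] by (auto simp: S'_def)
  qed
  then show "f ` S' \<subseteq> {0<..t}" by auto
  fix u v assume "u \<in> f ` S'" "v \<in> f ` S'" "u < v"
  then obtain i j where ij: "i \<in> S'" "j \<in> S'" "u = f i" "v = f j" by blast
  then show "u + 1 <= v" using lt[of i j] lt[of j i] \<open>u < v\<close> by (cases i j rule: linorder_cases) auto
 qed
 finally show ?thesis .
qed

lemma sep_max_le_R:
 assumes q: "q >= 1" and n: "real n <= t * real q"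
 shows "sep_max (Suc q) n (cell_max q) <= R t"
proof (rule sep_max_leI)
 have q0: "real q > 0" using q by simp
 fix S assume S: "S \<subseteq> {..<n}" "separated (Suc q) S"
 note c = cell_bounds[OF q]
 show "sum (cell_max q) S <= R t"
 proof (rule sep_max_cells_le[OF S(1)])
  fix i u assume i: "i \<in> S" "u \<in> cell q i"
  then have "Suc i <= n" using S(1) by auto
  then have "u * real q <= t * real q" using c[OF i(2)] n by linarith
  then show "u <= t" using q0 by simp
 next
  fix i j u v assume ij: "i \<in> S" "j \<in> S" "i < j" "u \<in> cell q i" "v \<in> cell q j"
  then have "real i + (real q + 1) <= real j" using separatedD[OF S(2), of i j] by linarith
  then have "(u + 1) * real q <= v * real q" using c[OF ij(4)] c[OF ij(5)] by (simp add: algebra_simps)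
  then show "u + 1 <= v" using q0 by simp
 qed
qed

text \<open>Finitely many times have finitely many distances, so on a fine mesh an inequality that
  holds up to one cell holds exactly.\<close>

lemma separations_resolved:
 assumes F: "finite F"
 shows "EV q. (\<forall>u\<in>F. (u - t) * real q < 1 \<longrightarrow> u <= t) \<and>
  (\<forall>u\<in>F. \<forall>v\<in>F. real q < (v - u) * real q + 1 \<longrightarrow> u + 1 <= v)"
proof -
 have *: "EV q. x * real q < 1 \<longrightarrow> x <= 0" for x :: real
 proof (cases "x <= 0")
  case False
  have "EV q. 1 / x <= real q" using filterlim_real_sequentially unfolding filterlim_at_top by blast
  then show ?thesis by eventually_elim (use False in \<open>simp add: field_simps\<close>)
 qed simp
 show ?thesis
 proof (intro eventually_conj eventually_ball_finite F ballI)
  fix u v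
  show "EV q. (u - t) * real q < 1 \<longrightarrow> u <= t" using *[of "u - t"] by simp
  show "EV q. real q < (v - u) * real q + 1 \<longrightarrow> u + 1 <= v"
   using *[of "1 - (v - u)"] by eventually_elim (simp add: algebra_simps)
 qed
qed

text \<open>On a fine mesh the cells of a separated set contain separated times, apart from small atoms.\<close>

lemma sep_max_cells_tendsto:
 assumes t: "t > 0"
 shows "(%q. sep_max (Suc q) (nat \<lceil>t * real (Suc q)\<rceil>) (cell_max (Suc q))) ----> R t"
proof (rule LIMSEQ_I)
 fix e :: real assume e: "e > 0"
 \<comment> \<open>Atoms smaller than \<open>a\<close> contribute at most \<open>a\<close> in each
   of at most \<open>t + 2\<close> chosen cells.\<close>
 define a where "a = e / (2 * (t + 2))"
 have a: "a > 0" "a * (t + 2) < e"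
 proof -
  show "a > 0" unfolding a_def using t e by (intro divide_pos_pos) auto
  have "a * (t + 2) = e * (t + 2) / ((t + 2) * 2)" by (simp add: a_def mult.commute)
  also have "... = e / 2" using t by (subst mult.commute) (simp del: distrib_right_numeral)
  finally have "a * (t + 2) = e / 2" .
  then show "a * (t + 2) < e" using e by linarith
 qed
 \<comment> \<open>The last cell may reach beyond \<open>t\<close>, but by less than 1.\<close>
 define F where "F = {u. u <= t + 1 \<and> a <= \<xi> u}"
 have "finite F" unfolding F_def by (rule locally_finite[OF a(1)])
 from separations_resolved[OF this, of t] obtain q0 where q0: "\<And>q. q >= q0 ==> (\<forall>u\<in>F. (u - t) * real q < 1 \<longrightarrow> u <= t) \<and>
  (\<forall>u\<in>F. \<forall>v\<in>F. real q < (v - u) * real q + 1 \<longrightarrow> u + 1 <= v)"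
  unfolding eventually_sequentially by blast
 show "\<exists>q0. \<forall>q\<ge>q0. norm (sep_max (Suc q) (nat \<lceil>t * real (Suc q)\<rceil>) (cell_max (Suc q)) - R t) < e"
 proof (intro exI allI impI)
  fix p assume p: "p >= q0"
  define q where "q = Suc p"
  define n where "n = nat \<lceil>t * real q\<rceil>"
  have q: "q >= 1" "real q > 0" "real q >= 1" by (auto simp: q_def)
  have n: "t * real q <= real n" "real n < t * real q + 1" unfolding n_def using t q by (auto simp: of_nat_nat) linarith
  have q1: "u <= t" if "u \<in> F" "(u - t) * real q < 1" for u using q0[of q] p that unfolding q_def by (meson le_SucI)
  have q2: "u + 1 <= v" if "u \<in> F" "v \<in> F" "real q < (v - u) * real q + 1" for u v using q0[of q] p that unfolding q_def by (meson le_SucI)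
  note c = cell_bounds[OF q(1)]
  have "sep_max q n (cell_max q) <= R t + a * (real n / real q + 1)"
  proof (rule sep_max_leI)
   fix S assume S: "S \<subseteq> {..<n}" "separated q S"
   have fin: "finite S" using S(1) finite_subset by blast
   define S1 where "S1 = {i\<in>S. a <= cell_max q i}"
   have u: "u \<in> F \<and> u <= t" if "i \<in> S1" "u \<in> cell q i" "\<xi> u = cell_max q i" for i u
   proof -
    have "Suc i <= n" using that S(1) by (auto simp: S1_def)
    then have lt: "(u - t) * real q < 1" using c[OF that(2)] n by (simp add: algebra_simps)
    also have "... <= 1 * real q" using q by simp
    finally have "u - t < 1" using q by (simp only: mult_less_cancel_right_pos)
    then have "u \<in> F" using that by (auto simp: F_def S1_def)
    then show ?thesis using q1 lt by blast
   qed
   have "sum (cell_max q) S1 <= R t"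
   proof (rule sep_max_cells_le[of _ n])
    show "S1 \<subseteq> {..<n}" using S(1) by (auto simp: S1_def)
    show "x <= t" if "i \<in> S1" "x \<in> cell q i" "\<xi> x = cell_max q i" for i x using u[OF that] by blast
    fix i j x y assume ij: "i \<in> S1" "j \<in> S1" "i < j" "x \<in> cell q i" "y \<in> cell q j" "\<xi> x = cell_max q i" "\<xi> y = cell_max q j"
    have "i + q <= j" using separatedD[OF S(2), of i j] ij by (auto simp: S1_def)
    then have "real i + real q <= real j" by linarith
    then have "real q < (y - x) * real q + 1" using c[OF ij(4)] c[OF ij(5)] by (simp add: algebra_simps)
    then show "x + 1 <= y" using q2 u ij by blast
   qed
   moreover have "sum (cell_max q) (S - S1) <= a * (real n / real q + 1)"
   proof -
    have "sum (cell_max q) (S - S1) <= (\<Sum>i\<in>S - S1. a)" by (intro sum_mono) (auto simp: S1_def)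
    also have "... <= sep_max q n (%_. a)" using S by (intro sep_max_ge separated_subset[OF S(2)]) auto
    also have "... <= a * (real n / real q + 1)" using a by (intro sep_max_le_card q) auto
    finally show ?thesis .
   qed
   moreover have "sum (cell_max q) S = sum (cell_max q) (S - S1) + sum (cell_max q) S1"
    using fin by (intro sum.subset_diff) (auto simp: S1_def)
   ultimately show "sum (cell_max q) S <= R t + a * (real n / real q + 1)" by linarith
  qed
  moreover have "R t <= sep_max q n (cell_max q)" by (rule R_le_sep_max(1)[OF q(1) n(1)])
  moreover have "a * (real n / real q + 1) <= a * (t + 2)"
  proof -
   have "real n <= (t + 1) * real q" using n q by (simp add: algebra_simps)
   then have "real n / real q <= t + 1" using q by (simp add: divide_le_eq)
   then show ?thesis using a by (intro mult_left_mono) auto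
  qed
  ultimately have "norm (sep_max q n (cell_max q) - R t) < e" using a unfolding real_norm_def by linarith
  then show "norm (sep_max (Suc p) (nat \<lceil>t * real (Suc p)\<rceil>) (cell_max (Suc p)) - R t) < e" unfolding q_def n_def .
 qed
qed

end

section \<open>Stairs processes\<close>

text \<open>Stated for numerical functions so that it applies to almost every path and to the
  expectations alike. For each fixed mesh time tends to infinity; then the mesh is refined.\<close>

lemma stairs_speed_squeeze:
 assumes \<alpha>: "\<alpha> > 1"
  and A: "\<And>q. q >= 1 ==> (%n. A q n / real n) ----> sep_speed (Suc q) (frechet \<alpha> (1 / real q))"
  and B: "\<And>q. q >= 1 ==> (%n. B q n / real n) ----> sep_speed q (frechet \<alpha> (1 / real q))"
  and le: "\<And>q t. q >= 1 ==> t > 0 ==> A q (nat \<lfloor>t * real q\<rfloor>) <= f t" "\<And>q t. q >= 1 ==> t > 0 ==> f t <= B q (nat \<lceil>t * real q\<rceil>)"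
 shows "((%t. f t / t) ---> stairs_speed \<alpha>) at_top"
proof -
 have *: "((%t. C (n t) / t) ---> real q * l) at_top"
  if C: "(%n. C n / real n) ----> l" and n: "((%t. real (n t) / t) ---> real q) at_top" and q: "q >= 1" and top: "filterlim (%t. real (n t)) at_top at_top"
  for C l q and n :: "real => nat"
 proof -
  have "filterlim n sequentially at_top" using top by (simp add: filterlim_sequentially_iff_filterlim_real)
  then have "((%t. C (n t) / real (n t)) ---> l) at_top" by (rule filterlim_compose[OF C])
  with n have "((%t. (real (n t) / t) * (C (n t) / real (n t))) ---> real q * l) at_top" by (rule tendsto_mult)
  moreover have "\<forall>\<^sub>F t in at_top. real (n t) > 0" using top unfolding filterlim_at_top_dense by blast
  then have "\<forall>\<^sub>F t in at_top. (real (n t) / t) * (C (n t) / real (n t)) = C (n t) / t" by eventually_elim simp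
  ultimately show ?thesis by (subst (asm) tendsto_cong) simp_all
 qed
 show ?thesis
 proof (rule order_tendstoI)
  fix x assume "x < stairs_speed \<alpha>"
  then have "EV q. x < lower_speed \<alpha> q \<and> q >= 1"
   by (intro eventually_conj order_tendstoD(1)[OF lower_speed_tendsto[OF \<alpha>]] eventually_ge_at_top)
  then obtain q where q: "x < lower_speed \<alpha> q" "q >= 1" by (auto dest: eventually_happens)
  then have q0: "real q > 0" by simp
  have "((%t. A q (nat \<lfloor>t * real q\<rfloor>) / t) ---> real q * sep_speed (Suc q) (frechet \<alpha> (1 / real q))) at_top"
   using q0 by (intro * A q) real_asymp+
  then have "\<forall>\<^sub>F t in at_top. x < A q (nat \<lfloor>t * real q\<rfloor>) / t \<and> t > 0"
   using q by (intro eventually_conj order_tendstoD(1) eventually_gt_at_top) (auto simp: lower_speed_def)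
  then show "\<forall>\<^sub>F t in at_top. x < f t / t"
  proof eventually_elim
   case (elim t)
   then have "A q (nat \<lfloor>t * real q\<rfloor>) / t <= f t / t" using le(1)[OF q(2), of t] by (intro divide_right_mono) auto
   then show ?case using elim by linarith
  qed
 next
  fix x assume "stairs_speed \<alpha> < x"
  then have "EV q. upper_speed \<alpha> (Suc q) < x"
   by (intro order_tendstoD(2)[OF upper_speed_tendsto[OF \<alpha>]])
  then obtain p where p: "upper_speed \<alpha> (Suc p) < x" by (auto dest: eventually_happens)
  define q where "q = Suc p"
  have q: "upper_speed \<alpha> q < x" "q >= 1" "real q > 0" using p by (auto simp: q_def)
  have "((%t. B q (nat \<lceil>t * real q\<rceil>) / t) ---> real q * sep_speed q (frechet \<alpha> (1 / real q))) at_top"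
   using q(3) by (intro * B q(2)) real_asymp+
  then have "\<forall>\<^sub>F t in at_top. B q (nat \<lceil>t * real q\<rceil>) / t < x \<and> t > 0"
   using q by (intro eventually_conj order_tendstoD(2) eventually_gt_at_top) (auto simp: upper_speed_def)
  then show "\<forall>\<^sub>F t in at_top. f t / t < x"
  proof eventually_elim
   case (elim t)
   then have "f t / t <= B q (nat \<lceil>t * real q\<rceil>) / t" using le(2)[OF q(2), of t] by (intro divide_right_mono) auto
   then show ?case using elim by linarith
  qed
 qed
qed

locale stairs_process = prob_space S for S :: "'s measure" +
 fixes \<mu> :: "real measure" and \<eta> :: "'s => (real \<times> real) set" and \<alpha> :: real
 assumes \<alpha>: "\<alpha> > 1" and \<mu>: "stairs_measure \<mu>" and tail: "x > 0 ==> emeasure \<mu> {x..} = ennreal (x powr (- \<alpha>))"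
  and pp: "stairs_point_process S \<mu> \<eta>"
begin

abbreviation \<Lambda> :: "(real \<times> real) measure" where
 "\<Lambda> \<equiv> restrict_space lborel {0<..} \<Otimes>\<^sub>M \<mu>"

abbreviation Z :: "nat => nat => 's => real" where
 "Z q i \<omega> \<equiv> stairs_function.cell_max (atom_size (\<eta> \<omega>)) q i"

lemma sets_\<mu>: "sets \<mu> = sets (restrict_space borel {0<..})"
 using \<mu> by (simp add: stairs_measure_def)

lemma space_\<mu>: "space \<mu> = {0<..}"
 using sets_eq_imp_space_eq[OF sets_\<mu>] by (simp add: space_restrict_space)

lemma tail_sets: "z > 0 ==> {z..} \<in> sets \<mu>"
 unfolding sets_\<mu> by (subst sets_restrict_space_iff) auto

lemma cell_sets: "cell q i \<in> sets (restrict_space lborel {0<..})"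
proof -
 have "cell q i \<subseteq> {0<..}" using cell_pos by auto
 moreover have "cell q i \<in> sets lborel" by (simp add: cell_def)
 ultimately show ?thesis by (simp add: sets_restrict_space_iff)
qed

lemma atoms_pos: "\<omega> \<in> space S ==> (t, x) \<in> \<eta> \<omega> ==> 0 < t \<and> 0 < x"
 using pp by (auto simp: stairs_point_process_def poisson_point_process_def space_pair_measure space_\<mu> space_restrict_space)

lemma locally_finite_atoms: "\<omega> \<in> space S ==> a > 0 ==> finite {(t, x) \<in> \<eta> \<omega>. t <= T \<and> a <= x}"
 using pp by (simp add: stairs_point_process_def)

lemma
 assumes \<omega>: "\<omega> \<in> space S"
 shows atom_size_ge: "(t, x) \<in> \<eta> \<omega> ==> x <= atom_size (\<eta> \<omega>) t"
  and atom_size_attained: "atom_size (\<eta> \<omega>) t = 0 \<or> (t, atom_size (\<eta> \<omega>) t) \<in> \<eta> \<omega>"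
  and stairs_function: "stairs_function (atom_size (\<eta> \<omega>))"
proof -
 have pos: "0 <= x" if "x \<in> {x. (t, x) \<in> \<eta> \<omega>}" for t x using atoms_pos[OF \<omega>] that by force
 have fin: "finite {y \<in> {x. (t, x) \<in> \<eta> \<omega>}. a <= y}" if "a > 0" for t a
  by (rule finite_subset[OF _ finite_imageI[OF locally_finite_atoms[OF \<omega> that, of t], of snd]]) force
 show ge: "(t, x) \<in> \<eta> \<omega> ==> x <= atom_size (\<eta> \<omega>) t" for t x
  unfolding atom_size_def by (rule le_Sup_insert_0[OF pos fin]) auto
 show att: "atom_size (\<eta> \<omega>) t = 0 \<or> (t, atom_size (\<eta> \<omega>) t) \<in> \<eta> \<omega>" for t
 proof -
  have "atom_size (\<eta> \<omega>) t \<in> insert 0 {x. (t, x) \<in> \<eta> \<omega>}"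
   unfolding atom_size_def by (rule Sup_insert_0_attained[OF pos fin])
  then show ?thesis by blast
 qed
 show "stairs_function (atom_size (\<eta> \<omega>))"
 proof
  show "0 <= atom_size (\<eta> \<omega>) t" for t using att[of t] atoms_pos[OF \<omega>] by force
  show "atom_size (\<eta> \<omega>) t = 0" if "t <= 0" for t using att[of t] atoms_pos[OF \<omega>] that by force
  fix a T :: real assume "a > 0"
  have "{t. t <= T \<and> a <= atom_size (\<eta> \<omega>) t} \<subseteq> fst ` {(t, x) \<in> \<eta> \<omega>. t <= T \<and> a <= x}"
  proof
   fix t assume t: "t \<in> {t. t <= T \<and> a <= atom_size (\<eta> \<omega>) t}"
   then have "(t, atom_size (\<eta> \<omega>) t) \<in> \<eta> \<omega>" using att[of t] \<open>a > 0\<close> by auto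
   then show "t \<in> fst ` {(t, x) \<in> \<eta> \<omega>. t <= T \<and> a <= x}" using t by force
  qed
  then show "finite {t. t <= T \<and> a <= atom_size (\<eta> \<omega>) t}"
   by (rule finite_subset) (intro finite_imageI locally_finite_atoms \<omega> \<open>a > 0\<close>)
 qed
qed

lemma Z_nonneg: "\<omega> \<in> space S ==> 0 <= Z q i \<omega>"
 by (rule stairs_function.cell_max_nonneg[OF stairs_function])

lemma not_Z_less: "z <= 0 ==> {\<omega>\<in>space S. Z q i \<omega> < z} = {}"
proof (rule equals0I)
 fix \<omega> assume "z <= 0" "\<omega> \<in> {\<omega>\<in>space S. Z q i \<omega> < z}"
 then show False using Z_nonneg[of \<omega> q i] by auto
qed

text \<open>The strict inequality matches void events, as the cell maximum is 0 or the size of an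
  atom.\<close>

lemma Z_less_iff:
 assumes \<omega>: "\<omega> \<in> space S" and z: "z > 0"
 shows "Z q i \<omega> < z \<longleftrightarrow> card (\<eta> \<omega> \<inter> cell q i \<times> {z..}) = 0"
proof -
 interpret F: stairs_function "atom_size (\<eta> \<omega>)" by (rule stairs_function[OF \<omega>])
 have "finite (\<eta> \<omega> \<inter> cell q i \<times> {z..})"
  by (rule finite_subset[OF _ locally_finite_atoms[OF \<omega> z, of "real (Suc i) / real q"]]) (auto simp: cell_def)
 then have "card (\<eta> \<omega> \<inter> cell q i \<times> {z..}) = 0 \<longleftrightarrow> \<eta> \<omega> \<inter> cell q i \<times> {z..} = {}" by simp
 also have "... \<longleftrightarrow> Z q i \<omega> < z"
 proof
  assume e: "\<eta> \<omega> \<inter> cell q i \<times> {z..} = {}"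
  show "Z q i \<omega> < z"
  proof (rule ccontr)
   assume n: "\<not> Z q i \<omega> < z"
   then obtain t where t: "t \<in> cell q i" "atom_size (\<eta> \<omega>) t = Z q i \<omega>" using F.cell_max_attained[of q i] z by auto
   then have "(t, atom_size (\<eta> \<omega>) t) \<in> \<eta> \<omega>" using atom_size_attained[OF \<omega>, of t] n z by auto
   then show False using e t n by auto
  qed
 next
  assume l: "Z q i \<omega> < z"
  have "x < z" if "(t, x) \<in> \<eta> \<omega>" "t \<in> cell q i" for t x
   using atom_size_ge[OF \<omega> that(1)] F.le_cell_max[OF that(2)] l by linarith
  then show "\<eta> \<omega> \<inter> cell q i \<times> {z..} = {}" by force
 qed
 finally show ?thesis by blast
qed

lemma poisson: "poisson_point_process S \<Lambda> \<eta>"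
 using pp by (simp add: stairs_point_process_def)

lemma box:
 assumes q: "q >= 1" and z: "z > 0"
 shows "cell q i \<times> {z..} \<in> sets \<Lambda>" and "emeasure \<Lambda> (cell q i \<times> {z..}) = ennreal (z powr (- \<alpha>) / real q)"
proof -
 show "cell q i \<times> {z..} \<in> sets \<Lambda>" by (intro pair_measureI cell_sets tail_sets z)
 interpret \<mu>: sigma_finite_measure \<mu>
 proof
  show "\<exists>A. countable A \<and> A \<subseteq> sets \<mu> \<and> \<Union> A = space \<mu> \<and> (\<forall>a\<in>A. emeasure \<mu> a \<noteq> \<infinity>)"
  proof (intro exI conjI)
   show "countable (range (%n. {inverse (real (Suc n))..}))" by simp
   show "range (%n. {inverse (real (Suc n))..}) \<subseteq> sets \<mu>" using tail_sets by auto
   show "\<Union> (range (%n. {inverse (real (Suc n))..})) = space \<mu>"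
   proof -
    have "\<exists>n. inverse (real (Suc n)) <= x" if "x > 0" for x
     using reals_Archimedean[OF that] less_imp_le by blast
    moreover have "0 < x" if "inverse (real (Suc n)) <= x" for x n
     using that by (rule less_le_trans[rotated]) simp
    ultimately show ?thesis unfolding space_\<mu> by (auto simp del: of_nat_Suc)
   qed
  qed (auto simp: tail)
 qed
 have "real (Suc i) / real q - real i / real q = 1 / real q" by (simp add: diff_divide_distrib[symmetric])
 then have "emeasure (restrict_space lborel {0<..}) (cell q i) = ennreal (1 / real q)"
  using q cell_pos[of _ q i] by (subst emeasure_restrict_space) (auto simp: cell_def divide_right_mono)
 then show "emeasure \<Lambda> (cell q i \<times> {z..}) = ennreal (z powr (- \<alpha>) / real q)"
  using \<mu>.emeasure_pair_measure_Times[OF cell_sets tail_sets[OF z], of q i]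
  by (simp add: tail z ennreal_mult[symmetric])
qed

lemma
 assumes q: "q >= 1" and z: "z > 0"
 shows Z_less_sets: "{\<omega>\<in>space S. Z q i \<omega> < z} \<in> events"
  and prob_Z_less: "prob {\<omega>\<in>space S. Z q i \<omega> < z} = exp (- (1 / real q) * z powr (- \<alpha>))"
proof -
 note b = box[OF q z, of i]
 have fin: "emeasure \<Lambda> (cell q i \<times> {z..}) < \<infinity>" unfolding b(2) by simp
 have eq: "{\<omega>\<in>space S. Z q i \<omega> < z} = {\<omega>\<in>space S. card (\<eta> \<omega> \<inter> cell q i \<times> {z..}) = 0}" using Z_less_iff[OF _ z] by blast
 have m: "(%\<omega>. card (\<eta> \<omega> \<inter> cell q i \<times> {z..})) \<in> measurable S (count_space UNIV)"
  and p: "prob {\<omega>\<in>space S. card (\<eta> \<omega> \<inter> cell q i \<times> {z..}) = 0} = measure \<Lambda> (cell q i \<times> {z..}) ^ 0 / fact 0 * exp (- measure \<Lambda> (cell q i \<times> {z..}))"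
  using poisson b(1) fin unfolding poisson_point_process_def by blast+
 show "{\<omega>\<in>space S. Z q i \<omega> < z} \<in> events"
  using measurable_sets[OF m, of "{0}"] unfolding eq by (simp add: vimage_def Int_def conj_commute)
 have "measure \<Lambda> (cell q i \<times> {z..}) = z powr (- \<alpha>) / real q" unfolding measure_def b(2) by simp
 then show "prob {\<omega>\<in>space S. Z q i \<omega> < z} = exp (- (1 / real q) * z powr (- \<alpha>))"
  unfolding eq p by simp
qed

lemma Z_measurable: "q >= 1 ==> Z q i \<in> borel_measurable S"
 unfolding borel_measurable_iff_less
proof
 fix z :: real assume q: "q >= 1"
 show "{\<omega>\<in>space S. Z q i \<omega> < z} \<in> events"
 proof (cases "z > 0")
  case False
  then have e: "{\<omega>\<in>space S. Z q i \<omega> < z} = {}" by (intro not_Z_less) simp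
  show ?thesis unfolding e by simp
 qed (rule Z_less_sets[OF q])
qed

text \<open>Void probabilities give the probability of \<open>Z < z\<close>. Right continuity of the
  Frechet cdf passes to \<open>Z \<le> z\<close>.\<close>

lemma distr_Z:
 assumes q: "q >= 1"
 shows "distr S borel (Z q i) = frechet \<alpha> (1 / real q)"
proof (rule cdf_unique)
 have pos: "\<alpha> > 0" "1 / real q > 0" using \<alpha> q by auto
 show "real_distribution (distr S borel (Z q i))" by (rule real_distribution_distr[OF Z_measurable[OF q]])
 show fr: "real_distribution (frechet \<alpha> (1 / real q))" by (rule real_distribution_frechet[OF pos])
 interpret fr: real_distribution "frechet \<alpha> (1 / real q)" by (rule fr)
 show "cdf (distr S borel (Z q i)) = cdf (frechet \<alpha> (1 / real q))"
 proof
  fix z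
  have eq: "cdf (distr S borel (Z q i)) z = prob {\<omega>\<in>space S. Z q i \<omega> <= z}"
   unfolding cdf_def by (subst measure_distr[OF Z_measurable[OF q]]) (auto intro!: arg_cong[where f=prob])
  have F: "prob {\<omega>\<in>space S. Z q i \<omega> < y} = cdf (frechet \<alpha> (1 / real q)) y" for y
  proof (cases "y > 0")
   case True
   then show ?thesis unfolding prob_Z_less[OF q True] cdf_frechet[OF pos] by simp
  next
   case False
   then have e: "{\<omega>\<in>space S. Z q i \<omega> < y} = {}" by (intro not_Z_less) simp
   show ?thesis unfolding e using False by (simp add: cdf_frechet[OF pos])
  qed
  have [measurable]: "Z q i \<in> borel_measurable S" by (rule Z_measurable[OF q])
  show "cdf (distr S borel (Z q i)) z = cdf (frechet \<alpha> (1 / real q)) z"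
  proof (rule antisym)
   have "prob {\<omega>\<in>space S. Z q i \<omega> <= z} <= cdf (frechet \<alpha> (1 / real q)) y" if "z < y" for y
    unfolding F[symmetric] by (rule finite_measure_mono) (use that in auto)
   then have "\<forall>\<^sub>F y in at_right z. prob {\<omega>\<in>space S. Z q i \<omega> <= z} <= cdf (frechet \<alpha> (1 / real q)) y"
    unfolding eventually_at_right_field by (intro exI[of _ "z + 1"]) auto
   moreover have "(cdf (frechet \<alpha> (1 / real q)) ---> cdf (frechet \<alpha> (1 / real q)) z) (at_right z)"
    using fr.cdf_is_right_cont[of z] by (simp add: continuous_within)
   ultimately show "cdf (distr S borel (Z q i)) z <= cdf (frechet \<alpha> (1 / real q)) z"
    unfolding eq by (intro tendsto_lowerbound) auto
   show "cdf (frechet \<alpha> (1 / real q)) z <= cdf (distr S borel (Z q i)) z"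
    unfolding eq F[symmetric] by (rule finite_measure_mono) auto
  qed
 qed
qed

lemma cells_disjoint: "q >= 1 ==> i \<noteq> j ==> cell q i \<inter> cell q j = {}"
proof (rule equals0I)
 fix u assume "q >= 1" "i \<noteq> j" "u \<in> cell q i \<inter> cell q j"
 then have "real i < u * real q" "u * real q <= real (Suc i)" "real j < u * real q" "u * real q <= real (Suc j)" "i \<noteq> j"
  using cell_bounds[of q u] by blast+
 then show False by (cases i j rule: linorder_cases) auto
qed

text \<open>Independence is checked on the rays \<open>{..<z}\<close>, where the events say that
  disjoint boxes contain no atom.\<close>

lemma indep_vars_Z_finite:
 assumes q: "q >= 1" and J: "J \<noteq> {}" "finite J"
 shows "indep_vars (%_. borel) (Z q) J"
proof (subst indep_vars_finite[where E="%_. insert UNIV (range lessThan)"])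
 show "sets (borel :: real measure) = sigma_sets (space borel) (insert UNIV (range lessThan))" for i :: nat
 proof -
  have "sigma_sets UNIV (insert UNIV (range lessThan)) = sigma_sets UNIV (range (lessThan :: real => _))"
   by (rule sigma_sets_eqI) (auto intro: sigma_sets.Basic sigma_sets_top)
  then show ?thesis unfolding borel_Iio by simp
 qed
 show "Int_stable (insert UNIV (range (lessThan :: real => _)))" for i :: nat
 proof -
  have "{..<a} \<inter> {..<b} = {..<min a b}" for a b :: real by auto
  then show ?thesis by (auto simp: Int_stable_def)
 qed
 show "\<forall>A\<in>(\<Pi> i\<in>J. insert UNIV (range lessThan)). prob (\<Inter>j\<in>J. Z q j -` A j \<inter> space S) = (\<Prod>j\<in>J. prob (Z q j -` A j \<inter> space S))"
 proof
  fix A :: "nat => real set" assume "A \<in> (\<Pi> i\<in>J. insert UNIV (range lessThan))"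
  then have "\<forall>j. \<exists>z. j \<in> J \<longrightarrow> A j = UNIV \<or> A j = {..<z}" by fast
  then obtain z where z: "\<And>j. j \<in> J ==> A j = UNIV \<or> A j = {..<z j}" by metis
  show "prob (\<Inter>j\<in>J. Z q j -` A j \<inter> space S) = (\<Prod>j\<in>J. prob (Z q j -` A j \<inter> space S))"
  proof (cases "\<exists>j\<in>J. A j \<noteq> UNIV \<and> z j <= 0")
   case True
   then obtain j where j: "j \<in> J" "A j = {..<z j}" "z j <= 0" using z by blast
   then have e: "Z q j -` A j \<inter> space S = {}" using not_Z_less[of "z j" q j] by auto
   then have "(\<Prod>j\<in>J. prob (Z q j -` A j \<inter> space S)) = 0" using J(2) j(1) by (intro prod_zero bexI[of _ j]) auto
   moreover have "(\<Inter>j\<in>J. Z q j -` A j \<inter> space S) = {}" using e j(1) by blast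
   ultimately show ?thesis by simp
  next
   case False
   \<comment> \<open>An index without a constraint gets the empty box, whose count is always
     0.\<close>
   define B where "B j = (if j \<in> J \<and> A j \<noteq> UNIV then cell q j \<times> {z j..} else {})" for j
   obtain n where n: "J \<subseteq> {..<n}" using finite_nat_iff_bounded[THEN iffD1, OF J(2)] by blast
   have "disjoint_family_on B {..<n}"
    unfolding disjoint_family_on_def
   proof (intro ballI impI)
    fix i j :: nat assume "i \<noteq> j"
    have "B i \<subseteq> cell q i \<times> UNIV" for i by (auto simp: B_def)
    then show "B i \<inter> B j = {}" using cells_disjoint[OF q \<open>i \<noteq> j\<close>] by fast
   qed
   moreover have "\<forall>i<n. B i \<in> sets \<Lambda> \<and> emeasure \<Lambda> (B i) < \<infinity>"
   proof (intro allI impI)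
    fix i
    show "B i \<in> sets \<Lambda> \<and> emeasure \<Lambda> (B i) < \<infinity>"
    proof (cases "i \<in> J \<and> A i \<noteq> UNIV")
     case True
     then have "z i > 0" "B i = cell q i \<times> {z i..}" using False by (auto simp: B_def not_le)
     then show ?thesis using box[OF q, of "z i" i] by simp
    next
     case nu: False
     then have "B i = {}" by (auto simp: B_def)
     then show ?thesis by simp
    qed
   qed
   ultimately have ind: "indep_vars (%_. count_space UNIV) (%i \<omega>. card (\<eta> \<omega> \<inter> B i)) {..<n}"
    using poisson unfolding poisson_point_process_def by blast
   have eq: "Z q j -` A j \<inter> space S = (%\<omega>. card (\<eta> \<omega> \<inter> B j)) -` {0} \<inter> space S" if "j \<in> J" for j
   proof (cases "A j = UNIV")
    case True
    then show ?thesis by (simp add: B_def)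
   next
    case nu: False
    then have A: "A j = {..<z j}" and z0: "z j > 0" and B: "B j = cell q j \<times> {z j..}"
     using z[OF that] False that by (auto simp: B_def not_le)
    show ?thesis
     unfolding A B vimage_def Int_def mem_Collect_eq lessThan_iff singleton_iff
     using Z_less_iff[OF _ z0, unfolded Int_def] by (intro Collect_cong) (simp only: conj_commute cong: conj_cong)
   qed
   have "prob (\<Inter>j\<in>J. (%\<omega>. card (\<eta> \<omega> \<inter> B j)) -` {0} \<inter> space S) = (\<Prod>j\<in>J. prob ((%\<omega>. card (\<eta> \<omega> \<inter> B j)) -` {0} \<inter> space S))"
    by (rule indep_varsD[OF ind J n]) simp
   then show ?thesis by (simp add: eq)
  qed
 qed
qed (use J Z_measurable[OF q] in auto)

lemma indep_vars_Z:
 assumes q: "q >= 1"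
 shows "indep_vars (%_. borel) (Z q) UNIV"
 unfolding indep_vars_def
proof (intro conjI ballI)
 show "indep_sets (%i. sigma_sets (space S) {Z q i -` A \<inter> space S |A. A \<in> sets borel}) UNIV"
  by (subst indep_sets_finite_index_sets) (use indep_vars_Z_finite[OF q] in \<open>auto simp: indep_vars_def\<close>)
qed (rule Z_measurable[OF q])

lemma distr_Z_sequence:
 assumes q: "q >= 1"
 shows "distr S (\<Pi>\<^sub>M i\<in>UNIV. borel) (%\<omega> i. Z q i \<omega>) = (\<Pi>\<^sub>M i\<in>UNIV. frechet \<alpha> (1 / real q))"
proof -
 have "distr S (\<Pi>\<^sub>M i\<in>UNIV. borel) (%\<omega>. \<lambda>i\<in>UNIV. Z q i \<omega>) = (\<Pi>\<^sub>M i\<in>UNIV. distr S borel (Z q i))"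
  using indep_vars_iff_distr_eq_PiM[of UNIV "Z q" "%_. borel"] indep_vars_Z[OF q] Z_measurable[OF q] by simp
 then show ?thesis unfolding distr_Z[OF q] by (simp add: restrict_UNIV)
qed

lemma
 assumes q: "q >= 1" and g: "g >= 1"
 shows AE_sep_max_Z: "AE \<omega> in S. (%n. sep_max g n (%i. Z q i \<omega>) / real n) ----> sep_speed g (frechet \<alpha> (1 / real q))"
  and integrable_sep_max_Z: "integrable S (%\<omega>. sep_max g n (%i. Z q i \<omega>))"
  and expectation_sep_max_Z: "expectation (%\<omega>. sep_max g n (%i. Z q i \<omega>)) = esep g n (frechet \<alpha> (1 / real q))"
proof -
 interpret F: sep_law "frechet \<alpha> (1 / real q)" by (rule fr_law[OF \<alpha> q])
 have m: "(%\<omega> i. Z q i \<omega>) \<in> measurable S (\<Pi>\<^sub>M i\<in>UNIV. borel)"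
  by (rule measurable_PiM_single') (auto intro: Z_measurable[OF q])
 have s: "sep_max g n \<in> borel_measurable (\<Pi>\<^sub>M i\<in>UNIV. borel)" by (rule sep_max_measurable_PiM) auto
 note D = distr_Z_sequence[OF q]
 show "AE \<omega> in S. (%n. sep_max g n (%i. Z q i \<omega>) / real n) ----> sep_speed g (frechet \<alpha> (1 / real q))"
  using F.AE_sep_max_tendsto[OF g] unfolding D[symmetric] by (rule AE_distrD[OF m])
 show "integrable S (%\<omega>. sep_max g n (%i. Z q i \<omega>))"
  using F.integrable_sep_max[of g n] unfolding D[symmetric] integrable_distr_eq[OF m s] .
 show "expectation (%\<omega>. sep_max g n (%i. Z q i \<omega>)) = esep g n (frechet \<alpha> (1 / real q))"
  unfolding esep_def D[symmetric] by (rule integral_distr[OF m s, symmetric])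
qed

lemma
 assumes "\<omega> \<in> space S" "q >= 1" "t > 0"
 shows sep_max_Z_le: "sep_max (Suc q) (nat \<lfloor>t * real q\<rfloor>) (%i. Z q i \<omega>) <= stairs (atom_size (\<eta> \<omega>)) t"
  and le_sep_max_Z: "stairs (atom_size (\<eta> \<omega>)) t <= sep_max q (nat \<lceil>t * real q\<rceil>) (%i. Z q i \<omega>)"
proof -
 interpret F: stairs_function "atom_size (\<eta> \<omega>)" by (rule stairs_function[OF assms(1)])
 have t: "0 <= t * real q" using assms by simp
 then show "sep_max (Suc q) (nat \<lfloor>t * real q\<rfloor>) (%i. Z q i \<omega>) <= stairs (atom_size (\<eta> \<omega>)) t"
  by (intro F.sep_max_le_R assms) (simp add: of_nat_nat)
 show "stairs (atom_size (\<eta> \<omega>)) t <= sep_max q (nat \<lceil>t * real q\<rceil>) (%i. Z q i \<omega>)"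
  using t by (intro F.R_le_sep_max assms) (simp add: of_nat_nat)
qed

text \<open>Measurability comes from the pointwise approximation by cell maxima on finer and finer
  meshes, integrability from the upper bound on the mesh 1.\<close>

lemma integrable_stairs: "integrable S (%\<omega>. stairs (atom_size (\<eta> \<omega>)) t)"
proof (cases "t <= 0")
 case True
 then have "stairs (atom_size (\<eta> \<omega>)) t = 0" for \<omega> by (subst stairs.simps) simp
 then show ?thesis by simp
next
 case False
 then have t: "t > 0" by simp
 show ?thesis
 proof (rule L1_bound)
  show "integrable S (%\<omega>. sep_max 1 (nat \<lceil>t * real 1\<rceil>) (%i. Z 1 i \<omega>))" by (rule integrable_sep_max_Z) simp_all
  show "(%\<omega>. stairs (atom_size (\<eta> \<omega>)) t) \<in> borel_measurable S"
  proof (rule borel_measurable_LIMSEQ_real)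
   show "(%q. sep_max (Suc q) (nat \<lceil>t * real (Suc q)\<rceil>) (%i. Z (Suc q) i \<omega>)) ----> stairs (atom_size (\<eta> \<omega>)) t" if "\<omega> \<in> space S" for \<omega>
    by (rule stairs_function.sep_max_cells_tendsto[OF stairs_function[OF that] t])
   show "(%\<omega>. sep_max (Suc q) (nat \<lceil>t * real (Suc q)\<rceil>) (%i. Z (Suc q) i \<omega>)) \<in> borel_measurable S" for q
    by (rule sep_max_measurable) (rule Z_measurable, simp)
  qed
  show "AE \<omega> in S. norm (stairs (atom_size (\<eta> \<omega>)) t) <= norm (sep_max 1 (nat \<lceil>t * real 1\<rceil>) (%i. Z 1 i \<omega>))"
  proof (rule AE_I2)
   fix \<omega> assume \<omega>: "\<omega> \<in> space S"
   have "0 <= stairs (atom_size (\<eta> \<omega>)) t" by (rule stairs_function.R_nonneg[OF stairs_function[OF \<omega>]])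
   then show "norm (stairs (atom_size (\<eta> \<omega>)) t) <= norm (sep_max 1 (nat \<lceil>t * real 1\<rceil>) (%i. Z 1 i \<omega>))"
    using le_sep_max_Z[OF \<omega> _ t, of 1] unfolding real_norm_def by linarith
  qed
 qed
qed

theorem stairs_tendsto_speed:
 "tendsto_AE_and_L1 S (%t \<omega>. stairs (atom_size (\<eta> \<omega>)) t / t) (stairs_speed \<alpha>) at_top"
proof (rule tendsto_AE_and_L1_at_topI)
 show "prob_space S" by (rule prob_space_axioms)
 have "AE \<omega> in S. \<forall>q g. q >= 1 \<longrightarrow> g >= 1 \<longrightarrow> (%n. sep_max g n (%i. Z q i \<omega>) / real n) ----> sep_speed g (frechet \<alpha> (1 / real q))"
  unfolding AE_all_countable using AE_sep_max_Z by (auto intro!: AE_impI)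
 then show "AE \<omega> in S. ((%t. stairs (atom_size (\<eta> \<omega>)) t / t) ---> stairs_speed \<alpha>) at_top"
  using AE_space
 proof eventually_elim
  case (elim \<omega>)
  show ?case
   by (rule stairs_speed_squeeze[OF \<alpha>, of "%q n. sep_max (Suc q) n (%i. Z q i \<omega>)" "%q n. sep_max q n (%i. Z q i \<omega>)"])
    (use elim in \<open>auto intro: sep_max_Z_le le_sep_max_Z\<close>)
 qed
 show "((%t. expectation (%\<omega>. stairs (atom_size (\<eta> \<omega>)) t / t)) ---> stairs_speed \<alpha>) at_top"
  unfolding integral_divide_zero
 proof (rule stairs_speed_squeeze[OF \<alpha>, of "%q n. esep (Suc q) n (frechet \<alpha> (1 / real q))" "%q n. esep q n (frechet \<alpha> (1 / real q))"])
  fix q :: nat and t :: real assume q: "q >= 1" and t: "t > 0"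
  have g: "Suc q >= 1" by simp
  show "esep (Suc q) (nat \<lfloor>t * real q\<rfloor>) (frechet \<alpha> (1 / real q)) <= expectation (%\<omega>. stairs (atom_size (\<eta> \<omega>)) t)"
   unfolding expectation_sep_max_Z[OF q g, symmetric]
   by (rule integral_mono[OF integrable_sep_max_Z[OF q g] integrable_stairs sep_max_Z_le[OF _ q t]])
  show "expectation (%\<omega>. stairs (atom_size (\<eta> \<omega>)) t) <= esep q (nat \<lceil>t * real q\<rceil>) (frechet \<alpha> (1 / real q))"
   unfolding expectation_sep_max_Z[OF q q, symmetric]
   by (rule integral_mono[OF integrable_stairs integrable_sep_max_Z[OF q q] le_sep_max_Z[OF _ q t]])
 qed (intro sep_law.esep_tendsto fr_law[OF \<alpha>], simp_all)+
 show "integrable S (%\<omega>. stairs (atom_size (\<eta> \<omega>)) t / t)" for t by (rule integrable_divide[OF integrable_stairs])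
 show "AE \<omega> in S. 0 <= stairs (atom_size (\<eta> \<omega>)) t / t" for t
 proof (rule AE_I2)
  fix \<omega> assume \<omega>: "\<omega> \<in> space S"
  interpret F: stairs_function "atom_size (\<eta> \<omega>)" by (rule stairs_function[OF \<omega>])
  show "0 <= stairs (atom_size (\<eta> \<omega>)) t / t"
   using F.R_nonneg[of t] F.R_0[of t] by (cases "t <= 0") auto
 qed
qed

end

section \<open>From arbitrary probability spaces to the canonical one\<close>

text \<open>Both modes of convergence to a constant depend only on the joint law, so agreement
  almost surely with a function of the canonical sample is enough.\<close>

lemma tendsto_AE_and_L1_transfer:
 assumes T: "T \<in> measurable M S" "distr M S T = S" and Y: "\<And>n. Y n \<in> borel_measurable S" "\<And>n. Y' n \<in> borel_measurable M"
  and eq: "AE w in M. \<forall>n. Y' n w = Y n (T w)" and lim: "tendsto_AE_and_L1 S Y v F"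
 shows "tendsto_AE_and_L1 M Y' v F"
proof -
 note [measurable] = T(1) Y
 have ae: "AE w in M. Y' n w = Y n (T w)" for n using eq by eventually_elim blast
 have "AE w in distr M S T. ((%n. Y n w) ---> v) F" using lim unfolding T(2) tendsto_AE_and_L1_def by blast
 then have "AE w in M. ((%n. Y n (T w)) ---> v) F" by (rule AE_distrD[OF T(1)])
 with eq have 1: "AE w in M. ((%n. Y' n w) ---> v) F" by eventually_elim simp
 have "integrable M (Y' n) \<longleftrightarrow> integrable S (Y n)" for n
 proof -
  have "integrable M (Y' n) \<longleftrightarrow> integrable M (%w. Y n (T w))"
   by (rule integrable_cong_AE[OF _ _ ae]) measurable
  also have "... \<longleftrightarrow> integrable (distr M S T) (Y n)" by (rule integrable_distr_eq[symmetric]) measurable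
  finally show ?thesis unfolding T(2) .
 qed
 moreover have "(LINT w|M. \<bar>Y' n w - v\<bar>) = (LINT w|S. \<bar>Y n w - v\<bar>)" for n
 proof -
  have "(LINT w|M. \<bar>Y' n w - v\<bar>) = (LINT w|M. \<bar>Y n (T w) - v\<bar>)"
   by (rule integral_cong_AE) (measurable, use ae[of n] in eventually_elim, simp)
  also have "... = (LINT w|(distr M S T). \<bar>Y n w - v\<bar>)" by (rule integral_distr[symmetric]) measurable
  finally show ?thesis unfolding T(2) .
 qed
 ultimately show ?thesis using 1 lim by (simp add: tendsto_AE_and_L1_def)
qed

text \<open>The jumps are grouped by generation: the groups use disjoint index sets, and each group
  has a product law.\<close>

lemma (in prob_space) generations_law:
 fixes \<Xi> :: "nat => nat => 'a => real"
 assumes ind: "indep_vars (%_. borel) (%(n, k). \<Xi> n k) (UNIV \<times> {1..m})" and m: "m >= 1"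
  and law: "\<And>n k. k \<in> {1..m} ==> distr M borel (\<Xi> n k) = \<nu>" and \<nu>: "sets \<nu> = sets borel"
 shows "(%w n. \<lambda>k\<in>{1..m}. \<Xi> n k w) \<in> measurable M (\<Pi>\<^sub>M n\<in>UNIV. \<Pi>\<^sub>M k\<in>{1..m}. \<nu>)" (is "?T \<in> measurable M ?S")
  and "distr M (\<Pi>\<^sub>M n\<in>UNIV. \<Pi>\<^sub>M k\<in>{1..m}. \<nu>) (%w n. \<lambda>k\<in>{1..m}. \<Xi> n k w) = (\<Pi>\<^sub>M n\<in>UNIV. \<Pi>\<^sub>M k\<in>{1..m}. \<nu>)"
proof -
 let ?B = "\<Pi>\<^sub>M k\<in>{1..m}. (borel :: real measure)"
 have rv: "\<Xi> n k \<in> borel_measurable M" if "k \<in> {1..m}" for n k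
 proof -
  have "\<forall>p\<in>UNIV \<times> {1..m}. (%(n, k). \<Xi> n k) p \<in> borel_measurable M" using ind unfolding indep_vars_def2 by blast
  from bspec[OF this, of "(n, k)"] that show ?thesis by simp
 qed
 have T: "(%w. \<lambda>k\<in>{1..m}. \<Xi> n k w) \<in> measurable M ?B" for n by (intro measurable_restrict rv)
 have S: "sets ?S = sets (\<Pi>\<^sub>M n\<in>(UNIV :: nat set). ?B)" by (intro sets_PiM_cong refl \<nu>)
 have T': "?T \<in> measurable M (\<Pi>\<^sub>M n\<in>UNIV. ?B)" by (rule measurable_PiM_single') (use measurable_space[OF T] in \<open>auto intro: T\<close>)
 then show "?T \<in> measurable M ?S" unfolding measurable_cong_sets[OF refl S] .
 have row: "distr M ?B (%w. \<lambda>k\<in>{1..m}. \<Xi> n k w) = (\<Pi>\<^sub>M k\<in>{1..m}. \<nu>)" for n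
 proof -
  let ?P = "UNIV \<times> {1..m} :: (nat \<times> nat) set" and ?X = "%(n, k). \<Xi> n k"
  have P: "prob_space \<nu>" using prob_space_distr[OF rv, of 1 0] law[of 1 0] m by simp
  have rvX: "?X p \<in> borel_measurable M" if "p \<in> ?P" for p using that rv by auto
  have X: "(%w. \<lambda>p\<in>?P. ?X p w) \<in> measurable M (\<Pi>\<^sub>M p\<in>?P. borel)" by (intro measurable_restrict rvX)
  have "distr M (\<Pi>\<^sub>M p\<in>?P. borel) (%w. \<lambda>p\<in>?P. ?X p w) = (\<Pi>\<^sub>M p\<in>?P. distr M borel (?X p))"
   using ind m rvX by (subst (asm) indep_vars_iff_distr_eq_PiM') auto
  also have "... = (\<Pi>\<^sub>M p\<in>?P. \<nu>)" by (intro PiM_cong refl) (use law in auto)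
  finally have D: "distr M (\<Pi>\<^sub>M p\<in>?P. borel) (%w. \<lambda>p\<in>?P. ?X p w) = (\<Pi>\<^sub>M p\<in>?P. \<nu>)" .
  have pr: "(%v. \<lambda>k\<in>{1..m}. v (n, k)) \<in> measurable (\<Pi>\<^sub>M p\<in>?P. borel) ?B"
   by (intro measurable_restrict measurable_component_singleton) auto
  have "distr M ?B (%w. \<lambda>k\<in>{1..m}. \<Xi> n k w) = distr (distr M (\<Pi>\<^sub>M p\<in>?P. borel) (%w. \<lambda>p\<in>?P. ?X p w)) ?B (%v. \<lambda>k\<in>{1..m}. v (n, k))"
   by (subst distr_distr[OF pr X]) (auto intro!: distr_cong simp: comp_def restrict_def)
  also have "... = distr (\<Pi>\<^sub>M p\<in>?P. \<nu>) (\<Pi>\<^sub>M k\<in>{1..m}. \<nu>) (%v. \<lambda>k\<in>{1..m}. v (n, k))"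
   unfolding D by (intro distr_cong sets_PiM_cong refl \<nu>[symmetric])
  also have "... = (\<Pi>\<^sub>M k\<in>{1..m}. \<nu>)"
   by (rule distr_PiM_reindex[of ?P "%_. \<nu>" "Pair n" "{1..m}"]) (use P in \<open>auto simp: inj_on_def\<close>)
  finally show ?thesis .
 qed
 have "indep_vars (%n. \<Pi>\<^sub>M i\<in>{n} \<times> {1..m}. borel) (%n w. restrict (%p. (%(n, k). \<Xi> n k) p w) ({n} \<times> {1..m})) UNIV"
  by (rule indep_vars_restrict[OF ind]) (auto simp: disjoint_family_on_def)
 then have "indep_vars (%n. ?B) (%n w. (%v. \<lambda>k\<in>{1..m}. v (n, k)) (restrict (%p. (%(n, k). \<Xi> n k) p w) ({n} \<times> {1..m}))) UNIV"
  by (rule indep_vars_compose2) (intro measurable_restrict measurable_component_singleton, auto)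
 also have "(%n w. (%v. \<lambda>k\<in>{1..m}. v (n, k)) (restrict (%p. (%(n, k). \<Xi> n k) p w) ({n} \<times> {1..m}))) = (%n w. \<lambda>k\<in>{1..m}. \<Xi> n k w)"
  by (intro ext) (auto simp: restrict_def)
 finally have "distr M (\<Pi>\<^sub>M n\<in>UNIV. ?B) (%w. \<lambda>n\<in>UNIV. \<lambda>k\<in>{1..m}. \<Xi> n k w) = (\<Pi>\<^sub>M n\<in>UNIV. distr M ?B (%w. \<lambda>k\<in>{1..m}. \<Xi> n k w))"
  using T by (subst (asm) indep_vars_iff_distr_eq_PiM') auto
 then have D: "distr M (\<Pi>\<^sub>M n\<in>UNIV. ?B) ?T = ?S" unfolding row restrict_UNIV .
 have "distr M ?S ?T = distr M (\<Pi>\<^sub>M n\<in>UNIV. ?B) ?T" by (rule distr_cong[OF refl S refl])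
 then show "distr M ?S ?T = ?S" unfolding D .
qed

text \<open>For \<open>N = 1\<close> both branches describe the same particle.\<close>

definition extreme :: "nat => nat => (nat => nat => real) => nat => real" where
 "extreme N i = (if i = 1 then population.lowest N else population.highest N)"

lemma (in prob_space) positions_law:
 fixes \<Xi> :: "nat => nat => 'a => real"
 assumes ind: "indep_vars (%_. borel) (%(n, k). \<Xi> n k) (UNIV \<times> {1..2 * N})" and N: "N >= 1"
  and law: "\<And>n k. k \<in> {1..2 * N} ==> distr M borel (\<Xi> n k) = \<nu>" and \<nu>: "sets \<nu> = sets borel" "AE x in \<nu>. 0 <= x"
  and i: "i \<in> {1, N}"
 obtains T where "T \<in> measurable M (\<Pi>\<^sub>M n\<in>UNIV. \<Pi>\<^sub>M k\<in>{1..2 * N}. \<nu>)"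
  "distr M (\<Pi>\<^sub>M n\<in>UNIV. \<Pi>\<^sub>M k\<in>{1..2 * N}. \<nu>) T = (\<Pi>\<^sub>M n\<in>UNIV. \<Pi>\<^sub>M k\<in>{1..2 * N}. \<nu>)"
  "AE w in M. \<forall>n. 0 <= nbrw N (%n k. \<Xi> n k w) i n \<and> nbrw N (%n k. \<Xi> n k w) i n = extreme N i (jumps (%x. max 0 x) (T w)) n"
  "\<And>n. (%w. nbrw N (%n k. \<Xi> n k w) i n) \<in> borel_measurable M"
proof
 let ?T = "%w n. \<lambda>k\<in>{1..2 * N}. \<Xi> n k w"
 interpret population N using N by unfold_locales
 have m: "2 * N >= 1" using N by simp
 note gl = generations_law[OF ind m law \<nu>(1)]
 show "?T \<in> measurable M (\<Pi>\<^sub>M n\<in>UNIV. \<Pi>\<^sub>M k\<in>{1..2 * N}. \<nu>)"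
  "distr M (\<Pi>\<^sub>M n\<in>UNIV. \<Pi>\<^sub>M k\<in>{1..2 * N}. \<nu>) ?T = (\<Pi>\<^sub>M n\<in>UNIV. \<Pi>\<^sub>M k\<in>{1..2 * N}. \<nu>)" using gl by blast+
 have rv: "\<Xi> n k \<in> borel_measurable M" if "k \<in> {1..2 * N}" for n k
 proof -
  have "\<forall>p\<in>UNIV \<times> {1..2 * N}. (%(n, k). \<Xi> n k) p \<in> borel_measurable M" using ind unfolding indep_vars_def2 by blast
  from bspec[OF this, of "(n, k)"] that show ?thesis by simp
 qed
 have iN: "i - 1 < N" using i N by auto
 show "(%w. nbrw N (%n k. \<Xi> n k w) i n) \<in> borel_measurable M" for n
  unfolding nbrw_def by (rule nbrw_measurable[OF rv iN])
 have "AE w in M. k \<in> {1..2 * N} \<longrightarrow> 0 <= \<Xi> n k w" for n k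
 proof (cases "k \<in> {1..2 * N}")
  case True
  have "AE x in distr M borel (\<Xi> n k). 0 <= x" unfolding law[OF True] by (rule \<nu>(2))
  from AE_distrD[OF rv[OF True] this] show ?thesis by simp
 qed (auto intro!: AE_I2)
 then have "AE w in M. \<forall>n k. k \<in> {1..2 * N} \<longrightarrow> 0 <= \<Xi> n k w" by (simp add: AE_all_countable)
 then show "AE w in M. \<forall>n. 0 <= nbrw N (%n k. \<Xi> n k w) i n \<and> nbrw N (%n k. \<Xi> n k w) i n = extreme N i (jumps (%x. max 0 x) (?T w)) n"
 proof eventually_elim
  case (elim w)
  interpret J: nonneg_jumps N "jumps (%x. max 0 x) (?T w)" by unfold_locales (simp add: jumps_def)
  have "nbrw N (%n k. \<Xi> n k w) i n = extreme N i (jumps (%x. max 0 x) (?T w)) n" for n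
  proof -
   have "nbrw N (%n k. \<Xi> n k w) i n = nbrw_list N (jumps (%x. max 0 x) (?T w)) n ! (i - 1)"
    unfolding nbrw_def by (rule nbrw_cong[OF _ iN]) (use elim in \<open>simp add: jumps_def\<close>)
   then show ?thesis using i by (auto simp: extreme_def lowest_def highest_def)
  qed
  moreover have "0 <= extreme N i (jumps (%x. max 0 x) (?T w)) n" for n
   using J.lowest_nonneg[of n] lowest_le_highest[of _ n] by (auto simp: extreme_def intro: order_trans)
  ultimately show ?case by simp
 qed
qed

lemma limsup_tendsto_0:
 fixes f :: "nat => nat => real"
 assumes nonneg: "EV N. \<forall>n. 0 <= f N n" and e: "e ----> 0"
  and le: "EV N. \<exists>g. g ----> 0 \<and> (EV n. f N n <= g n + e N)"
 shows "(%N. limsup (%n. ereal (f N n))) ----> 0"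
proof (rule tendsto_sandwich)
 show "EV N. 0 <= limsup (%n. ereal (f N n))"
  using nonneg by eventually_elim (intro le_Limsup always_eventually allI, simp_all)
 show "EV N. limsup (%n. ereal (f N n)) <= ereal (e N)"
  using le
 proof eventually_elim
  case (elim N)
  then obtain g where g: "g ----> 0" "EV n. f N n <= g n + e N" by blast
  have "(%n. g n + e N) ----> 0 + e N" by (intro tendsto_add g tendsto_const)
  then have "limsup (%n. ereal (g n + e N)) = ereal (e N)" by (intro lim_imp_Limsup) simp_all
  moreover have "limsup (%n. ereal (f N n)) <= limsup (%n. ereal (g n + e N))"
   by (rule Limsup_mono) (use g(2) in eventually_elim, simp)
  ultimately show ?case by simp
 qed
 show "(%N. ereal (e N)) ----> 0" using tendsto_ereal[OF e] by (simp add: zero_ereal_def)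
qed simp

section \<open>The integrals in the statement\<close>

context heavy_tail
begin

text \<open>\<open>h c / h (c * x) = G (c * x) / G c\<close>, and the substitution y = c x maps
  \<open>I\<close> onto \<open>J\<close>; \<open>E\<close> is the integral of the tail over
  \<open>J\<close>.\<close>

lemma integral_ratio:
 assumes c: "c > 0" and E: "0 <= E" "ennreal E = (\<integral>\<^sup>+y. ennreal (G y) * indicator J y \<partial>lborel)"
  and I: "I \<in> sets borel" "J \<in> sets borel" "I \<subseteq> {0..}" and IJ: "\<And>x. c * x \<in> J \<longleftrightarrow> x \<in> I"
 shows "(LBINT x:I. h c / h (c * x)) = E / (c * G c)"
proof -
 note [measurable] = I(1,2)
 have E': "ennreal E = ennreal c * (\<integral>\<^sup>+x. ennreal (G (c * x)) * indicator I x \<partial>lborel)"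
  unfolding E(2) using c I IJ
  by (subst nn_integral_real_affine[where c=c and t=0]) (auto simp: indicator_def cong: if_cong)
 then have "ennreal (E / (c * G c)) = ennreal (1 / (c * G c)) * (ennreal c * (\<integral>\<^sup>+x. ennreal (G (c * x)) * indicator I x \<partial>lborel))"
 proof -
  have "ennreal (E / (c * G c)) = ennreal (1 / (c * G c)) * ennreal E"
   using E(1) c G_pos[of c] by (subst ennreal_mult[symmetric]) auto
  then show ?thesis unfolding E' .
 qed
 also have "... = ennreal (1 / G c) * (\<integral>\<^sup>+x. ennreal (G (c * x)) * indicator I x \<partial>lborel)"
  using c G_pos[of c] by (simp add: mult.assoc[symmetric] ennreal_mult[symmetric])
 also have "... = (\<integral>\<^sup>+x. ennreal (1 / G c) * (ennreal (G (c * x)) * indicator I x) \<partial>lborel)"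
  by (intro nn_integral_cmult[symmetric]) measurable
 also have "... = (\<integral>\<^sup>+x. ennreal (indicator I x *\<^sub>R (h c / h (c * x))) \<partial>lborel)"
 proof (rule nn_integral_cong)
  fix x
  show "ennreal (1 / G c) * (ennreal (G (c * x)) * indicator I x) = ennreal (indicator I x *\<^sub>R (h c / h (c * x)))"
  proof (cases "x \<in> I")
   case True
   then have "0 <= c * x" using I c by auto
   then have "h c / h (c * x) = 1 / G c * G (c * x)" using c by (simp add: h_eq)
   then show ?thesis using True G_nonneg by (simp add: ennreal_mult[symmetric])
  qed simp
 qed
 finally have nn: "(\<integral>\<^sup>+x. ennreal (indicator I x *\<^sub>R (h c / h (c * x))) \<partial>lborel) = ennreal (E / (c * G c))" by simp
 have "(%x. indicator I x *\<^sub>R (h c / h (c * x))) = (%x. indicator I x *\<^sub>R ((1 / G c) * G (c * x)))"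
 proof
  fix x
  have "0 <= c * x" if "x \<in> I" using I c that by auto
  then show "indicator I x *\<^sub>R (h c / h (c * x)) = indicator I x *\<^sub>R ((1 / G c) * G (c * x))"
   using c by (cases "x \<in> I") (simp_all add: h_eq)
 qed
 moreover have "(%x. indicator I x *\<^sub>R ((1 / G c) * G (c * x))) \<in> borel_measurable lborel" by measurable
 ultimately have m: "(%x. indicator I x *\<^sub>R (h c / h (c * x))) \<in> borel_measurable lborel" by simp
 have "0 <= indicator I x *\<^sub>R (h c / h (c * x))" for x
  using I c h_pos[of c] h_pos[of "c * x"] by (cases "x \<in> I") auto
 then have "integral\<^sup>L lborel (%x. indicator I x *\<^sub>R (h c / h (c * x))) = enn2real (ennreal (E / (c * G c)))"
  unfolding nn[symmetric] by (intro integral_eq_nn_integral m) simp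
 then show ?thesis using E(1) c G_pos[of c] unfolding set_lebesgue_integral_def by simp
qed

lemma integral_ratio_excess:
 assumes "integrable \<nu> (%x. max 0 x)" and c: "c > 0"
 shows "(LBINT x=1..\<infinity>. h c / h (c * x)) = excess c / (c * G c)"
proof -
 have e: "einterval 1 \<infinity> = {1::real<..}" by (auto simp: einterval_def one_ereal_def)
 have "(LBINT x:{1<..}. h c / h (c * x)) = excess c / (c * G c)"
 proof (rule integral_ratio[OF c _ ennreal_excess[OF assms(1)]])
  show "0 <= excess c" unfolding excess_def by (rule LINT_nonneg) simp
 qed (use c in auto)
 then show ?thesis by (simp add: interval_lebesgue_integral_def e)
qed

lemma integral_ratio_trunc:
 assumes c: "c > 0" and A: "1 <= A"
 shows "(LBINT x=1..ereal A. h c / h (c * x)) = (trunc (c * A) - trunc c) / (c * G c)"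
proof -
 have e: "einterval 1 (ereal A) = {1<..<A}" by (auto simp: einterval_def one_ereal_def)
 define B where "B = c * A"
 have cA: "c <= B" unfolding B_def using mult_left_mono[OF A, of c] c by simp
 have "ennreal (trunc B) = (\<integral>\<^sup>+y. ennreal (G y) * indicator {0<..<c} y + ennreal (G y) * indicator {c<..<B} y \<partial>lborel)"
  unfolding nn_integral_trunc[OF order_trans[OF less_imp_le[OF c] cA]]
 proof (rule nn_integral_cong_AE)
  show "AE y in lborel. ennreal (G y) * indicator {0<..<B} y = ennreal (G y) * indicator {0<..<c} y + ennreal (G y) * indicator {c<..<B} y"
   using AE_lborel_singleton[of c] by eventually_elim (use c cA in \<open>auto simp: indicator_def\<close>)
 qed
 also have "... = ennreal (trunc c) + (\<integral>\<^sup>+y. ennreal (G y) * indicator {c<..<B} y \<partial>lborel)"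
  unfolding nn_integral_trunc[OF less_imp_le[OF c]] by (rule nn_integral_add) measurable
 finally have "ennreal (trunc B - trunc c) = (\<integral>\<^sup>+y. ennreal (G y) * indicator {c<..<B} y \<partial>lborel)"
  by (subst ennreal_minus[symmetric]) (simp_all add: trunc_nonneg)
 then have "(LBINT x:{1<..<A}. h c / h (c * x)) = (trunc B - trunc c) / (c * G c)"
  by (intro integral_ratio[OF c]) (use c trunc_mono[OF cA] in \<open>auto simp: B_def\<close>)
 then show ?thesis using A by (simp add: interval_lebesgue_integral_def e one_ereal_def B_def)
qed

lemma stable_exp_nonneg: "t >= 0 ==> 0 <= stable_exp t"
 unfolding stable_exp_def by (intro LINT_nonneg) simp

lemma stable_exp_scale:
 assumes "c > 0"
 shows "stable_exp (c * t) = c powr \<alpha> * stable_exp t"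
proof -
 have "stable_exp t = (LINT u|lborel. c * (t * exp (- t * (c * u)) * ((c * u) powr (- \<alpha>)) * indicator {0<..} (c * u)))"
  unfolding stable_exp_def using assms by (subst lborel_integral_real_affine[where c=c and t=0]) auto
 also have "... = (LINT u|lborel. c powr (- \<alpha>) * ((c * t) * exp (- (c * t) * u) * (u powr (- \<alpha>)) * indicator {0<..} u))"
 proof (rule LINT_cong[OF refl])
  fix u
  show "c * (t * exp (- t * (c * u)) * ((c * u) powr (- \<alpha>)) * indicator {0<..} (c * u))
   = c powr (- \<alpha>) * ((c * t) * exp (- (c * t) * u) * (u powr (- \<alpha>)) * indicator {0<..} u)"
   using assms by (cases "u > 0") (simp_all add: powr_mult zero_less_mult_iff mult_ac)
 qed
 also have "... = c powr (- \<alpha>) * stable_exp (c * t)" unfolding stable_exp_def by (rule integral_mult_right_zero)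
 finally show ?thesis using assms by (simp add: powr_minus field_simps)
qed

text \<open>The integration by parts is the layer cake formula for the Levy measure with density
  \<alpha> x^(-\<alpha> - 1), whose mass beyond y is y^(-\<alpha>).\<close>

lemma stable_exp_eq:
 assumes l: "l > 0"
 shows "\<alpha> * (LBINT x=0..\<infinity>. (1 - exp (- l * x)) * x powr (- \<alpha> - 1)) = stable_exp l"
proof -
 have e: "einterval 0 \<infinity> = {0::real<..}" by (auto simp: einterval_def zero_ereal_def)
 define d where "d x = ennreal (\<alpha> * x powr (- \<alpha> - 1) * indicator {0<..} x)" for x :: real
 have d: "d \<in> borel_measurable borel" unfolding d_def by measurable
 have sf: "sigma_finite_measure (density lborel d)"
  using d by (subst sigma_finite_measure.sigma_finite_iff_density_finite[OF sigma_finite_lborel]) (simp_all add: d_def)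
 have tail: "emeasure (density lborel d) {y<..} = ennreal (y powr (- \<alpha>))" if y: "y > 0" for y
 proof -
  have "emeasure (density lborel d) {y<..} = (\<integral>\<^sup>+x. d x * indicator {y<..} x \<partial>lborel)" using d by (simp add: emeasure_density)
  also have "... = (\<integral>\<^sup>+x. ennreal \<alpha> * (ennreal (x powr (- \<alpha> - 1)) * indicator {y..} x) \<partial>lborel)"
  proof (rule nn_integral_cong_AE)
   show "AE x in lborel. d x * indicator {y<..} x = ennreal \<alpha> * (ennreal (x powr (- \<alpha> - 1)) * indicator {y..} x)"
    using AE_lborel_singleton[of y] by eventually_elim (use y \<alpha> in \<open>auto simp: d_def indicator_def ennreal_mult\<close>)
  qed
  also have "... = ennreal \<alpha> * (\<integral>\<^sup>+x. ennreal (x powr (- \<alpha> - 1)) * indicator {y..} x \<partial>lborel)" by (rule nn_integral_cmult) measurable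
  also have "(\<integral>\<^sup>+x. ennreal (x powr (- \<alpha> - 1)) * indicator {y..} x \<partial>lborel) = ennreal (- (y powr (- \<alpha> - 1 + 1)) / (- \<alpha> - 1 + 1))"
   using y \<alpha> by (intro nn_integral_has_integral_lebesgue' has_integral_powr_to_inf) auto
  also have "ennreal \<alpha> * ... = ennreal (y powr (- \<alpha>))" using \<alpha> by (simp add: ennreal_mult[symmetric])
  finally show ?thesis .
 qed
 let ?f = "%y. ennreal (l * exp (- l * y)) * indicator {0<..} y"
 have "(\<integral>\<^sup>+x. ennreal ((1 - exp (- l * x)) * (\<alpha> * x powr (- \<alpha> - 1)) * indicator {0<..} x) \<partial>lborel)
  = (\<integral>\<^sup>+x. d x * ennreal (1 - exp (- l * max 0 x)) \<partial>lborel)"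
  using l \<alpha> by (intro nn_integral_cong) (auto simp: d_def indicator_def ennreal_mult[symmetric] mult.commute)
 also have "... = (\<integral>\<^sup>+x. ennreal (1 - exp (- l * max 0 x)) \<partial>density lborel d)"
  using d by (subst nn_integral_density) auto
 also have "... = (\<integral>\<^sup>+x. (\<integral>\<^sup>+y. ?f y * indicator {..<x} y \<partial>lborel) \<partial>density lborel d)"
  unfolding nn_integral_exp_density[OF l] ..
 also have "... = (\<integral>\<^sup>+y. ?f y * emeasure (density lborel d) {y<..} \<partial>lborel)" by (rule layer_cake[OF sf]) simp_all
 also have "... = (\<integral>\<^sup>+y. ennreal (l * exp (- l * y) * (y powr (- \<alpha>)) * indicator {0<..} y) \<partial>lborel)"
  using l by (intro nn_integral_cong) (auto simp: indicator_def tail ennreal_mult[symmetric])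
 finally have nn: "(\<integral>\<^sup>+x. ennreal ((1 - exp (- l * x)) * (\<alpha> * x powr (- \<alpha> - 1)) * indicator {0<..} x) \<partial>lborel)
  = (\<integral>\<^sup>+y. ennreal (l * exp (- l * y) * (y powr (- \<alpha>)) * indicator {0<..} y) \<partial>lborel)" .
 have "\<alpha> * (LBINT x=0..\<infinity>. (1 - exp (- l * x)) * x powr (- \<alpha> - 1))
  = (LINT x|lborel. \<alpha> * (indicator {0<..} x * ((1 - exp (- l * x)) * x powr (- \<alpha> - 1))))"
  by (simp add: interval_lebesgue_integral_def e set_lebesgue_integral_def)
 also have "... = (LINT x|lborel. (1 - exp (- l * x)) * (\<alpha> * x powr (- \<alpha> - 1)) * indicator {0<..} x)"
  by (intro LINT_cong) (auto simp: mult_ac)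
 also have "... = stable_exp l"
 proof -
  have "(LINT x|lborel. (1 - exp (- l * x)) * (\<alpha> * x powr (- \<alpha> - 1)) * indicator {0<..} x)
   = enn2real (\<integral>\<^sup>+x. ennreal ((1 - exp (- l * x)) * (\<alpha> * x powr (- \<alpha> - 1)) * indicator {0<..} x) \<partial>lborel)"
   by (rule integral_eq_nn_integral) (use l \<alpha> in \<open>auto simp: indicator_def\<close>)
  also have "... = stable_exp l"
   unfolding stable_exp_def nn by (rule integral_eq_nn_integral[symmetric]) (use l in \<open>auto simp: indicator_def\<close>)
  finally show ?thesis .
 qed
 finally show ?thesis .
qed

text \<open>Potter's bound with an exponent below 1 makes x G(x) unbounded, contradicting Markov's
  inequality.\<close>

lemma infinite_mean:
 assumes "\<alpha> < 1"
 shows "(\<integral>\<^sup>+x. ennreal (max 0 x) \<partial>\<nu>) = \<infinity>"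
proof (rule ccontr)
 assume "(\<integral>\<^sup>+x. ennreal (max 0 x) \<partial>\<nu>) \<noteq> \<infinity>"
 then obtain m where m: "0 <= m" "(\<integral>\<^sup>+x. ennreal (max 0 x) \<partial>\<nu>) = ennreal m"
  by (cases "\<integral>\<^sup>+x. ennreal (max 0 x) \<partial>\<nu>") auto
 define \<beta> where "\<beta> = (1 + \<alpha>) / 2"
 have \<beta>: "\<alpha> < \<beta>" "\<beta> < 1" using assms by (auto simp: \<beta>_def)
 obtain C x0 where x0: "C > 0" "x0 > 0" "\<And>x s. x0 <= x ==> 1 <= s ==> G (x / s) <= C * s powr \<beta> * G x"
  using G_potter_lower[OF \<beta>(1)] by blast
 have le: "s powr (1 - \<beta>) * (x0 * G x0 / C) <= m" if s: "s >= 1" for s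
 proof -
  let ?x = "s * x0"
  have x: "x0 <= ?x" "0 <= ?x" using s x0 by auto
  have "ennreal (?x * G ?x) = (\<integral>\<^sup>+y. ennreal ?x * indicator {?x<..} y \<partial>\<nu>)"
   using x by (simp add: nn_integral_cmult_indicator G_def emeasure_eq_measure ennreal_mult)
  also have "... <= ennreal m" unfolding m(2)[symmetric] by (intro nn_integral_mono) (auto simp: indicator_def intro!: ennreal_leI)
  finally have "?x * G ?x <= m" using m(1) by simp
  moreover have "G x0 <= C * s powr \<beta> * G ?x" using x0(3)[OF x(1) s] s by simp
  then have "?x / (C * s powr \<beta>) * G x0 <= ?x / (C * s powr \<beta>) * (C * s powr \<beta> * G ?x)" using x x0 s by (intro mult_left_mono) auto
  moreover have "?x / (C * s powr \<beta>) * (C * s powr \<beta> * G ?x) = ?x * G ?x" using x0 s by simp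
  moreover have "?x / (C * s powr \<beta>) * G x0 = s powr (1 - \<beta>) * (x0 * G x0 / C)" using x0 s by (simp add: powr_diff mult.commute)
  ultimately show ?thesis by linarith
 qed
 have "0 < x0 * G x0 / C" using x0 G_pos by simp
 then have "filterlim (%s. s powr (1 - \<beta>) * (x0 * G x0 / C)) at_top at_top" using \<beta> by real_asymp
 then have "\<forall>\<^sub>F s in at_top. m < s powr (1 - \<beta>) * (x0 * G x0 / C) \<and> s >= 1"
  unfolding filterlim_at_top_dense by (intro eventually_conj eventually_ge_at_top) blast
 then obtain s where "m < s powr (1 - \<beta>) * (x0 * G x0 / C)" "s >= 1" by (auto simp: eventually_at_top_linorder)
 with le[of s] show False by linarith
qed

text \<open>Slow variation of \<open>trunc\<close>; the constant \<open>trunc c\<close> disappears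
  because the mean is infinite.\<close>

lemma trunc_ratio:
 assumes \<alpha>1: "\<alpha> = 1" and inf: "(\<integral>\<^sup>+x. ennreal (max 0 x) \<partial>\<nu>) = \<infinity>" and c: "c >= 1"
 shows "((%A. trunc A / (trunc (c * A) - trunc c)) ---> 1) at_top"
proof -
 have pos: "\<forall>\<^sub>F A in at_top. 0 < trunc A \<and> A > 0" using eventually_gt_at_top[of 0] by eventually_elim (simp add: trunc_pos)
 have "((%A. trunc (c * A) / trunc A) ---> 1) at_top" by (rule trunc_slowly_varying[OF \<alpha>1 c])
 moreover have "((%A. trunc c * inverse (trunc A)) ---> trunc c * 0) at_top"
  by (intro tendsto_mult tendsto_const tendsto_inverse_0_at_top trunc_at_top inf)
 ultimately have "((%A. inverse (trunc (c * A) / trunc A - trunc c * inverse (trunc A))) ---> inverse (1 - trunc c * 0)) at_top"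
  by (intro tendsto_inverse tendsto_diff) simp_all
 moreover have "\<forall>\<^sub>F A in at_top. inverse (trunc (c * A) / trunc A - trunc c * inverse (trunc A)) = trunc A / (trunc (c * A) - trunc c)"
 proof (intro always_eventually allI)
  fix A
  have "trunc (c * A) / trunc A - trunc c * inverse (trunc A) = (trunc (c * A) - trunc c) / trunc A"
   by (simp only: divide_inverse left_diff_distrib)
  then show "inverse (trunc (c * A) / trunc A - trunc c * inverse (trunc A)) = trunc A / (trunc (c * A) - trunc c)"
   by (simp only: inverse_divide)
 qed
 ultimately show ?thesis by (subst (asm) tendsto_cong) simp_all
qed

end

section \<open>Positions of the particles\<close>

locale nbrw_sample = heavy_tail +
 fixes M :: "'a measure" and \<Xi> :: "nat => nat => 'a => real" and N i :: nat
 assumes M: "prob_space M" and ind: "prob_space.indep_vars M (%_. borel) (%(n, k). \<Xi> n k) (UNIV \<times> {1..2 * N})"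
  and law: "k \<in> {1..2 * N} ==> distr M borel (\<Xi> n k) = \<nu>" and nonneg: "AE x in \<nu>. 0 <= x"
  and N: "N >= 1" and i: "i \<in> {1, N}"
begin

abbreviation pos :: "nat => 'a => real" where
 "pos n w \<equiv> nbrw N (%n k. \<Xi> n k w) i n"

abbreviation space_S :: "(nat => nat => real) measure" where
 "space_S \<equiv> \<Pi>\<^sub>M n\<in>UNIV. \<Pi>\<^sub>M k\<in>{1..2 * N}. \<nu>"

lemma pos_law:
 obtains T where "T \<in> measurable M space_S" "distr M space_S T = space_S"
  "AE w in M. \<forall>n. 0 <= pos n w \<and> pos n w = extreme N i (jumps (%x. max 0 x) (T w)) n"
  "\<And>n. pos n \<in> borel_measurable M"
 by (rule prob_space.positions_law[OF M ind N law _ nonneg i]) (simp_all)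

lemma pos_measurable: "pos n \<in> borel_measurable M"
 and AE_pos_nonneg: "AE w in M. 0 <= pos n w"
proof -
 obtain T where T: "AE w in M. \<forall>n. 0 <= pos n w \<and> pos n w = extreme N i (jumps (%x. max 0 x) (T w)) n"
  "\<And>n. pos n \<in> borel_measurable M" by (rule pos_law) blast
 show "pos n \<in> borel_measurable M" by (rule T(2))
 show "AE w in M. 0 <= pos n w" using T(1) by eventually_elim blast
qed

lemma extreme_measurable: "(%w. extreme N i (jumps (%x. max 0 x) w) n) \<in> borel_measurable space_S"
proof -
 interpret X: nbrw_law N \<nu> "%x. max 0 x" using N by (intro nbrw_lawI) auto
 show ?thesis unfolding extreme_def using X.lowest_measurable[of n] X.highest_measurable[of n] by auto
qed

lemma pos_tendsto:
 assumes int: "integrable \<nu> (%x. max 0 x)"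
 shows "tendsto_AE_and_L1 M (%n w. pos n w / real n) (v N) sequentially"
proof -
 interpret X: nbrw_law N \<nu> "%x. max 0 x" using N by (intro nbrw_lawI) auto
 obtain T where T: "T \<in> measurable M space_S" "distr M space_S T = space_S"
  "AE w in M. \<forall>n. 0 <= pos n w \<and> pos n w = extreme N i (jumps (%x. max 0 x) (T w)) n"
  "\<And>n. pos n \<in> borel_measurable M" by (rule pos_law) blast
 have "tendsto_AE_and_L1 space_S (%n w. extreme N i (jumps (%x. max 0 x) w) n / real n) (v N) sequentially"
  unfolding extreme_def v_def using X.positions_tendsto_speed[OF int] by auto
 then show ?thesis
 proof (rule tendsto_AE_and_L1_transfer[OF T(1,2), rotated -1])
  show "AE w in M. \<forall>n. pos n w / real n = extreme N i (jumps (%x. max 0 x) (T w)) n / real n"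
   using T(3) by eventually_elim simp
 qed (intro borel_measurable_divide borel_measurable_const extreme_measurable T(4))+
qed

lemma pos_laplace:
 assumes inf: "(\<integral>\<^sup>+x. ennreal (max 0 x) \<partial>\<nu>) = \<infinity>"
  and r: "EV n. r n > 0 \<and> s n <= C * r n" and C: "C > 0" and t: "t > 0"
  and lim: "(%n. real n * lap_exp (t / r n)) ----> \<theta>"
 shows "(%n. \<integral>w. exp (- t * (pos n w / r n)) \<partial>M) ----> exp (- 2 * real N * \<theta>)"
proof -
 obtain T where T: "T \<in> measurable M space_S" "distr M space_S T = space_S"
  "AE w in M. \<forall>n. 0 <= pos n w \<and> pos n w = extreme N i (jumps (%x. max 0 x) (T w)) n"
  "\<And>n. pos n \<in> borel_measurable M" by (rule pos_law) blast
 have "(LINT w|M. exp (- t * (pos n w / r n))) = (LINT w|space_S. exp (- t * (extreme N i (jumps (%x. max 0 x) w) n / r n)))" for n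
 proof -
  note [measurable] = T(1,4) extreme_measurable
  have "(LINT w|M. exp (- t * (pos n w / r n))) = (LINT w|M. exp (- t * (extreme N i (jumps (%x. max 0 x) (T w)) n / r n)))"
   by (rule integral_cong_AE) (measurable, use T(3) in eventually_elim, simp)
  also have "... = (LINT w|(distr M space_S T). exp (- t * (extreme N i (jumps (%x. max 0 x) w) n / r n)))"
   by (rule integral_distr[symmetric]) measurable
  finally show ?thesis unfolding T(2) .
 qed
 then show ?thesis
  using positions_laplace[OF N inf r C t lim, of "extreme N i"] by (simp add: extreme_def)
qed

text \<open>Divided by \<open>s n\<close> the position tends to \<open>2 * N\<close>. In the norming
  of the statement the limit is \<kappa> = \<open>scale N * G (c_scale h N)\<close>, which is close
  to 1 only for large \<open>N\<close>; this is the remaining error.\<close>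

lemma prokhorov_boundary:
 assumes \<alpha>1: "\<alpha> = 1" and inf: "(\<integral>\<^sup>+x. ennreal (max 0 x) \<partial>\<nu>) = \<infinity>"
  and c: "c_scale h N >= 1" and l: "log 2 (real N) >= 1"
  and b: "\<And>n. b n = (LBINT x=1..ereal (a (real n)). h (c_scale h N) / h (c_scale h N * x))"
 shows "\<exists>g. g ----> 0 \<and> (EV n. prokhorov_dist
  (distr M borel (%w. log 2 (real N) / c_scale h N * (pos n w / (real n * b n)))) (return borel 1)
  <= g n + \<bar>1 - scale N * G (c_scale h N)\<bar>)"
proof -
 interpret M: prob_space M by (rule M)
 define c where "c = c_scale h N"
 define l where "l = log 2 (real N)"
 have c1: "c >= 1" and l1: "l >= 1" using assms by (auto simp: c_def l_def)
 define d0 where "d0 = l * G c"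
 have d0: "d0 > 0" using l1 G_pos by (simp add: d0_def)
 define \<kappa> where "\<kappa> = scale N * G c"
 have \<kappa>: "\<kappa> = 2 * real N * d0" by (simp add: \<kappa>_def d0_def l_def)
 \<comment> \<open>The factor between the two normings; it tends to \<open>d0\<close> because
   \<open>trunc (c * A) - trunc c\<close> is asymptotic to \<open>trunc A\<close>. The variant
   \<open>d'\<close> is positive for every \<open>n\<close>.\<close>
 define d where "d n = l / c * (s n / (real n * b n))" for n
 define d' where "d' n = (if d n > 0 then d n else 1)" for n
 have spos: "EV n. s n > 0" using s_at_top[OF inf] unfolding filterlim_at_top_dense by blast
 have sn: "0 <= s n" for n unfolding s_def by (simp add: trunc_nonneg)
 have "(%n. d0 * (trunc (a (real n)) / (trunc (c * a (real n)) - trunc c))) ----> d0 * 1"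
  by (intro tendsto_mult tendsto_const filterlim_compose[OF trunc_ratio[OF \<alpha>1 inf c1] a_nat_at_top])
 moreover have "EV n. d0 * (trunc (a (real n)) / (trunc (c * a (real n)) - trunc c)) = d n"
  using filterlim_at_top[THEN iffD1, OF a_nat_at_top, rule_format, of 1] eventually_gt_at_top[of 0]
 proof eventually_elim
  case (elim n)
  have "b n = (trunc (c * a (real n)) - trunc c) / (c * G c)"
   unfolding b c_def[symmetric] by (rule integral_ratio_trunc) (use c1 elim in auto)
  then show ?case using c1 elim(2) by (simp add: d_def d0_def s_def)
 qed
 ultimately have d: "d ----> d0" by (subst (asm) tendsto_cong) simp_all
 then have "EV n. d n > 0" using d0 by (rule order_tendstoD(1))
 then have dd: "EV n. d n = d' n" by eventually_elim (simp add: d'_def)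
 have d': "d' ----> d0" using Lim_transform_eventually[OF d dd] .
 define Z where "Z n w = pos n w / s n" for n w
 have Z: "Z n \<in> borel_measurable M" for n unfolding Z_def[abs_def] by (intro borel_measurable_divide pos_measurable borel_measurable_const)
 have Z0: "AE w in M. 0 <= Z n w" for n using AE_pos_nonneg[of n] by eventually_elim (simp add: Z_def sn)
 have dpos: "d' n > 0" for n by (simp add: d'_def)
 have lim: "(%n. \<integral>w. exp (- real k * (d' n * Z n w)) \<partial>M) ----> (LINT x|(return borel \<kappa>). exp (- real k * x))" for k :: nat
 proof (cases "k = 0")
  case True
  have "prob_space (return borel \<kappa>)" by (rule prob_space_return) simp
  from prob_space.prob_space[OF this] True show ?thesis by (simp add: M.prob_space)
 next
  case False
  have "(%n. s n * (real k / (s n / d' n))) ----> real k * d0"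
  proof (rule Lim_transform_eventually[OF tendsto_mult[OF tendsto_const d']])
   show "EV n. real k * d' n = s n * (real k / (s n / d' n))" using spos by eventually_elim simp
  qed
  then have lap: "(%n. real n * lap_exp (real k / (s n / d' n))) ----> real k * d0"
   using sn dpos by (intro lap_exp_boundary[OF \<alpha>1]) (simp add: less_imp_le)
  have "EV n. d' n < d0 + 1" using d' by (rule order_tendstoD(2)) simp
  with spos have "EV n. s n / d' n > 0 \<and> s n <= (d0 + 1) * (s n / d' n)"
  proof eventually_elim
   case (elim n)
   then have "s n * d' n <= s n * (d0 + 1)" by (intro mult_left_mono) auto
   then show ?case using elim dpos[of n] by (simp add: le_divide_eq mult.commute)
  qed
  then have "(%n. \<integral>w. exp (- real k * (pos n w / (s n / d' n))) \<partial>M) ----> exp (- 2 * real N * (real k * d0))"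
   using False d0 by (intro pos_laplace[OF inf _ _ _ lap, where C="d0 + 1"]) auto
  then show ?thesis by (simp add: Z_def \<kappa> integral_return mult_ac)
 qed
 define g where "g n = prokhorov_dist (distr M borel (%w. d' n * Z n w)) (return borel \<kappa>)" for n
 have "(%n. prokhorov_dist (distr M borel (%w. d' n * Z n w)) (distr (return borel \<kappa>) borel (%x. x))) ----> 0"
 proof (rule prokhorov_dist_tendsto_if_laplace[OF M _ _ _ _ _ lim])
  show "prob_space (return borel \<kappa>)" by (rule prob_space_return) simp
  show "(%w. d' n * Z n w) \<in> borel_measurable M" for n by (intro borel_measurable_times borel_measurable_const Z)
  show "AE w in M. 0 <= d' n * Z n w" for n using Z0[of n] dpos[of n] by (auto elim: eventually_mono)
  show "AE w in return borel \<kappa>. 0 <= w" using d0 by (simp add: AE_return \<kappa>)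
 qed simp
 then have g: "g ----> 0" by (simp add: g_def[abs_def] distr_return)
 have "EV n. prokhorov_dist (distr M borel (%w. l / c * (pos n w / (real n * b n)))) (return borel 1) <= g n + \<bar>1 - \<kappa>\<bar>"
  using dd spos
 proof eventually_elim
  case (elim n)
  have "l / c * (pos n w / (real n * b n)) = d' n * Z n w" for w
   using elim(2) unfolding elim(1)[symmetric] by (simp add: d_def Z_def)
  moreover have "prob_space (distr M borel (%w. d' n * Z n w))"
   by (intro M.prob_space_distr borel_measurable_times borel_measurable_const Z)
  ultimately show ?case using prokhorov_dist_return_le[of "distr M borel (%w. d' n * Z n w)" 1 \<kappa>] by (simp add: g_def)
 qed
 then show ?thesis using g unfolding c_def l_def \<kappa>_def by blast
qed

text \<open>The factor (2N)^(-1/\<alpha>) compensates the \<open>2 * N\<close> jumps per generation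
  exactly, by the scaling of \<open>stable_exp\<close>, so the limit is the law of \<open>W\<close>
  for every \<open>N\<close>.\<close>

lemma prokhorov_stable:
 assumes \<alpha>1: "\<alpha> < 1" and Q: "prob_space Q" and W: "W \<in> borel_measurable Q"
  and lap: "\<And>l. l >= 0 ==> (LINT w|Q. exp (- l * W w)) = exp (- \<alpha> * (LBINT x=0..\<infinity>. (1 - exp (- l * x)) * x powr (- \<alpha> - 1)))"
 shows "(%n. prokhorov_dist (distr M borel (%w. (2 * real N) powr (- 1 / \<alpha>) * (pos n w / a (real n)))) (distr Q borel W)) ----> 0"
proof -
 interpret M: prob_space M by (rule M)
 interpret Q: prob_space Q by (rule Q)
 define c where "c = (2 * real N) powr (- 1 / \<alpha>)"
 have c: "c > 0" "2 * real N * c powr \<alpha> = 1"   proof -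
  have "- 1 / \<alpha> * \<alpha> = - 1" using \<alpha> by simp
  then have c: "c powr \<alpha> = inverse (2 * real N)" using N unfolding c_def powr_powr by (simp add: powr_minus)
  show "2 * real N * c powr \<alpha> = 1" unfolding c using N by simp
 qed (use N in \<open>simp add: c_def\<close>)
 have EW: "(LINT w|Q. exp (- real k * W w)) = (if k = 0 then 1 else exp (- stable_exp (real k)))" for k :: nat
 proof (cases "k = 0")
  case False
  then have "- \<alpha> * (LBINT x=0..\<infinity>. (1 - exp (- real k * x)) * x powr (- \<alpha> - 1)) = - stable_exp (real k)"
   using stable_exp_eq[of "real k"] by simp
  then show ?thesis using False lap[of "real k"] by simp
 qed (simp add: Q.prob_space)
 note inf = infinite_mean[OF \<alpha>1]
 obtain C x0 where C: "C > 0" "x0 > 0" "\<And>A. x0 <= A ==> trunc A <= C * (A * G A)" using trunc_le[OF \<alpha>1] by blast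
 \<comment> \<open>For \<alpha> < 1 the truncated mean at A is at most of order A G(A), and n
   G(a(n)) is at most 1.\<close>
 have r: "EV n. a (real n) > 0 \<and> s n <= C * a (real n)"
  using filterlim_at_top[THEN iffD1, OF a_nat_at_top, rule_format, of x0] eventually_gt_at_top[of 0]
 proof eventually_elim
  case (elim n)
  have "s n <= real n * (C * (a (real n) * G (a (real n))))" unfolding s_def by (intro mult_left_mono C(3) elim) simp
  also have "... = C * a (real n) * (real n * G (a (real n)))" by simp
  also have "... <= C * a (real n) * 1"
   using G_a_le[of "real n"] elim C by (intro mult_left_mono) (auto simp: field_simps)
  finally show ?case using elim C by simp
 qed
 have Y: "(%w. c * (pos n w / a (real n))) \<in> borel_measurable M" for n
  by (intro borel_measurable_times borel_measurable_divide borel_measurable_const pos_measurable)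
 have "(%n. prokhorov_dist (distr M borel (%w. c * (pos n w / a (real n)))) (distr Q borel W)) ----> 0"
 proof (rule prokhorov_dist_tendsto_if_laplace[OF M Q Y W])
  show "AE w in M. 0 <= c * (pos n w / a (real n))" for n
   using AE_pos_nonneg[of n] by eventually_elim (simp add: c less_imp_le a_nonneg)
  show "AE w in Q. 0 <= W w"
   by (rule Q.AE_nonneg_if_laplace[OF W]) (simp_all only: EW, auto simp: stable_exp_nonneg)
  fix k :: nat
  show "(%n. \<integral>w. exp (- real k * (c * (pos n w / a (real n)))) \<partial>M) ----> (LINT w|Q. exp (- real k * W w))"
  proof (cases "k = 0")
   case True
   then show ?thesis by (simp add: M.prob_space Q.prob_space)
  next
   case False
   then have t: "c * real k > 0" using c by simp
   have "(%n. \<integral>w. exp (- (c * real k) * (pos n w / a (real n))) \<partial>M) ----> exp (- 2 * real N * stable_exp (c * real k))"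
    by (rule pos_laplace[OF inf r C(1) t lap_exp_stable[OF \<alpha>1 t]])
   also have "- 2 * real N * stable_exp (c * real k) = - stable_exp (real k)"
    using c(2) stable_exp_scale[OF c(1), of "real k"] by (simp add: mult.assoc[symmetric])
   finally show ?thesis using False unfolding EW by (simp add: mult_ac)
  qed
 qed
 then show ?thesis unfolding c_def .
qed

end

theorem theorem1p2:
  fixes P :: "'p measure" and X :: "'p \<Rightarrow> real" and h :: "real \<Rightarrow> real" and \<alpha> :: real
    and M :: "nat \<Rightarrow> 'a measure" and \<Xi> :: "nat \<Rightarrow> nat \<Rightarrow> nat \<Rightarrow> 'a \<Rightarrow> real"
    and \<X> :: "nat \<Rightarrow> nat \<Rightarrow> nat \<Rightarrow> 'a \<Rightarrow> real"
  assumes "prob_space P" and "X \<in> borel_measurable P" and "\<forall>\<omega>\<in>space P. 0 \<le> X \<omega>"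
    and "\<forall>x\<ge>0. measure P {\<omega>\<in>space P. X \<omega> > x} = 1 / h x"
    and "\<alpha> > 0" and "regularly_varying h \<alpha>"
    and "\<forall>N\<ge>1. prob_space (M N)"
    and "\<forall>N\<ge>1. iid_copies P X (M N) (\<lambda>(n, i). \<Xi> N n i) (UNIV \<times> {1..2 * N})"
    and "\<forall>N\<ge>1. \<forall>i n \<omega>. \<X> N i n \<omega> = nbrw N (\<lambda>n k. \<Xi> N n k \<omega>) i n"
  shows
    "(\<alpha> > 1 \<longrightarrow>
       (\<exists>v \<rho>. \<rho> > 0 \<and>
         (\<forall>N\<ge>1. \<forall>i\<in>{1, N}.
            tendsto_AE_and_L1 (M N) (\<lambda>n \<omega>. \<X> N i n \<omega> / real n) (v N) sequentially) \<and>
         (\<forall>(S :: 's measure) \<mu> \<eta>.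
            prob_space S \<longrightarrow> stairs_measure \<mu> \<longrightarrow>
            (\<forall>x>0. emeasure \<mu> {x..} = ennreal (x powr (- \<alpha>))) \<longrightarrow>
            stairs_point_process S \<mu> \<eta> \<longrightarrow>
            tendsto_AE_and_L1 S (\<lambda>t \<omega>. stairs (atom_size (\<eta> \<omega>)) t / t) \<rho> at_top) \<and>
         (\<lambda>N. v N / (\<rho> * c_scale h N / log 2 (real N))) \<longlonglongrightarrow> 1)) \<and>
     (\<alpha> = 1 \<and> (\<integral>\<^sup>+\<omega>. ennreal (X \<omega>) \<partial>P) < \<infinity> \<longrightarrow>
       (\<exists>v.
         (\<forall>N\<ge>1. \<forall>i\<in>{1, N}.
            tendsto_AE_and_L1 (M N) (\<lambda>n \<omega>. \<X> N i n \<omega> / real n) (v N) sequentially) \<and>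
         (\<lambda>N. v N / (c_scale h N / log 2 (real N) *
                  (LBINT x=1..\<infinity>. h (c_scale h N) / h (c_scale h N * x)))) \<longlonglongrightarrow> 1)) \<and>
     (\<alpha> = 1 \<and> (\<integral>\<^sup>+\<omega>. ennreal (X \<omega>) \<partial>P) = \<infinity> \<longrightarrow>
       (\<forall>b. (\<forall>N n. b N n =
              (LBINT x=1..ereal (gen_inverse h (real n)). h (c_scale h N) / h (c_scale h N * x))) \<longrightarrow>
         (\<forall>ix\<in>{\<lambda>N. 1, \<lambda>N. N}.
           (\<lambda>N. limsup (\<lambda>n. ereal (prokhorov_dist
              (distr (M N) borel
                 (\<lambda>\<omega>. log 2 (real N) / c_scale h N * (\<X> N (ix N) n \<omega> / (real n * b N n))))
              (return borel 1)))) \<longlonglongrightarrow> 0))) \<and>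
     (\<alpha> < 1 \<longrightarrow>
       (\<forall>(Q :: 'w measure) W.
         prob_space Q \<longrightarrow> W \<in> borel_measurable Q \<longrightarrow>
         (\<forall>l\<ge>0. (\<integral>\<omega>. exp (- l * W \<omega>) \<partial>Q) =
            exp (- \<alpha> * (LBINT x=0..\<infinity>. (1 - exp (- l * x)) * x powr (- \<alpha> - 1)))) \<longrightarrow>
         (\<forall>ix\<in>{\<lambda>N. 1, \<lambda>N. N}.
           (\<lambda>N. limsup (\<lambda>n. ereal (prokhorov_dist
              (distr (M N) borel
                 (\<lambda>\<omega>. (2 * real N) powr (- 1 / \<alpha>) * (\<X> N (ix N) n \<omega> / gen_inverse h (real n))))
              (distr Q borel W)))) \<longlonglongrightarrow> 0)))"
proof -
 define \<nu> where "\<nu> = distr P borel X"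
 note PX = assms(1,2)
 have rd: "real_distribution \<nu>" unfolding \<nu>_def by (rule prob_space.real_distribution_distr[OF PX])
 interpret heavy_tail \<nu> h \<alpha>
 proof (intro heavy_tail.intro heavy_tail_axioms.intro rd assms(5,6))
  fix x :: real assume "0 <= x"
  have "X -` {x<..} \<inter> space P = {\<omega>\<in>space P. X \<omega> > x}" by auto
  then show "measure \<nu> {x<..} = 1 / h x"
   unfolding \<nu>_def using assms(2,4) \<open>0 <= x\<close> by (subst measure_distr) simp_all
 qed
 have nonneg: "AE x in \<nu>. 0 <= x"
  unfolding \<nu>_def using assms(2,3) by (subst AE_distr_iff) (auto intro!: AE_I2)
 have mean: "(\<integral>\<^sup>+x. ennreal (max 0 x) \<partial>\<nu>) = (\<integral>\<^sup>+\<omega>. ennreal (X \<omega>) \<partial>P)"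
  unfolding \<nu>_def using assms(2,3) by (subst nn_integral_distr) (auto intro!: nn_integral_cong)
 have sample: "nbrw_sample \<nu> h \<alpha> (M N) (\<Xi> N) N i" if "N >= 1" "i \<in> {1, N}" for N i
 proof (intro nbrw_sample.intro nbrw_sample_axioms.intro heavy_tail_axioms nonneg that)
  show "prob_space (M N)" using assms(7) that by blast
  have iid: "iid_copies P X (M N) (%(n, i). \<Xi> N n i) (UNIV \<times> {1..2 * N})" using assms(8) that by blast
  then show "prob_space.indep_vars (M N) (%_. borel) (%(n, k). \<Xi> N n k) (UNIV \<times> {1..2 * N})"
   unfolding iid_copies_def by blast
  show "distr (M N) borel (\<Xi> N n k) = \<nu>" if "k \<in> {1..2 * N}" for n k
   using iid that unfolding iid_copies_def \<nu>_def by fastforce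
 qed
 have X_eq: "\<X> N i = (%n \<omega>. nbrw N (%n k. \<Xi> N n k \<omega>) i n)" if "N >= 1" for N i
  using assms(9) that by (intro ext) blast
 have speed: "tendsto_AE_and_L1 (M N) (%n \<omega>. \<X> N i n \<omega> / real n) (v N) sequentially"
  if "integrable \<nu> (%x. max 0 x)" "N >= 1" "i \<in> {1, N}" for N i
  unfolding X_eq[OF that(2)] by (rule nbrw_sample.pos_tendsto[OF sample[OF that(2,3)] that(1)])
 have cpos: "EV N. N >= 2 \<and> c_scale h N >= 1"
  using c_scale_at_top unfolding filterlim_at_top by (intro eventually_conj eventually_ge_at_top) blast
 have ix: "ix N \<in> {1, N}" if "ix \<in> {%N. 1, %N. N}" for ix :: "nat => nat" and N using that by auto
 have prokh0: "0 <= prokhorov_dist (distr (M N) borel (%\<omega>. c * (\<X> N (ix N) n \<omega> / d))) \<mu>"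
  if "N >= 1" "ix \<in> {%N. 1, %N. N}" "prob_space \<mu>" for N n c d \<mu> and ix :: "nat => nat"
 proof (rule prokhorov_dist_nonneg[OF _ that(3)])
  interpret s: nbrw_sample \<nu> h \<alpha> "M N" "\<Xi> N" N "ix N" by (rule sample[OF that(1) ix[OF that(2)]])
  show "prob_space (distr (M N) borel (%\<omega>. c * (\<X> N (ix N) n \<omega> / d)))"
   unfolding X_eq[OF that(1)]
   by (intro prob_space.prob_space_distr s.M borel_measurable_times borel_measurable_divide borel_measurable_const s.pos_measurable)
 qed
 show ?thesis
 proof (intro conjI impI allI ballI, goal_cases)
  case \<alpha>1: 1
  have int: "integrable \<nu> (%x. max 0 x)" using excess_le[OF \<alpha>1] by blast
  show ?case
  proof (intro exI conjI)
   show "stairs_speed \<alpha> > 0" by (rule stairs_speed_pos[OF \<alpha>1])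
   show "\<forall>N\<ge>1. \<forall>i\<in>{1, N}. tendsto_AE_and_L1 (M N) (%n \<omega>. \<X> N i n \<omega> / real n) (v N) sequentially"
    using speed[OF int] by blast
   show "\<forall>(S :: 's measure) \<mu> \<eta>. prob_space S \<longrightarrow> stairs_measure \<mu> \<longrightarrow>
    (\<forall>x>0. emeasure \<mu> {x..} = ennreal (x powr (- \<alpha>))) \<longrightarrow> stairs_point_process S \<mu> \<eta> \<longrightarrow>
    tendsto_AE_and_L1 S (%t \<omega>. stairs (atom_size (\<eta> \<omega>)) t / t) (stairs_speed \<alpha>) at_top"
    using \<alpha>1 by (intro allI impI stairs_process.stairs_tendsto_speed stairs_process.intro stairs_process_axioms.intro) auto
   show "(%N. v N / (stairs_speed \<alpha> * c_scale h N / log 2 (real N))) ----> 1" by (rule speed_thin[OF \<alpha>1 int])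
  qed
 next
  case 2
  then have \<alpha>1: "\<alpha> = 1" and int: "integrable \<nu> (%x. max 0 x)"
   using mean by (auto intro!: integrableI_bounded)
  show ?case
  proof (intro exI conjI)
   show "\<forall>N\<ge>1. \<forall>i\<in>{1, N}. tendsto_AE_and_L1 (M N) (%n \<omega>. \<X> N i n \<omega> / real n) (v N) sequentially"
    using speed[OF int] by blast
   \<comment> \<open>The integral equals \<open>excess c / (c * G c)\<close>; the factor
     \<open>scale N * G c\<close> needed to insert it tends to 1.\<close>
   have "(%N. v N / (2 * real N * excess (c_scale h N)) * (scale N * G (1 * c_scale h N))) ----> 1 * 1 powr (- \<alpha>)"
    by (intro tendsto_mult speed_boundary[OF int \<alpha>1] G_c_scale) simp
   then show "(%N. v N / (c_scale h N / log 2 (real N) * (LBINT x=1..\<infinity>. h (c_scale h N) / h (c_scale h N * x)))) ----> 1"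
    unfolding powr_one_eq_one mult_1
   proof (rule Lim_transform_eventually)
    show "EV N. v N / (2 * real N * excess (c_scale h N)) * (scale N * G (c_scale h N))
     = v N / (c_scale h N / log 2 (real N) * (LBINT x=1..\<infinity>. h (c_scale h N) / h (c_scale h N * x)))"
     using cpos
    proof eventually_elim
     case (elim N)
     then have c: "c_scale h N > 0" by linarith
     show ?case using c elim unfolding integral_ratio_excess[OF int c] by simp
    qed
   qed
  qed
 next
  case (3 b ix)
  then have \<alpha>1: "\<alpha> = 1" and inf: "(\<integral>\<^sup>+\<omega>. ennreal (X \<omega>) \<partial>P) = \<infinity>" by blast+
  let ?d = "%N n. prokhorov_dist (distr (M N) borel
   (%\<omega>. log 2 (real N) / c_scale h N * (\<X> N (ix N) n \<omega> / (real n * b N n)))) (return borel 1)"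
  show ?case
  proof (rule limsup_tendsto_0)
   show "EV N. \<forall>n. 0 <= ?d N n"
    using eventually_ge_at_top[of 1] by eventually_elim (intro allI prokh0 3(3) prob_space_return, simp_all)
   \<comment> \<open>The distance from 1 of the limit point for fixed \<open>N\<close> vanishes by
     the definition of the scale.\<close>
   have "(%N. \<bar>1 - scale N * G (1 * c_scale h N)\<bar>) ----> \<bar>1 - 1 powr (- \<alpha>)\<bar>"
    by (intro tendsto_rabs tendsto_diff tendsto_const G_c_scale) simp
   then show "(%N. \<bar>1 - scale N * G (c_scale h N)\<bar>) ----> 0" by simp
   show "EV N. \<exists>g. g ----> 0 \<and> (EV n. ?d N n <= g n + \<bar>1 - scale N * G (c_scale h N)\<bar>)"
    using cpos
   proof eventually_elim
    case (elim N)
    then have N: "N >= 1" "log 2 (real N) >= 1" by (simp_all add: le_log_iff)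
    interpret s: nbrw_sample \<nu> h \<alpha> "M N" "\<Xi> N" N "ix N" by (rule sample[OF N(1) ix[OF 3(3)]])
    show ?case unfolding X_eq[OF N(1)] using elim 3(2) by (intro s.prokhorov_boundary \<alpha>1 mean[unfolded inf] N(2)) simp_all
   qed
  qed
 next
  case (4 Q W ix)
  let ?d = "%N n. prokhorov_dist (distr (M N) borel
   (%\<omega>. (2 * real N) powr (- 1 / \<alpha>) * (\<X> N (ix N) n \<omega> / gen_inverse h (real n)))) (distr Q borel W)"
  show ?case
  proof (rule limsup_tendsto_0)
   show "EV N. \<forall>n. 0 <= ?d N n"
    using eventually_ge_at_top[of 1] by eventually_elim (intro allI prokh0 4(5) prob_space.prob_space_distr 4(2,3))
   show "(%N. 0 :: real) ----> 0" by simp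
   show "EV N. \<exists>g. g ----> 0 \<and> (EV n. ?d N n <= g n + 0)"
    using eventually_ge_at_top[of 1]
   proof eventually_elim
    case (elim N)
    interpret s: nbrw_sample \<nu> h \<alpha> "M N" "\<Xi> N" N "ix N" by (rule sample[OF elim ix[OF 4(5)]])
    have "?d N ----> 0"
     unfolding X_eq[OF elim] using 4(4) by (intro s.prokhorov_stable 4(1-3)) blast
    then show ?case by (intro exI conjI, assumption) (simp add: always_eventually)
   qed
  qed
 qed
qed

end
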